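(* Let $k\geqslant 0$ be an integer and let $\mathcal{M}_k$ be the space of $\mathbb{C}_{2m,0}$-valued discrete monogenic polynomials on $\mathbb{Z}^m$, homogeneous of degree $k$, regarded as a representation of $\mathfrak{so}(m,\mathbb{C})$ through the operators $dR(e_{a,b})$. (i) If $m=2n+1$ is odd ($n\geqslant 1$), then $\mathcal{M}_k$ decomposes as a direct sum of $2^{2m-n}$ isomorphic irreducible representations of $\mathfrak{so}(m,\mathbb{C})$ with highest weight $\left(k+\frac12,\frac12,\ldots,\frac12\right)$. (ii) If $m=2n$ is even ($n\geqslant 2$), then $\mathcal{M}_k$ decomposes as a direct sum of $2^{2m-n}$ isomorphic irreducible representations of $\mathfrak{so}(m,\mathbb{C})$ with highest weight $(k)'_+=\left(k+\frac12,\frac12,\ldots,\frac12,\frac12\right)$ and $2^{2m-n}$ isomorphic irreducible representations with highest weight $(k)'_-=\left(k+\frac12,\frac12,\ldots,\frac12,-\frac12\right)$.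
   Context: Clifford algebra. $\mathbb{C}_{2m,0}$ is the complex Clifford algebra of dimension $2^{2m}$, generated by $\mathbf{e}_j^+,\mathbf{e}_j^-$ ($j=1,\ldots,m$) with $\{\mathbf{e}_j^-,\mathbf{e}_\ell^-\}=\{\mathbf{e}_j^+,\mathbf{e}_\ell^+\}=0$ and $\{\mathbf{e}_j^+,\mathbf{e}_\ell^-\}=\delta_{j\ell}$, where $\{x,y\}=xy+yx$. Put $e_j=\mathbf{e}_j^++\mathbf{e}_j^-$ and $e_j^\perp=\mathbf{e}_j^+-\mathbf{e}_j^-$. Discrete polynomials and operators. Discrete polynomials are $\mathbb{C}_{2m,0}$-valued polynomial functions on $\mathbb{Z}^m$. With $\Delta_j^+f(x)=f(x+\mathbf{e}_j)-f(x)$ and $\Delta_j^-f(x)=f(x)-f(x-\mathbf{e}_j)$ (here $\mathbf{e}_j$ is the $j$-th unit lattice vector), set $\partial_j=\mathbf{e}_j^+\Delta_j^++\mathbf{e}_j^-\Delta_j^-$ and let $\partial=\sum_{j=1}^m\partial_j$ be the discrete Dirac operator. The vector variable operators are $\xi_j=\mathbf{e}_j^+X_j^-+\mathbf{e}_j^-X_j^+$, where $X_j^\pm$ are scalar operators acting in the variable $x_j$; they satisfy $\partial_j\xi_j-\xi_j\partial_j=1$ and $\{\xi_j,\xi_\ell\}=\{\partial_j,\partial_\ell\}=\{\partial_j,\xi_\ell\}=0$ for $j\neq\ell$. Concretely, with $u_k(x)=\prod_{i=-k}^{k}(x+i)$ for $k\geqslant0$, $v_0^\pm=1$, $v_k^\pm(x)=u_{k-1}(x)(x\pm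 k)$ for $k\geqslant 1$, the operators $X_j^\pm$ are the linear maps (in the variable $x=x_j$) given by $X^+v_k^+=u_k$, $X^+u_k=v_{k+1}^-$, $X^-v_k^-=u_k$, $X^-u_k=v_{k+1}^+$. The polynomials $\xi_1^{\alpha_1}\cdots\xi_m^{\alpha_m}[1]$ (operators applied to the constant function $1$) form a basis of the discrete polynomials as a right $\mathbb{C}_{2m,0}$-module. The Euler operator is $\mathbb{E}=\sum_j\xi_j\partial_j$; a polynomial $f$ is homogeneous of degree $k$ if $\mathbb{E}f=kf$, and (left) discrete monogenic if $\partial f=0$. Representation. For $a\neq b$ put $L_{a,b}=\xi_a\partial_b+\xi_b\partial_a$, $V_{a,b}=e_ae_be_a^\perp e_b^\perp=-e_a^\perp e_ae_b^\perp e_b$, and $$dR(e_{a,b})f=V_{a,b}\left(L_{a,b}-\tfrac12\right)f\,e_a^\perp e_b^\perp,\qquad dR(e_{a,a})=0.$$ These operators satisfy the relations of $\mathfrak{so}(m,\mathbb{C})$, namely $[dR(e_{a,b}),dR(e_{c,d})]=\delta_{b,c}dR(e_{a,d})-\delta_{b,d}dR(e_{a,c})-\delta_{a,c}dR(e_{b,d})+\delta_{a,d}dR(e_{b,c})$, and preserve $\mathcal{M}_k$. Weights. For $1\leqslant a,b\leqslant n$ (where $m=2n$ or $m=2n+1$) let $H_a=i\,dR(e_{2a-1,2a})$, $X_{a,b}=\frac12\left(dR(e_{2a-1,2b-1})+i\,dR(e_{2a-1,2b})-i\,dR(e_{2a,2b-1})+dR(e_{2a,2b})\right)$, $Y_{a,b}=\frac12\left(dR(e_{2a-1,2b-1})-i\,dR(e_{2a-1,2b})-i\,dR(e_{2a,2b-1})-dR(e_{2a,2b})\right)$,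 and, if $m=2n+1$, $U_a=\frac1{\sqrt2}\left(dR(e_{2a-1,m})-i\,dR(e_{2a,m})\right)$. The Cartan subalgebra is spanned by the $H_a$; the positive root vectors are $X_{a,b}$ ($a<b$), $Y_{a,b}$ ($a\neq b$) and, in odd dimension, $U_a$. A weight is written $(\lambda_1,\ldots,\lambda_n)$, where $\lambda_a$ is the eigenvalue of $H_a$; highest weights are taken with respect to these positive root vectors. *)

theory Defs
  imports Complex_Main "HOL-Library.Function_Algebras"
begin

section \<open>The scalar operators $X^+$ and $X^-$ in one lattice variable\<close>

definition u_poly :: "nat \<Rightarrow> int \<Rightarrow> int" where
  "u_poly k x = (\<Prod>i = - int k..int k. x + i)"

text \<open>The sign \<open>s\<close> is \<open>1\<close> or \<open>-1\<close>; \<open>v_poly s k\<close> is $v_k^{\pm}$ accordingly.\<close>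

definition v_poly :: "int \<Rightarrow> nat \<Rightarrow> int \<Rightarrow> int" where
  "v_poly s k x = (if k = 0 then 1 else u_poly (k - 1) x * (x + s * int k))"

text \<open>
  The basis $v_0^s, u_0, v_1^s, u_1, \ldots$ of the polynomial functions of one variable (the
  \<open>i\<close>-th member has degree \<open>i\<close>), and the images $u_0, v_1^{-s}, u_1, v_2^{-s}, \ldots$ under $X^s$.
\<close>

definition X_basis :: "int \<Rightarrow> nat \<Rightarrow> int \<Rightarrow> int" where
  "X_basis s i = (if even i then v_poly s (i div 2) else u_poly (i div 2))"

definition X_image :: "int \<Rightarrow> nat \<Rightarrow> int \<Rightarrow> int" where
  "X_image s i = (if even i then u_poly (i div 2) else v_poly (- s) (Suc (i div 2)))"

text \<open>
  The linear extension to polynomial functions with coefficients in an algebra. It is well defined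
  by lemma \<open>X_op_expansion\<close> below; the value on functions that are not polynomial is irrelevant.
\<close>

definition X_op :: "int \<Rightarrow> (int \<Rightarrow> 'c::ring_1) \<Rightarrow> int \<Rightarrow> 'c" where
  "X_op s h = (THE g. \<exists>N c. h = (\<lambda>t. \<Sum>i<N. of_int (X_basis s i t) * c i) \<and>
                            g = (\<lambda>t. \<Sum>i<N. of_int (X_image s i t) * c i))"

section \<open>The Clifford algebra and the discrete operators\<close>

text \<open>
  A complex algebra of dimension $2^{2m}$ generated by a Witt basis: \<open>ep j\<close> and \<open>em j\<close> are
  $\mathbf{e}_j^+$ and $\mathbf{e}_j^-$. This determines the algebra up to isomorphism.
\<close>

locale clifford_algebra = vector_space scale
  for scale :: "complex \<Rightarrow> 'c::ring_1 \<Rightarrow> 'c" +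
  fixes m :: nat and ep em :: "nat \<Rightarrow> 'c"
  assumes scale_mult_left: "scale z x * y = scale z (x * y)"
    and scale_mult_right: "x * scale z y = scale z (x * y)"
    and anticommute_em: "j \<in> {1..m} \<Longrightarrow> l \<in> {1..m} \<Longrightarrow> em j * em l + em l * em j = 0"
    and anticommute_ep: "j \<in> {1..m} \<Longrightarrow> l \<in> {1..m} \<Longrightarrow> ep j * ep l + ep l * ep j = 0"
    and anticommute_ep_em:
      "j \<in> {1..m} \<Longrightarrow> l \<in> {1..m} \<Longrightarrow> ep j * em l + em l * ep j = of_bool (j = l)"
    and generated: "subspace S \<Longrightarrow> 1 \<in> S \<Longrightarrow> (\<And>x y. x \<in> S \<Longrightarrow> y \<in> S \<Longrightarrow> x * y \<in> S) \<Longrightarrow>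
      (\<And>j. j \<in> {1..m} \<Longrightarrow> ep j \<in> S \<and> em j \<in> S) \<Longrightarrow> S = UNIV"
    and dim_algebra: "dim UNIV = 2 ^ (2 * m)"
begin

definition e :: "nat \<Rightarrow> 'c" where "e j = ep j + em j"

definition e_perp :: "nat \<Rightarrow> 'c" where "e_perp j = ep j - em j"

text \<open>
  A point of $\mathbb{Z}^m$ is given by the values at \<open>1, \<dots>, m\<close> of a function \<open>nat \<Rightarrow> int\<close>. The
  polynomial functions below depend on these values only.
\<close>

definition fscale :: "complex \<Rightarrow> ((nat \<Rightarrow> int) \<Rightarrow> 'c) \<Rightarrow> (nat \<Rightarrow> int) \<Rightarrow> 'c" where
  "fscale z f = (\<lambda>x. scale z (f x))"

sublocale fun_space: vector_space fscale
  by unfold_locales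
    (simp_all add: fscale_def fun_eq_iff scale_right_distrib scale_left_distrib)

definition discrete_polynomials :: "((nat \<Rightarrow> int) \<Rightarrow> 'c) set" where
  "discrete_polynomials =
    fun_space.span {\<lambda>x. of_int (\<Prod>j = 1..m. x j ^ \<alpha> j) * c | (\<alpha> :: nat \<Rightarrow> nat) c. True}"

definition forward_diff :: "nat \<Rightarrow> ((nat \<Rightarrow> int) \<Rightarrow> 'c) \<Rightarrow> (nat \<Rightarrow> int) \<Rightarrow> 'c" where
  "forward_diff j f = (\<lambda>x. f (x(j := x j + 1)) - f x)"

definition backward_diff :: "nat \<Rightarrow> ((nat \<Rightarrow> int) \<Rightarrow> 'c) \<Rightarrow> (nat \<Rightarrow> int) \<Rightarrow> 'c" where
  "backward_diff j f = (\<lambda>x. f x - f (x(j := x j - 1)))"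

definition partial :: "nat \<Rightarrow> ((nat \<Rightarrow> int) \<Rightarrow> 'c) \<Rightarrow> (nat \<Rightarrow> int) \<Rightarrow> 'c" where
  "partial j f = (\<lambda>x. ep j * forward_diff j f x + em j * backward_diff j f x)"

definition dirac :: "((nat \<Rightarrow> int) \<Rightarrow> 'c) \<Rightarrow> (nat \<Rightarrow> int) \<Rightarrow> 'c" where
  "dirac f = (\<Sum>j = 1..m. partial j f)"

definition X_var :: "int \<Rightarrow> nat \<Rightarrow> ((nat \<Rightarrow> int) \<Rightarrow> 'c) \<Rightarrow> (nat \<Rightarrow> int) \<Rightarrow> 'c" where
  "X_var s j f = (\<lambda>x. X_op s (\<lambda>t. f (x(j := t))) (x j))"

definition xi :: "nat \<Rightarrow> ((nat \<Rightarrow> int) \<Rightarrow> 'c) \<Rightarrow> (nat \<Rightarrow> int) \<Rightarrow> 'c" where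
  "xi j f = (\<lambda>x. ep j * X_var (- 1) j f x + em j * X_var 1 j f x)"

definition euler :: "((nat \<Rightarrow> int) \<Rightarrow> 'c) \<Rightarrow> (nat \<Rightarrow> int) \<Rightarrow> 'c" where
  "euler f = (\<Sum>j = 1..m. xi j (partial j f))"

definition homogeneous :: "nat \<Rightarrow> ((nat \<Rightarrow> int) \<Rightarrow> 'c) \<Rightarrow> bool" where
  "homogeneous k f \<longleftrightarrow> euler f = fscale (of_nat k) f"

definition monogenic :: "((nat \<Rightarrow> int) \<Rightarrow> 'c) \<Rightarrow> bool" where
  "monogenic f \<longleftrightarrow> dirac f = 0"

definition monogenics :: "nat \<Rightarrow> ((nat \<Rightarrow> int) \<Rightarrow> 'c) set" where
  "monogenics k = {f \<in> discrete_polynomials. homogeneous k f \<and> monogenic f}"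

definition L_op :: "nat \<Rightarrow> nat \<Rightarrow> ((nat \<Rightarrow> int) \<Rightarrow> 'c) \<Rightarrow> (nat \<Rightarrow> int) \<Rightarrow> 'c" where
  "L_op a b f = xi a (partial b f) + xi b (partial a f)"

definition V_elt :: "nat \<Rightarrow> nat \<Rightarrow> 'c" where
  "V_elt a b = e a * e b * e_perp a * e_perp b"

definition dR :: "nat \<Rightarrow> nat \<Rightarrow> ((nat \<Rightarrow> int) \<Rightarrow> 'c) \<Rightarrow> (nat \<Rightarrow> int) \<Rightarrow> 'c" where
  "dR a b f = (if a = b then 0
     else (\<lambda>x. V_elt a b * (L_op a b f x - scale (1 / 2) (f x)) * e_perp a * e_perp b))"

end

section \<open>Representations of $\mathfrak{so}(m, \mathbb{C})$\<close>

text \<open>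
  A representation of $\mathfrak{so}(m, \mathbb{C})$ on a subspace \<open>V\<close>, given by the action \<open>\<rho> a b\<close> of
  the spanning elements $e_{a,b} = - e_{b,a}$ with $1 \le a, b \le m$.
\<close>

locale so_representation = vector_space scale
  for scale :: "complex \<Rightarrow> 'v::ab_group_add \<Rightarrow> 'v" +
  fixes m :: nat and \<rho> :: "nat \<Rightarrow> nat \<Rightarrow> 'v \<Rightarrow> 'v" and V :: "'v set"
  assumes subspace_V: "subspace V"
    and maps_to: "a \<in> {1..m} \<Longrightarrow> b \<in> {1..m} \<Longrightarrow> x \<in> V \<Longrightarrow> \<rho> a b x \<in> V"
    and rho_add: "a \<in> {1..m} \<Longrightarrow> b \<in> {1..m} \<Longrightarrow> x \<in> V \<Longrightarrow> y \<in> V \<Longrightarrow>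
      \<rho> a b (x + y) = \<rho> a b x + \<rho> a b y"
    and rho_scale: "a \<in> {1..m} \<Longrightarrow> b \<in> {1..m} \<Longrightarrow> x \<in> V \<Longrightarrow> \<rho> a b (scale z x) = scale z (\<rho> a b x)"
    and rho_skew: "a \<in> {1..m} \<Longrightarrow> b \<in> {1..m} \<Longrightarrow> x \<in> V \<Longrightarrow> \<rho> b a x = - \<rho> a b x"
    and rho_bracket: "a \<in> {1..m} \<Longrightarrow> b \<in> {1..m} \<Longrightarrow> c \<in> {1..m} \<Longrightarrow> d \<in> {1..m} \<Longrightarrow> x \<in> V \<Longrightarrow>
      \<rho> a b (\<rho> c d x) - \<rho> c d (\<rho> a b x) =
        scale (of_bool (b = c)) (\<rho> a d x) - scale (of_bool (b = d)) (\<rho> a c x)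
        - scale (of_bool (a = c)) (\<rho> b d x) + scale (of_bool (a = d)) (\<rho> b c x)"

definition so_irreducible ::
  "(complex \<Rightarrow> 'v::ab_group_add \<Rightarrow> 'v) \<Rightarrow> nat \<Rightarrow> (nat \<Rightarrow> nat \<Rightarrow> 'v \<Rightarrow> 'v) \<Rightarrow> 'v set \<Rightarrow> bool" where
  "so_irreducible scale m \<rho> V \<longleftrightarrow> so_representation scale m \<rho> V \<and> V \<noteq> {0} \<and>
    (\<forall>U \<subseteq> V. so_representation scale m \<rho> U \<longrightarrow> U = {0} \<or> U = V)"

definition so_isomorphic ::
  "(complex \<Rightarrow> 'v::ab_group_add \<Rightarrow> 'v) \<Rightarrow> nat \<Rightarrow> (nat \<Rightarrow> nat \<Rightarrow> 'v \<Rightarrow> 'v) \<Rightarrow> 'v set \<Rightarrow> 'v set \<Rightarrow> bool"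
  where
  "so_isomorphic scale m \<rho> V W \<longleftrightarrow> (\<exists>\<phi>. bij_betw \<phi> V W \<and>
    (\<forall>x\<in>V. \<forall>y\<in>V. \<phi> (x + y) = \<phi> x + \<phi> y) \<and> (\<forall>z. \<forall>x\<in>V. \<phi> (scale z x) = scale z (\<phi> x)) \<and>
    (\<forall>a\<in>{1..m}. \<forall>b\<in>{1..m}. \<forall>x\<in>V. \<phi> (\<rho> a b x) = \<rho> a b (\<phi> x)))"

definition internal_direct_sum :: "'v::ab_group_add set \<Rightarrow> 'i set \<Rightarrow> ('i \<Rightarrow> 'v set) \<Rightarrow> bool" where
  "internal_direct_sum V I W \<longleftrightarrow> V = {\<Sum>i\<in>I. w i | w. \<forall>i\<in>I. w i \<in> W i} \<and>
    (\<forall>w. (\<forall>i\<in>I. w i \<in> W i) \<longrightarrow> (\<Sum>i\<in>I. w i) = 0 \<longrightarrow> (\<forall>i\<in>I. w i = 0))"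

context
  fixes scale :: "complex \<Rightarrow> 'v::ab_group_add \<Rightarrow> 'v"
    and m :: nat
    and \<rho> :: "nat \<Rightarrow> nat \<Rightarrow> 'v \<Rightarrow> 'v"
begin

definition cartan_H :: "nat \<Rightarrow> 'v \<Rightarrow> 'v" where
  "cartan_H a x = scale \<i> (\<rho> (2 * a - 1) (2 * a) x)"

definition root_X :: "nat \<Rightarrow> nat \<Rightarrow> 'v \<Rightarrow> 'v" where
  "root_X a b x = scale (1 / 2) (\<rho> (2 * a - 1) (2 * b - 1) x + scale \<i> (\<rho> (2 * a - 1) (2 * b) x)
     - scale \<i> (\<rho> (2 * a) (2 * b - 1) x) + \<rho> (2 * a) (2 * b) x)"

definition root_Y :: "nat \<Rightarrow> nat \<Rightarrow> 'v \<Rightarrow> 'v" where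
  "root_Y a b x = scale (1 / 2) (\<rho> (2 * a - 1) (2 * b - 1) x - scale \<i> (\<rho> (2 * a - 1) (2 * b) x)
     - scale \<i> (\<rho> (2 * a) (2 * b - 1) x) - \<rho> (2 * a) (2 * b) x)"

definition root_U :: "nat \<Rightarrow> 'v \<Rightarrow> 'v" where
  "root_U a x = scale (of_real (1 / sqrt 2)) (\<rho> (2 * a - 1) m x - scale \<i> (\<rho> (2 * a) m x))"

text \<open>Here \<open>m div 2\<close> is the rank; the weight is \<open>(wt 1, \<dots>, wt (m div 2))\<close>.\<close>

definition highest_weight_vector :: "(nat \<Rightarrow> complex) \<Rightarrow> 'v \<Rightarrow> bool" where
  "highest_weight_vector wt x \<longleftrightarrow> x \<noteq> 0 \<and>
    (\<forall>a\<in>{1..m div 2}. cartan_H a x = scale (wt a) x) \<and>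
    (\<forall>a\<in>{1..m div 2}. \<forall>b\<in>{1..m div 2}. a < b \<longrightarrow> root_X a b x = 0) \<and>
    (\<forall>a\<in>{1..m div 2}. \<forall>b\<in>{1..m div 2}. a \<noteq> b \<longrightarrow> root_Y a b x = 0) \<and>
    (odd m \<longrightarrow> (\<forall>a\<in>{1..m div 2}. root_U a x = 0))"

definition so_irreducible_with_highest_weight :: "(nat \<Rightarrow> complex) \<Rightarrow> 'v set \<Rightarrow> bool" where
  "so_irreducible_with_highest_weight wt V \<longleftrightarrow>
    so_irreducible scale m \<rho> V \<and> (\<exists>x\<in>V. highest_weight_vector wt x)"

definition isomorphic_irreducibles :: "(nat \<Rightarrow> complex) \<Rightarrow> 'i set \<Rightarrow> ('i \<Rightarrow> 'v set) \<Rightarrow> bool" where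
  "isomorphic_irreducibles wt I W \<longleftrightarrow>
    (\<forall>i\<in>I. so_irreducible_with_highest_weight wt (W i)) \<and>
    (\<forall>i\<in>I. \<forall>j\<in>I. so_isomorphic scale m \<rho> (W i) (W j))"

end

section \<open>The operators $X^+$ and $X^-$ are well defined\<close>

lemma u_poly_eq_0_iff: "u_poly k x = 0 \<longleftrightarrow> \<bar>x\<bar> \<le> int k"
proof -
  have "u_poly k x = 0 \<longleftrightarrow> (\<exists>i\<in>{- int k..int k}. x + i = 0)"
    unfolding u_poly_def by (simp add: prod_zero_iff)
  also have "\<dots> \<longleftrightarrow> - x \<in> {- int k..int k}"
    by (auto simp: add_eq_0_iff)
  finally show ?thesis by auto
qed

lemma X_basis_triangular:
  assumes s: "s = 1 \<or> s = - 1"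
  shows "\<exists>t. X_basis s j t \<noteq> 0 \<and> (\<forall>i>j. X_basis s i t = 0)"
proof (intro exI conjI allI impI)
  define t where "t = (if even j then s * int (j div 2) else - s * int (Suc (j div 2)))"
  have abs_t: "\<bar>t\<bar> = int (Suc j div 2)"
    using s by (auto simp: t_def abs_mult elim!: evenE oddE)
  show "X_basis s j t \<noteq> 0"
  proof (cases "even j")
    case True
    then have "t = s * int (j div 2)" "Suc j div 2 = j div 2"
      by (auto simp: t_def)
    with True abs_t s show ?thesis
      by (auto simp: X_basis_def v_poly_def u_poly_eq_0_iff)
  next
    case False
    then have "Suc j div 2 = Suc (j div 2)"
      by (auto elim!: oddE)
    with False abs_t show ?thesis
      by (simp add: X_basis_def u_poly_eq_0_iff)
  qed
  fix i assume ij: "j < i"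
  show "X_basis s i t = 0"
  proof (cases "even i")
    case False
    with ij have "Suc j div 2 \<le> i div 2"
      by (simp add: div_le_mono)
    with False abs_t show ?thesis
      by (simp add: X_basis_def u_poly_eq_0_iff)
  next
    case True
    then obtain k where k: "i = 2 * k" ..
    with ij have "k > 0" by simp
    show ?thesis
    proof (cases "j = 2 * k - 1")
      case True
      with \<open>k > 0\<close> have "odd j" "Suc (j div 2) = k"
        by simp_all
      with k \<open>k > 0\<close> show ?thesis
        by (simp add: X_basis_def v_poly_def t_def)
    next
      case False
      with ij k have "Suc j div 2 \<le> k - 1"
        by linarith
      with k abs_t have "u_poly (k - 1) t = 0"
        by (simp add: u_poly_eq_0_iff)
      with k \<open>k > 0\<close> show ?thesis
        by (simp add: X_basis_def v_poly_def)
    qed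
  qed
qed

context clifford_algebra
begin

lemma of_int_mult_eq_0:
  assumes "of_int z * (c :: 'c) = 0" "z \<noteq> 0"
  shows "c = 0"
proof -
  have "of_int z * c = scale (of_int z) c" for z
  proof (induction z rule: int_induct [where k = 0])
    case base
    show ?case by simp
  next
    case (step1 i)
    then show ?case by (simp add: distrib_right scale_left_distrib)
  next
    case (step2 i)
    then show ?case by (simp add: left_diff_distrib scale_left_diff_distrib)
  qed
  with assms show ?thesis by simp
qed

lemma X_basis_independent:
  fixes c :: "nat \<Rightarrow> 'c"
  assumes s: "s = 1 \<or> s = - 1"
    and 0: "\<And>t. (\<Sum>i<N. of_int (X_basis s i t) * c i) = 0"
  shows "i < N \<Longrightarrow> c i = 0"
proof (induction i rule: less_induct)
  case (less j)
  obtain t where t: "X_basis s j t \<noteq> 0" "\<And>i. j < i \<Longrightarrow> X_basis s i t = 0"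
    using X_basis_triangular [OF s, of j] by blast
  have "(\<Sum>i<N. of_int (X_basis s i t) * c i) = of_int (X_basis s j t) * c j"
  proof (rule sum.remove [of _ j, THEN trans])
    have "of_int (X_basis s i t) * c i = 0" if "i \<in> {..<N} - {j}" for i
      using that less t(2) by (cases "i < j") auto
    then show "of_int (X_basis s j t) * c j
        + (\<Sum>i\<in>{..<N} - {j}. of_int (X_basis s i t) * c i) = of_int (X_basis s j t) * c j"
      by (simp add: sum.neutral)
  qed (use less.prems in auto)
  then show ?case
    using 0 t(1) of_int_mult_eq_0 by metis
qed

lemma X_op_expansion:
  fixes c :: "nat \<Rightarrow> 'c"
  assumes s: "s = 1 \<or> s = - 1"
  shows "X_op s (\<lambda>t. \<Sum>i<N. of_int (X_basis s i t) * c i) =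
    (\<lambda>t. \<Sum>i<N. of_int (X_image s i t) * c i)"
proof -
  have "(\<lambda>t. \<Sum>i<N. of_int (X_image s i t) * c i) = (\<lambda>t. \<Sum>i<N'. of_int (X_image s i t) * c' i)"
    if eq: "(\<lambda>t. \<Sum>i<N. of_int (X_basis s i t) * c i) =
      (\<lambda>t. \<Sum>i<N'. of_int (X_basis s i t) * c' i)" for N' c'
  proof -
    define M where "M = max N N'"
    define b where "b i = (if i < N then c i else 0)" for i
    define b' where "b' i = (if i < N' then c' i else 0)" for i
    have pad: "(\<Sum>i<N. of_int (p i t) * c i) = (\<Sum>i<M. of_int (p i t) * b i)"
      "(\<Sum>i<N'. of_int (p i t) * c' i) = (\<Sum>i<M. of_int (p i t) * b' i)"
      for p :: "nat \<Rightarrow> int \<Rightarrow> int" and t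
      by (rule sum.mono_neutral_cong_left; auto simp: M_def b_def b'_def)+
    have "(\<Sum>i<M. of_int (X_basis s i t) * (b i - b' i)) = 0" for t
      using fun_cong [OF eq, of t] unfolding pad right_diff_distrib sum_subtractf by (rule right_minus_eq [THEN iffD2])
    from X_basis_independent [OF s this] have "b i = b' i" if "i < M" for i
      using that by simp
    then show ?thesis
      unfolding pad by (intro ext sum.cong) auto
  qed
  note unique = this
  show ?thesis
    unfolding X_op_def
  proof (rule the_equality)
    show "\<exists>N' c'. (\<lambda>t. \<Sum>i<N. of_int (X_basis s i t) * c i) =
        (\<lambda>t. \<Sum>i<N'. of_int (X_basis s i t) * c' i) \<and>
      (\<lambda>t. \<Sum>i<N. of_int (X_image s i t) * c i) =
        (\<lambda>t. \<Sum>i<N'. of_int (X_image s i t) * c' i)"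
      by (intro exI conjI; rule refl)
  qed (elim exE conjE, simp only: unique)
qed

lemma X_op_v_poly:
  assumes "s = 1 \<or> s = - 1"
  shows "X_op s (\<lambda>t. of_int (v_poly s k t) * (c :: 'c)) = (\<lambda>t. of_int (u_poly k t) * c)"
  using X_op_expansion [OF assms, where N = "Suc (2 * k)" and c = "\<lambda>i. if i = 2 * k then c else 0"]
  by (simp add: X_basis_def X_image_def)

lemma X_op_u_poly:
  assumes "s = 1 \<or> s = - 1"
  shows "X_op s (\<lambda>t. of_int (u_poly k t) * (c :: 'c)) =
    (\<lambda>t. of_int (v_poly (- s) (Suc k) t) * c)"
  using X_op_expansion [OF assms, where N = "Suc (Suc (2 * k))" and c = "\<lambda>i. if i = Suc (2 * k) then c else 0"]
  by (simp add: X_basis_def X_image_def)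

end

end

theory Submission
  imports Defs "HOL-Library.Multiset" "HOL-Computational_Algebra.Polynomial"
begin

text \<open>
  The operators of discrete Clifford analysis are the classical ones in disguise. The element
  \<open>klein a\<close> = $e_a e_a^\perp$ squares to 1, anticommutes with $\mathbf{e}_a^\pm$ and commutes with
  $\mathbf{e}_b^\pm$ for $b \neq a$. Multiplying by it from the left and by $e_a^\perp$ from the right, that is,
  replacing $\xi_a$ and $\partial_a$ by
  \<open>yF a\<close> $f = e_a e_a^\perp (\xi_a f) e_a^\perp$ and \<open>dF a\<close> $f = e_a e_a^\perp (\partial_a f) e_a^\perp$,
  turns the anticommuting operators into commuting variables $y_a$ with commuting partial derivatives
  $d_a$ (lemma \<open>dF_yF\<close>), while \<open>Gam a\<close> $f = e_a e_a^\perp f e_a^\perp$ are Clifford generators of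
  square $-1$. They anticommute with all $y_b$ and $d_b$, which in degree $k$ only costs a sign $(-1)^k$.
  In these terms (lemmas \<open>dirac_eq\<close>, \<open>euler_eq\<close>, \<open>dR_eq\<close>) the Dirac operator is
  $-\sum \Gamma_j d_j$, the Euler operator is $\sum y_j d_j$ and
  $dR(e_{a,b}) = y_a d_b - y_b d_a - \frac12 \Gamma_a \Gamma_b$: the rotations of polynomials with values
  in a Clifford module. So $\mathcal{M}_k$ is a space of classical homogeneous monogenic polynomials,
  with values in the $4^m$-dimensional module formed by the constants.

  The module of constants is a multiple of the spinor space. With $n = \lfloor m/2 \rfloor$ the
  generators, or for odd $m$ their products with the last one, give $n$ pairs of annihilation and
  creation operators. A module over the canonical anticommutation relations is the tensor product of
  the $2^n$-dimensional spinor space with its space of vacua (lemma \<open>coordinates\<close>), so $2^{2m-n}$ copies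
  occur. Taylor coefficients of a polynomial, read off in coordinates of the constants,
  then identify $\mathcal{M}_k$ with the sum of $2^{2m-n}$ copies of the space of
  monogenic spinor-valued polynomials (lemmas \<open>fock_map_dR\<close>, \<open>dirac_0_iff\<close>,
  \<open>fock_map_inj\<close>, \<open>fock_map_surj\<close>). For even $m$ each copy splits into two, by the parity of
  the degree in the exterior algebra that models the spinors (lemmas \<open>odd_case\<close>, \<open>even_case\<close>).

  It remains to see that the monogenic spinor-valued polynomials of degree $k$ (of one parity, if $m$
  is even) are irreducible. Let \<open>U\<close> be a nonzero invariant subspace. The weights of $H_1$ are bounded,
  so \<open>U\<close> contains a vector killed by the root vectors that raise the weight of $H_1$ (lemma
  \<open>exists_killed\<close>). Together with the Dirac equation this is so strong that the vector must be a
  multiple of the power $z^k$ of a null coordinate $z$, times a spinor killed by $\Gamma_1 - i \Gamma_2$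
  (lemma \<open>killed_by_Eop\<close>); and from such a spinor the remaining rotations produce the vacuum (lemma
  \<open>subrep_contains_hw_vec\<close>). Hence every nonzero invariant subspace contains one and the same vector
  \<open>hw_vec\<close>, a highest weight vector of the required weight (lemma \<open>hw_vec_highest\<close>). The rotations are
  skew-adjoint for the Fischer inner product, so the orthogonal complement of a proper
  invariant subspace would be a nonzero invariant subspace as well; it cannot contain \<open>hw_vec\<close> too. This
  is lemma \<open>fock_monogenics_irreducible\<close>.
\<close>

section \<open>Fock space\<close>

text \<open>
  Polynomials with values in the exterior algebra on \<open>n\<close> generators, the standard model of spinors. The
  number \<open>f \<alpha> B\<close> is the derivative of \<open>f\<close> at 0 along the multiset \<open>\<alpha>\<close> of variables (not the
  coefficient of the monomial), at the exterior basis vector given by the set \<open>B\<close>. The type imposes no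
  finiteness, so it also contains formal power series; that way the commutation relations hold
  for every element of the type.
\<close>

type_synonym fock = "nat multiset \<Rightarrow> nat set \<Rightarrow> complex"

definition smul :: "complex \<Rightarrow> fock \<Rightarrow> fock" (infixr "\<odot>" 75) where
  "z \<odot> f = (\<lambda>\<alpha> B. z * f \<alpha> B)"

lemma smul_apply [simp]: "(z \<odot> f) \<alpha> B = z * f \<alpha> B"
  by (simp add: smul_def)

lemma fock_eqI: "(\<And>\<alpha> B. f \<alpha> B = g \<alpha> B) \<Longrightarrow> f = (g :: fock)"
  by (intro ext)

interpretation fock: vector_space smul
  by unfold_locales (simp_all add: smul_def fun_eq_iff algebra_simps)

lemma sum_apply [simp]: "(\<Sum>i\<in>I. f i) x = (\<Sum>i\<in>I. f i x)"
  for f :: "'i \<Rightarrow> 'x \<Rightarrow> 'y::ab_group_add"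
  by (induction I rule: infinite_finite_induct) auto

definition fock_linear :: "(fock \<Rightarrow> fock) \<Rightarrow> bool" where
  "fock_linear T \<longleftrightarrow> (\<forall>x y. T (x + y) = T x + T y) \<and> (\<forall>z x. T (z \<odot> x) = z \<odot> T x)"

lemma lin_add: "fock_linear T \<Longrightarrow> T (x + y) = T x + T y"
  and lin_smul: "fock_linear T \<Longrightarrow> T (z \<odot> x) = z \<odot> T x"
  by (auto simp: fock_linear_def)

lemma lin_0: "fock_linear T \<Longrightarrow> T 0 = 0"
  using lin_smul [of T 0 0] by simp

lemma lin_minus: "fock_linear T \<Longrightarrow> T (- x) = - T x"
  using lin_smul [of T "- 1" x] by (simp add: fock.scale_minus_left)

lemma lin_diff: "fock_linear T \<Longrightarrow> T (x - y) = T x - T y"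
  using lin_add [of T x "- y"] lin_minus [of T y] by simp

lemma lin_sum: "fock_linear T \<Longrightarrow> T (\<Sum>i\<in>I. f i) = (\<Sum>i\<in>I. T (f i))"
  by (induction I rule: infinite_finite_induct)
     (simp_all add: lin_0 [of T] lin_add [of T])

lemmas lin_rules = lin_add lin_smul lin_0 lin_minus lin_diff lin_sum

text \<open>
  With derivatives as coefficients, differentiation is a shift, and the product rule puts the
  multiplicity of the variable into multiplication.
\<close>

definition mulw :: "nat \<Rightarrow> fock \<Rightarrow> fock" where
  "mulw j f = (\<lambda>\<alpha> B. of_nat (count \<alpha> j) * f (\<alpha> - {#j#}) B)"

definition derw :: "nat \<Rightarrow> fock \<Rightarrow> fock" where
  "derw j f = (\<lambda>\<alpha>. f (add_mset j \<alpha>))"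

text \<open>
  The Jordan--Wigner sign: moving the generator \<open>a\<close> to its place in the ordered product of the generators
  in \<open>B\<close> passes those with a smaller index. It makes operators with different indices anticommute.
\<close>

definition ksign :: "nat \<Rightarrow> nat set \<Rightarrow> complex" where
  "ksign a B = (- 1) ^ card {b \<in> B. b < a}"

definition ann :: "nat \<Rightarrow> fock \<Rightarrow> fock" where
  "ann a f = (\<lambda>\<alpha> B. if a \<in> B then 0 else ksign a B * f \<alpha> (insert a B))"

definition cre :: "nat \<Rightarrow> fock \<Rightarrow> fock" where
  "cre a f = (\<lambda>\<alpha> B. if a \<in> B then ksign a B * f \<alpha> (B - {a}) else 0)"

lemma ksign_sq [simp]: "ksign a B * ksign a B = 1" "ksign a B * (ksign a B * z) = z"
proof -
  show "ksign a B * ksign a B = 1"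
    by (simp add: ksign_def power_mult_distrib [symmetric])
  then show "ksign a B * (ksign a B * z) = z"
    by (simp add: mult.assoc [symmetric])
qed

lemma ksign_nz [simp]: "ksign a B \<noteq> 0"
  by (simp add: ksign_def)

lemma cnj_ksign [simp]: "cnj (ksign a B) = ksign a B"
  by (simp add: ksign_def)

lemma ksign_insert: "ksign a (insert b B) = (if b < a \<and> b \<notin> B then - ksign a B else ksign a B)"
proof -
  have "{c \<in> insert b B. c < a} = (if b < a then insert b {c \<in> B. c < a} else {c \<in> B. c < a})"
    by auto
  then show ?thesis
    by (auto simp: ksign_def card_insert_if)
qed

lemma ksign_remove: "ksign a (B - {b}) = (if b < a \<and> b \<in> B then - ksign a B else ksign a B)"
proof (cases "b \<in> B")
  case True
  then have "insert b (B - {b}) = B" by auto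
  with True show ?thesis using ksign_insert [of a b "B - {b}"] by auto
qed auto

lemma mulw_lin: "fock_linear (mulw j)" and derw_lin: "fock_linear (derw j)"
  and ann_lin: "fock_linear (ann a)" and cre_lin: "fock_linear (cre a)"
  by (auto simp: fock_linear_def mulw_def derw_def ann_def cre_def fun_eq_iff algebra_simps)

lemmas op_simps = lin_rules [OF mulw_lin] lin_rules [OF derw_lin] lin_rules [OF ann_lin]
  lin_rules [OF cre_lin]

lemma mulw_mulw: "mulw i (mulw j f) = mulw j (mulw i f)"
  by (rule fock_eqI) (auto simp: mulw_def count_eq_zero_iff add_mset_commute)

lemma derw_derw: "derw i (derw j f) = derw j (derw i f)"
  by (simp add: derw_def add_mset_commute)

lemma derw_mulw: "derw i (mulw j f) = mulw j (derw i f) + of_bool (i = j) \<odot> f"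
proof (rule fock_eqI)
  fix \<alpha> B
  show "derw i (mulw j f) \<alpha> B = (mulw j (derw i f) + of_bool (i = j) \<odot> f) \<alpha> B"
  proof (cases "i = j")
    case True
    then show ?thesis
      by (cases "j \<in># \<alpha>") (auto simp: derw_def mulw_def algebra_simps count_eq_zero_iff)
  next
    case False
    then show ?thesis
      by (cases "j \<in># \<alpha>") (auto simp: derw_def mulw_def algebra_simps count_eq_zero_iff)
  qed
qed

lemma mulw_derw: "mulw j (derw j f) = (\<lambda>\<alpha> B. of_nat (count \<alpha> j) * f \<alpha> B)"
proof (rule fock_eqI)
  fix \<alpha> B
  show "mulw j (derw j f) \<alpha> B = of_nat (count \<alpha> j) * f \<alpha> B"
    by (cases "j \<in># \<alpha>") (auto simp: derw_def mulw_def count_eq_zero_iff)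
qed

lemma mulw_inj: "mulw j f = 0 \<Longrightarrow> f = 0"
proof (rule fock_eqI)
  fix \<alpha> B assume "mulw j f = 0"
  then have "mulw j f (add_mset j \<alpha>) B = 0" by simp
  then show "f \<alpha> B = 0 \<alpha> B" by (simp add: mulw_def flip: of_nat_Suc)
qed

lemma ann_ann: "ann a (ann b f) = - ann b (ann a f)"
  by (rule fock_eqI) (auto simp: ann_def ksign_insert insert_commute)

lemma ann_ann_same [simp]: "ann a (ann a f) = 0"
  by (rule fock_eqI) (auto simp: ann_def)

lemma cre_cre: "cre a (cre b f) = - cre b (cre a f)"
proof (rule fock_eqI)
  fix \<alpha> B
  have "B - {a} - {b} = B - {b} - {a}" by auto
  then show "cre a (cre b f) \<alpha> B = (- cre b (cre a f)) \<alpha> B"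
    by (auto simp: cre_def ksign_remove)
qed

lemma cre_cre_same [simp]: "cre a (cre a f) = 0"
  by (rule fock_eqI) (auto simp: cre_def)

lemma ann_cre: "ann a (cre b f) = of_bool (a = b) \<odot> f - cre b (ann a f)"
proof (rule fock_eqI)
  fix \<alpha> B
  show "ann a (cre b f) \<alpha> B = (of_bool (a = b) \<odot> f - cre b (ann a f)) \<alpha> B"
  proof (cases "a = b")
    case True
    then show ?thesis
      by (auto simp: ann_def cre_def ksign_insert ksign_remove insert_absorb)
  next
    case False
    then have "insert a B - {b} = insert a (B - {b})" by auto
    with False show ?thesis
      by (auto simp: ann_def cre_def ksign_insert ksign_remove)
  qed
qed

lemma ann_commutes: "ann a (mulw j f) = mulw j (ann a f)" "ann a (derw j f) = derw j (ann a f)"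
  and cre_commutes: "cre a (mulw j f) = mulw j (cre a f)" "cre a (derw j f) = derw j (cre a f)"
  by (rule fock_eqI; auto simp: ann_def cre_def mulw_def derw_def)+

section \<open>The Clifford generators on spinors\<close>

definition inv_sqrt2 :: complex where "inv_sqrt2 = of_real (1 / sqrt 2)"

lemma inv_sqrt2_sq [simp]: "inv_sqrt2 * inv_sqrt2 = 1 / 2" "inv_sqrt2 * (inv_sqrt2 * z) = z / 2"
proof -
  have "1 / sqrt 2 * (1 / sqrt 2) = (1 / 2 :: real)" by simp
  then show "inv_sqrt2 * inv_sqrt2 = 1 / 2" unfolding inv_sqrt2_def of_real_mult [symmetric] by simp
  then show "inv_sqrt2 * (inv_sqrt2 * z) = z / 2" by (simp add: mult.assoc [symmetric])
qed

lemma inv_sqrt2_nz [simp]: "inv_sqrt2 \<noteq> 0" by (simp add: inv_sqrt2_def)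
lemma cnj_inv_sqrt2 [simp]: "cnj inv_sqrt2 = inv_sqrt2" by (simp add: inv_sqrt2_def)

text \<open>
  The chirality operator, normalised to have square $-1$: on sets \<open>B \<subseteq> {1..n}\<close> the sign \<open>ksign (Suc n) B\<close>
  counts all of \<open>B\<close>.
\<close>

definition kappa :: "nat \<Rightarrow> fock \<Rightarrow> fock" where
  "kappa n f = (\<lambda>\<alpha> B. \<i> * ksign (Suc n) B * f \<alpha> B)"

definition theta :: "nat \<Rightarrow> fock \<Rightarrow> fock" where
  "theta a f = (if odd a then ann (Suc a div 2) f - cre (Suc a div 2) f
                else \<i> \<odot> (ann (a div 2) f + cre (a div 2) f))"

text \<open>
  For odd \<open>m\<close> the chirality is the last generator, and the others are multiplied by it so that
  \<open>gam m a (gam m m f) = - theta a f\<close> (lemma \<open>gam_gam_last\<close>). Only products of two generators enter the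
  representation; in this form they are products of the operators \<open>theta\<close>. An abstract Clifford
  module for odd \<open>m\<close> has the same even products, whichever of the two irreducible modules occurs in it.
\<close>

definition gam :: "nat \<Rightarrow> nat \<Rightarrow> fock \<Rightarrow> fock" where
  "gam m a f = (if even m then theta a f else if a = m then kappa (m div 2) f
                else theta a (kappa (m div 2) f))"

lemma kappa_lin: "fock_linear (kappa n)"
  by (auto simp: fock_linear_def kappa_def fun_eq_iff algebra_simps)

lemma theta_lin: "fock_linear (theta a)"
  by (cases "even a") (auto simp: fock_linear_def theta_def op_simps fun_eq_iff algebra_simps)

lemma gam_lin: "fock_linear (gam m a)"
  unfolding gam_def using theta_lin kappa_lin by (auto simp: fock_linear_def)

lemmas kappa_rules = lin_rules [OF kappa_lin]
lemmas theta_rules = lin_rules [OF theta_lin]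
lemmas gam_rules = lin_rules [OF gam_lin]

lemma kappa_kappa [simp]: "kappa n (kappa n f) = - f"
  by (rule fock_eqI) (auto simp: kappa_def algebra_simps)

lemma kappa_ann: "a \<le> n \<Longrightarrow> kappa n (ann a f) = - ann a (kappa n f)"
  and kappa_cre: "a \<le> n \<Longrightarrow> kappa n (cre a f) = - cre a (kappa n f)"
  by (rule fock_eqI; auto simp: kappa_def ann_def cre_def ksign_insert ksign_remove)+

lemma kappa_theta: "a \<le> 2 * n \<Longrightarrow> kappa n (theta a f) = - theta a (kappa n f)"
  by (cases "even a"; rule fock_eqI)
     (auto simp: theta_def kappa_rules kappa_ann kappa_cre algebra_simps elim!: oddE)

lemma theta_same: "theta a (theta a f) = - f"
  by (cases "even a"; rule fock_eqI)
     (auto simp: theta_def op_simps ann_cre algebra_simps)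

lemma theta_anti: "a \<noteq> b \<Longrightarrow> a > 0 \<Longrightarrow> b > 0 \<Longrightarrow> theta a (theta b f) = - theta b (theta a f)"
proof -
  have *: "theta a (theta b f) = - theta b (theta a f)" if "a < b" for a b
  proof (cases "odd a \<and> b = Suc a")
    case True
    then show ?thesis
      by (auto intro!: fock_eqI simp: theta_def op_simps ann_cre algebra_simps)
  next
    case False
    define a' b' where "a' = Suc a div 2" and "b' = Suc b div 2"
    have ne: "a' \<noteq> b'" using False that unfolding a'_def b'_def by presburger
    have th: "theta a f = (if odd a then ann a' f - cre a' f else \<i> \<odot> (ann a' f + cre a' f))"
      "theta b f = (if odd b then ann b' f - cre b' f else \<i> \<odot> (ann b' f + cre b' f))" for f
      by (auto simp: theta_def a'_def b'_def)
    show ?thesis unfolding th using ne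
      by (auto intro!: fock_eqI simp: op_simps ann_cre ann_ann [of a' b'] cre_cre [of a' b'] algebra_simps)
  qed
  assume "a \<noteq> b"
  then show ?thesis using * [of a b] * [of b a] by (cases "a < b") auto
qed

lemma kappa_commutes: "kappa n (mulw j f) = mulw j (kappa n f)" "kappa n (derw j f) = derw j (kappa n f)"
  by (rule fock_eqI; auto simp: kappa_def mulw_def derw_def)+

lemma theta_commutes: "theta a (mulw j f) = mulw j (theta a f)" "theta a (derw j f) = derw j (theta a f)"
  by (auto simp: theta_def ann_commutes cre_commutes op_simps)

lemma gam_commutes: "gam m a (mulw j f) = mulw j (gam m a f)" "gam m a (derw j f) = derw j (gam m a f)"
  by (auto simp: gam_def theta_commutes kappa_commutes)

lemma gam_sq: "a \<in> {1..m} \<Longrightarrow> gam m a (gam m a f) = - f"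
  by (auto simp: gam_def theta_rules theta_same kappa_theta elim!: oddE)

lemma gam_anti:
  assumes "a \<in> {1..m}" "b \<in> {1..m}" "a \<noteq> b"
  shows "gam m a (gam m b f) = - gam m b (gam m a f)"
proof (cases "even m")
  case True
  with assms show ?thesis by (simp add: gam_def theta_anti [of a b])
next
  case False
  then obtain n where "m = 2 * n + 1" by (auto elim: oddE)
  with assms show ?thesis
    by (auto simp: gam_def theta_rules kappa_theta theta_anti [of a b])
qed

section \<open>Spinor-valued polynomials as a representation\<close>

text \<open>
  The Cartesian variables $y_1 = (z_1 + z_2)/\sqrt2$ and $y_2 = i (z_1 - z_2)/\sqrt2$, where \<open>mulw 1\<close> and
  \<open>mulw 2\<close> multiply by the null coordinates $z_1, z_2 = (y_1 \mp i y_2)/\sqrt2$. In null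
  coordinates the first Cartan element $H_1$ is diagonal on monomials, and raising its weight trades
  $z_2$ for other variables and these for $z_1$.
\<close>

definition yop :: "nat \<Rightarrow> fock \<Rightarrow> fock" where
  "yop j f = (if j = 1 then inv_sqrt2 \<odot> (mulw 1 f + mulw 2 f)
              else if j = 2 then (\<i> * inv_sqrt2) \<odot> (mulw 1 f - mulw 2 f) else mulw j f)"

definition dop :: "nat \<Rightarrow> fock \<Rightarrow> fock" where
  "dop j f = (if j = 1 then inv_sqrt2 \<odot> (derw 1 f + derw 2 f)
              else if j = 2 then (- \<i> * inv_sqrt2) \<odot> (derw 1 f - derw 2 f) else derw j f)"

lemma yop_lin: "fock_linear (yop j)" and dop_lin: "fock_linear (dop j)"
  by (auto simp: fock_linear_def yop_def dop_def op_simps fun_eq_iff algebra_simps)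

lemmas yop_rules = lin_rules [OF yop_lin]
lemmas dop_rules = lin_rules [OF dop_lin]

lemma yop_yop: "yop i (yop j f) = yop j (yop i f)"
  by (rule fock_eqI) (auto simp: yop_def op_simps mulw_mulw algebra_simps)

lemma dop_dop: "dop i (dop j f) = dop j (dop i f)"
  by (rule fock_eqI) (auto simp: dop_def op_simps derw_derw algebra_simps)

lemma dop_yop: "dop i (yop j f) = yop j (dop i f) + of_bool (i = j) \<odot> f"
  by (rule fock_eqI) (auto simp: dop_def yop_def op_simps derw_mulw algebra_simps)

lemma gam_yop: "gam m a (yop j f) = yop j (gam m a f)"
  and gam_dop: "gam m a (dop j f) = dop j (gam m a f)"
  by (auto simp: yop_def dop_def gam_commutes gam_rules)

definition rho_fock :: "nat \<Rightarrow> nat \<Rightarrow> nat \<Rightarrow> fock \<Rightarrow> fock" where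
  "rho_fock m a b f = (if a = b then 0
     else yop a (dop b f) - yop b (dop a f) - (1 / 2) \<odot> gam m a (gam m b f))"

definition dirac_fock :: "nat \<Rightarrow> fock \<Rightarrow> fock" where
  "dirac_fock m f = (\<Sum>a = 1..m. gam m a (dop a f))"

lemma rho_fock_lin: "fock_linear (rho_fock m a b)"
  by (auto simp: fock_linear_def rho_fock_def yop_rules dop_rules gam_rules fun_eq_iff algebra_simps)

lemma dirac_fock_lin: "fock_linear (dirac_fock m)"
  by (auto simp: fock_linear_def dirac_fock_def dop_rules gam_rules fun_eq_iff algebra_simps sum.distrib sum_distrib_left)

lemmas rho_fock_rules = lin_rules [OF rho_fock_lin]
lemmas dirac_fock_rules = lin_rules [OF dirac_fock_lin]

lemma gam_ac:
  assumes "a \<in> {1..m}" "b \<in> {1..m}"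
  shows "gam m a (gam m b f) = - gam m b (gam m a f) - (2 * of_bool (a = b)) \<odot> f"
  using gam_anti [OF assms] gam_sq [OF assms(1)]
  by (cases "a = b") (auto intro!: fock_eqI simp: algebra_simps)

lemma gam_quad:
  assumes "a \<in> {1..m}" "b \<in> {1..m}" "c \<in> {1..m}"
  shows "gam m a (gam m b (gam m c f)) = gam m c (gam m a (gam m b f))
    - (2 * of_bool (b = c)) \<odot> gam m a f + (2 * of_bool (a = c)) \<odot> gam m b f"
  unfolding gam_ac [OF assms(2,3)] gam_rules gam_ac [OF assms(1,3)]
  by (rule fock_eqI) (auto simp: algebra_simps)

lemma rho_fock_eq:
  assumes "a \<in> {1..m}" "b \<in> {1..m}"
  shows "rho_fock m a b f = yop a (dop b f) - yop b (dop a f) - (1 / 2) \<odot> gam m a (gam m b f)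
     - (of_bool (a = b) / 2) \<odot> f"
  using gam_sq [OF assms(1), of f] by (auto simp: rho_fock_def intro!: fock_eqI)

lemma rho_fock_skew: "a \<in> {1..m} \<Longrightarrow> b \<in> {1..m} \<Longrightarrow> rho_fock m b a f = - rho_fock m a b f"
  using gam_anti [of a m b f] by (auto simp: rho_fock_def intro!: fock_eqI)

definition orbital :: "nat \<Rightarrow> nat \<Rightarrow> fock \<Rightarrow> fock" where
  "orbital a b f = yop a (dop b f) - yop b (dop a f)"

definition spinorial :: "nat \<Rightarrow> nat \<Rightarrow> nat \<Rightarrow> fock \<Rightarrow> fock" where
  "spinorial m a b f = (- 1 / 2) \<odot> gam m a (gam m b f) - (of_bool (a = b) / 2) \<odot> f"

lemma orbital_bracket:
  "orbital a b (orbital c d f) - orbital c d (orbital a b f) = of_bool (b = c) \<odot> orbital a d f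
     - of_bool (b = d) \<odot> orbital a c f - of_bool (a = c) \<odot> orbital b d f + of_bool (a = d) \<odot> orbital b c f"
proof -
  have ec: "(c = a) = (a = c)" "(d = a) = (a = d)" "(c = b) = (b = c)" "(d = b) = (b = d)"
    by auto
  show ?thesis
    by (rule fock_eqI)
       (simp add: orbital_def yop_rules dop_rules dop_yop yop_yop dop_dop algebra_simps ec)
qed

lemma spin_bracket:
  assumes "a \<in> {1..m}" "b \<in> {1..m}" "c \<in> {1..m}" "d \<in> {1..m}"
  shows "spinorial m a b (spinorial m c d f) - spinorial m c d (spinorial m a b f) = of_bool (b = c) \<odot> spinorial m a d f
     - of_bool (b = d) \<odot> spinorial m a c f - of_bool (a = c) \<odot> spinorial m b d f + of_bool (a = d) \<odot> spinorial m b c f"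
proof -
  have ec: "(c = a) = (a = c)" "(d = a) = (a = d)" "(c = b) = (b = c)" "(d = b) = (b = d)"
    by auto
  show ?thesis
    unfolding spinorial_def
    by (rule fock_eqI)
       (auto simp: gam_rules gam_quad [OF assms(1,2,3)] gam_quad [OF assms(1,2,4)]
          gam_ac [OF assms(3,1)] gam_ac [OF assms(3,2)] ec algebra_simps)
qed

text \<open>
  The orbital part and the spin part commute, and each satisfies the relations by itself.
\<close>

lemma rho_fock_bracket:
  assumes "a \<in> {1..m}" "b \<in> {1..m}" "c \<in> {1..m}" "d \<in> {1..m}"
  shows "rho_fock m a b (rho_fock m c d f) - rho_fock m c d (rho_fock m a b f) = of_bool (b = c) \<odot> rho_fock m a d f
     - of_bool (b = d) \<odot> rho_fock m a c f - of_bool (a = c) \<odot> rho_fock m b d f + of_bool (a = d) \<odot> rho_fock m b c f"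
proof -
  have r: "rho_fock m a b f = orbital a b f + spinorial m a b f" if "a \<in> {1..m}" "b \<in> {1..m}" for a b f
    unfolding rho_fock_eq [OF that] orbital_def spinorial_def by (rule fock_eqI) simp
  have OS: "orbital a b (spinorial m c d f) = spinorial m c d (orbital a b f)" for a b c d f
    unfolding orbital_def spinorial_def
    by (rule fock_eqI) (simp add: yop_rules dop_rules gam_rules gam_yop gam_dop algebra_simps)
  have lO: "orbital a b (f + g) = orbital a b f + orbital a b g" for a b f g
    unfolding orbital_def by (rule fock_eqI) (simp add: yop_rules dop_rules)
  have lS: "spinorial m a b (f + g) = spinorial m a b f + spinorial m a b g" for a b f g
    unfolding spinorial_def by (rule fock_eqI) (simp add: gam_rules algebra_simps)
  have "rho_fock m a b (rho_fock m c d f) - rho_fock m c d (rho_fock m a b f)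
     = (orbital a b (orbital c d f) - orbital c d (orbital a b f)) + (spinorial m a b (spinorial m c d f) - spinorial m c d (spinorial m a b f))"
    unfolding r [OF assms(1,2)] r [OF assms(3,4)] lO lS OS by simp
  also have "\<dots> = of_bool (b = c) \<odot> rho_fock m a d f - of_bool (b = d) \<odot> rho_fock m a c f
     - of_bool (a = c) \<odot> rho_fock m b d f + of_bool (a = d) \<odot> rho_fock m b c f"
    unfolding orbital_bracket [of a b c d f] spin_bracket [OF assms, of f]
      r [OF assms(1,4)] r [OF assms(1,3)] r [OF assms(2,4)] r [OF assms(2,3)]
    by (simp only: fock.scale_right_distrib diff_conv_add_uminus minus_add_distrib add_ac)
  finally show ?thesis .
qed

text \<open>
  Commuting the rotation past \<open>dop c\<close> and past \<open>gam m c\<close> produces two correction terms each; after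
  summing over \<open>c\<close> the orbital ones cancel against those from the spin part.
\<close>

lemma dirac_fock_rho_fock:
  assumes "a \<in> {1..m}" "b \<in> {1..m}"
  shows "dirac_fock m (rho_fock m a b f) = rho_fock m a b (dirac_fock m f)"
proof -
  have 1: "gam m c (dop c (rho_fock m a b f)) = rho_fock m a b (gam m c (dop c f))
     + of_bool (c = a) \<odot> gam m a (dop b f) - of_bool (c = b) \<odot> gam m b (dop a f)
     - of_bool (c = b) \<odot> gam m a (dop b f) + of_bool (c = a) \<odot> gam m b (dop a f)"
    if c: "c \<in> {1..m}" for c
  proof -
    have q: "gam m c (gam m a (gam m b g)) = gam m a (gam m b (gam m c g))
      + (2 * of_bool (c = b)) \<odot> gam m a g - (2 * of_bool (c = a)) \<odot> gam m b g" for g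
      using gam_quad [OF assms c, of g] by (auto intro!: fock_eqI)
    show ?thesis
      unfolding rho_fock_eq [OF assms]
      by (rule fock_eqI)
        (auto simp: gam_rules dop_rules yop_rules dop_yop gam_yop gam_dop dop_dop q algebra_simps)
  qed
  have "dirac_fock m (rho_fock m a b f) = (\<Sum>c = 1..m. rho_fock m a b (gam m c (dop c f)))
     + (\<Sum>c = 1..m. of_bool (c = a) \<odot> gam m a (dop b f)) - (\<Sum>c = 1..m. of_bool (c = b) \<odot> gam m b (dop a f))
     - (\<Sum>c = 1..m. of_bool (c = b) \<odot> gam m a (dop b f)) + (\<Sum>c = 1..m. of_bool (c = a) \<odot> gam m b (dop a f))"
    unfolding dirac_fock_def by (simp only: 1 sum.distrib sum_subtractf cong: sum.cong)
  also have "\<dots> = rho_fock m a b (dirac_fock m f)"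
  proof -
    have "(\<Sum>c = 1..m. of_bool (c = a') \<odot> g) = g" if "a' \<in> {1..m}" for a' and g :: fock
    proof -
      have "(\<Sum>c = 1..m. of_bool (c = a') \<odot> g) = (\<Sum>c = 1..m. if c = a' then g else 0)"
        by (rule sum.cong) auto
      with that show ?thesis by simp
    qed
    then show ?thesis using assms by (simp add: dirac_fock_def rho_fock_rules)
  qed
  finally show ?thesis .
qed

section \<open>Vectors killed by raising operators\<close>

text \<open>
  The Clifford elements along the two null directions: they have square 0, and \<open>gam_null\<close> goes with the
  derivative by $z_1$ in the Dirac operator (lemma \<open>dirac_fock_eq\<close>).
\<close>

definition gam_null :: "nat \<Rightarrow> fock \<Rightarrow> fock" where
  "gam_null m f = inv_sqrt2 \<odot> (gam m 1 f - \<i> \<odot> gam m 2 f)"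

definition gam_null_conj :: "nat \<Rightarrow> fock \<Rightarrow> fock" where
  "gam_null_conj m f = inv_sqrt2 \<odot> (gam m 1 f + \<i> \<odot> gam m 2 f)"

lemma gam_null_lin: "fock_linear (gam_null m)" and gam_null_conj_lin: "fock_linear (gam_null_conj m)"
  by (auto simp: fock_linear_def gam_null_def gam_null_conj_def gam_rules fun_eq_iff algebra_simps)

lemmas gam_null_rules = lin_rules [OF gam_null_lin] lin_rules [OF gam_null_conj_lin]

lemma gam_null_commutes: "gam_null m (mulw j f) = mulw j (gam_null m f)" "gam_null m (derw j f) = derw j (gam_null m f)"
  "gam_null_conj m (mulw j f) = mulw j (gam_null_conj m f)" "gam_null_conj m (derw j f) = derw j (gam_null_conj m f)"
  by (auto simp: gam_null_def gam_null_conj_def gam_commutes op_simps)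

lemma
  assumes "m \<ge> 2"
  shows gam_null_gam_null: "gam_null m (gam_null m f) = 0" and gam_null_conj_gam_null_conj: "gam_null_conj m (gam_null_conj m f) = 0"
    and gam_null_gam_null_conj: "gam_null m (gam_null_conj m f) = - (2 \<odot> f) - gam_null_conj m (gam_null m f)"
  using assms gam_anti [of 2 m 1 f] gam_sq [of 1 m f] gam_sq [of 2 m f]
  by (auto intro!: fock_eqI simp: gam_null_def gam_null_conj_def gam_rules algebra_simps)

lemma
  assumes "v \<in> {3..m}"
  shows gam_null_gam: "gam_null m (gam m v f) = - gam m v (gam_null m f)"
    and gam_null_conj_gam: "gam_null_conj m (gam m v f) = - gam m v (gam_null_conj m f)"
  using assms gam_anti [of 1 m v f] gam_anti [of 2 m v f]
  by (auto intro!: fock_eqI simp: gam_null_def gam_null_conj_def gam_rules algebra_simps)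

text \<open>
  These span the root vectors that raise the weight of $H_1$ by one: they are combinations of $X_{1,b}$,
  $Y_{1,b}$ and $U_1$.
\<close>

definition Eop :: "nat \<Rightarrow> nat \<Rightarrow> fock \<Rightarrow> fock" where
  "Eop m v f = inv_sqrt2 \<odot> (rho_fock m 1 v f - \<i> \<odot> rho_fock m 2 v f)"

lemma Eop_eq:
  assumes "v \<in> {3..m}"
  shows "Eop m v f = mulw 1 (derw v f) - mulw v (derw 2 f) - (1 / 2) \<odot> gam_null m (gam m v f)"
  using assms
  by (auto intro!: fock_eqI simp: Eop_def rho_fock_def gam_null_def yop_def dop_def op_simps algebra_simps)

lemma dirac_fock_eq:
  assumes "m \<ge> 3"
  shows "dirac_fock m f = gam_null m (derw 1 f) + gam_null_conj m (derw 2 f) + (\<Sum>v = 3..m. gam m v (derw v f))"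
proof -
  have "{1..m} = insert 1 (insert 2 {3..m})" using assms by auto
  then have "dirac_fock m f = gam m 1 (dop 1 f) + (gam m 2 (dop 2 f) + (\<Sum>v = 3..m. gam m v (dop v f)))"
    by (simp add: dirac_fock_def)
  also have "(\<Sum>v = 3..m. gam m v (dop v f)) = (\<Sum>v = 3..m. gam m v (derw v f))"
    by (rule sum.cong) (auto simp: dop_def)
  finally have *: "dirac_fock m f = gam m 1 (dop 1 f) + (gam m 2 (dop 2 f) + (\<Sum>v = 3..m. gam m v (derw v f)))" .
  show ?thesis
    unfolding * by (rule fock_eqI) (simp add: dop_def gam_null_def gam_null_conj_def gam_rules algebra_simps)
qed

text \<open>
  Write $W_j, P_j$ for \<open>mulw j\<close>, \<open>derw j\<close>, and $G, G'$ for \<open>gam_null\<close>, \<open>gam_null_conj\<close>; put $h = G f$, $q = P_2 f$,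
  $X = \sum_{v \ge 3} W_v \gamma_v$, $R = \sum_{v \ge 3} W_v^2 = -X^2$ and $c = (m-2)/2$. Adding up
  $\gamma_v E_v f = 0$ and eliminating $\sum \gamma_v P_v f$ by the Dirac equation gives
  $W_1 P_1 h + W_1 G' q + X q + c h = 0$. Since $G^2 = G'^2 = 0$, applying $G$ and $G G'$ leaves
  $W_1 G G' q = X P_2 h$ and $X G G' q = 2 (W_1 P_1 h + c h)$, and so
  $R P_2 h = - 2 W_1 (W_1 P_1 h + c h)$. On the other hand $G E_v f = 0$ reads $W_1 P_v h = W_v P_2 h$, so that
  $R P_2 h = W_1 \sum_{v \ge 3} W_v P_v h$ is known from the Euler equation. Comparing the two and
  cancelling $W_1$ one finds $(2 W_1 P_1 + \sum_{v \ge 3} W_v P_v + m - 2) h = 0$. This operator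
  multiplies every coefficient by a positive number, hence $h = 0$. Then $G$ applied to the Dirac equation
  yields $-2 q = G G' q = 0$, and what remains of $E_v f = 0$ is $W_1 P_v f = 0$.
\<close>

lemma killed_by_Eop:
  assumes m: "m \<ge> 3" and dir0: "dirac_fock m f = 0"
    and eul: "(\<Sum>j = 1..m. mulw j (derw j f)) = of_nat k \<odot> f"
    and E0: "\<And>v. v \<in> {3..m} \<Longrightarrow> Eop m v f = 0"
  shows "gam_null m f = 0 \<and> derw 2 f = 0 \<and> (\<forall>v\<in>{3..m}. derw v f = 0)"
proof -
  define V where "V = {3..m}"
  have split: "{1..m} = insert 1 (insert 2 V)" "1 \<notin> V" "2 \<notin> V" "finite V"
    using m by (auto simp: V_def)
  define X where "X g = (\<Sum>v\<in>V. mulw v (gam m v g))" for g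
  define R where "R g = (\<Sum>v\<in>V. mulw v (mulw v g))" for g
  define h where "h = gam_null m f"
  define q where "q = derw 2 f"
  define c :: complex where "c = of_nat (m - 2) / 2"
  have cardV: "card V = m - 2" by (simp add: V_def)
  have dV: "(\<Sum>v\<in>V. gam m v (derw v f)) = - (derw 1 h) - gam_null_conj m q"
    using dir0 unfolding dirac_fock_eq [OF m] V_def h_def q_def gam_null_commutes
    by (auto simp: algebra_simps eq_neg_iff_add_eq_0)
  have G2: "gam_null m (gam_null m g) = 0" "gam_null_conj m (gam_null_conj m g) = 0" "gam_null m (gam_null_conj m g) = - (2 \<odot> g) - gam_null_conj m (gam_null m g)" for g
    using m gam_null_gam_null [of m g] gam_null_conj_gam_null_conj [of m g] gam_null_gam_null_conj [of m g] by auto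
  have XX: "X (X g) = - R g" for g
  proof -
    define A where "A = (\<Sum>v\<in>V. \<Sum>u\<in>V. mulw v (mulw u (gam m v (gam m u g))))"
    have XA: "X (X g) = A"
      by (simp add: A_def X_def gam_rules gam_commutes op_simps)
    have "A = (\<Sum>v\<in>V. \<Sum>u\<in>V. mulw u (mulw v (gam m u (gam m v g))))"
      unfolding A_def by (rule sum.swap)
    then have "A + A = A + (\<Sum>v\<in>V. \<Sum>u\<in>V. mulw u (mulw v (gam m u (gam m v g))))"
      by simp
    also have "\<dots> = (\<Sum>v\<in>V. \<Sum>u\<in>V. mulw v (mulw u (gam m v (gam m u g) + gam m u (gam m v g))))"
      by (simp add: A_def sum.distrib [symmetric] op_simps mulw_mulw)
    also have "\<dots> = (\<Sum>v\<in>V. \<Sum>u\<in>V. if u = v then (- 2) \<odot> mulw v (mulw v g) else 0)"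
    proof (intro sum.cong refl)
      fix v u assume "v \<in> V" "u \<in> V"
      then have "gam m v (gam m u g) = - gam m u (gam m v g) - (2 * of_bool (v = u)) \<odot> g"
        by (intro gam_ac) (auto simp: V_def)
      then show "mulw v (mulw u (gam m v (gam m u g) + gam m u (gam m v g)))
        = (if u = v then (- 2) \<odot> mulw v (mulw v g) else 0)"
        by (auto simp: op_simps)
    qed
    also have "\<dots> = (-2) \<odot> R g"
      using split by (simp add: R_def fock.scale_sum_right)
    finally have AA: "A + A = (-2) \<odot> R g" .
    show ?thesis unfolding XA
    proof (rule fock_eqI)
      fix \<alpha> B
      show "A \<alpha> B = (- R g) \<alpha> B"
        using fun_cong [OF fun_cong [OF AA, of \<alpha>], of B] by simp
    qed
  qed
  have X_lin: "fock_linear X"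
    by (auto simp: fock_linear_def X_def gam_rules op_simps sum.distrib fock.scale_sum_right)
  note X_rules = lin_rules [OF X_lin]
  have GX: "gam_null m (X g) = - X (gam_null m g)" "gam_null_conj m (X g) = - X (gam_null_conj m g)" for g
    unfolding X_def gam_null_rules sum_negf [symmetric]
    by (intro sum.cong refl; simp add: gam_null_commutes gam_null_gam gam_null_conj_gam V_def op_simps)+
  have XW: "X (mulw 1 g) = mulw 1 (X g)" for g
    by (simp add: X_def gam_commutes op_simps mulw_mulw)
  have star: "mulw 1 (derw 1 h) + mulw 1 (gam_null_conj m q) + X q + c \<odot> h = 0"
  proof -
    have "gam m v (Eop m v f) = mulw 1 (gam m v (derw v f)) - mulw v (gam m v q) - (1/2) \<odot> h"
      if "v \<in> V" for v
    proof -
      have v: "v \<in> {3..m}" "v \<in> {1..m}" using that by (auto simp: V_def)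
      have "gam m v (gam_null m (gam m v f)) = h"
        using gam_null_gam [OF v(1), of "gam m v f"] gam_sq [OF v(2), of f] 
        by (simp add: h_def gam_null_rules)
      then show ?thesis
        unfolding Eop_eq [OF v(1)] by (simp add: gam_rules gam_commutes q_def)
    qed
    then have "(\<Sum>v\<in>V. gam m v (Eop m v f))
       = (\<Sum>v\<in>V. mulw 1 (gam m v (derw v f)) - mulw v (gam m v q) - (1/2) \<odot> h)"
      by simp
    also have "(\<Sum>v\<in>V. gam m v (Eop m v f)) = 0"
      using E0 by (intro sum.neutral) (auto simp: V_def gam_rules)
    also have "(\<Sum>v\<in>V. mulw 1 (gam m v (derw v f)) - mulw v (gam m v q) - (1/2) \<odot> h)
       = mulw 1 (\<Sum>v\<in>V. gam m v (derw v f)) - X q - (\<Sum>v\<in>V. (1/2) \<odot> h)"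
      by (simp add: sum_subtractf X_def op_simps)
    also have "(\<Sum>v\<in>V. (1/2) \<odot> h) = c \<odot> h"
      by (rule fock_eqI) (simp add: c_def cardV)
    finally have A: "0 = mulw 1 (- (derw 1 h) - gam_null_conj m q) - X q - c \<odot> h"
      unfolding dV .
    show ?thesis
    proof (rule fock_eqI)
      fix \<alpha> B
      show "(mulw 1 (derw 1 h) + mulw 1 (gam_null_conj m q) + X q + c \<odot> h) \<alpha> B = 0 \<alpha> B"
        using fun_cong [OF fun_cong [OF A, of \<alpha>], of B]
        unfolding op_simps by (simp only: plus_fun_apply minus_apply uminus_apply zero_fun_apply smul_apply) algebra
    qed
  qed
  have s1: "mulw 1 (gam_null m (gam_null_conj m q)) = X (derw 2 h)"
  proof -
    have "gam_null m (mulw 1 (derw 1 h) + mulw 1 (gam_null_conj m q) + X q + c \<odot> h) = 0"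
      unfolding star by (simp add: gam_null_rules)
    then show ?thesis
      by (simp add: gam_null_rules gam_null_commutes GX h_def q_def G2 op_simps)
  qed
  have GGbh: "gam_null m (gam_null_conj m h) = (-2) \<odot> h"
    by (simp add: h_def G2 gam_null_rules)
  have s2: "X (gam_null m (gam_null_conj m q)) = 2 \<odot> (mulw 1 (derw 1 h) + c \<odot> h)"
  proof -
    have "gam_null m (gam_null_conj m (mulw 1 (derw 1 h) + mulw 1 (gam_null_conj m q) + X q + c \<odot> h)) = 0"
      unfolding star by (simp add: gam_null_rules)
    then have "mulw 1 (derw 1 (gam_null m (gam_null_conj m h))) + X (gam_null m (gam_null_conj m q)) + c \<odot> gam_null m (gam_null_conj m h) = 0"
      by (simp add: gam_null_rules gam_null_commutes GX G2(1,2) X_rules op_simps del: G2(3))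
    then show ?thesis unfolding GGbh
      by (simp add: op_simps algebra_simps fock.scale_right_distrib add_eq_0_iff)
  qed
  have s12: "R (derw 2 h) = (-2) \<odot> mulw 1 (mulw 1 (derw 1 h) + c \<odot> h)"
  proof -
    have "R (derw 2 h) = - X (X (derw 2 h))" by (simp add: XX)
    also have "\<dots> = - mulw 1 (X (gam_null m (gam_null_conj m q)))" by (simp only: s1 [symmetric] XW)
    finally show ?thesis by (simp add: s2 op_simps)
  qed
  have s3: "mulw 1 (derw v h) = mulw v (derw 2 h)" if "v \<in> V" for v
  proof -
    have v: "v \<in> {3..m}" using that by (simp add: V_def)
    have "gam_null m (Eop m v f) = 0" using E0 [OF v] by (simp add: gam_null_rules)
    then show ?thesis
      unfolding Eop_eq [OF v] by (simp add: gam_null_rules gam_null_commutes G2 h_def)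
  qed
  have eulh: "mulw 1 (derw 1 h) + mulw 2 (derw 2 h) + (\<Sum>v\<in>V. mulw v (derw v h)) = of_nat k \<odot> h"
  proof -
    have "gam_null m (\<Sum>j = 1..m. mulw j (derw j f)) = of_nat k \<odot> h"
      unfolding eul by (simp add: gam_null_rules h_def)
    then show ?thesis using split by (simp add: gam_null_rules gam_null_commutes h_def add.assoc)
  qed
  have "mulw 1 (mulw 1 (derw 1 h)) + mulw 1 (mulw 2 (derw 2 h)) + R (derw 2 h) = of_nat k \<odot> mulw 1 h"
  proof -
    have "R (derw 2 h) = mulw 1 (\<Sum>v\<in>V. mulw v (derw v h))"
      unfolding R_def op_simps
      by (intro sum.cong refl) (subst s3 [symmetric], assumption, rule mulw_mulw)
    then show ?thesis using arg_cong [OF eulh, of "mulw 1"] by (simp add: op_simps)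
  qed
  then have A: "mulw 1 (mulw 1 (derw 1 h)) + mulw 1 (mulw 2 (derw 2 h))
      + (-2) \<odot> mulw 1 (mulw 1 (derw 1 h) + c \<odot> h) = of_nat k \<odot> mulw 1 h"
    unfolding s12 .
  have "mulw 1 (mulw 2 (derw 2 h) - mulw 1 (derw 1 h) - (2 * c + of_nat k) \<odot> h) = 0"
  proof (rule fock_eqI)
    fix \<alpha> B
    show "mulw 1 (mulw 2 (derw 2 h) - mulw 1 (derw 1 h) - (2 * c + of_nat k) \<odot> h) \<alpha> B = 0 \<alpha> B"
      using fun_cong [OF fun_cong [OF A, of \<alpha>], of B] by (simp add: op_simps algebra_simps)
  qed
  then have "mulw 2 (derw 2 h) - mulw 1 (derw 1 h) - (2 * c + of_nat k) \<odot> h = 0"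
    by (rule mulw_inj)
  note C = this
  have T: "2 \<odot> mulw 1 (derw 1 h) + (\<Sum>v\<in>V. mulw v (derw v h)) + (2 * c) \<odot> h = 0"
  proof (rule fock_eqI)
    fix \<alpha> B
    show "(2 \<odot> mulw 1 (derw 1 h) + (\<Sum>v\<in>V. mulw v (derw v h)) + (2 * c) \<odot> h) \<alpha> B = 0 \<alpha> B"
      using fun_cong [OF fun_cong [OF C, of \<alpha>], of B] fun_cong [OF fun_cong [OF eulh, of \<alpha>], of B]
      by (simp add: algebra_simps)
  qed
  have h0: "h = 0"
  proof (rule fock_eqI)
    fix \<alpha> B
    have "of_nat (2 * count \<alpha> 1 + (\<Sum>v\<in>V. count \<alpha> v) + (m - 2)) * h \<alpha> B = 0"
      using fun_cong [OF fun_cong [OF T, of \<alpha>], of B]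
      by (simp add: mulw_derw c_def algebra_simps sum_distrib_left sum_distrib_right)
    moreover have "2 * count \<alpha> 1 + (\<Sum>v\<in>V. count \<alpha> v) + (m - 2) \<noteq> 0" using m by simp
    ultimately show "h \<alpha> B = 0 \<alpha> B" by (simp only: mult_eq_0_iff of_nat_eq_0_iff zero_fun_apply simp_thms)
  qed
  have q0: "q = 0"
  proof -
    have "gam_null m (\<Sum>v\<in>V. gam m v (derw v f)) = (\<Sum>v\<in>V. - gam m v (derw v h))"
      unfolding gam_null_rules by (intro sum.cong refl) (simp add: gam_null_gam V_def h_def gam_null_commutes)
    then have "gam_null m (gam_null_conj m q) = 0" 
      unfolding dV h0 by (simp add: gam_null_rules op_simps gam_rules sum.neutral)
    then show ?thesis
      using h0 by (auto simp: G2 q_def h_def gam_null_commutes gam_null_rules op_simps)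
  qed
  have "derw v f = 0" if "v \<in> V" for v
  proof -
    have v: "v \<in> {3..m}" using that by (simp add: V_def)
    have "mulw 1 (derw v f) = 0"
      using E0 [OF v] q0 h0 unfolding Eop_eq [OF v]
      by (simp add: q_def h_def gam_null_gam [OF v] gam_rules op_simps)
    then show ?thesis by (rule mulw_inj)
  qed
  with h0 q0 show ?thesis by (auto simp: h_def q_def V_def)
qed

section \<open>Homogeneous components\<close>

definition supported :: "(nat multiset \<Rightarrow> nat set \<Rightarrow> bool) \<Rightarrow> fock set" where
  "supported P = {f. \<forall>\<alpha> B. f \<alpha> B \<noteq> 0 \<longrightarrow> P \<alpha> B}"

lemma supported_subspace: "fock.subspace (supported P)"
  unfolding fock.subspace_def by (auto simp: supported_def) (metis add_0)

lemmas supported_closed = fock.subspace_add [OF supported_subspace] fock.subspace_diff [OF supported_subspace]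
  fock.subspace_scale [OF supported_subspace] fock.subspace_neg [OF supported_subspace]
  fock.subspace_0 [OF supported_subspace] fock.subspace_sum [OF supported_subspace]

lemma supportedI: "(\<And>\<alpha> B. f \<alpha> B \<noteq> 0 \<Longrightarrow> P \<alpha> B) \<Longrightarrow> f \<in> supported P"
  and supportedD: "f \<in> supported P \<Longrightarrow> f \<alpha> B \<noteq> 0 \<Longrightarrow> P \<alpha> B"
  by (auto simp: supported_def)

definition multi_index :: "nat \<Rightarrow> nat \<Rightarrow> nat multiset set" where
  "multi_index m k = {\<alpha>. size \<alpha> = k \<and> set_mset \<alpha> \<subseteq> {1..m}}"

definition fock_deg :: "nat \<Rightarrow> nat \<Rightarrow> fock set" where
  "fock_deg m k = supported (\<lambda>\<alpha> B. \<alpha> \<in> multi_index m k \<and> B \<subseteq> {1..m div 2})"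

definition fock_par :: "bool set \<Rightarrow> fock set" where
  "fock_par Q = supported (\<lambda>\<alpha> B. even (card B) \<in> Q)"

lemma finite_multi_index: "finite (multi_index m k)"
proof (induction k)
  case (Suc k)
  have "multi_index m (Suc k) \<subseteq> (\<Union>j\<in>{1..m}. add_mset j ` multi_index m k)"
  proof
    fix \<alpha> assume a: "\<alpha> \<in> multi_index m (Suc k)"
    then obtain j \<beta> where "\<alpha> = add_mset j \<beta>" by (auto simp: multi_index_def size_eq_Suc_imp_eq_union dest!: size_eq_Suc_imp_eq_union)
    with a show "\<alpha> \<in> (\<Union>j\<in>{1..m}. add_mset j ` multi_index m k)" by (auto simp: multi_index_def)
  qed
  with Suc show ?case by (meson finite_UN finite_atLeastAtMost finite_imageI finite_subset)
qed (simp add: multi_index_def)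

lemma fock_degD: "f \<in> fock_deg m k \<Longrightarrow> f \<alpha> B \<noteq> 0 \<Longrightarrow>
    size \<alpha> = k \<and> set_mset \<alpha> \<subseteq> {1..m} \<and> B \<subseteq> {1..m div 2}"
  unfolding fock_deg_def multi_index_def by (drule (1) supportedD) simp

lemma fock_degI: "(\<And>\<alpha> B. f \<alpha> B \<noteq> 0 \<Longrightarrow>
    size \<alpha> = k \<and> set_mset \<alpha> \<subseteq> {1..m} \<and> B \<subseteq> {1..m div 2}) \<Longrightarrow> f \<in> fock_deg m k"
  unfolding fock_deg_def multi_index_def by (rule supportedI) simp

lemma fock_deg_derw: "f \<in> fock_deg m (Suc k) \<Longrightarrow> derw j f \<in> fock_deg m k"
  by (rule fock_degI) (unfold derw_def, drule (1) fock_degD, simp)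

lemma fock_deg_derw_0: "f \<in> fock_deg m 0 \<Longrightarrow> derw j f = 0"
  by (rule fock_eqI) (use fock_degD [of f m 0] in \<open>force simp: derw_def\<close>)

lemma fock_deg_mulw:
  assumes "f \<in> fock_deg m k" "j \<in> {1..m}"
  shows "mulw j f \<in> fock_deg m (Suc k)"
proof (rule fock_degI)
  fix \<alpha> B
  assume "mulw j f \<alpha> B \<noteq> 0"
  then have "j \<in># \<alpha>" and f: "f (\<alpha> - {#j#}) B \<noteq> 0" by (auto simp: mulw_def)
  then obtain \<beta> where "\<alpha> = add_mset j \<beta>" by (auto dest: multi_member_split)
  with fock_degD [OF assms(1) f] assms(2)
  show "size \<alpha> = Suc k \<and> set_mset \<alpha> \<subseteq> {1..m} \<and> B \<subseteq> {1..m div 2}"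
    by auto
qed

lemma fock_deg_closed: "f \<in> fock_deg m k \<Longrightarrow> g \<in> fock_deg m k \<Longrightarrow> f + g \<in> fock_deg m k"
  "f \<in> fock_deg m k \<Longrightarrow> g \<in> fock_deg m k \<Longrightarrow> f - g \<in> fock_deg m k"
  "f \<in> fock_deg m k \<Longrightarrow> z \<odot> f \<in> fock_deg m k" "0 \<in> fock_deg m k"
  by (simp_all add: fock_deg_def supported_closed)

lemma fock_deg_yop: "f \<in> fock_deg m k \<Longrightarrow> j \<in> {1..m} \<Longrightarrow> m \<ge> 2 \<Longrightarrow> yop j f \<in> fock_deg m (Suc k)"
  by (auto simp: yop_def intro!: fock_deg_closed fock_deg_mulw)

lemma fock_deg_dop: "f \<in> fock_deg m (Suc k) \<Longrightarrow> dop j f \<in> fock_deg m k"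
  by (auto simp: dop_def simp del: fock.scale_minus_left intro!: fock_deg_closed fock_deg_derw)

lemma fock_deg_dop_0: "f \<in> fock_deg m 0 \<Longrightarrow> dop j f = 0"
  by (auto simp: dop_def fock_deg_derw_0)

lemma fock_deg_ann: "f \<in> fock_deg m k \<Longrightarrow> ann a f \<in> fock_deg m k"
  by (auto simp: fock_deg_def supported_def ann_def split: if_splits)

lemma fock_deg_cre: "f \<in> fock_deg m k \<Longrightarrow> a \<in> {1..m div 2} \<Longrightarrow> cre a f \<in> fock_deg m k"
  unfolding fock_deg_def supported_def cre_def by (fastforce split: if_splits)

lemma fock_deg_theta: "f \<in> fock_deg m k \<Longrightarrow> a \<in> {1..2 * (m div 2)} \<Longrightarrow> theta a f \<in> fock_deg m k"
  unfolding theta_def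
  by (cases "odd a") (auto intro!: fock_deg_closed fock_deg_ann fock_deg_cre elim!: oddE evenE)

lemma fock_deg_kappa: "f \<in> fock_deg m k \<Longrightarrow> kappa j f \<in> fock_deg m k"
  by (auto simp: fock_deg_def supported_def kappa_def)

lemma fock_deg_gam: "f \<in> fock_deg m k \<Longrightarrow> a \<in> {1..m} \<Longrightarrow> gam m a f \<in> fock_deg m k"
  unfolding gam_def using fock_deg_theta [of _ m k a] fock_deg_kappa
  by (auto elim!: oddE)

lemma fock_deg_rho_fock:
  assumes "f \<in> fock_deg m k" "a \<in> {1..m}" "b \<in> {1..m}" "m \<ge> 2"
  shows "rho_fock m a b f \<in> fock_deg m k"
proof -
  have "yop a (dop b f) \<in> fock_deg m k" if "a \<in> {1..m}" for a b
    using that assms by (cases k) (auto simp: fock_deg_dop_0 yop_rules fock_deg_closed intro!: fock_deg_yop fock_deg_dop)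
  with assms show ?thesis
    by (auto simp: rho_fock_def intro!: fock_deg_closed fock_deg_gam)
qed

lemma fock_deg_finite: "f \<in> fock_deg m k \<Longrightarrow> f \<alpha> B \<noteq> 0 \<Longrightarrow> finite B"
  by (auto simp: fock_deg_def supported_def intro: finite_subset)

lemma fock_par_ann: "f \<in> fock_par Q \<Longrightarrow> f \<in> fock_deg m k \<Longrightarrow> ann a f \<in> fock_par (Not ` Q)"
proof (unfold fock_par_def, rule supportedI)
  fix \<alpha> B
  assume f: "f \<in> supported (\<lambda>\<alpha> B. even (card B) \<in> Q)" "f \<in> fock_deg m k" "ann a f \<alpha> B \<noteq> 0"
  then have a: "a \<notin> B" "f \<alpha> (insert a B) \<noteq> 0" by (auto simp: ann_def split: if_splits)
  then have "finite (insert a B)" using fock_deg_finite [OF f(2) a(2)] by simp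
  then have "even (card B) = (\<not> even (card (insert a B)))" using a(1) by simp
  moreover have "(\<not> even (card (insert a B))) \<in> Not ` Q" using supportedD [OF f(1) a(2)] by (rule imageI)
  ultimately show "even (card B) \<in> Not ` Q" by simp
qed

lemma fock_par_cre: "f \<in> fock_par Q \<Longrightarrow> f \<in> fock_deg m k \<Longrightarrow> cre a f \<in> fock_par (Not ` Q)"
proof (unfold fock_par_def, rule supportedI)
  fix \<alpha> B
  assume f: "f \<in> supported (\<lambda>\<alpha> B. even (card B) \<in> Q)" "f \<in> fock_deg m k" "cre a f \<alpha> B \<noteq> 0"
  then have a: "a \<in> B" "f \<alpha> (B - {a}) \<noteq> 0" by (auto simp: cre_def split: if_splits)
  then have "finite (B - {a})" using fock_deg_finite [OF f(2) a(2)] by simp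
  then have "card B = Suc (card (B - {a}))" using a(1) card_Suc_Diff1 [of B a] by simp
  then have "even (card B) = (\<not> even (card (B - {a})))" by simp
  moreover have "(\<not> even (card (B - {a}))) \<in> Not ` Q" using supportedD [OF f(1) a(2)] by (rule imageI)
  ultimately show "even (card B) \<in> Not ` Q" by simp
qed

lemma fock_par_closed: "f \<in> fock_par Q \<Longrightarrow> g \<in> fock_par Q \<Longrightarrow> f + g \<in> fock_par Q"
  "f \<in> fock_par Q \<Longrightarrow> g \<in> fock_par Q \<Longrightarrow> f - g \<in> fock_par Q"
  "f \<in> fock_par Q \<Longrightarrow> z \<odot> f \<in> fock_par Q" "0 \<in> fock_par Q"
  by (simp_all add: fock_par_def supported_closed)

lemma fock_par_theta: "f \<in> fock_par Q \<Longrightarrow> f \<in> fock_deg m k \<Longrightarrow> theta a f \<in> fock_par (Not ` Q)"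
  unfolding theta_def by (auto intro!: fock_par_closed fock_par_ann fock_par_cre)

lemma fock_par_mulw: "f \<in> fock_par Q \<Longrightarrow> mulw a f \<in> fock_par Q" and fock_par_derw: "f \<in> fock_par Q \<Longrightarrow> derw a f \<in> fock_par Q"
  by (auto simp: fock_par_def supported_def mulw_def derw_def)

lemma fock_par_yop: "f \<in> fock_par Q \<Longrightarrow> yop a f \<in> fock_par Q" and fock_par_dop: "f \<in> fock_par Q \<Longrightarrow> dop a f \<in> fock_par Q"
  by (auto simp: yop_def dop_def simp del: fock.scale_minus_left intro!: fock_par_closed fock_par_mulw fock_par_derw)

text \<open>
  The parities of the exterior degree in one irreducible component. For even \<open>m\<close> products of two
  generators preserve the parity; for odd \<open>m\<close> they do not.
\<close>

definition valid_parity :: "nat \<Rightarrow> bool set \<Rightarrow> bool" where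
  "valid_parity m Q \<longleftrightarrow> m \<ge> 3 \<and> (if odd m then Q = UNIV else Q = {True} \<or> Q = {False})"

lemma fock_par_rho_fock:
  assumes "valid_parity m Q" "f \<in> fock_par Q" "f \<in> fock_deg m k" "a \<in> {1..m}" "b \<in> {1..m}"
  shows "rho_fock m a b f \<in> fock_par Q"
proof (cases "odd m")
  case True
  with assms show ?thesis by (auto simp: valid_parity_def fock_par_def supported_def)
next
  case False
  have NN: "Not ` Not ` Q = Q" by (simp add: image_image)
  have "theta b f \<in> fock_deg m k" using assms False by (intro fock_deg_theta) auto
  then have "theta a (theta b f) \<in> fock_par (Not ` Not ` Q)"
    using assms by (intro fock_par_theta) auto
  with assms False show ?thesis
    unfolding NN by (auto simp: rho_fock_def gam_def intro!: fock_par_closed fock_par_yop fock_par_dop)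
qed

definition fock_monogenics :: "nat \<Rightarrow> nat \<Rightarrow> bool set \<Rightarrow> fock set" where
  "fock_monogenics m k Q = {f \<in> fock_deg m k. f \<in> fock_par Q \<and> dirac_fock m f = 0}"

lemma fock_monogenics_subspace: "fock.subspace (fock_monogenics m k Q)"
  unfolding fock.subspace_def
  by (auto simp: fock_monogenics_def fock_deg_closed fock_par_closed dirac_fock_rules)

lemma fock_monogenics_rho_fock:
  assumes "valid_parity m Q" "f \<in> fock_monogenics m k Q" "a \<in> {1..m}" "b \<in> {1..m}"
  shows "rho_fock m a b f \<in> fock_monogenics m k Q"
  using assms
  by (auto simp: fock_monogenics_def dirac_fock_rho_fock rho_fock_rules valid_parity_def intro!: fock_deg_rho_fock intro: fock_par_rho_fock)

lemma fock_monogenics_representation: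
  assumes "valid_parity m Q"
  shows "so_representation smul m (rho_fock m) (fock_monogenics m k Q)"
proof unfold_locales
  fix a b x assume "a \<in> {1..m}" "b \<in> {1..m}" "x \<in> fock_monogenics m k Q"
  then show "rho_fock m b a x = - rho_fock m a b x" by (intro rho_fock_skew)
qed (use assms in \<open>auto simp: fock_monogenics_subspace fock_monogenics_rho_fock rho_fock_rules rho_fock_bracket\<close>)

section \<open>Existence of vectors killed by raising operators\<close>

text \<open>
  The eigenvalue of $H_1$ on the coefficient at \<open>\<alpha>\<close>, \<open>B\<close>, lowered by $\frac12$ to be an integer.
\<close>

definition H1_weight :: "nat multiset \<Rightarrow> nat set \<Rightarrow> int" where
  "H1_weight \<alpha> B = int (count \<alpha> 1) - int (count \<alpha> 2) - of_bool (1 \<in> B)"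

definition weight_ge :: "int \<Rightarrow> fock set" where
  "weight_ge j = supported (\<lambda>\<alpha> B. H1_weight \<alpha> B \<ge> j)"

lemma weight_ge_closed: "f \<in> weight_ge Q \<Longrightarrow> g \<in> weight_ge Q \<Longrightarrow> f + g \<in> weight_ge Q"
  "f \<in> weight_ge Q \<Longrightarrow> g \<in> weight_ge Q \<Longrightarrow> f - g \<in> weight_ge Q"
  "f \<in> weight_ge Q \<Longrightarrow> z \<odot> f \<in> weight_ge Q" "0 \<in> weight_ge Q"
  by (simp_all add: weight_ge_def supported_closed)

lemma theta_ann: "a \<ge> 1 \<Longrightarrow> theta (2 * a - 1) f - \<i> \<odot> theta (2 * a) f = 2 \<odot> ann a f"
  and theta_cre: "a \<ge> 1 \<Longrightarrow> theta (2 * a - 1) f + \<i> \<odot> theta (2 * a) f = (- 2) \<odot> cre a f"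
  by (rule fock_eqI; simp add: theta_def algebra_simps)+

lemma gam_null_ann:
  assumes "m \<ge> 3"
  shows "gam_null m f = (2 * inv_sqrt2) \<odot> ann 1 (if even m then f else kappa (m div 2) f)"
proof -
  have "gam_null m f = inv_sqrt2 \<odot> (theta (2 * 1 - 1) (if even m then f else kappa (m div 2) f)
      - \<i> \<odot> theta (2 * 1) (if even m then f else kappa (m div 2) f))"
    using assms by (simp add: gam_null_def gam_def)
  also have "\<dots> = (2 * inv_sqrt2) \<odot> ann 1 (if even m then f else kappa (m div 2) f)"
    by (subst theta_ann) simp_all
  finally show ?thesis .
qed

lemma weight_ge_ann1: "f \<in> weight_ge j \<Longrightarrow> ann 1 f \<in> weight_ge (j + 1)"
  unfolding weight_ge_def supported_def H1_weight_def ann_def by (fastforce split: if_splits)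

lemma weight_ge_kappa: "f \<in> weight_ge j \<Longrightarrow> kappa i f \<in> weight_ge j"
  by (auto simp: weight_ge_def supported_def kappa_def)

lemma weight_ge_ann: "f \<in> weight_ge j \<Longrightarrow> a \<noteq> 1 \<Longrightarrow> ann a f \<in> weight_ge j"
  and weight_ge_cre: "f \<in> weight_ge j \<Longrightarrow> a \<noteq> 1 \<Longrightarrow> cre a f \<in> weight_ge j"
  unfolding weight_ge_def supported_def H1_weight_def ann_def cre_def by (fastforce split: if_splits)+

lemma weight_ge_theta: "f \<in> weight_ge j \<Longrightarrow> a \<ge> 3 \<Longrightarrow> theta a f \<in> weight_ge j"
  unfolding theta_def by (auto intro!: weight_ge_closed weight_ge_ann weight_ge_cre)

lemma weight_ge_gam: "f \<in> weight_ge j \<Longrightarrow> a \<ge> 3 \<Longrightarrow> gam m a f \<in> weight_ge j"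
  unfolding gam_def by (auto intro!: weight_ge_theta weight_ge_kappa)

lemma weight_ge_gam_null: "f \<in> weight_ge j \<Longrightarrow> m \<ge> 3 \<Longrightarrow> gam_null m f \<in> weight_ge (j + 1)"
  unfolding gam_null_ann by (auto intro!: weight_ge_closed weight_ge_ann1 [simplified] weight_ge_kappa)

lemma weight_ge_Eop:
  assumes "f \<in> weight_ge j" "v \<in> {3..m}"
  shows "Eop m v f \<in> weight_ge (j + 1)"
proof -
  have 1: "mulw 1 (derw v f) \<in> weight_ge (j + 1)" unfolding weight_ge_def
  proof (rule supportedI)
    fix \<alpha> B assume "mulw 1 (derw v f) \<alpha> B \<noteq> 0"
    then have *: "count \<alpha> 1 > 0" "f (add_mset v (\<alpha> - {#1#})) B \<noteq> 0" by (auto simp: mulw_def derw_def)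
    with supportedD [OF assms(1) [unfolded weight_ge_def] *(2)] assms(2) show "H1_weight \<alpha> B \<ge> j + 1"
      by (auto simp: H1_weight_def)
  qed
  have 2: "mulw v (derw 2 f) \<in> weight_ge (j + 1)" unfolding weight_ge_def
  proof (rule supportedI)
    fix \<alpha> B assume "mulw v (derw 2 f) \<alpha> B \<noteq> 0"
    then have *: "f (add_mset 2 (\<alpha> - {#v#})) B \<noteq> 0" by (auto simp: mulw_def derw_def)
    with supportedD [OF assms(1) [unfolded weight_ge_def] *] assms(2) show "H1_weight \<alpha> B \<ge> j + 1"
      by (auto simp: H1_weight_def)
  qed
  show ?thesis
    unfolding Eop_eq [OF assms(2)] using assms
    by (intro weight_ge_closed 1 2 weight_ge_gam_null weight_ge_gam) auto
qed

definition subrep :: "nat \<Rightarrow> nat \<Rightarrow> bool set \<Rightarrow> fock set \<Rightarrow> bool" where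
  "subrep m k Q U \<longleftrightarrow> fock.subspace U \<and> U \<subseteq> fock_monogenics m k Q \<and>
     (\<forall>a\<in>{1..m}. \<forall>b\<in>{1..m}. \<forall>f\<in>U. rho_fock m a b f \<in> U)"

text \<open>
  Filter the invariant subspace by the least weight of $H_1$ that occurs in a vector. In degree \<open>k\<close> the weights lie
  between \<open>- k - 1\<close> and \<open>k\<close>, so some nonzero vector lies as high as possible, and \<open>Eop\<close> would lift it further.
\<close>

lemma exists_killed:
  assumes "valid_parity m Q" "subrep m k Q U" "U \<noteq> {0}"
  obtains u where "u \<in> U" "u \<noteq> 0" "\<And>v. v \<in> {3..m} \<Longrightarrow> Eop m v u = 0"
proof -
  have sub: "fock.subspace U" using assms by (auto simp: subrep_def)
  have m: "m \<ge> 3" using assms by (simp add: valid_parity_def)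
  obtain u0 where u0: "u0 \<in> U" "u0 \<noteq> 0" using assms(3) fock.subspace_0 [OF sub] by blast
  \<comment> \<open>The index is shifted by k + 1 to count levels from 0.\<close>
  define P where "P i \<longleftrightarrow> (\<exists>u\<in>U. u \<noteq> 0 \<and> u \<in> weight_ge (int i - int k - 1))" for i
  have cnt: "count \<alpha> i \<le> k" if "\<alpha> \<in> multi_index m k" for \<alpha> i
    using that count_le_size [of \<alpha> i] by (simp add: multi_index_def)
  have "P 0"
    unfolding P_def
  proof (intro bexI [OF _ u0(1)] conjI u0(2))
    have "u0 \<in> fock_deg m k" using u0 assms by (auto simp: subrep_def fock_monogenics_def)
    then have I: "\<alpha> \<in> multi_index m k" if "u0 \<alpha> B \<noteq> 0" for \<alpha> B
      using that by (auto simp: fock_deg_def dest: supportedD)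
    show "u0 \<in> weight_ge (int 0 - int k - 1)"
      unfolding weight_ge_def
    proof (rule supportedI)
      fix \<alpha> B assume "u0 \<alpha> B \<noteq> 0"
      then show "int 0 - int k - 1 \<le> H1_weight \<alpha> B"
        using cnt [OF I, of \<alpha> B 2] by (simp add: H1_weight_def)
    qed
  qed
  moreover have bound: "i \<le> 2 * k + 1" if Pi: "P i" for i
  proof -
    obtain u where u: "u \<in> U" "u \<noteq> 0" "u \<in> weight_ge (int i - int k - 1)" using Pi by (auto simp: P_def)
    obtain \<alpha> B where ne: "u \<alpha> B \<noteq> 0" using u(2) by (auto simp: fun_eq_iff)
    have "u \<in> fock_deg m k" using u assms by (auto simp: subrep_def fock_monogenics_def)
    then have "\<alpha> \<in> multi_index m k" using ne by (auto simp: fock_deg_def dest: supportedD)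
    then have "H1_weight \<alpha> B \<le> int k" using cnt [of \<alpha> 1] by (auto simp: H1_weight_def)
    moreover have "H1_weight \<alpha> B \<ge> int i - int k - 1" using u(3) ne by (auto simp: weight_ge_def dest: supportedD)
    ultimately show ?thesis by linarith
  qed
  ultimately obtain i where i: "P i" "\<And>i'. P i' \<Longrightarrow> i' \<le> i"
    by (metis GreatestI_nat Greatest_le_nat)
  then obtain u where u: "u \<in> U" "u \<noteq> 0" "u \<in> weight_ge (int i - int k - 1)" by (auto simp: P_def)
  have "Eop m v u = 0" if v: "v \<in> {3..m}" for v
  proof (rule ccontr)
    assume ne: "Eop m v u \<noteq> 0"
    have "Eop m v u \<in> U" unfolding Eop_def
      using assms(2) u(1) v by (intro fock.subspace_scale [OF sub] fock.subspace_diff [OF sub]) (auto simp: subrep_def)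
    moreover have "Eop m v u \<in> weight_ge (int (Suc i) - int k - 1)"
      using weight_ge_Eop [OF u(3) v] by (simp add: algebra_simps)
    ultimately have "P (Suc i)" using ne by (auto simp: P_def)
    with i(2) show False by fastforce
  qed
  with u that show thesis by blast
qed

lemma euler_fock_deg:
  assumes "f \<in> fock_deg m k"
  shows "(\<Sum>j = 1..m. mulw j (derw j f)) = of_nat k \<odot> f"
proof (rule fock_eqI)
  fix \<alpha> B
  have "(\<Sum>j = 1..m. mulw j (derw j f)) \<alpha> B = of_nat (\<Sum>j = 1..m. count \<alpha> j) * f \<alpha> B"
    by (simp add: mulw_derw sum_distrib_right)
  also have "\<dots> = of_nat k * f \<alpha> B"
  proof (cases "f \<alpha> B = 0")
    case False
    then have *: "size \<alpha> = k" "set_mset \<alpha> \<subseteq> {1..m}"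
      using assms by (auto simp: fock_deg_def multi_index_def dest!: supportedD)
    have "size \<alpha> = (\<Sum>j = 1..m. count \<alpha> j)"
      unfolding size_multiset_overloaded_eq
      by (rule sum.mono_neutral_left) (use *(2) in \<open>auto simp: count_eq_zero_iff\<close>)
    with * show ?thesis by simp
  qed simp
  finally show "(\<Sum>j = 1..m. mulw j (derw j f)) \<alpha> B = (of_nat k \<odot> f) \<alpha> B" by simp
qed

section \<open>From the top space to the highest weight vector\<close>

text \<open>
  The vectors that \<open>killed_by_Eop\<close> leaves: a power of the first null coordinate times a spinor.
\<close>

definition top_space :: "nat \<Rightarrow> nat \<Rightarrow> fock set" where
  "top_space m k = {f \<in> fock_deg m k. gam_null m f = 0 \<and> derw 2 f = 0 \<and> (\<forall>v\<in>{3..m}. derw v f = 0)}"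

lemma exists_top_space:
  assumes "valid_parity m Q" "subrep m k Q U" "U \<noteq> {0}"
  obtains u where "u \<in> U" "u \<noteq> 0" "u \<in> top_space m k"
proof -
  obtain u where u: "u \<in> U" "u \<noteq> 0" "\<And>v. v \<in> {3..m} \<Longrightarrow> Eop m v u = 0"
    using exists_killed [OF assms] by blast
  then have "u \<in> fock_deg m k" "dirac_fock m u = 0" using assms(2) by (auto simp: subrep_def fock_monogenics_def)
  with u killed_by_Eop [OF _ _ euler_fock_deg, of m u k] assms(1) that show thesis
    by (auto simp: top_space_def valid_parity_def)
qed

lemma top_space_support:
  assumes "u \<in> top_space m k" "u \<alpha> B \<noteq> 0" "m \<ge> 3"
  shows "\<alpha> = replicate_mset k 1" "B \<subseteq> {2..m div 2}"
proof -
  have a: "size \<alpha> = k" "set_mset \<alpha> \<subseteq> {1..m}" "B \<subseteq> {1..m div 2}"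
    using assms by (auto simp: top_space_def fock_deg_def multi_index_def dest!: supportedD)
  have "v \<notin># \<alpha>" if "v \<in> {2..m}" for v
  proof
    assume "v \<in># \<alpha>"
    then obtain \<beta> where "\<alpha> = add_mset v \<beta>" by (rule mset_add)
    moreover have "derw v u = 0" using that assms(1) by (cases "v = 2") (auto simp: top_space_def)
    ultimately show False using assms(2) by (simp add: derw_def fun_eq_iff)
  qed
  then have "\<forall>v\<in>#\<alpha>. v = 1" using a(2)
    by (metis One_nat_def Suc_leI atLeastAtMost_iff le_antisym not_less_eq_eq numeral_2_eq_2 subsetD)
  then have "\<alpha> = replicate_mset (size \<alpha>) 1"
    by (metis set_mset_subset_singletonD singletonI subsetI)
  with a(1) show "\<alpha> = replicate_mset k 1" by simp
  have "1 \<notin> B"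
  proof
    assume "1 \<in> B"
    then have "insert 1 (B - {1}) = B" by auto
    moreover have "gam_null m u \<alpha> (B - {1}) = 0" using assms(1) by (simp add: top_space_def)
    ultimately show False using assms(2) unfolding gam_null_ann [OF assms(3)]
      by (auto simp: ann_def kappa_def split: if_splits)
  qed
  moreover have "{1..m div 2} \<subseteq> insert 1 {2..m div 2}" by auto
  ultimately show "B \<subseteq> {2..m div 2}" using a(3) by blast
qed

lemma top_space_gam_gam:
  assumes "u \<in> top_space m k" "a \<in> {3..m}" "b \<in> {3..m}" "m \<ge> 3"
  shows "gam m a (gam m b u) \<in> top_space m k"
proof -
  have "gam_null m (gam m a (gam m b u)) = gam m a (gam m b (gam_null m u))"
    using assms by (simp add: gam_null_gam gam_rules)
  moreover have "gam m a (gam m b u) \<in> fock_deg m k"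
    using assms by (intro fock_deg_gam) (auto simp: top_space_def)
  ultimately show ?thesis using assms
    by (auto simp: top_space_def gam_commutes [symmetric] gam_rules)
qed

lemma top_space_subspace: "m \<ge> 3 \<Longrightarrow> fock.subspace (top_space m k)"
  unfolding fock.subspace_def
  by (auto simp: top_space_def fock_deg_closed gam_null_rules op_simps)

text \<open>
  On the top space the orbital part of the rotations of the indices from 3 on vanishes, so that they act by
  Clifford multiplication alone.
\<close>

lemma subrep_gam_gam:
  assumes "subrep m k Q U" "u \<in> U" "u \<in> top_space m k" "a \<in> {3..m}" "b \<in> {3..m}" "a \<noteq> b"
  shows "gam m a (gam m b u) \<in> U"
proof -
  have "rho_fock m a b u = (- 1 / 2) \<odot> gam m a (gam m b u)"
    using assms by (auto simp: rho_fock_def dop_def top_space_def yop_rules)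
  then have "gam m a (gam m b u) = (- 2) \<odot> rho_fock m a b u" by simp
  moreover have "rho_fock m a b u \<in> U" using assms by (auto simp: subrep_def)
  ultimately show ?thesis using assms(1) by (auto simp: subrep_def simp del: fock.scale_minus_left intro: fock.subspace_scale)
qed

lemma gam_gam_theta:
  assumes "a \<in> {1..2 * (m div 2)}" "b \<in> {1..2 * (m div 2)}"
  shows "gam m a (gam m b f) = theta a (theta b f)"
  using assms by (auto simp: gam_def kappa_theta theta_rules)

lemma gam_gam_last:
  assumes "odd m" "a \<in> {1..2 * (m div 2)}"
  shows "gam m a (gam m m f) = - theta a f"
  using assms by (auto simp: gam_def theta_rules)

text \<open>
  The spinor part of the highest weight vector; in the odd half spin representation it is the basis vector
  whose only negative weight is in the last place.
\<close>

definition vacuum :: "nat \<Rightarrow> bool set \<Rightarrow> nat set" where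
  "vacuum m Q = (if True \<in> Q then {} else {m div 2})"

definition hw_vec :: "nat \<Rightarrow> nat \<Rightarrow> bool set \<Rightarrow> fock" where
  "hw_vec m k Q = (\<lambda>\<alpha> B. if \<alpha> = replicate_mset k 1 \<and> B = vacuum m Q then 1 else 0)"

lemma subrep_ann_ann:
  assumes v: "valid_parity m Q" and U: "subrep m k Q U" and u: "u \<in> U \<inter> top_space m k"
    and ij: "i \<in> {2..m div 2}" "j \<in> {2..m div 2}" "i \<noteq> j"
  shows "ann i (ann j u) \<in> U \<inter> top_space m k" "cre i (ann j u) \<in> U \<inter> top_space m k"
proof -
  have m: "m \<ge> 3" using v by (simp add: valid_parity_def)
  have sub: "fock.subspace (U \<inter> top_space m k)"
    using U top_space_subspace [OF m] by (auto simp: subrep_def intro: fock.subspace_inter)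
  have th: "theta a (theta b u) \<in> U \<inter> top_space m k"
    if "a \<in> {2 * i - 1, 2 * i}" "b \<in> {2 * j - 1, 2 * j}" for a b
  proof -
    have ab: "a \<in> {3..2 * (m div 2)}" "b \<in> {3..2 * (m div 2)}" "a \<noteq> b"
      using that ij by auto
    then have ab': "a \<in> {3..m}" "b \<in> {3..m}" by auto
    show ?thesis
      using subrep_gam_gam [OF U _ _ ab' ab(3)] top_space_gam_gam [OF _ ab' m] u
        gam_gam_theta [of a m b] ab by auto
  qed
  have 1: "2 \<odot> ann i f = theta (2 * i - 1) f - \<i> \<odot> theta (2 * i) f" for f
    using theta_ann [of i f] ij by simp
  have 2: "2 \<odot> ann j f = theta (2 * j - 1) f - \<i> \<odot> theta (2 * j) f" for f
    using theta_ann [of j f] ij by simp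
  have 3: "(-2) \<odot> cre i f = theta (2 * i - 1) f + \<i> \<odot> theta (2 * i) f" for f
    using theta_cre [of i f] ij by simp
  have "ann i (ann j u) = (1 / 4) \<odot> (2 \<odot> ann i (2 \<odot> ann j u))"
    by (simp add: op_simps)
  also have "\<dots> \<in> U \<inter> top_space m k"
    unfolding 1 unfolding 2 theta_rules
    by (intro fock.subspace_scale [OF sub] fock.subspace_add [OF sub] fock.subspace_diff [OF sub] th) auto
  finally show "ann i (ann j u) \<in> U \<inter> top_space m k" .
  have "cre i (ann j u) = (- 1 / 4) \<odot> ((-2) \<odot> cre i (2 \<odot> ann j u))"
    by (simp add: op_simps)
  also have "\<dots> \<in> U \<inter> top_space m k"
    unfolding 3 unfolding 2 theta_rules
    by (intro fock.subspace_scale [OF sub] fock.subspace_add [OF sub] fock.subspace_diff [OF sub] th) auto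
  finally show "cre i (ann j u) \<in> U \<inter> top_space m k" .
qed

lemma subrep_ann:
  assumes v: "valid_parity m Q" "odd m" and U: "subrep m k Q U" and u: "u \<in> U \<inter> top_space m k"
    and ij: "i \<in> {2..m div 2}"
  shows "ann i u \<in> U \<inter> top_space m k"
proof -
  have m: "m \<ge> 3" using v by (simp add: valid_parity_def)
  have sub: "fock.subspace (U \<inter> top_space m k)"
    using U top_space_subspace [OF m] by (auto simp: subrep_def intro: fock.subspace_inter)
  have th: "theta a u \<in> U \<inter> top_space m k"
    if "a \<in> {2 * i - 1, 2 * i}" for a
  proof -
    have a: "a \<in> {3..2 * (m div 2)}"
      using that ij by auto
    then have ab': "a \<in> {3..m}" "m \<in> {3..m}" "a \<noteq> m" using m v(2) by (auto elim: oddE)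
    have "- theta a u \<in> U \<inter> top_space m k"
      using subrep_gam_gam [OF U _ _ ab'] top_space_gam_gam [OF _ ab'(1,2) m] u
        gam_gam_last [OF v(2), of a] a by auto
    then show ?thesis using fock.subspace_neg [OF sub] by fastforce
  qed
  have "ann i u = (1 / 2) \<odot> (2 \<odot> ann i u)"
    by (simp add: op_simps)
  also have "2 \<odot> ann i u = theta (2 * i - 1) u - \<i> \<odot> theta (2 * i) u"
    by (subst theta_ann) (use ij in auto)
  also have "(1 / 2) \<odot> \<dots> \<in> U \<inter> top_space m k"
    by (intro fock.subspace_scale [OF sub] fock.subspace_add [OF sub] fock.subspace_diff [OF sub] th) auto
  finally show "ann i u \<in> U \<inter> top_space m k" .
qed

text \<open>
  In the top space only even Clifford products are at hand. Take a nonzero vector of \<open>U\<close> there whose exterior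
  degree is least possible. For odd \<open>m\<close> a single annihilator is an even product (with the last generator),
  so the degree is 0. For even \<open>m\<close> two annihilators lower the degree by 2, so it is at most 1. In degree
  1 the vector is a combination of the basis vectors \<open>{j}\<close>, and \<open>cre (m div 2) (ann j u)\<close> moves one of them
  to the last place.
\<close>

lemma subrep_contains_hw_vec:
  assumes v: "valid_parity m Q" and U: "subrep m k Q U" "U \<noteq> {0}"
  shows "hw_vec m k Q \<in> U"
proof -
  have m: "m \<ge> 3" using v by (simp add: valid_parity_def)
  have subU: "fock.subspace U" using U by (simp add: subrep_def)
  define bnd where "bnd r u \<longleftrightarrow> (\<forall>\<alpha> B. u \<alpha> B \<noteq> 0 \<longrightarrow> card B \<le> r)" for r and u :: fock
  define P where "P r \<longleftrightarrow> (\<exists>u\<in>U \<inter> top_space m k. u \<noteq> 0 \<and> bnd r u)" for r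
  have sup: "\<alpha> = replicate_mset k 1" "B \<subseteq> {2..m div 2}" "finite B"
    if "u \<in> U \<inter> top_space m k" "u \<alpha> B \<noteq> 0" for u \<alpha> B
    using top_space_support [of u m k \<alpha> B] that m by (auto intro: finite_subset)
  have bnd_ann: "bnd (r - 1) (ann b u)" if "u \<in> U \<inter> top_space m k" "bnd r u" for r b u
    unfolding bnd_def
  proof (intro allI impI)
    fix \<alpha> B assume "ann b u \<alpha> B \<noteq> 0"
    then have *: "b \<notin> B" "u \<alpha> (insert b B) \<noteq> 0" by (auto simp: ann_def split: if_splits)
    with that(2) have "card (insert b B) \<le> r" by (auto simp: bnd_def)
    moreover have "finite B" using sup(3) [OF that(1) *(2)] by simp
    ultimately show "card B \<le> r - 1" using * by simp
  qed
  obtain u0 where u0: "u0 \<in> U \<inter> top_space m k" "u0 \<noteq> 0" using exists_top_space [OF v U] by auto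
  have "bnd (m div 2) u0"
    unfolding bnd_def
  proof (intro allI impI)
    fix \<alpha> B assume "u0 \<alpha> B \<noteq> 0"
    then have "B \<subseteq> {2..m div 2}" using sup u0 by blast
    then have "card B \<le> card {2..m div 2}" by (rule card_mono [rotated]) simp
    then show "card B \<le> m div 2" by simp
  qed
  with u0 have "P (m div 2)" by (auto simp: P_def)
  then obtain r where r: "P r" "\<And>r'. r' < r \<Longrightarrow> \<not> P r'"
    by (metis LeastI not_less_Least)
  then obtain u where u: "u \<in> U \<inter> top_space m k" "u \<noteq> 0" "bnd r u" by (auto simp: P_def)
  have Upar: "even (card B) \<in> Q" if "w \<in> U" "w \<alpha> B \<noteq> 0" for w \<alpha> B
    using that U by (auto simp: subrep_def fock_monogenics_def fock_par_def dest!: supportedD)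
  obtain \<alpha> B where AB: "u \<alpha> B \<noteq> 0" "card B = r"
  proof -
    have "\<exists>\<alpha> B. u \<alpha> B \<noteq> 0 \<and> card B = r"
    proof (rule ccontr)
      assume n: "\<not> ?thesis"
      have "r > 0"
      proof (rule ccontr)
        assume "\<not> r > 0"
        obtain \<alpha> B where "u \<alpha> B \<noteq> 0" using u(2) by (auto simp: fun_eq_iff)
        moreover from this have "card B = r" using u(3) \<open>\<not> r > 0\<close> unfolding bnd_def by (metis gr0I le_zero_eq)
        ultimately show False using n by blast
      qed
      moreover have "bnd (r - 1) u" using n u(3) \<open>r > 0\<close> unfolding bnd_def
        by (metis One_nat_def Suc_pred le_antisym not_less_eq_eq)
      ultimately show False using r(2) [of "r - 1"] u by (auto simp: P_def)
    qed
    with that show thesis by blast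
  qed
  note B = sup [OF u(1) AB(1)]
  have final: "hw_vec m k Q \<in> U" if "w \<in> U \<inter> top_space m k" "w \<noteq> 0" "\<And>\<alpha> B. w \<alpha> B \<noteq> 0 \<Longrightarrow> B = vacuum m Q" for w
  proof -
    define c where "c = w (replicate_mset k 1) (vacuum m Q)"
    have w: "w = c \<odot> hw_vec m k Q"
    proof (rule fock_eqI)
      fix \<alpha> B
      show "w \<alpha> B = (c \<odot> hw_vec m k Q) \<alpha> B"
      proof (cases "w \<alpha> B = 0")
        case True
        then show ?thesis by (auto simp: c_def hw_vec_def)
      next
        case False
        then have "B = vacuum m Q" "\<alpha> = replicate_mset k 1" by (rule that(3), rule sup(1) [OF that(1)])
        then show ?thesis by (simp add: c_def hw_vec_def)
      qed
    qed
    with that(2) have "c \<noteq> 0" by auto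
    then have "hw_vec m k Q = (1 / c) \<odot> w" using w by simp
    then show ?thesis using that(1) fock.subspace_scale [OF subU] by auto
  qed
  show ?thesis
  proof (cases "odd m")
    case True
    have "r = 0"
    proof (rule ccontr)
      assume "r \<noteq> 0"
      then obtain b where b: "b \<in> B" using AB(2) by fastforce
      then have "insert b (B - {b}) = B" by auto
      then have "ann b u \<alpha> (B - {b}) \<noteq> 0" using AB(1) by (simp add: ann_def)
      then have "ann b u \<noteq> 0" by (auto simp: fun_eq_iff)
      moreover have "ann b u \<in> U \<inter> top_space m k"
        using subrep_ann [OF v True U(1) u(1)] b B by auto
      ultimately have "P (r - 1)" using bnd_ann [OF u(1,3)] by (auto simp: P_def)
      with r(2) \<open>r \<noteq> 0\<close> show False by auto
    qed
    moreover have "vacuum m Q = {}" using v True by (auto simp: valid_parity_def vacuum_def)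
    ultimately show ?thesis
      using u sup(3) by (intro final [OF u(1,2)]) (auto simp: bnd_def)
  next
    case False
    have "r \<le> 1"
    proof (rule ccontr)
      assume "\<not> r \<le> 1"
      then obtain b where b: "b \<in> B" using AB(2) by fastforce
      then have "card (B - {b}) \<noteq> 0" using AB(2) \<open>\<not> r \<le> 1\<close> B(3) by simp
      then obtain b' where b': "b' \<in> B - {b}" by (metis card.empty ex_in_conv)
      then have *: "insert b (insert b' (B - {b} - {b'})) = B" using b by auto
      then have "ann b' (ann b u) \<alpha> (B - {b} - {b'}) \<noteq> 0" using AB(1) b b'
        by (simp add: ann_def)
      then have "ann b' (ann b u) \<noteq> 0" by (auto simp: fun_eq_iff)
      moreover have "ann b' (ann b u) \<in> U \<inter> top_space m k"
        using b b' B(2) by (intro subrep_ann_ann(1) [OF v U(1) u(1)]) auto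
      moreover have "bnd (r - 2) (ann b' (ann b u))"
        unfolding bnd_def
      proof (intro allI impI)
        fix \<beta> C assume "ann b' (ann b u) \<beta> C \<noteq> 0"
        then have *: "b' \<notin> C" "b \<notin> insert b' C" "u \<beta> (insert b (insert b' C)) \<noteq> 0"
          by (auto simp: ann_def split: if_splits)
        with u(3) have "card (insert b (insert b' C)) \<le> r" by (auto simp: bnd_def)
        moreover have "finite C" using sup(3) [OF u(1) *(3)] by simp
        ultimately show "card C \<le> r - 2" using * by simp
      qed
      ultimately have "P (r - 2)" by (auto simp: P_def)
      with r(2) \<open>\<not> r \<le> 1\<close> show False by auto
    qed
    consider "Q = {True}" | "Q = {False}" using v False by (auto simp: valid_parity_def)
    then show ?thesis
    proof cases
      case 1
      have "C = vacuum m Q" if "u \<beta> C \<noteq> 0" for \<beta> C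
      proof -
        have "card C \<le> 1" using u(3) that \<open>r \<le> 1\<close> by (fastforce simp: bnd_def)
        moreover have "even (card C)" using Upar [of u \<beta> C] u(1) that 1 by auto
        ultimately have "card C = 0" by (metis One_nat_def le_SucE le_zero_eq odd_one)
        with sup(3) [OF u(1) that] show ?thesis by (simp add: vacuum_def 1)
      qed
      then show ?thesis by (rule final [OF u(1,2)])
    next
      case 2
      have sing: "\<exists>j\<in>{2..m div 2}. C = {j}" if "u \<beta> C \<noteq> 0" for \<beta> C
      proof -
        have "card C \<le> 1" using u(3) that \<open>r \<le> 1\<close> by (fastforce simp: bnd_def)
        moreover have "odd (card C)" using Upar [of u \<beta> C] u(1) that 2 by auto
        ultimately have "card C = 1" by (metis even_zero le_SucE le_zero_eq One_nat_def)
        with sup(2) [OF u(1) that] show ?thesis by (auto simp: card_1_singleton_iff)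
      qed
      have vacuum: "vacuum m Q = {m div 2}" by (simp add: vacuum_def 2)
      have n: "m div 2 \<in> {2..m div 2}" using m False by (auto elim!: evenE)
      show ?thesis
      proof (cases "\<forall>\<beta> C. u \<beta> C \<noteq> 0 \<longrightarrow> C = vacuum m Q")
        case True
        then show ?thesis by (intro final [OF u(1,2)]) auto
      next
        case False
        then obtain \<beta> j where j: "u \<beta> {j} \<noteq> 0" "j \<in> {2..m div 2}" "j \<noteq> m div 2"
          using sing vacuum by metis
        define w where "w = cre (m div 2) (ann j u)"
        have "w \<in> U \<inter> top_space m k" unfolding w_def
          using subrep_ann_ann(2) [OF v U(1) u(1) n j(2)] j(3) by auto
        moreover have "w \<beta> {m div 2} \<noteq> 0" using j by (simp add: w_def cre_def ann_def)
        then have "w \<noteq> 0" by (auto simp: fun_eq_iff)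
        moreover have "C = vacuum m Q" if "w \<gamma> C \<noteq> 0" for \<gamma> C
        proof -
          have c: "m div 2 \<in> C" "j \<notin> C - {m div 2}" "u \<gamma> (insert j (C - {m div 2})) \<noteq> 0"
            using that by (auto simp: w_def cre_def ann_def split: if_splits)
          from sing [OF c(3)] have "C - {m div 2} = {}" using c(2) by auto
          with c(1) show ?thesis by (auto simp: vacuum)
        qed
        ultimately show ?thesis by (rule final)
      qed
    qed
  qed
qed

section \<open>The Fischer form\<close>

text \<open>
  The entries of an element of Fock space are derivatives, so dividing by the factorials gives the
  Fischer inner product, in which monomials are orthogonal of squared norm \<open>\<alpha>!\<close> and multiplication by a variable
  is adjoint to the derivative. Null coordinates are related to Cartesian ones by a unitary matrix, hence the same
  holds for \<open>yop\<close> and \<open>dop\<close>.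
\<close>

definition fischer_wgt :: "nat \<Rightarrow> nat multiset \<Rightarrow> complex" where
  "fischer_wgt m \<alpha> = of_real (1 / (\<Prod>j = 1..m. fact (count \<alpha> j)))"

definition fischer :: "nat \<Rightarrow> nat \<Rightarrow> fock \<Rightarrow> fock \<Rightarrow> complex" where
  "fischer m k f g = (\<Sum>\<alpha>\<in>multi_index m k. \<Sum>B\<in>Pow {1..m div 2}. fischer_wgt m \<alpha> * f \<alpha> B * cnj (g \<alpha> B))"

lemma fischer_add: "fischer m k (f + g) h = fischer m k f h + fischer m k g h"
  and fischer_smul: "fischer m k (z \<odot> f) h = z * fischer m k f h"
  by (simp_all add: fischer_def algebra_simps sum.distrib sum_distrib_left)

lemma fischer_cnj: "cnj (fischer m k f g) = fischer m k g f"
  by (simp add: fischer_def fischer_wgt_def mult.commute mult.left_commute)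

lemma fischer_diff: "fischer m k (f - g) h = fischer m k f h - fischer m k g h"
  using fischer_add [of m k f "(-1) \<odot> g" h] fischer_smul [of m k "-1" g h] by simp

lemma fischer_add2: "fischer m k h (f + g) = fischer m k h f + fischer m k h g"
  and fischer_smul2: "fischer m k h (z \<odot> f) = cnj z * fischer m k h f"
  and fischer_diff2: "fischer m k h (f - g) = fischer m k h f - fischer m k h g"
  by (subst (1 2 3) fischer_cnj [symmetric], simp add: fischer_add fischer_diff fischer_smul,
      subst (1 2) fischer_cnj [symmetric], simp add: fischer_add fischer_diff fischer_smul)+

lemma fischer_pos:
  assumes "f \<in> fock_deg m k" "fischer m k f f = 0"
  shows "f = 0"
proof -
  define p where "p x = 1 / (\<Prod>j = 1..m. fact (count (fst x) j)) * (cmod (f (fst x) (snd x)))\<^sup>2"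
    for x :: "nat multiset \<times> nat set"
  have pos: "(\<Prod>j = 1..m. fact (count \<alpha> j) :: real) > 0" for \<alpha> :: "nat multiset"
    by (intro prod_pos) simp
  have "fischer m k f f = of_real (\<Sum>x\<in>multi_index m k \<times> Pow {1..m div 2}. p x)"
    unfolding fischer_def p_def of_real_sum
    by (subst sum.cartesian_product, rule sum.cong)
       (auto simp: fischer_wgt_def complex_norm_square [symmetric] mult.assoc simp del: of_real_prod)
  with assms(2) have "(\<Sum>x\<in>multi_index m k \<times> Pow {1..m div 2}. p x) = 0" by (simp only: of_real_eq_0_iff)
  then have p0: "\<forall>x\<in>multi_index m k \<times> Pow {1..m div 2}. p x = 0"
    by (subst (asm) sum_nonneg_eq_0_iff)
       (auto simp: finite_multi_index p_def intro!: mult_nonneg_nonneg divide_nonneg_nonneg prod_nonneg)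
  show ?thesis
  proof (rule fock_eqI, rule ccontr)
    fix \<alpha> B assume "f \<alpha> B \<noteq> 0 \<alpha> B"
    then have ne: "f \<alpha> B \<noteq> 0" by simp
    then have "(\<alpha>, B) \<in> multi_index m k \<times> Pow {1..m div 2}" using fock_degD [OF assms(1) ne] by (auto simp: multi_index_def)
    with p0 have "p (\<alpha>, B) = 0" by blast
    with ne pos [of \<alpha>] show False by (simp add: p_def)
  qed
qed

lemma fischer_wgt_add: "i \<in> {1..m} \<Longrightarrow> fischer_wgt m (add_mset i \<beta>) * of_nat (Suc (count \<beta> i)) = fischer_wgt m \<beta>"
proof -
  assume i: "i \<in> {1..m}"
  have "(\<Prod>j = 1..m. fact (count (add_mset i \<beta>) j) :: real)
    = fact (Suc (count \<beta> i)) * (\<Prod>j\<in>{1..m} - {i}. fact (count \<beta> j))"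
    using i by (subst prod.remove [of _ i]) auto
  also have "\<dots> = of_nat (Suc (count \<beta> i)) * (\<Prod>j = 1..m. fact (count \<beta> j))"
    using i by (subst prod.remove [of _ i]) auto
  finally have *: "(\<Prod>j = 1..m. fact (count (add_mset i \<beta>) j) :: real)
    = of_nat (Suc (count \<beta> i)) * (\<Prod>j = 1..m. fact (count \<beta> j))" .
  show ?thesis unfolding fischer_wgt_def *
    by (simp del: of_nat_Suc of_real_prod add: of_real_divide)
qed

lemma fischer_mulw:
  assumes i: "i \<in> {1..m}"
  shows "fischer m (Suc k) (mulw i f) g = fischer m k f (derw i g)"
proof -
  define T where "T \<alpha> = (\<Sum>B\<in>Pow {1..m div 2}. fischer_wgt m \<alpha> * mulw i f \<alpha> B * cnj (g \<alpha> B))" for \<alpha>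
  have "fischer m (Suc k) (mulw i f) g = (\<Sum>\<alpha>\<in>multi_index m (Suc k). T \<alpha>)"
    by (simp add: fischer_def T_def)
  also have "\<dots> = (\<Sum>\<alpha>\<in>add_mset i ` multi_index m k. T \<alpha>)"
  proof (rule sum.mono_neutral_right)
    show "add_mset i ` multi_index m k \<subseteq> multi_index m (Suc k)" using i by (auto simp: multi_index_def)
    show "\<forall>\<alpha>\<in>multi_index m (Suc k) - add_mset i ` multi_index m k. T \<alpha> = 0"
    proof
      fix \<alpha> assume a: "\<alpha> \<in> multi_index m (Suc k) - add_mset i ` multi_index m k"
      have "i \<notin># \<alpha>"
      proof
        assume "i \<in># \<alpha>"
        then obtain \<beta> where "\<alpha> = add_mset i \<beta>" by (rule mset_add)
        with a show False by (auto simp: multi_index_def)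
      qed
      then show "T \<alpha> = 0" by (simp add: T_def mulw_def not_in_iff)
    qed
  qed (simp add: finite_multi_index)
  also have "\<dots> = (\<Sum>\<beta>\<in>multi_index m k. T (add_mset i \<beta>))"
    by (rule sum.reindex_cong [of "add_mset i"]) (auto simp: inj_on_def)
  also have "\<dots> = fischer m k f (derw i g)"
    unfolding fischer_def T_def
  proof (intro sum.cong refl)
    fix \<beta> B
    show "fischer_wgt m (add_mset i \<beta>) * mulw i f (add_mset i \<beta>) B * cnj (g (add_mset i \<beta>) B)
      = fischer_wgt m \<beta> * f \<beta> B * cnj (derw i g \<beta> B)"
      using fischer_wgt_add [OF i, of \<beta>] by (simp add: mulw_def derw_def mult.assoc [symmetric])
  qed
  finally show ?thesis .
qed

lemma fischer_ann:
  assumes a: "a \<in> {1..m div 2}"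
  shows "fischer m k (ann a f) g = fischer m k f (cre a g)"
  unfolding fischer_def
proof (rule sum.cong [OF refl])
  fix \<alpha>
  let ?P = "Pow {1..m div 2}"
  have "(\<Sum>B\<in>?P. fischer_wgt m \<alpha> * ann a f \<alpha> B * cnj (g \<alpha> B))
    = (\<Sum>B\<in>{B \<in> ?P. a \<notin> B}. fischer_wgt m \<alpha> * ann a f \<alpha> B * cnj (g \<alpha> B))"
    by (rule sum.mono_neutral_right) (auto simp: ann_def)
  also have "\<dots> = (\<Sum>B\<in>{B \<in> ?P. a \<in> B}. fischer_wgt m \<alpha> * f \<alpha> B * cnj (cre a g \<alpha> B))"
  proof (rule sum.reindex_bij_witness [of _ "\<lambda>B. B - {a}" "insert a"])
    fix B assume "B \<in> {B \<in> ?P. a \<notin> B}"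
    then have "insert a B - {a} = B" "a \<notin> B" by auto
    then show "fischer_wgt m \<alpha> * f \<alpha> (insert a B) * cnj (cre a g \<alpha> (insert a B))
        = fischer_wgt m \<alpha> * ann a f \<alpha> B * cnj (g \<alpha> B)"
      by (simp add: ann_def cre_def ksign_insert)
  qed (use a in auto)
  also have "\<dots> = (\<Sum>B\<in>?P. fischer_wgt m \<alpha> * f \<alpha> B * cnj (cre a g \<alpha> B))"
    by (rule sum.mono_neutral_left) (auto simp: cre_def)
  finally show "(\<Sum>B\<in>?P. fischer_wgt m \<alpha> * ann a f \<alpha> B * cnj (g \<alpha> B))
    = (\<Sum>B\<in>?P. fischer_wgt m \<alpha> * f \<alpha> B * cnj (cre a g \<alpha> B))" .
qed

lemma fischer_cre: "a \<in> {1..m div 2} \<Longrightarrow> fischer m k (cre a f) g = fischer m k f (ann a g)"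
  using fischer_ann [of a m k g f] fischer_cnj [of m k "cre a f" g] fischer_cnj [of m k f "ann a g"]
  by (metis complex_cnj_cnj fischer_cnj)

lemma fischer_kappa: "fischer m k (kappa j f) g = - fischer m k f (kappa j g)"
  by (simp add: fischer_def kappa_def sum_negf [symmetric] algebra_simps)

lemmas fischer_rules = fischer_add fischer_smul fischer_diff fischer_add2 fischer_smul2 fischer_diff2

lemma fischer_theta:
  assumes "a \<in> {1..2 * (m div 2)}"
  shows "fischer m k (theta a f) g = - fischer m k f (theta a g)"
proof (cases "odd a")
  case True
  then have "Suc a div 2 \<in> {1..m div 2}" using assms by (auto elim!: oddE)
  with True show ?thesis by (simp add: theta_def fischer_rules fischer_ann fischer_cre)
next
  case False
  then have "a div 2 \<in> {1..m div 2}" using assms by (auto elim!: evenE)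
  with False show ?thesis by (simp add: theta_def fischer_rules fischer_ann fischer_cre algebra_simps)
qed

lemma fischer_minus2: "fischer m k f (- g) = - fischer m k f g"
  using fischer_smul2 [of m k f "-1" g] by simp

lemma fischer_gam:
  assumes "a \<in> {1..m}"
  shows "fischer m k (gam m a f) g = - fischer m k f (gam m a g)"
proof (cases "odd m \<and> a \<noteq> m")
  case True
  then have a: "a \<in> {1..2 * (m div 2)}" using assms by (auto elim!: oddE)
  then have "kappa (m div 2) (theta a g) = - theta a (kappa (m div 2) g)"
    by (intro kappa_theta) auto
  with True a show ?thesis
    by (simp add: gam_def fischer_theta fischer_kappa fischer_minus2)
next
  case False
  with assms fischer_theta [of a m k f g] fischer_kappa show ?thesis
    by (auto simp: gam_def elim!: evenE)
qed

lemma fischer_yop: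
  assumes "i \<in> {1..m}" "m \<ge> 2"
  shows "fischer m (Suc k) (yop i f) g = fischer m k f (dop i g)"
  using assms by (auto simp: yop_def dop_def fischer_rules fischer_mulw algebra_simps simp del: fock.scale_minus_left)

lemma fischer_0 [simp]: "fischer m k 0 g = 0" "fischer m k g 0 = 0"
  by (simp_all add: fischer_def)

lemma fischer_yop_dop:
  assumes "f \<in> fock_deg m k" "g \<in> fock_deg m k" "a \<in> {1..m}" "b \<in> {1..m}" "m \<ge> 2"
  shows "fischer m k (yop a (dop b f)) g = fischer m k f (yop b (dop a g))"
proof (cases k)
  case 0
  with assms show ?thesis by (simp add: fock_deg_dop_0 yop_rules)
next
  case (Suc j)
  have "fischer m (Suc j) (yop a (dop b f)) g = fischer m j (dop b f) (dop a g)"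
    using assms by (simp add: fischer_yop)
  also have "\<dots> = cnj (fischer m j (dop a g) (dop b f))" by (simp add: fischer_cnj)
  also have "\<dots> = cnj (fischer m (Suc j) (yop b (dop a g)) f)" using assms by (simp add: fischer_yop)
  finally show ?thesis by (simp add: Suc fischer_cnj)
qed

lemma fischer_rho_fock:
  assumes "f \<in> fock_deg m k" "g \<in> fock_deg m k" "a \<in> {1..m}" "b \<in> {1..m}" "m \<ge> 2"
  shows "fischer m k (rho_fock m a b f) g = - fischer m k f (rho_fock m a b g)"
  using gam_anti [OF assms(3,4), of g] assms
  by (auto simp: rho_fock_def fischer_rules fischer_yop_dop fischer_gam fischer_minus2)

section \<open>Orthogonal complements and irreducibility\<close>

lemma fock_deg_span: "\<exists>S. finite S \<and> fock_deg m k \<subseteq> fock.span S"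
proof (intro exI conjI subsetI)
  define d where "d x = (\<lambda>\<alpha> B. if x = (\<alpha>, B) then 1 else 0 :: complex)" for x :: "nat multiset \<times> nat set"
  let ?X = "multi_index m k \<times> Pow {1..m div 2}"
  show fX: "finite (d ` ?X)" by (simp add: finite_multi_index)
  fix f assume f: "f \<in> fock_deg m k"
  have "f = (\<Sum>x\<in>?X. f (fst x) (snd x) \<odot> d x)"
  proof (rule fock_eqI)
    fix \<alpha> B
    have "(\<Sum>x\<in>?X. f (fst x) (snd x) \<odot> d x) \<alpha> B = (\<Sum>x\<in>?X. if x = (\<alpha>, B) then f \<alpha> B else 0)"
      unfolding sum_apply by (rule sum.cong) (auto simp: d_def)
    also have "\<dots> = (if (\<alpha>, B) \<in> ?X then f \<alpha> B else 0)"
      by (rule sum.delta) (simp add: finite_multi_index)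
    also have "\<dots> = f \<alpha> B" using fock_degD [OF f, of \<alpha> B] by (auto simp: multi_index_def)
    finally show "f \<alpha> B = (\<Sum>x\<in>?X. f (fst x) (snd x) \<odot> d x) \<alpha> B" by simp
  qed
  also have "\<dots> \<in> fock.span (d ` ?X)"
    by (intro fock.span_sum fock.span_scale fock.span_base imageI)
  finally show "f \<in> fock.span (d ` ?X)" .
qed

lemma projection_span:
  assumes "finite S" "S \<subseteq> fock_deg m k" "w \<in> fock_deg m k"
  shows "\<exists>p\<in>fock.span S. \<forall>u\<in>fock.span S. fischer m k (w - p) u = 0"
  using assms
proof (induction S arbitrary: w rule: finite_induct)
  case empty
  then show ?case unfolding fock.span_empty by (simp add: fischer_def)
next
  case (insert x S)
  have hsub: "fock.subspace (fock_deg m k)" by (simp add: fock_deg_def supported_subspace)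
  have Sh: "fock.span S \<subseteq> fock_deg m k" using insert.prems by (intro fock.span_minimal hsub) auto
  obtain px where px: "px \<in> fock.span S" "\<And>u. u \<in> fock.span S \<Longrightarrow> fischer m k (x - px) u = 0"
    using insert by (metis insert_subset)
  obtain pw where pw: "pw \<in> fock.span S" "\<And>u. u \<in> fock.span S \<Longrightarrow> fischer m k (w - pw) u = 0"
    using insert by (metis insert_subset)
  define x' where "x' = x - px"
  have x'h: "x' \<in> fock_deg m k" unfolding x'_def using insert.prems px(1) Sh by (intro fock_deg_closed) auto
  define t where "t = (if x' = 0 then 0 else fischer m k (w - pw) x' / fischer m k x' x')"
  have up: "fock.span S \<subseteq> fock.span (insert x S)" by (rule fock.span_mono) auto
  have "x' \<in> fock.span (insert x S)" unfolding x'_def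
    by (intro fock.span_diff fock.span_base subsetD [OF up px(1)]) simp
  then have "pw + t \<odot> x' \<in> fock.span (insert x S)"
    by (intro fock.span_add fock.span_scale subsetD [OF up pw(1)])
  moreover have "fischer m k (w - (pw + t \<odot> x')) u = 0" if u: "u \<in> fock.span (insert x S)" for u
  proof -
    obtain c where c: "u - c \<odot> x \<in> fock.span S" using u fock.span_breakdown_eq by blast
    define s where "s = (u - c \<odot> x) + c \<odot> px"
    have s: "s \<in> fock.span S" unfolding s_def using c px(1) by (intro fock.span_add fock.span_scale)
    have us: "u = s + c \<odot> x'" by (rule fock_eqI) (simp add: s_def x'_def algebra_simps)
    have "fischer m k (w - pw) x' = t * fischer m k x' x'"
      using fischer_pos [OF x'h] by (auto simp: t_def)
    then show ?thesis
      unfolding us diff_diff_eq [symmetric]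
      using pw(2) [OF s] px(2) [OF s, folded x'_def] by (simp add: fischer_rules)
  qed
  ultimately show ?case by blast
qed

text \<open>
  Existence of the orthogonal projection, by Gram--Schmidt on a finite spanning set (lemma
  \<open>projection_span\<close>).
\<close>

lemma projection:
  assumes "fock.subspace U" "U \<subseteq> fock_deg m k" "w \<in> fock_deg m k"
  obtains p where "p \<in> U" "\<And>u. u \<in> U \<Longrightarrow> fischer m k (w - p) u = 0"
proof -
  obtain T where T: "finite T" "fock_deg m k \<subseteq> fock.span T" using fock_deg_span by blast
  obtain S where S: "S \<subseteq> U" "fock.independent S" "U \<subseteq> fock.span S"
    using fock.maximal_independent_subset by blast
  have "finite S" using fock.independent_span_bound [OF T(1) S(2)] S(1) assms(2) T(2) by blast
  moreover have "fock.span S = U"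
    using S assms(1) fock.span_minimal by blast
  ultimately show thesis using projection_span [of S m k w] assms S that by blast
qed

lemma hw_vec_ne: "hw_vec m k Q \<noteq> 0"
proof
  assume "hw_vec m k Q = 0"
  then have "hw_vec m k Q (replicate_mset k 1) (vacuum m Q) = 0" by simp
  then show False by (simp add: hw_vec_def)
qed

lemma vacuum_bounds: "valid_parity m Q \<Longrightarrow> vacuum m Q \<subseteq> {1..m div 2} \<and> 1 \<notin> vacuum m Q \<and> even (card (vacuum m Q)) \<in> Q"
  by (auto simp: valid_parity_def vacuum_def split: if_splits elim!: evenE)

lemma hw_vec_fock_deg: "valid_parity m Q \<Longrightarrow> hw_vec m k Q \<in> fock_deg m k"
  using vacuum_bounds [of m Q]
  by (intro fock_degI) (auto simp: hw_vec_def valid_parity_def split: if_splits)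

lemma derw_hw_vec: "j \<noteq> 1 \<Longrightarrow> derw j (hw_vec m k Q) = 0"
  by (rule fock_eqI) (auto simp: derw_def hw_vec_def dest!: arg_cong [of _ _ "\<lambda>M. count M j"])

lemma ann_hw_vec: "a \<notin> vacuum m Q \<Longrightarrow> ann a (hw_vec m k Q) = 0"
  by (rule fock_eqI) (auto simp: ann_def hw_vec_def)

lemma ann_kappa_hw_vec: "a \<notin> vacuum m Q \<Longrightarrow> ann a (kappa j (hw_vec m k Q)) = 0"
  by (rule fock_eqI) (auto simp: ann_def hw_vec_def kappa_def)

lemma gam_null_hw_vec:
  assumes "valid_parity m Q"
  shows "gam_null m (hw_vec m k Q) = 0"
proof -
  have "m \<ge> 3" "1 \<notin> vacuum m Q" using assms vacuum_bounds [OF assms] by (auto simp: valid_parity_def)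
  then show ?thesis by (simp add: gam_null_ann ann_hw_vec ann_kappa_hw_vec)
qed

lemma hw_vec_fock_monogenics:
  assumes "valid_parity m Q"
  shows "hw_vec m k Q \<in> fock_monogenics m k Q"
proof -
  have "dirac_fock m (hw_vec m k Q) = 0"
    using assms by (subst dirac_fock_eq) (auto simp: valid_parity_def derw_hw_vec gam_null_rules gam_rules gam_null_commutes gam_null_hw_vec [OF assms] op_simps)
  moreover have "hw_vec m k Q \<in> fock_par Q"
    using vacuum_bounds [OF assms] by (auto simp: fock_par_def supported_def hw_vec_def)
  ultimately show ?thesis using hw_vec_fock_deg [OF assms] by (simp add: fock_monogenics_def)
qed

text \<open>
  If \<open>U\<close> is a proper nonzero subrepresentation, both \<open>U\<close> and its orthogonal complement are nonzero and
  invariant, so both contain \<open>hw_vec\<close>, which would be orthogonal to itself.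
\<close>

theorem fock_monogenics_irreducible:
  assumes v: "valid_parity m Q"
  shows "so_irreducible smul m (rho_fock m) (fock_monogenics m k Q)"
  unfolding so_irreducible_def
proof (intro conjI allI impI)
  let ?M = "fock_monogenics m k Q"
  have m: "m \<ge> 2" using v by (simp add: valid_parity_def)
  show "so_representation smul m (rho_fock m) ?M" by (rule fock_monogenics_representation [OF v])
  show "?M \<noteq> {0}" using hw_vec_fock_monogenics [OF v, of k] hw_vec_ne by auto
  fix U assume UM: "U \<subseteq> ?M" and rep: "so_representation smul m (rho_fock m) U"
  interpret U: so_representation smul m "rho_fock m" U by (rule rep)
  have sU: "subrep m k Q U"
    using UM U.subspace_V U.maps_to by (auto simp: subrep_def)
  have Mh: "?M \<subseteq> fock_deg m k" by (auto simp: fock_monogenics_def)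
  show "U = {0} \<or> U = ?M"
  proof (rule ccontr)
    assume n: "\<not> ?thesis"
    then obtain w where w: "w \<in> ?M" "w \<notin> U" using UM by blast
    obtain p where p: "p \<in> U" "\<And>u. u \<in> U \<Longrightarrow> fischer m k (w - p) u = 0"
      using projection [OF U.subspace_V, of m k w] UM Mh w(1) by blast
    define C where "C = {f \<in> ?M. \<forall>u\<in>U. fischer m k f u = 0}"
    have "subrep m k Q C"
      unfolding subrep_def
    proof (intro conjI ballI)
      show "fock.subspace C"
        using fock_monogenics_subspace [of m k Q] unfolding fock.subspace_def C_def
        by (auto simp: fischer_rules)
      fix a b f assume abf: "a \<in> {1..m}" "b \<in> {1..m}" "f \<in> C"
      have "fischer m k (rho_fock m a b f) u = 0" if u: "u \<in> U" for u
      proof -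
        have "fischer m k (rho_fock m a b f) u = - fischer m k f (rho_fock m a b u)"
          using abf u UM Mh m by (intro fischer_rho_fock) (auto simp: C_def)
        also have "\<dots> = 0" using abf U.maps_to [OF abf(1,2) u] by (auto simp: C_def)
        finally show ?thesis .
      qed
      then show "rho_fock m a b f \<in> C" using abf fock_monogenics_rho_fock [OF v] by (auto simp: C_def)
    qed (auto simp: C_def)
    moreover have "w - p \<in> C"
      using w p UM fock.subspace_diff [OF fock_monogenics_subspace] by (auto simp: C_def)
    moreover have "w - p \<noteq> 0" using w p by auto
    ultimately have "hw_vec m k Q \<in> C" by (intro subrep_contains_hw_vec [OF v]) auto
    moreover have "hw_vec m k Q \<in> U" using n by (intro subrep_contains_hw_vec [OF v sU]) auto
    ultimately have "fischer m k (hw_vec m k Q) (hw_vec m k Q) = 0" by (auto simp: C_def)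
    with fischer_pos [OF hw_vec_fock_deg [OF v]] hw_vec_ne show False by blast
  qed
qed

section \<open>The highest weight\<close>

definition hw_weight :: "nat \<Rightarrow> nat \<Rightarrow> bool set \<Rightarrow> nat \<Rightarrow> complex" where
  "hw_weight m k Q a = (if a = 1 then of_nat k + 1 / 2 else if a \<in> vacuum m Q then - (1 / 2) else 1 / 2)"

text \<open>
  \<open>hw_vec\<close> is $z_1^k$ times a basis spinor. The orbital part contributes \<open>k\<close> to the weight of $H_1$ and
  nothing else, because the null derivative by $z_2$ and the derivatives of index at least 3 vanish. The spin parts
  of the root vectors are, up to a factor, \<open>ann a \<circ> cre b\<close> for $X_{a,b}$, \<open>ann a \<circ> ann b\<close> for
  $Y_{a,b}$ and \<open>ann a\<close> for $U_a$. They kill \<open>vacuum\<close>: for $X_{a,b}$ with \<open>a < b\<close> the annihilator finds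
  \<open>a \<notin> vacuum\<close>.
\<close>

lemma hw_vec_highest:
  assumes v: "valid_parity m Q"
  shows "highest_weight_vector smul m (rho_fock m) (hw_weight m k Q) (hw_vec m k Q)"
proof -
  let ?v = "hw_vec m k Q"
  define n where "n = m div 2"
  have m: "m \<ge> 3" using v by (simp add: valid_parity_def)
  have vb: "1 \<notin> vacuum m Q" "vacuum m Q \<subseteq> {n}" using vacuum_bounds [OF v] by (auto simp: vacuum_def n_def)
  have d3: "dop j ?v = 0" if "j \<ge> 3" for j using that by (simp add: dop_def derw_hw_vec)
  have d2: "dop (2 * a) ?v = (- \<i>) \<odot> dop (2 * a - 1) ?v" if "a \<ge> 1" for a
  proof (cases "a = 1")
    case True
    then show ?thesis by (simp add: dop_def derw_hw_vec)
  next
    case False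
    with that show ?thesis by (simp add: d3)
  qed
  have W: "mulw 1 (derw 1 ?v) = of_nat k \<odot> ?v"
    by (rule fock_eqI) (simp only: mulw_derw, auto simp: hw_vec_def)
  have th: "gam m a (gam m b f) = theta a (theta b f)" if "a \<in> {1..2 * n}" "b \<in> {1..2 * n}" for a b f
    using that by (simp add: gam_gam_theta n_def)
  have ca: "\<i> \<odot> rho_fock m (2 * a - 1) (2 * a) ?v = hw_weight m k Q a \<odot> ?v" if a: "a \<in> {1..n}" for a
  proof -
    have sp: "theta (2 * a - 1) (theta (2 * a) ?v) = (if a \<in> vacuum m Q then - \<i> else \<i>) \<odot> ?v"
    proof (cases "a \<in> vacuum m Q")
      case True
      then have "cre a ?v = 0" by (intro fock_eqI) (auto simp: cre_def hw_vec_def)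
      then have "cre a (ann a ?v) = ?v" using ann_cre [of a a ?v] by (simp add: op_simps)
      with \<open>cre a ?v = 0\<close> show ?thesis using a True
        by (intro fock_eqI) (auto simp: theta_def op_simps ann_cre)
    next
      case False
      then have "ann a ?v = 0" by (rule ann_hw_vec)
      then show ?thesis using a False
        by (intro fock_eqI) (auto simp: theta_def op_simps ann_cre)
    qed
    have orbital: "yop (2 * a - 1) (dop (2 * a) ?v) - yop (2 * a) (dop (2 * a - 1) ?v)
      = (if a = 1 then - \<i> * of_nat k else 0) \<odot> ?v"
    proof (cases "a = 1")
      case True
      have "yop 1 (dop 2 ?v) - yop 2 (dop 1 ?v) = (- \<i>) \<odot> mulw 1 (derw 1 ?v)"
        by (rule fock_eqI) (simp add: yop_def dop_def derw_hw_vec op_simps algebra_simps)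
      with True show ?thesis unfolding W by simp
    next
      case False
      with a have "2 * a - 1 \<ge> 3" "2 * a \<ge> 3" by auto
      from this [THEN d3] False show ?thesis by (simp only: yop_rules) simp
    qed
    have "2 * a - 1 \<noteq> 2 * a" "2 * a - 1 \<in> {1..2 * n}" "2 * a \<in> {1..2 * n}" using a by auto
    then have "rho_fock m (2 * a - 1) (2 * a) ?v = (if a = 1 then - \<i> * of_nat k else 0) \<odot> ?v
       - (1 / 2) \<odot> (if a \<in> vacuum m Q then - \<i> else \<i>) \<odot> ?v"
      unfolding rho_fock_def orbital [symmetric] sp [symmetric] by (simp only: th if_False simp_thms)
    then show ?thesis using vb(1)
      by (simp only:) (rule fock_eqI, simp add: hw_weight_def algebra_simps)
  qed
  have ne: "2 * a \<noteq> 2 * b - 1" "2 * a - 1 \<noteq> 2 * b" "2 * b - 1 \<noteq> 2 * a" "2 * b \<noteq> 2 * a - 1" if "a \<ge> 1" "b \<ge> 1" for a b :: nat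
    using that by presburger+
  have orbX: "yop (2 * a - 1) (dop j ?v) - \<i> \<odot> yop (2 * a) (dop j ?v) = 0 " if "j \<ge> 3" for a j
    using that by (simp add: d3 yop_rules)
  have X: "root_X smul (rho_fock m) a b ?v = 0" if ab: "a \<in> {1..n}" "b \<in> {1..n}" "a < b" for a b
  proof -
    have b: "b \<ge> 2" and na: "a \<notin> vacuum m Q" using ab vb by auto
    have db: "dop (2 * b) ?v = 0" "dop (2 * b - 1) ?v = 0" using b by (auto intro!: d3)
    have "ann a (cre b ?v) = 0" using ab ann_hw_vec [OF na] by (simp add: ann_cre op_simps)
    moreover have "4 \<odot> ann a (cre b ?v) = (-1) \<odot> (2 \<odot> ann a ((-2) \<odot> cre b ?v))"
      by (simp add: op_simps)
    moreover have "2 \<odot> ann a f = theta (2 * a - 1) f - \<i> \<odot> theta (2 * a) f" for f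
      using ab theta_ann [of a f] by simp
    moreover have "(-2) \<odot> cre b f = theta (2 * b - 1) f + \<i> \<odot> theta (2 * b) f" for f
      using ab theta_cre [of b f] by simp
    ultimately have Z: "theta (2 * a - 1) (theta (2 * b - 1) ?v + \<i> \<odot> theta (2 * b) ?v)
       - \<i> \<odot> theta (2 * a) (theta (2 * b - 1) ?v + \<i> \<odot> theta (2 * b) ?v) = 0"
      by simp
    define p q r s where pq: "p = 2 * a - 1" "q = 2 * a" "r = 2 * b - 1" "s = 2 * b"
    have ab1: "a \<ge> 1" "b \<ge> 1" using ab by auto
    have ran: "p \<in> {1..2 * n}" "q \<in> {1..2 * n}" "r \<in> {1..2 * n}" "s \<in> {1..2 * n}"
      and dist: "p \<noteq> r" "p \<noteq> s" "q \<noteq> r" "q \<noteq> s"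
      using ab unfolding pq by (auto simp: ) (presburger+)?
    note th' = th [OF ran(1,3)] th [OF ran(1,4)] th [OF ran(2,3)] th [OF ran(2,4)]
    note dd = d2 [OF ab1(1), folded pq(1,3), folded pq(2,4)] db [folded pq(1,3), folded pq(2,4)]
    show ?thesis
    proof (rule fock_eqI)
      fix \<alpha> B
      show "root_X smul (rho_fock m) a b ?v \<alpha> B = 0 \<alpha> B"
        using fun_cong [OF fun_cong [OF Z, of \<alpha>], of B]
        unfolding root_X_def unfolding pq(1,3) [symmetric] unfolding pq(2,4) [symmetric]
        by (simp add: rho_fock_def dist th' dd yop_rules theta_rules algebra_simps)
    qed
  qed
  have Y: "root_Y smul (rho_fock m) a b ?v = 0" if ab: "a \<in> {1..n}" "b \<in> {1..n}" "a \<noteq> b" for a b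
  proof -
    have "ann a (ann b ?v) = 0"
    proof (cases "b \<in> vacuum m Q")
      case True
      then have "a \<notin> vacuum m Q" using ab vb by auto
      then show ?thesis using ann_ann [of a b ?v] ann_hw_vec by (simp add: op_simps)
    next
      case False
      then show ?thesis by (simp add: ann_hw_vec op_simps)
    qed
    moreover have "4 \<odot> ann a (ann b ?v) = 2 \<odot> ann a (2 \<odot> ann b ?v)"
      by (simp add: op_simps)
    moreover have "2 \<odot> ann a f = theta (2 * a - 1) f - \<i> \<odot> theta (2 * a) f" for f
      using ab theta_ann [of a f] by simp
    moreover have "2 \<odot> ann b f = theta (2 * b - 1) f - \<i> \<odot> theta (2 * b) f" for f
      using ab theta_ann [of b f] by simp
    ultimately have Z: "theta (2 * a - 1) (theta (2 * b - 1) ?v - \<i> \<odot> theta (2 * b) ?v)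
       - \<i> \<odot> theta (2 * a) (theta (2 * b - 1) ?v - \<i> \<odot> theta (2 * b) ?v) = 0"
      by simp
    define p q r s where pq: "p = 2 * a - 1" "q = 2 * a" "r = 2 * b - 1" "s = 2 * b"
    have ab1: "a \<ge> 1" "b \<ge> 1" using ab by auto
    have ran: "p \<in> {1..2 * n}" "q \<in> {1..2 * n}" "r \<in> {1..2 * n}" "s \<in> {1..2 * n}"
      and dist: "p \<noteq> r" "p \<noteq> s" "q \<noteq> r" "q \<noteq> s"
      using ab unfolding pq by (auto simp: ) (presburger+)?
    note th' = th [OF ran(1,3)] th [OF ran(1,4)] th [OF ran(2,3)] th [OF ran(2,4)]
    note dd = d2 [OF ab1(1), folded pq(1,3), folded pq(2,4)] d2 [OF ab1(2), folded pq(1,3), folded pq(2,4)]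
    show ?thesis
    proof (rule fock_eqI)
      fix \<alpha> B
      show "root_Y smul (rho_fock m) a b ?v \<alpha> B = 0 \<alpha> B"
        using fun_cong [OF fun_cong [OF Z, of \<alpha>], of B]
        unfolding root_Y_def unfolding pq(1,3) [symmetric] unfolding pq(2,4) [symmetric]
        by (simp add: rho_fock_def dist th' dd yop_rules theta_rules algebra_simps)
    qed
  qed
  have U: "root_U smul m (rho_fock m) a ?v = 0" if a: "a \<in> {1..n}" and "odd m" for a
  proof -
    have "vacuum m Q = {}" using v \<open>odd m\<close> by (simp add: valid_parity_def vacuum_def)
    then have "ann a ?v = 0" by (simp add: ann_hw_vec)
    then have Z: "theta (2 * a - 1) ?v - \<i> \<odot> theta (2 * a) ?v = 0"
      using theta_ann [of a ?v] a by simp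
    have last: "gam m j (gam m m f) = - theta j f" if "j \<in> {1..2 * n}" for j f
      using that \<open>odd m\<close> by (simp add: gam_gam_last n_def)
    define p q where pq: "p = 2 * a - 1" "q = 2 * a"
    have a1: "a \<ge> 1" using a by auto
    have "m = 2 * n + 1" using \<open>odd m\<close> unfolding n_def by simp
    then have ne: "p \<noteq> m" "q \<noteq> m" using a unfolding pq atLeastAtMost_iff by presburger+
    have ran: "p \<in> {1..2 * n}" "q \<in> {1..2 * n}" using a unfolding pq by auto
    show ?thesis
    proof (rule fock_eqI)
      fix \<alpha> B
      show "root_U smul m (rho_fock m) a ?v \<alpha> B = 0 \<alpha> B"
        using fun_cong [OF fun_cong [OF Z, of \<alpha>], of B]
        unfolding root_U_def unfolding pq(1) [symmetric] unfolding pq(2) [symmetric]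
        by (simp add: rho_fock_def ne last [OF ran(1)] last [OF ran(2)] d2 [OF a1, folded pq(1), folded pq(2)] d3 [OF m] yop_rules algebra_simps)
    qed
  qed
  show ?thesis
    unfolding highest_weight_vector_def cartan_H_def n_def [symmetric]
    using hw_vec_ne ca X Y U by auto
qed

section \<open>Polynomial functions of one integer variable\<close>

definition poly_funs :: "(int \<Rightarrow> int) set" where
  "poly_funs = range poly"

text \<open>
  The forward difference for \<open>s = 1\<close> and the backward difference for \<open>s = - 1\<close>.
\<close>

definition step_diff :: "int \<Rightarrow> (int \<Rightarrow> int) \<Rightarrow> int \<Rightarrow> int" where
  "step_diff s p = (\<lambda>t. s * (p (t + s) - p t))"

lemma u_poly_monic: "\<exists>q. u_poly k = poly q \<and> degree q = 2 * k + 1 \<and> lead_coeff q = 1"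
proof (intro exI conjI)
  let ?q = "\<Prod>i = - int k..int k. [:i, 1:]"
  show "u_poly k = poly ?q" by (auto simp: u_poly_def poly_prod fun_eq_iff add.commute)
  show "degree ?q = 2 * k + 1" by (subst degree_prod_eq_sum_degree) auto
  show "lead_coeff ?q = 1" by (simp add: lead_coeff_prod)
qed

lemma X_basis_monic: "\<exists>q. X_basis s j = poly q \<and> degree q = j \<and> lead_coeff q = 1"
proof (cases "even j")
  case False
  then show ?thesis using u_poly_monic [of "j div 2"] by (auto simp: X_basis_def fun_eq_iff)
next
  case True
  then obtain k where k: "j = 2 * k" ..
  show ?thesis
  proof (cases k)
    case 0
    then show ?thesis using k by (intro exI [of _ 1]) (auto simp: X_basis_def v_poly_def fun_eq_iff)
  next
    case (Suc i)
    obtain q where q: "u_poly i = poly q" "degree q = 2 * i + 1" "lead_coeff q = 1"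
      using u_poly_monic by blast
    have "q \<noteq> 0" using q by auto
    then have "degree (q * [:s * int k, 1:]) = j" using q k Suc by (subst degree_mult_eq) auto
    moreover have "lead_coeff (q * [:s * int k, 1:]) = 1" using q by (simp add: lead_coeff_mult del: mult_pCons_right)
    moreover have "X_basis s j = poly (q * [:s * int k, 1:])"
      using q k Suc by (auto simp: X_basis_def v_poly_def fun_eq_iff algebra_simps)
    ultimately show ?thesis by blast
  qed
qed

lemma poly_funs_expand_aux: "degree q < N \<Longrightarrow> \<exists>a. poly q = (\<lambda>t. \<Sum>i<N. X_basis s i t * a i)"
proof (induction N arbitrary: q)
  case (Suc N)
  obtain b where b: "X_basis s N = poly b" "degree b = N" "lead_coeff b = 1"
    using X_basis_monic by blast
  define r where "r = q - smult (coeff q N) b"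
  have "degree r \<le> N" unfolding r_def using Suc.prems b
    by (intro degree_diff_le) (auto intro: order_trans [OF degree_smult_le])
  moreover have "coeff r N = 0" using b by (simp add: r_def)
  ultimately have r: "r = 0 \<or> degree r < N"
    by (metis le_neq_implies_less leading_coeff_0_iff)
  have "\<exists>a. poly r = (\<lambda>t. \<Sum>i<N. X_basis s i t * a i)"
  proof (cases "r = 0")
    case True
    then show ?thesis by (intro exI [of _ "\<lambda>_. 0"]) (auto simp: fun_eq_iff)
  qed (use r Suc.IH in auto)
  then obtain a where a: "poly r = (\<lambda>t. \<Sum>i<N. X_basis s i t * a i)" by blast
  have "poly q t = (\<Sum>i<Suc N. X_basis s i t * (a(N := coeff q N)) i)" for t
  proof -
    have "q = r + smult (coeff q N) b" by (simp add: r_def)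
    then have "poly q t = poly r t + coeff q N * poly b t" by (metis poly_add poly_smult)
    then show ?thesis unfolding a by (simp add: b)
  qed
  then show ?case by blast
qed auto

lemma poly_funs_expand: "p \<in> poly_funs \<Longrightarrow> \<exists>N a. p = (\<lambda>t. \<Sum>i<N. X_basis s i t * a i)"
  using poly_funs_expand_aux [OF lessI] unfolding poly_funs_def by blast

lemma poly_funs_const: "(\<lambda>_. a) \<in> poly_funs"
  unfolding poly_funs_def by (rule image_eqI [of _ _ "[:a:]"]) auto

lemma poly_funs_add: "p \<in> poly_funs \<Longrightarrow> q \<in> poly_funs \<Longrightarrow> (\<lambda>t. p t + q t) \<in> poly_funs"
  unfolding poly_funs_def by (auto simp flip: poly_add)

lemma poly_funs_mult: "p \<in> poly_funs \<Longrightarrow> q \<in> poly_funs \<Longrightarrow> (\<lambda>t. p t * q t) \<in> poly_funs"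
  unfolding poly_funs_def by (auto simp flip: poly_mult)

lemma poly_funs_sum: "(\<And>i. i \<in> I \<Longrightarrow> p i \<in> poly_funs) \<Longrightarrow> (\<lambda>t. \<Sum>i\<in>I. p i t) \<in> poly_funs"
  by (induction I rule: infinite_finite_induct) (auto intro: poly_funs_const poly_funs_add)

lemma poly_funs_X_basis: "X_basis s i \<in> poly_funs"
  using X_basis_monic [of s i] by (auto simp: poly_funs_def)

lemma poly_funs_X_image: "X_image s i \<in> poly_funs"
proof -
  have "X_image s i = X_basis (if even i then s else - s) (Suc i)"
    by (auto simp: X_image_def X_basis_def fun_eq_iff elim!: evenE oddE)
  then show ?thesis by (simp add: poly_funs_X_basis)
qed

lemma step_diff_poly:
  assumes "s = 1 \<or> s = - 1"
  shows "\<exists>q'. step_diff s (poly q) = poly q' \<and> (q' = 0 \<or> degree q' < degree q)"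
proof -
  define r where "r = pcompose q [:s, 1:] - q"
  have eq: "step_diff s (poly q) = poly (smult s r)"
    by (auto simp: step_diff_def r_def poly_pcompose fun_eq_iff add.commute)
  have "r = 0 \<or> degree r < degree q"
  proof (cases "degree q = 0")
    case True
    then obtain a where "q = [:a:]" using degree_eq_zeroE by blast
    then show ?thesis by (simp add: r_def)
  next
    case False
    have "degree r \<le> degree q" unfolding r_def by (intro degree_diff_le) (auto simp: degree_pcompose)
    moreover have "coeff r (degree q) = 0"
      using lead_coeff_comp [of "[:s, 1:]" q] by (simp add: r_def degree_pcompose)
    ultimately show ?thesis by (metis le_neq_implies_less leading_coeff_0_iff)
  qed
  then have "smult s r = 0 \<or> degree (smult s r) < degree q" using assms by auto
  with eq show ?thesis by blast
qed

lemma poly_funs_step_diff: "p \<in> poly_funs \<Longrightarrow> s = 1 \<or> s = - 1 \<Longrightarrow> step_diff s p \<in> poly_funs"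
  using step_diff_poly [of s] by (fastforce simp: poly_funs_def)

lemma u_poly_Suc: "u_poly (Suc k) t = u_poly k t * (t + int (Suc k)) * (t - int (Suc k))"
proof -
  have "{- int (Suc k)..int (Suc k)} = insert (int (Suc k)) (insert (- int (Suc k)) {- int k..int k})"
    by auto
  then show ?thesis by (simp add: u_poly_def algebra_simps)
qed

lemma u_poly_0: "u_poly 0 t = t"
  by (simp add: u_poly_def)

text \<open>
  $u_k$ is a product of \<open>2 k + 1\<close> consecutive factors; a shift by one exchanges an extreme factor for the
  next one beyond the other end.
\<close>

lemma u_poly_shift: "s = 1 \<or> s = - 1 \<Longrightarrow>
  u_poly k (t + s) * (t - s * int k) = u_poly k t * (t + s * int (Suc k))"
proof (induction k)
  case (Suc k)
  have "u_poly (Suc k) (t + s) * (t - s * int (Suc k))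
      = u_poly k (t + s) * (t + s + int (Suc k)) * (t + s - int (Suc k)) * (t - s * int (Suc k))"
    by (simp add: u_poly_Suc)
  also have "\<dots> = (u_poly k (t + s) * (t - s * int k)) * (t + s * int (Suc (Suc k))) * (t - s * int (Suc k))"
    using Suc.prems by (auto simp: algebra_simps)
  also have "\<dots> = u_poly k t * (t + s * int (Suc k)) * (t + s * int (Suc (Suc k))) * (t - s * int (Suc k))"
    by (simp only: Suc.IH [OF Suc.prems])
  also have "\<dots> = u_poly (Suc k) t * (t + s * int (Suc (Suc k)))"
    using Suc.prems by (auto simp: u_poly_Suc algebra_simps)
  finally show ?case .
qed (auto simp: u_poly_0)

lemma v_poly_prod:
  assumes "s = 1 \<or> s = - 1"
  shows "v_poly s (Suc k) t = u_poly k t * (t + s * int (Suc k))"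
    "v_poly s (Suc k) t = u_poly k (t + s) * (t - s * int k)"
  using u_poly_shift [OF assms, of k t] by (simp_all add: v_poly_def)

lemma u_poly_v_poly:
  assumes "s = 1 \<or> s = - 1"
  shows "u_poly k t = v_poly s k t * (t - s * int k)"
  using assms by (cases k) (auto simp: u_poly_0 v_poly_def u_poly_Suc algebra_simps)

lemma u_poly_shift_v:
  assumes "s = 1 \<or> s = - 1"
  shows "u_poly k (t + s) = v_poly s k t * (t + s * int (Suc k))"
proof (cases k)
  case (Suc i)
  have "u_poly (Suc i) (t + s) = u_poly i (t + s) * (t + s + int (Suc i)) * (t + s - int (Suc i))"
    by (simp add: u_poly_Suc)
  also have "\<dots> = (u_poly i (t + s) * (t - s * int i)) * (t + s * int (Suc (Suc i)))"
    using assms by (auto simp: algebra_simps)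
  finally show ?thesis using Suc v_poly_prod(2) [OF assms, of i t] by simp
qed (simp add: u_poly_0 v_poly_def)

lemma step_diff_u:
  assumes "s = 1 \<or> s = - 1"
  shows "step_diff s (u_poly k) = (\<lambda>t. int (2 * k + 1) * v_poly s k t)"
proof
  fix t
  have "step_diff s (u_poly k) t = s * (v_poly s k t * (t + s * int (Suc k)) - v_poly s k t * (t - s * int k))"
    using u_poly_shift_v [OF assms, of k t] u_poly_v_poly [OF assms, of k t] by (simp add: step_diff_def)
  also have "\<dots> = (s * s) * int (2 * k + 1) * v_poly s k t" by (simp add: algebra_simps)
  finally show "step_diff s (u_poly k) t = int (2 * k + 1) * v_poly s k t" using assms by auto
qed

lemma step_diff_v:
  assumes "s = 1 \<or> s = - 1"
  shows "step_diff (- s) (v_poly s k) = (\<lambda>t. int (2 * k) * u_poly (k - 1) t)"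
proof
  fix t
  show "step_diff (- s) (v_poly s k) t = int (2 * k) * u_poly (k - 1) t"
  proof (cases k)
    case (Suc i)
    have "v_poly s (Suc i) (t - s) = u_poly i t * (t - s * int (Suc i))"
      using v_poly_prod(2) [OF assms, of i "t - s"] by (simp add: algebra_simps)
    then have "step_diff (- s) (v_poly s k) t
        = (- s) * (u_poly i t * (t - s * int (Suc i)) - u_poly i t * (t + s * int (Suc i)))"
      using v_poly_prod(1) [OF assms, of i t] Suc by (simp add: step_diff_def)
    also have "\<dots> = (s * s) * (2 * int (Suc i)) * u_poly i t" by (simp add: algebra_simps)
    finally show ?thesis using Suc assms by auto
  qed (simp add: step_diff_def v_poly_def)
qed

context clifford_algebra
begin

lemma of_int_scale: "of_int z * (c :: 'c) = scale (of_int z) c"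
proof (induction z rule: int_induct [where k = 0])
  case base
  show ?case by simp
qed (simp_all add: distrib_right scale_left_distrib left_diff_distrib scale_left_diff_distrib)

lemma of_int_commute: "of_int z * (c :: 'c) = c * of_int z"
  using of_int_scale [of z c] of_int_scale [of z 1] scale_mult_right [of c "of_int z" 1] by simp

lemma of_int_left_commute: "(a :: 'c) * (of_int z * c) = of_int z * (a * c)"
  by (metis mult.assoc of_int_commute)

text \<open>
  The operator $X^s$ on integer-valued polynomial functions; \<open>X_op\<close> is its extension to coefficients in the
  algebra (lemma \<open>X_op_tau\<close>).
\<close>

definition tau :: "int \<Rightarrow> (int \<Rightarrow> int) \<Rightarrow> int \<Rightarrow> int" where
  "tau s p = (THE q. \<exists>N a. p = (\<lambda>t. \<Sum>i<N. X_basis s i t * a i)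
      \<and> q = (\<lambda>t. \<Sum>i<N. X_image s i t * a i))"

lemma basis_unique:
  assumes s: "s = 1 \<or> s = - 1"
    and eq: "\<And>t. (\<Sum>i<N. X_basis s i t * a i) = (\<Sum>i<N. X_basis s i t * b i)" and i: "i < N"
  shows "a i = b i"
proof -
  have "(\<Sum>i<N. of_int (X_basis s i t) * (of_int (a i - b i) :: 'c)) = 0" for t
  proof -
    have "(\<Sum>i<N. of_int (X_basis s i t) * (of_int (a i - b i) :: 'c))
      = of_int ((\<Sum>i<N. X_basis s i t * a i) - (\<Sum>i<N. X_basis s i t * b i))"
      by (simp only: of_int_mult [symmetric] of_int_sum [symmetric] right_diff_distrib sum_subtractf)
    then show ?thesis by (simp add: eq)
  qed
  then have "(of_int (a i - b i) :: 'c) = 0" by (rule X_basis_independent [OF s _ i])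
  then show ?thesis using of_int_mult_eq_0 [of "a i - b i" 1] by auto
qed

lemma tau_expansion:
  assumes s: "s = 1 \<or> s = - 1"
  shows "tau s (\<lambda>t. \<Sum>i<N. X_basis s i t * a i) = (\<lambda>t. \<Sum>i<N. X_image s i t * a i)"
  unfolding tau_def
proof (rule the_equality)
  fix q assume "\<exists>N' b. (\<lambda>t. \<Sum>i<N. X_basis s i t * a i) = (\<lambda>t. \<Sum>i<N'. X_basis s i t * b i)
      \<and> q = (\<lambda>t. \<Sum>i<N'. X_image s i t * b i)"
  then obtain N' b where eq: "(\<lambda>t. \<Sum>i<N. X_basis s i t * a i) = (\<lambda>t. \<Sum>i<N'. X_basis s i t * b i)"
    and q: "q = (\<lambda>t. \<Sum>i<N'. X_image s i t * b i)" by blast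
  define M where "M = max N N'"
  define a' where "a' i = (if i < N then a i else 0)" for i
  define b' where "b' i = (if i < N' then b i else 0)" for i
  have pad: "(\<Sum>i<N. p i t * a i) = (\<Sum>i<M. p i t * a' i)"
    "(\<Sum>i<N'. p i t * b i) = (\<Sum>i<M. p i t * b' i)" for p :: "nat \<Rightarrow> int \<Rightarrow> int" and t
    by (rule sum.mono_neutral_cong_left; auto simp: M_def a'_def b'_def)+
  have "a' i = b' i" if "i < M" for i
    by (rule basis_unique [OF s _ that]) (use fun_cong [OF eq] in \<open>simp add: pad\<close>)
  then show "q = (\<lambda>t. \<Sum>i<N. X_image s i t * a i)"
    unfolding q pad by auto
qed blast

lemma X_op_tau:
  assumes s: "s = 1 \<or> s = - 1" and p: "p \<in> poly_funs"
  shows "X_op s (\<lambda>t. of_int (p t) * (c :: 'c)) = (\<lambda>t. of_int (tau s p t) * c)"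
proof -
  obtain N a where a: "p = (\<lambda>t. \<Sum>i<N. X_basis s i t * a i)" using poly_funs_expand [OF p] by blast
  have "(\<lambda>t. of_int (p t) * c) = (\<lambda>t. \<Sum>i<N. of_int (X_basis s i t) * (of_int (a i) * c))"
    by (simp add: a sum_distrib_right mult.assoc)
  then have "X_op s (\<lambda>t. of_int (p t) * c) = (\<lambda>t. \<Sum>i<N. of_int (X_image s i t) * (of_int (a i) * c))"
    using X_op_expansion [OF s] by simp
  also have "\<dots> = (\<lambda>t. of_int (tau s p t) * c)"
    by (simp add: a tau_expansion [OF s] sum_distrib_right mult.assoc)
  finally show ?thesis .
qed

lemma poly_funs_tau:
  assumes s: "s = 1 \<or> s = - 1" and p: "p \<in> poly_funs"
  shows "tau s p \<in> poly_funs"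
proof -
  obtain N a where a: "p = (\<lambda>t. \<Sum>i<N. X_basis s i t * a i)" using poly_funs_expand [OF p] by blast
  show ?thesis
    unfolding a tau_expansion [OF s] by (intro poly_funs_sum poly_funs_mult poly_funs_X_image poly_funs_const)
qed

lemma tau_lincomb:
  fixes N :: nat
  assumes s: "s = 1 \<or> s = - 1" and p: "\<And>i. i < N \<Longrightarrow> p i \<in> poly_funs"
  shows "tau s (\<lambda>t. \<Sum>i<N. p i t * a i) = (\<lambda>t. \<Sum>i<N. tau s (p i) t * a i)"
proof -
  have "\<forall>i. \<exists>M b. i < N \<longrightarrow> p i = (\<lambda>t. \<Sum>j<M. X_basis s j t * b j)"
    using poly_funs_expand p by blast
  then obtain M b where Mb: "\<And>i. i < N \<Longrightarrow> p i = (\<lambda>t. \<Sum>j<M i. X_basis s j t * b i j)"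
    by metis
  define K where "K = (\<Sum>i<N. M i)"
  have MK: "M i \<le> K" if "i < N" for i
    unfolding K_def using that by (intro member_le_sum) auto
  define b' where "b' i j = (if j < M i then b i j else 0)" for i j
  have Mb': "p i = (\<lambda>t. \<Sum>j<K. X_basis s j t * b' i j)" if "i < N" for i
    unfolding Mb [OF that] b'_def using MK [OF that]
    by (intro ext sum.mono_neutral_cong_left) auto
  have "(\<lambda>t. \<Sum>i<N. p i t * a i) = (\<lambda>t. \<Sum>i<N. \<Sum>j<K. X_basis s j t * b' i j * a i)"
    by (intro ext sum.cong refl) (simp add: Mb' sum_distrib_right)
  also have "\<dots> = (\<lambda>t. \<Sum>j<K. X_basis s j t * (\<Sum>i<N. b' i j * a i))"
    by (subst sum.swap) (simp add: sum_distrib_left mult.assoc)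
  finally have "tau s (\<lambda>t. \<Sum>i<N. p i t * a i) = (\<lambda>t. \<Sum>j<K. X_image s j t * (\<Sum>i<N. b' i j * a i))"
    using tau_expansion [OF s] by simp
  also have "\<dots> = (\<lambda>t. \<Sum>i<N. \<Sum>j<K. X_image s j t * b' i j * a i)"
    by (subst sum.swap) (simp add: sum_distrib_left mult.assoc)
  also have "\<dots> = (\<lambda>t. \<Sum>i<N. tau s (p i) t * a i)"
    by (intro ext sum.cong refl) (simp add: Mb' tau_expansion [OF s] sum_distrib_right)
  finally show ?thesis .
qed

lemma tau_smult:
  assumes "s = 1 \<or> s = - 1" "p \<in> poly_funs"
  shows "tau s (\<lambda>t. a * p t) = (\<lambda>t. a * tau s p t)"
  using tau_lincomb [OF assms(1), of 1 "\<lambda>_. p" "\<lambda>_. a"] assms(2)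
  by (simp add: mult.commute lessThan_Suc)

lemma tau_basis:
  assumes s: "s = 1 \<or> s = - 1"
  shows "tau s (X_basis s i) = X_image s i"
  using tau_expansion [OF s, where N = "Suc i" and a = "\<lambda>j. of_bool (j = i)"] by simp

lemma tau_u: "s = 1 \<or> s = - 1 \<Longrightarrow> tau s (u_poly k) = v_poly (- s) (Suc k)"
  using tau_basis [of s "Suc (2 * k)"] by (simp add: X_basis_def X_image_def cong: if_cong)

lemma tau_v: "s = 1 \<or> s = - 1 \<Longrightarrow> tau s (v_poly s k) = u_poly k"
  using tau_basis [of s "2 * k"] by (simp add: X_basis_def X_image_def cong: if_cong)

lemma step_diff_lincomb: "step_diff s (\<lambda>t. \<Sum>i<N. p i t * a i) = (\<lambda>t. \<Sum>i<N. step_diff s (p i) t * a i)"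
  by (simp add: step_diff_def fun_eq_iff sum_subtractf [symmetric] sum_distrib_left algebra_simps)

lemma step_diff_tau_basis:
  assumes s: "s = 1 \<or> s = - 1"
  shows "step_diff s (tau s (X_basis s i)) t - tau (- s) (step_diff (- s) (X_basis s i)) t = X_basis s i t"
proof -
  have s': "- s = 1 \<or> - s = - 1" using s by auto
  have Pu: "u_poly k \<in> poly_funs" and Pv: "v_poly r k \<in> poly_funs" for k r
    using poly_funs_X_basis [of 1 "Suc (2 * k)"] poly_funs_X_basis [of r "2 * k"]
    by (simp_all add: X_basis_def cong: if_cong)
  show ?thesis
  proof (cases "even i")
    case True
    then obtain k where k: "i = 2 * k" ..
    have B: "X_basis s i = v_poly s k" by (simp add: X_basis_def k fun_eq_iff)
    have "tau (- s) (\<lambda>t. int (2 * k) * u_poly (k - 1) t) t = int (2 * k) * v_poly s k t"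
      by (subst tau_smult [OF s' Pu]) (cases k, auto simp: tau_u [OF s'])
    then show ?thesis
      unfolding B tau_v [OF s] step_diff_u [OF s] step_diff_v [OF s] by (simp add: algebra_simps)
  next
    case False
    then obtain k where k: "i = 2 * k + 1" by (auto elim: oddE)
    have B: "X_basis s i = u_poly k" by (simp add: X_basis_def k fun_eq_iff)
    have "tau (- s) (\<lambda>t. int (2 * k + 1) * v_poly (- s) k t) t = int (2 * k + 1) * u_poly k t"
      by (subst tau_smult [OF s' Pv]) (simp add: tau_v [OF s'])
    moreover have "step_diff s (v_poly (- s) (Suc k)) t = int (2 * Suc k) * u_poly k t"
      using step_diff_v [OF s', of "Suc k"] by simp
    ultimately show ?thesis
      unfolding B tau_u [OF s] step_diff_u [OF s'] by (simp add: algebra_simps)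
  qed
qed

text \<open>
  $\Delta^s X^s - X^{-s} \Delta^{-s} = 1$, the one scalar relation behind $\partial_j \xi_j - \xi_j \partial_j = 1$. On the
  basis of $X^s$ both products are multiples of the argument, with coefficients that differ by 1: for
  example $\Delta^s X^s v_k^s = \Delta^s u_k = (2 k + 1) v_k^s$ and $X^{-s} \Delta^{-s} v_k^s = 2 k\, X^{-s} u_{k-1} = 2 k\, v_k^s$.
\<close>

lemma step_diff_tau:
  assumes s: "s = 1 \<or> s = - 1" and p: "p \<in> poly_funs"
  shows "step_diff s (tau s p) t - tau (- s) (step_diff (- s) p) t = p t"
proof -
  have s': "- s = 1 \<or> - s = - 1" using s by auto
  obtain N a where a: "p = (\<lambda>t. \<Sum>i<N. X_basis s i t * a i)" using poly_funs_expand [OF p] by blast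
  have "tau s p = (\<lambda>t. \<Sum>i<N. tau s (X_basis s i) t * a i)"
    unfolding a by (rule tau_lincomb [OF s poly_funs_X_basis])
  then have 1: "step_diff s (tau s p) t = (\<Sum>i<N. step_diff s (tau s (X_basis s i)) t * a i)"
    by (simp add: step_diff_lincomb)
  have "tau (- s) (step_diff (- s) p) = tau (- s) (\<lambda>t. \<Sum>i<N. step_diff (- s) (X_basis s i) t * a i)"
    unfolding a step_diff_lincomb ..
  also have "\<dots> = (\<lambda>t. \<Sum>i<N. tau (- s) (step_diff (- s) (X_basis s i)) t * a i)"
    by (rule tau_lincomb [OF s' poly_funs_step_diff [OF poly_funs_X_basis s']])
  finally have 2: "tau (- s) (step_diff (- s) p) t = (\<Sum>i<N. tau (- s) (step_diff (- s) (X_basis s i)) t * a i)"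
    by simp
  show ?thesis
    unfolding 1 2 sum_subtractf [symmetric] left_diff_distrib [symmetric] step_diff_tau_basis [OF s]
    by (simp add: a)
qed

end

context clifford_algebra
begin

section \<open>Relations in the Clifford algebra\<close>

lemma double_0: "x + x = 0 \<Longrightarrow> x = (0 :: 'c)"
proof (rule of_int_mult_eq_0 [of 2])
  assume "x + x = 0"
  then show "of_int 2 * x = 0" unfolding of_int_numeral mult_2 .
qed simp

lemma ep_sq: "a \<in> {1..m} \<Longrightarrow> ep a * ep a = 0" and em_sq: "a \<in> {1..m} \<Longrightarrow> em a * em a = 0"
  by (rule double_0, rule anticommute_ep anticommute_em; assumption)+

lemma em_ep: "a \<in> {1..m} \<Longrightarrow> em a * ep a = 1 - ep a * em a"
  using anticommute_ep_em [of a a] by (simp add: algebra_simps eq_diff_eq)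

lemma ep_em_ep: "a \<in> {1..m} \<Longrightarrow> ep a * em a * ep a = ep a" 
  and em_ep_em: "a \<in> {1..m} \<Longrightarrow> em a * ep a * em a = em a"
  by (simp_all add: mult.assoc em_ep right_diff_distrib em_sq)
     (simp_all add: mult.assoc [symmetric] ep_sq em_ep left_diff_distrib, simp add: mult.assoc em_sq)

text \<open>
  A Klein factor: it distinguishes the index \<open>a\<close> from the others by a sign and thereby converts
  anticommutation into commutation.
\<close>

definition klein :: "nat \<Rightarrow> 'c" where "klein a = e a * e_perp a"

lemma klein_eq: "a \<in> {1..m} \<Longrightarrow> klein a = em a * ep a - ep a * em a"
  by (simp add: klein_def e_def e_perp_def algebra_simps ep_sq em_sq)

lemma klein_ep: "a \<in> {1..m} \<Longrightarrow> klein a * ep a = - ep a"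
  and klein_em: "a \<in> {1..m} \<Longrightarrow> klein a * em a = em a"
  and ep_klein: "a \<in> {1..m} \<Longrightarrow> ep a * klein a = ep a"
  and em_klein: "a \<in> {1..m} \<Longrightarrow> em a * klein a = - em a"
  using ep_em_ep [of a] em_ep_em [of a] ep_sq [of a] em_sq [of a]
  by (simp_all add: klein_eq algebra_simps) (simp_all add: mult.assoc [symmetric])

lemma klein_sq: "a \<in> {1..m} \<Longrightarrow> klein a * klein a = 1"
proof -
  assume a: "a \<in> {1..m}"
  have "klein a * klein a = (klein a * em a) * ep a - (klein a * ep a) * em a"
    using a by (subst (2) klein_eq) (simp_all add: right_diff_distrib mult.assoc)
  also have "\<dots> = em a * ep a + ep a * em a" using a by (simp add: klein_em klein_ep)
  finally show ?thesis using a by (simp add: em_ep)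
qed

lemma e_perp_sq: "a \<in> {1..m} \<Longrightarrow> e_perp a * e_perp a = - 1"
  by (simp add: e_perp_def algebra_simps ep_sq em_sq em_ep)

lemma anti:
  assumes "a \<in> {1..m}" "b \<in> {1..m}" "a \<noteq> b"
  shows "ep a * ep b = - (ep b * ep a)" "em a * em b = - (em b * em a)"
    "ep a * em b = - (em b * ep a)" "em a * ep b = - (ep b * em a)"
    "e_perp a * e_perp b = - (e_perp b * e_perp a)" "e a * e_perp b = - (e_perp b * e a)"
    "e a * e b = - (e b * e a)"
proof -
  show *: "ep a * ep b = - (ep b * ep a)" "em a * em b = - (em b * em a)"
    "ep a * em b = - (em b * ep a)" "em a * ep b = - (ep b * em a)"
    unfolding eq_neg_iff_add_eq_0
    using anticommute_ep [of a b] anticommute_em [of a b] anticommute_ep_em [of a b]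
      anticommute_ep_em [of b a] assms by (simp_all add: add.commute)
  show "e_perp a * e_perp b = - (e_perp b * e_perp a)" "e a * e_perp b = - (e_perp b * e a)"
    "e a * e b = - (e b * e a)"
    by (simp_all add: e_def e_perp_def algebra_simps *)
qed

lemma swap_even:
  fixes x y z :: 'c
  assumes "x * z = - (z * x)" "y * z = - (z * y)"
  shows "x * y * z = z * (x * y)"
  using assms by (metis mult.assoc mult_minus_left mult_minus_right minus_minus)

lemma klein_commute:
  assumes "a \<in> {1..m}" "b \<in> {1..m}" "a \<noteq> b"
  shows "klein a * ep b = ep b * klein a" "klein a * em b = em b * klein a" "klein a * klein b = klein b * klein a"
proof -
  note A = anti [OF assms]
  have *: "e a * ep b = - (ep b * e a)" "e a * em b = - (em b * e a)"
    "e_perp a * ep b = - (ep b * e_perp a)" "e_perp a * em b = - (em b * e_perp a)"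
    by (simp_all add: e_def e_perp_def algebra_simps A)
  show 1: "klein a * ep b = ep b * klein a" "klein a * em b = em b * klein a"
    unfolding klein_def by (intro swap_even *)+
  show "klein a * klein b = klein b * klein a"
    unfolding klein_eq [OF assms(2)]
    by (simp add: right_diff_distrib left_diff_distrib mult.assoc [symmetric] 1)
       (simp add: mult.assoc 1)
qed

lemma V_elt_klein:
  assumes "a \<in> {1..m}" "b \<in> {1..m}" "a \<noteq> b"
  shows "V_elt a b = - (klein a * klein b)"
  using anti(6) [of b a] assms by (simp add: V_elt_def klein_def mult.assoc)

section \<open>Discrete polynomials as sums of products\<close>

abbreviation (input) "F \<equiv> discrete_polynomials"

definition gen :: "(nat \<Rightarrow> int \<Rightarrow> int) \<Rightarrow> 'c \<Rightarrow> (nat \<Rightarrow> int) \<Rightarrow> 'c" where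
  "gen p c = (\<lambda>x. of_int (\<Prod>l = 1..m. p l (x l)) * c)"

lemma gen_split:
  assumes "j \<in> {1..m}"
  shows "gen p c x = of_int (p j (x j)) * (of_int (\<Prod>l\<in>{1..m} - {j}. p l (x l)) * c)"
  unfolding gen_def using assms by (subst prod.remove [of _ j]) (auto simp: mult.assoc)

lemma gen_upd:
  assumes "j \<in> {1..m}"
  shows "gen (p(j := q)) c x = of_int (q (x j)) * (of_int (\<Prod>l\<in>{1..m} - {j}. p l (x l)) * c)"
proof -
  have "(\<Prod>l\<in>{1..m} - {j}. (p(j := q)) l (x l)) = (\<Prod>l\<in>{1..m} - {j}. p l (x l))"
    by (rule prod.cong) auto
  then show ?thesis unfolding gen_split [OF assms] by simp
qed

lemma gen_at:
  assumes "j \<in> {1..m}"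
  shows "gen p c (x(j := t)) = of_int (p j t) * (of_int (\<Prod>l\<in>{1..m} - {j}. p l (x l)) * c)"
proof -
  have "(\<Prod>l\<in>{1..m} - {j}. p l ((x(j := t)) l)) = (\<Prod>l\<in>{1..m} - {j}. p l (x l))"
    by (rule prod.cong) auto
  then show ?thesis unfolding gen_split [OF assms] by simp
qed

lemma gen_expand:
  assumes "j \<in> {1..m}" "p j = (\<lambda>t. \<Sum>i<N. b i t * a i)"
  shows "gen p c = (\<Sum>i<N. gen (p(j := b i)) (of_int (a i) * c))"
proof
  fix x
  define r :: 'c where "r = of_int (\<Prod>l\<in>{1..m} - {j}. p l (x l))"
  have comm: "of_int z * (r * y) = r * (of_int z * y)" for z y
    by (simp add: of_int_left_commute)
  have "gen p c x = (\<Sum>i<N. of_int (b i (x j)) * (r * (of_int (a i) * c)))"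
    unfolding gen_split [OF assms(1)] assms(2) r_def [symmetric]
    by (simp add: sum_distrib_right mult.assoc comm)
  then show "gen p c x = (\<Sum>i<N. gen (p(j := b i)) (of_int (a i) * c)) x"
    by (simp add: gen_upd [OF assms(1)] r_def)
qed

text \<open>
  Products of polynomial functions of one variable each. The difference operators and $X_j^\pm$ act
  on one factor of such a product, so identities between operators need to be checked on them only (lemma
  \<open>linF_eq\<close>).
\<close>

definition gens :: "((nat \<Rightarrow> int) \<Rightarrow> 'c) set" where
  "gens = {gen p c | p c. \<forall>l. p l \<in> poly_funs}"

lemma poly_funs_power: "(\<lambda>t. t ^ k) \<in> poly_funs"
  unfolding poly_funs_def by (rule image_eqI [of _ _ "monom 1 k"]) (auto simp: poly_monom)

lemma F_subspace: "fun_space.subspace F"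
  unfolding discrete_polynomials_def by (rule fun_space.subspace_span)

lemma gen_F_aux:
  assumes "finite A" "A \<subseteq> {1..m}" "\<And>l. l \<in> A \<Longrightarrow> p l \<in> poly_funs" "\<And>l. l \<notin> A \<Longrightarrow> \<exists>k. p l = (\<lambda>t. t ^ k)"
  shows "gen p c \<in> F"
  using assms
proof (induction A arbitrary: p c rule: finite_induct)
  case empty
  then have "\<forall>l. \<exists>k. p l = (\<lambda>t. t ^ k)" by simp
  then obtain k where "\<And>l. p l = (\<lambda>t. t ^ k l)" by (rule choice [THEN exE]) blast
  then have "gen p c = (\<lambda>x. of_int (\<Prod>j = 1..m. x j ^ k j) * c)" by (simp add: gen_def)
  then show ?case unfolding discrete_polynomials_def by (auto intro!: fun_space.span_base)
next
  case (insert j A)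
  then have "p j \<in> poly_funs" by blast
  then obtain q where q: "p j = poly q" unfolding poly_funs_def by blast
  have j: "j \<in> {1..m}" using insert by blast
  have "p j = (\<lambda>t. \<Sum>i<Suc (degree q). t ^ i * coeff q i)"
    unfolding q poly_altdef by (simp add: lessThan_Suc_atMost mult.commute)
  then have "gen p c = (\<Sum>i<Suc (degree q). gen (p(j := \<lambda>t. t ^ i)) (of_int (coeff q i) * c))"
    by (rule gen_expand [OF j])
  also have "\<dots> \<in> F"
  proof (intro fun_space.subspace_sum F_subspace insert.IH)
    fix i l assume "l \<notin> A"
    then show "\<exists>k. (p(j := \<lambda>t. t ^ i)) l = (\<lambda>t. t ^ k)"
      using insert.prems(3) [of l] by (cases "l = j") auto
  qed (use insert in auto)
  finally show ?case .
qed

lemma F_span: "F = fun_space.span gens"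
proof
  show "F \<subseteq> fun_space.span gens"
    unfolding discrete_polynomials_def
  proof (rule fun_space.span_mono, clarify)
    fix \<alpha> :: "nat \<Rightarrow> nat" and c
    have "(\<lambda>x. of_int (\<Prod>j = 1..m. x j ^ \<alpha> j) * c) = gen (\<lambda>l t. t ^ \<alpha> l) c"
      by (simp add: gen_def)
    then show "(\<lambda>x. of_int (\<Prod>j = 1..m. x j ^ \<alpha> j) * c) \<in> gens"
      by (auto simp: gens_def intro!: exI [of _ "\<lambda>l t. t ^ \<alpha> l"] exI [of _ c] poly_funs_power)
  qed
  show "fun_space.span gens \<subseteq> F"
  proof (rule fun_space.span_minimal [OF _ F_subspace], unfold gens_def, clarify)
    fix p :: "nat \<Rightarrow> int \<Rightarrow> int" and c assume p: "\<forall>l. p l \<in> poly_funs"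
    define p' where "p' l = (if l \<in> {1..m} then p l else (\<lambda>t. t ^ 0))" for l
    have "gen p c = gen p' c" by (auto simp: gen_def p'_def fun_eq_iff intro!: arg_cong [of _ _ "\<lambda>x. x * c"] arg_cong [of _ _ of_int] prod.cong)
    also have "\<dots> \<in> F" by (rule gen_F_aux [of "{1..m}"]) (auto simp: p'_def p intro: exI [of _ 0])
    finally show "gen p c \<in> F" .
  qed
qed

lemma gen_F: "(\<And>l. p l \<in> poly_funs) \<Longrightarrow> gen p c \<in> F"
  unfolding F_span by (rule fun_space.span_base) (auto simp: gens_def)

definition linF :: "(((nat \<Rightarrow> int) \<Rightarrow> 'c) \<Rightarrow> (nat \<Rightarrow> int) \<Rightarrow> 'c) \<Rightarrow> bool" where
  "linF T \<longleftrightarrow> (\<forall>f\<in>F. T f \<in> F) \<and> (\<forall>f\<in>F. \<forall>g\<in>F. T (f + g) = T f + T g)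
     \<and> (\<forall>z. \<forall>f\<in>F. T (fscale z f) = fscale z (T f))"

lemma F_add: "f \<in> F \<Longrightarrow> g \<in> F \<Longrightarrow> f + g \<in> F"
  and F_diff: "f \<in> F \<Longrightarrow> g \<in> F \<Longrightarrow> f - g \<in> F"
  and F_neg: "f \<in> F \<Longrightarrow> - f \<in> F"
  and F_scale: "f \<in> F \<Longrightarrow> fscale z f \<in> F"
  and F_0: "0 \<in> F"
  and F_sum: "(\<And>i. i \<in> I \<Longrightarrow> h i \<in> F) \<Longrightarrow> (\<Sum>i\<in>I. h i) \<in> F"
  using F_subspace by (auto intro: fun_space.subspace_add fun_space.subspace_diff
    fun_space.subspace_neg fun_space.subspace_scale fun_space.subspace_0 fun_space.subspace_sum)

lemma linFD:
  assumes "linF T"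
  shows "f \<in> F \<Longrightarrow> T f \<in> F" "f \<in> F \<Longrightarrow> g \<in> F \<Longrightarrow> T (f + g) = T f + T g"
    "f \<in> F \<Longrightarrow> T (fscale z f) = fscale z (T f)"
  using assms by (auto simp: linF_def)

lemma linF_0: "linF T \<Longrightarrow> T 0 = 0"
  using linFD(3) [of T 0 0] F_0 by simp

lemma linF_neg: "linF T \<Longrightarrow> f \<in> F \<Longrightarrow> T (- f) = - T f"
  using linFD(3) [of T f "- 1"] by (simp add: fun_space.scale_minus_left)

lemma linF_apply_diff: "linF T \<Longrightarrow> f \<in> F \<Longrightarrow> g \<in> F \<Longrightarrow> T (f - g) = T f - T g"
  using linFD(2) [of T f "- g"] linF_neg [of T g] F_neg [of g] by simp

lemma linF_apply_sum: "linF T \<Longrightarrow> (\<And>i. i \<in> I \<Longrightarrow> h i \<in> F) \<Longrightarrow> T (\<Sum>i\<in>I. h i) = (\<Sum>i\<in>I. T (h i))"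
proof (induction I rule: infinite_finite_induct)
  case (insert x A)
  have "T (h x + sum h A) = T (h x) + T (sum h A)"
    by (rule linFD(2) [OF insert.prems(1)], rule insert.prems(2), simp, rule F_sum,
        rule insert.prems(2), simp)
  also have "T (sum h A) = (\<Sum>i\<in>A. T (h i))"
    by (rule insert.IH [OF insert.prems(1)], rule insert.prems(2), simp)
  finally show ?case using insert.hyps by simp
qed (simp_all add: linF_0 [of T])

lemma linF_comp: "linF T \<Longrightarrow> linF T' \<Longrightarrow> linF (\<lambda>f. T (T' f))"
  by (simp add: linF_def)

lemma linF_add: "linF T \<Longrightarrow> linF T' \<Longrightarrow> linF (\<lambda>f. T f + T' f)"
  by (auto simp: linF_def F_add fun_space.scale_right_distrib)

lemma linF_scale: "linF T \<Longrightarrow> linF (\<lambda>f. fscale z (T f))"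
  by (auto simp: linF_def F_scale fun_space.scale_right_distrib mult.commute)

lemma linF_minus: "linF T \<Longrightarrow> linF (\<lambda>f. - T f)"
  by (auto simp: linF_def F_neg fun_space.scale_minus_right)

lemma linF_diff: "linF T \<Longrightarrow> linF T' \<Longrightarrow> linF (\<lambda>f. T f - T' f)"
  using linF_add [of T "\<lambda>f. - T' f"] linF_minus [of T'] by simp

lemma linF_id: "linF (\<lambda>f. f)"
  by (auto simp: linF_def)

lemma F_induct [consumes 1, case_names gen add scale zero]:
  assumes f: "f \<in> F"
    and gen: "\<And>p c. (\<And>l. p l \<in> poly_funs) \<Longrightarrow> P (gen p c)"
    and add: "\<And>f g. f \<in> F \<Longrightarrow> g \<in> F \<Longrightarrow> P f \<Longrightarrow> P g \<Longrightarrow> P (f + g)"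
    and scale: "\<And>z f. f \<in> F \<Longrightarrow> P f \<Longrightarrow> P (fscale z f)" and 0: "P 0"
  shows "P f"
proof -
  have "f \<in> fun_space.span gens" using f F_span by simp
  then have "f \<in> F \<and> P f"
  proof (rule fun_space.span_induct)
    show "fun_space.subspace {f. f \<in> F \<and> P f}"
      unfolding fun_space.subspace_def using add scale 0 by (auto simp: F_add F_scale F_0)
    fix x assume "x \<in> gens"
    then show "x \<in> F \<and> P x" by (auto simp: gens_def gen gen_F)
  qed
  then show ?thesis ..
qed

lemma linF_eq:
  assumes "linF T" "linF T'" "f \<in> F"
    and gen: "\<And>p c. (\<And>l. p l \<in> poly_funs) \<Longrightarrow> T (gen p c) = T' (gen p c)"
  shows "T f = T' f"
  using assms(3)
proof (induction rule: F_induct)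
  case (gen p c)
  then show ?case by (rule assms(4))
next
  case (add f g)
  then show ?case using linFD(2) [OF assms(1)] linFD(2) [OF assms(2)] by metis
next
  case (scale z f)
  then show ?case using linFD(3) [OF assms(1)] linFD(3) [OF assms(2)] by metis
next
  case zero
  show ?case unfolding linF_0 [OF assms(1)] linF_0 [OF assms(2)] ..
qed

lemma linF_I:
  assumes "\<And>f g. f \<in> F \<Longrightarrow> g \<in> F \<Longrightarrow> T (f + g) = T f + T g"
    and "\<And>z f. f \<in> F \<Longrightarrow> T (fscale z f) = fscale z (T f)"
    and "\<And>p c. (\<And>l. p l \<in> poly_funs) \<Longrightarrow> T (gen p c) \<in> F"
  shows "linF T"
proof -
  have T0: "T 0 = 0" using assms(2) [of 0 0] F_0 by simp
  have "T f \<in> F" if "f \<in> F" for f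
    using that
  proof (induction rule: F_induct)
    case (gen p c)
    then show ?case by (rule assms(3))
  next
    case (add f g)
    then show ?case unfolding assms(1) [OF add(1,2)] by (intro F_add)
  next
    case (scale z f)
    then show ?case unfolding assms(2) [OF scale(1)] by (intro F_scale)
  next
    case zero
    show ?case unfolding T0 by (rule F_0)
  qed
  with assms show ?thesis by (auto simp: linF_def)
qed

section \<open>Scalar operators in one lattice variable\<close>

definition lr :: "'c \<Rightarrow> 'c \<Rightarrow> ((nat \<Rightarrow> int) \<Rightarrow> 'c) \<Rightarrow> (nat \<Rightarrow> int) \<Rightarrow> 'c" where
  "lr a b f = (\<lambda>x. a * f x * b)"

definition var_diff :: "int \<Rightarrow> nat \<Rightarrow> ((nat \<Rightarrow> int) \<Rightarrow> 'c) \<Rightarrow> (nat \<Rightarrow> int) \<Rightarrow> 'c" where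
  "var_diff s j f = (\<lambda>x. of_int s * (f (x(j := x j + s)) - f x))"

lemma forward_var_diff: "forward_diff j f = var_diff 1 j f" and backward_var_diff: "backward_diff j f = var_diff (- 1) j f"
  by (simp_all add: forward_diff_def backward_diff_def var_diff_def)

lemma lr_gen: "lr a b (gen p c) = gen p (a * c * b)"
  by (simp add: lr_def gen_def of_int_left_commute mult.assoc)

lemma linF_lr: "linF (lr a b)"
proof (rule linF_I)
  fix p :: "nat \<Rightarrow> int \<Rightarrow> int" and c assume "\<And>l. p l \<in> poly_funs"
  then show "lr a b (gen p c) \<in> F" by (simp add: lr_gen gen_F)
qed (auto simp: lr_def fun_eq_iff fscale_def algebra_simps scale_mult_left scale_mult_right)

lemma var_diff_gen:
  assumes "j \<in> {1..m}"
  shows "var_diff s j (gen p c) = gen (p(j := step_diff s (p j))) c"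
  by (rule ext) (simp add: var_diff_def gen_at [OF assms] gen_upd [OF assms] gen_split [OF assms]
      step_diff_def algebra_simps)

lemma linF_var_diff:
  assumes "j \<in> {1..m}" "s = 1 \<or> s = - 1"
  shows "linF (var_diff s j)"
proof (rule linF_I)
  fix p :: "nat \<Rightarrow> int \<Rightarrow> int" and c assume "\<And>l. p l \<in> poly_funs"
  then show "var_diff s j (gen p c) \<in> F"
    unfolding var_diff_gen [OF assms(1)] using assms by (intro gen_F) (auto intro: poly_funs_step_diff)
next
  fix z f
  show "var_diff s j (fscale z f) = fscale z (var_diff s j f)"
    by (simp add: var_diff_def fscale_def fun_eq_iff scale_right_diff_distrib [symmetric] scale_mult_right)
qed (auto simp: var_diff_def fun_eq_iff algebra_simps)

text \<open>
  The functions of one variable on which \<open>X_op s\<close> is meaningful; its additivity is needed on arbitrary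
  restrictions of discrete polynomials to a line, which are not products.
\<close>

definition P1 :: "int \<Rightarrow> (int \<Rightarrow> 'c) set" where
  "P1 s = {h. \<exists>N c. h = (\<lambda>t. \<Sum>i<N. of_int (X_basis s i t) * c i)}"

lemma P1_common:
  assumes "h \<in> P1 s" "h' \<in> P1 s"
  obtains N c c' where "h = (\<lambda>t. \<Sum>i<N. of_int (X_basis s i t) * c i)"
    "h' = (\<lambda>t. \<Sum>i<N. of_int (X_basis s i t) * (c' i :: 'c))"
proof -
  obtain N c N' c' where *: "h = (\<lambda>t. \<Sum>i<N. of_int (X_basis s i t) * c i)"
    "h' = (\<lambda>t. \<Sum>i<N'. of_int (X_basis s i t) * c' i)" using assms by (auto simp: P1_def)
  define M where "M = max N N'"
  have "h = (\<lambda>t. \<Sum>i<M. of_int (X_basis s i t) * (if i < N then c i else 0))"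
    unfolding * by (intro ext sum.mono_neutral_cong_left) (auto simp: M_def)
  moreover have "h' = (\<lambda>t. \<Sum>i<M. of_int (X_basis s i t) * (if i < N' then c' i else 0))"
    unfolding * by (intro ext sum.mono_neutral_cong_left) (auto simp: M_def)
  ultimately show thesis by (rule that)
qed

lemma P1_add:
  assumes s: "s = 1 \<or> s = - 1" and h: "h \<in> P1 s" "h' \<in> P1 s"
  shows "(\<lambda>t. h t + h' t) \<in> P1 s" "X_op s (\<lambda>t. h t + h' t) = (\<lambda>t. X_op s h t + X_op s h' t)"
proof -
  obtain N c c' where hh: "h = (\<lambda>t. \<Sum>i<N. of_int (X_basis s i t) * c i)"
    "h' = (\<lambda>t. \<Sum>i<N. of_int (X_basis s i t) * c' i)" by (rule P1_common [OF h])
  have *: "(\<lambda>t. h t + h' t) = (\<lambda>t. \<Sum>i<N. of_int (X_basis s i t) * (c i + c' i))"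
    unfolding hh by (simp add: distrib_left sum.distrib)
  then show "(\<lambda>t. h t + h' t) \<in> P1 s" by (auto simp: P1_def)
  show "X_op s (\<lambda>t. h t + h' t) = (\<lambda>t. X_op s h t + X_op s h' t)"
    unfolding * unfolding hh X_op_expansion [OF s] by (simp add: distrib_left sum.distrib)
qed

lemma P1_scale:
  assumes s: "s = 1 \<or> s = - 1" and h: "h \<in> P1 s"
  shows "(\<lambda>t. scale z (h t)) \<in> P1 s" "X_op s (\<lambda>t. scale z (h t)) = (\<lambda>t. scale z (X_op s h t))"
proof -
  obtain N c where hh: "h = (\<lambda>t. \<Sum>i<N. of_int (X_basis s i t) * c i)" using h by (auto simp: P1_def)
  have *: "(\<lambda>t. scale z (h t)) = (\<lambda>t. \<Sum>i<N. of_int (X_basis s i t) * scale z (c i))"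
    unfolding hh by (simp add: scale_sum_right scale_mult_right)
  then show "(\<lambda>t. scale z (h t)) \<in> P1 s" by (auto simp: P1_def)
  show "X_op s (\<lambda>t. scale z (h t)) = (\<lambda>t. scale z (X_op s h t))"
    unfolding * unfolding hh X_op_expansion [OF s] by (simp add: scale_sum_right scale_mult_right)
qed

lemma F_P1:
  assumes j: "j \<in> {1..m}" and s: "s = 1 \<or> s = - 1" and f: "f \<in> F"
  shows "(\<lambda>t. f (x(j := t))) \<in> P1 s"
  using f
proof (induction rule: F_induct)
  case (gen p c)
  obtain N a where a: "p j = (\<lambda>t. \<Sum>i<N. X_basis s i t * a i)" using poly_funs_expand gen by blast
  show ?case
    unfolding gen_at [OF j] a P1_def
    by (intro CollectI exI [of _ N] exI [of _ "\<lambda>i. of_int (a i) * (of_int (\<Prod>l\<in>{1..m} - {j}. p l (x l)) * c)"])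
       (simp add: sum_distrib_right mult.assoc)
next
  case (add f g)
  then show ?case using P1_add(1) [OF s] by simp
next
  case (scale z f)
  then show ?case using P1_scale(1) [OF s] by (simp add: fscale_def)
next
  case zero
  show ?case by (auto simp: P1_def intro: exI [of _ 0])
qed

lemma X_var_gen:
  assumes j: "j \<in> {1..m}" and s: "s = 1 \<or> s = - 1" and p: "p j \<in> poly_funs"
  shows "X_var s j (gen p c) = gen (p(j := tau s (p j))) c"
  by (rule ext) (simp add: X_var_def gen_at [OF j] X_op_tau [OF s p] gen_upd [OF j])

lemma linF_X:
  assumes j: "j \<in> {1..m}" and s: "s = 1 \<or> s = - 1"
  shows "linF (X_var s j)"
proof (rule linF_I)
  fix p :: "nat \<Rightarrow> int \<Rightarrow> int" and c assume "\<And>l. p l \<in> poly_funs"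
  then show "X_var s j (gen p c) \<in> F"
    using X_var_gen [OF j s] s by (auto intro!: gen_F poly_funs_tau)
next
  fix f g assume "f \<in> F" "g \<in> F"
  then show "X_var s j (f + g) = X_var s j f + X_var s j g"
    using P1_add(2) [OF s F_P1 [OF j s] F_P1 [OF j s]]
    by (simp add: X_var_def fun_eq_iff)
next
  fix z f assume "f \<in> F"
  then show "X_var s j (fscale z f) = fscale z (X_var s j f)"
    using P1_scale(2) [OF s F_P1 [OF j s]]
    by (simp add: X_var_def fun_eq_iff fscale_def)
qed

definition scalar_op :: "(((nat \<Rightarrow> int) \<Rightarrow> 'c) \<Rightarrow> (nat \<Rightarrow> int) \<Rightarrow> 'c) \<Rightarrow> bool" where
  "scalar_op Z \<longleftrightarrow> linF Z \<and> (\<forall>a b. \<forall>f\<in>F. Z (lr a b f) = lr a b (Z f))"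

lemma scalar_op_D: "scalar_op Z \<Longrightarrow> linF Z" "scalar_op Z \<Longrightarrow> f \<in> F \<Longrightarrow> Z (lr a b f) = lr a b (Z f)"
  by (auto simp: scalar_op_def)

lemma scalar_op_var_diff:
  assumes "j \<in> {1..m}" "s = 1 \<or> s = - 1"
  shows "scalar_op (var_diff s j)"
  unfolding scalar_op_def
proof (intro conjI allI ballI linF_var_diff assms)
  fix a b f
  have "of_int s * (a * x * b) = a * (of_int s * x) * b" for x :: 'c
    by (metis mult.assoc of_int_left_commute)
  then show "var_diff s j (lr a b f) = lr a b (var_diff s j f)"
    by (simp add: var_diff_def lr_def fun_eq_iff right_diff_distrib left_diff_distrib)
qed

lemma scalar_op_X:
  assumes "j \<in> {1..m}" "s = 1 \<or> s = - 1"
  shows "scalar_op (X_var s j)"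
  unfolding scalar_op_def
proof (intro conjI allI ballI linF_X assms)
  fix a b f assume "f \<in> F"
  then show "X_var s j (lr a b f) = lr a b (X_var s j f)"
    by (rule linF_eq [OF linF_comp [OF linF_X [OF assms] linF_lr] linF_comp [OF linF_lr linF_X [OF assms]]])
       (simp add: lr_gen X_var_gen [OF assms])
qed

lemma X_X_commute:
  assumes "j \<in> {1..m}" "s = 1 \<or> s = - 1" "l \<in> {1..m}" "s' = 1 \<or> s' = - 1" "j \<noteq> l" "f \<in> F"
  shows "X_var s j (X_var s' l f) = X_var s' l (X_var s j f)"
  using assms(6)
  by (rule linF_eq [OF linF_comp [OF linF_X [OF assms(1,2)] linF_X [OF assms(3,4)]]
      linF_comp [OF linF_X [OF assms(3,4)] linF_X [OF assms(1,2)]]])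
     (use assms in \<open>simp add: X_var_gen fun_upd_twist\<close>)

lemma D_X_commute:
  assumes "j \<in> {1..m}" "s = 1 \<or> s = - 1" "l \<in> {1..m}" "s' = 1 \<or> s' = - 1" "j \<noteq> l" "f \<in> F"
  shows "var_diff s j (X_var s' l f) = X_var s' l (var_diff s j f)"
  using assms(6)
  by (rule linF_eq [OF linF_comp [OF linF_var_diff [OF assms(1,2)] linF_X [OF assms(3,4)]]
      linF_comp [OF linF_X [OF assms(3,4)] linF_var_diff [OF assms(1,2)]]])
     (use assms in \<open>simp add: X_var_gen var_diff_gen fun_upd_twist\<close>)

lemma D_D_commute:
  assumes "j \<noteq> l"
  shows "var_diff s j (var_diff s' l f) = var_diff s' l (var_diff s j f)"
proof -
  have "of_int s * (of_int s' * x) = of_int s' * (of_int s * (x :: 'c))" for x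
    by (metis of_int_left_commute)
  then show ?thesis
    using assms by (simp add: var_diff_def fun_eq_iff right_diff_distrib fun_upd_twist algebra_simps)
qed

lemma D_X_same:
  assumes "j \<in> {1..m}" "s = 1 \<or> s = - 1" "f \<in> F"
  shows "var_diff s j (X_var s j f) - X_var (- s) j (var_diff (- s) j f) = f"
proof -
  have s': "- s = 1 \<or> - s = - 1" using assms by auto
  show ?thesis
    using assms(3)
  proof (rule linF_eq [OF linF_diff [OF linF_comp [OF linF_var_diff [OF assms(1,2)] linF_X [OF assms(1,2)]]
      linF_comp [OF linF_X [OF assms(1) s'] linF_var_diff [OF assms(1) s']]] linF_id])
    fix p :: "nat \<Rightarrow> int \<Rightarrow> int" and c assume p: "\<And>l. p l \<in> poly_funs"
    have "step_diff s (tau s (p j)) t = p j t + tau (- s) (step_diff (- s) (p j)) t" for t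
      using step_diff_tau [OF assms(2) p, of j t] by (simp add: algebra_simps)
    then show "var_diff s j (X_var s j (gen p c)) - X_var (- s) j (var_diff (- s) j (gen p c)) = gen p c"
      using p assms s'
      by (simp add: X_var_gen var_diff_gen poly_funs_step_diff fun_eq_iff gen_upd gen_split [of j] algebra_simps)
  qed
qed

end

section \<open>Commuting variables and derivatives\<close>

context clifford_algebra
begin

text \<open>
  The common shape of the new variables and derivatives: a pair of scalar operators is attached to the Witt
  basis from the left, and $e_j^\perp$ is multiplied from the right. For two different indices the left
  factors anticommute and so do the right factors; the two signs cancel (lemma \<open>witt_op_commute\<close>).
\<close>

definition witt_op where
  "witt_op Zp Zm j f = lr (em j) (e_perp j) (Zp f) - lr (ep j) (e_perp j) (Zm f)"

definition yF :: "nat \<Rightarrow> ((nat \<Rightarrow> int) \<Rightarrow> 'c) \<Rightarrow> (nat \<Rightarrow> int) \<Rightarrow> 'c" where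
  "yF j = witt_op (X_var 1 j) (X_var (- 1) j) j"

definition dF :: "nat \<Rightarrow> ((nat \<Rightarrow> int) \<Rightarrow> 'c) \<Rightarrow> (nat \<Rightarrow> int) \<Rightarrow> 'c" where
  "dF j = witt_op (var_diff (- 1) j) (var_diff 1 j) j"

definition Gam :: "nat \<Rightarrow> ((nat \<Rightarrow> int) \<Rightarrow> 'c) \<Rightarrow> (nat \<Rightarrow> int) \<Rightarrow> 'c" where
  "Gam j = lr (klein j) (e_perp j)"

lemma linF_witt_op: "linF Zp \<Longrightarrow> linF Zm \<Longrightarrow> linF (witt_op Zp Zm j)"
  unfolding witt_op_def by (intro linF_diff linF_comp [OF linF_lr])

lemma linF_yF: "j \<in> {1..m} \<Longrightarrow> linF (yF j)" and linF_dF: "j \<in> {1..m} \<Longrightarrow> linF (dF j)"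
  and linF_Gam: "linF (Gam j)"
  unfolding yF_def dF_def Gam_def by (intro linF_witt_op linF_X linF_var_diff linF_lr; simp)+

lemma sandwich:
  fixes a b c d u :: 'c
  assumes "a * b = - (b * a)" "c * d = - (d * c)"
  shows "a * (b * u * c) * d = b * (a * u * d) * c"
proof -
  have "a * (b * u * c) * d = (a * b) * u * (c * d)" by (simp add: mult.assoc)
  also have "\<dots> = (b * a) * u * (d * c)" unfolding assms by simp
  finally show ?thesis by (simp add: mult.assoc)
qed

lemma witt_op_witt_op:
  assumes Z: "scalar_op Zp" "scalar_op Zm" and Y: "linF Yp" "linF Ym" and f: "f \<in> F"
  shows "witt_op Zp Zm j (witt_op Yp Ym l f) x =
    em j * (em l * Zp (Yp f) x * e_perp l) * e_perp j - em j * (ep l * Zp (Ym f) x * e_perp l) * e_perp j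
    - ep j * (em l * Zm (Yp f) x * e_perp l) * e_perp j + ep j * (ep l * Zm (Ym f) x * e_perp l) * e_perp j"
proof -
  have YF: "Yp f \<in> F" "Ym f \<in> F" using Y f by (auto simp: linFD)
  then have lF: "lr a b (Yp f) \<in> F" "lr a b (Ym f) \<in> F" for a b using linF_lr by (auto simp: linFD)
  have H: "W (witt_op Yp Ym l f) = lr (em l) (e_perp l) (W (Yp f)) - lr (ep l) (e_perp l) (W (Ym f))"
    if "scalar_op W" for W
    unfolding witt_op_def linF_apply_diff [OF scalar_op_D(1) [OF that] lF] by (simp only: scalar_op_D(2) [OF that] YF)
  then show ?thesis
    unfolding witt_op_def [of Zp] H [OF Z(1)] H [OF Z(2)] by (simp add: lr_def algebra_simps)
qed

lemma witt_op_commute: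
  assumes Z: "scalar_op Zp" "scalar_op Zm" and Y: "scalar_op Yp" "scalar_op Ym" and f: "f \<in> F"
    and c: "Zp (Yp f) = Yp (Zp f)" "Zp (Ym f) = Ym (Zp f)" "Zm (Yp f) = Yp (Zm f)" "Zm (Ym f) = Ym (Zm f)"
    and jl: "j \<in> {1..m}" "l \<in> {1..m}" "j \<noteq> l"
  shows "witt_op Zp Zm j (witt_op Yp Ym l f) = witt_op Yp Ym l (witt_op Zp Zm j f)"
proof
  fix x
  have e: "e_perp l * e_perp j = - (e_perp j * e_perp l)" using anti(5) [of l j] jl by simp
  note A = anti [OF jl]
  show "witt_op Zp Zm j (witt_op Yp Ym l f) x = witt_op Yp Ym l (witt_op Zp Zm j f) x"
    unfolding witt_op_witt_op [OF Z scalar_op_D(1) [OF Y(1)] scalar_op_D(1) [OF Y(2)] f]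
      witt_op_witt_op [OF Y scalar_op_D(1) [OF Z(1)] scalar_op_D(1) [OF Z(2)] f] c
    using sandwich [OF A(1) e, of "Ym (Zm f) x"] sandwich [OF A(2) e, of "Yp (Zp f) x"]
      sandwich [OF A(3) e, of "Yp (Zm f) x"] sandwich [OF A(4) e, of "Ym (Zp f) x"]
    by simp
qed

text \<open>
  For equal indices the products of equal Witt generators vanish, and only the mixed ones remain.
\<close>

lemma witt_op_same:
  assumes Z: "scalar_op Zp" "scalar_op Zm" and Y: "linF Yp" "linF Ym" and f: "f \<in> F" and j: "j \<in> {1..m}"
  shows "witt_op Zp Zm j (witt_op Yp Ym j f) x = em j * ep j * Zp (Ym f) x + ep j * em j * Zm (Yp f) x"
proof -
  have p: "a * (b * u * e_perp j) * e_perp j = - (a * b * u)" for a b u :: 'c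
  proof -
    have "a * (b * u * e_perp j) * e_perp j = a * b * u * (e_perp j * e_perp j)" by (simp add: mult.assoc)
    then show ?thesis by (simp add: e_perp_sq [OF j])
  qed
  show ?thesis unfolding witt_op_witt_op [OF Z Y f] p by (simp add: em_sq [OF j] ep_sq [OF j])
qed

lemma scalar_op_ops: "j \<in> {1..m} \<Longrightarrow> scalar_op (X_var 1 j)" "j \<in> {1..m} \<Longrightarrow> scalar_op (X_var (- 1) j)"
  "j \<in> {1..m} \<Longrightarrow> scalar_op (var_diff 1 j)" "j \<in> {1..m} \<Longrightarrow> scalar_op (var_diff (- 1) j)"
  by (auto intro: scalar_op_X scalar_op_var_diff)

lemma yF_yF: "i \<in> {1..m} \<Longrightarrow> j \<in> {1..m} \<Longrightarrow> f \<in> F \<Longrightarrow> yF i (yF j f) = yF j (yF i f)"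
  by (cases "i = j", simp, unfold yF_def, rule witt_op_commute)
     (simp_all add: scalar_op_ops X_X_commute)

lemma dF_dF: "i \<in> {1..m} \<Longrightarrow> j \<in> {1..m} \<Longrightarrow> f \<in> F \<Longrightarrow> dF i (dF j f) = dF j (dF i f)"
  by (cases "i = j", simp, unfold dF_def, rule witt_op_commute)
     (simp_all add: scalar_op_ops D_D_commute)

lemma dF_yF:
  assumes "i \<in> {1..m}" "j \<in> {1..m}" "f \<in> F"
  shows "dF i (yF j f) = yF j (dF i f) + fscale (of_bool (i = j)) f"
proof (cases "i = j")
  case False
  have "dF i (yF j f) = yF j (dF i f)"
    unfolding yF_def dF_def
    by (rule witt_op_commute) (use assms False in \<open>simp_all add: scalar_op_ops D_X_commute\<close>)
  with False show ?thesis by simp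
next
  case True
  have *: "var_diff 1 j (X_var 1 j f) = f + X_var (- 1) j (var_diff (- 1) j f)"
    "var_diff (- 1) j (X_var (- 1) j f) = f + X_var 1 j (var_diff 1 j f)"
    using D_X_same [of j 1 f] D_X_same [of j "- 1" f] assms by (auto simp: diff_eq_eq)
  have "dF j (yF j f) x = yF j (dF j f) x + f x" for x
  proof -
    have 1: "dF j (yF j f) x = em j * ep j * var_diff (- 1) j (X_var (- 1) j f) x + ep j * em j * var_diff 1 j (X_var 1 j f) x"
      unfolding dF_def yF_def by (rule witt_op_same) (use assms in \<open>simp_all add: scalar_op_ops scalar_op_D\<close>)
    have 2: "yF j (dF j f) x = em j * ep j * X_var 1 j (var_diff 1 j f) x + ep j * em j * X_var (- 1) j (var_diff (- 1) j f) x"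
      unfolding dF_def yF_def by (rule witt_op_same) (use assms in \<open>simp_all add: scalar_op_ops scalar_op_D\<close>)
    have "em j * ep j * f x + ep j * em j * f x = f x"
      using assms by (simp add: em_ep left_diff_distrib)
    then show ?thesis unfolding 1 2 * by (simp add: distrib_left algebra_simps)
  qed
  with True show ?thesis by (simp add: fun_eq_iff)
qed

text \<open>
  Both cases give the same sign. For \<open>a \<noteq> j\<close> the Klein factor commutes with the Witt generators on the left
  and the factors on the right anticommute; for \<open>a = j\<close> it is the other way round.
\<close>

lemma Gam_witt_op:
  assumes Z: "scalar_op Zp" "scalar_op Zm" and f: "f \<in> F" and j: "a \<in> {1..m}" "j \<in> {1..m}"
  shows "Gam a (witt_op Zp Zm j f) = - witt_op Zp Zm j (Gam a f)"
proof
  fix x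
  have 1: "Zp (Gam a f) = Gam a (Zp f)" "Zm (Gam a f) = Gam a (Zm f)"
    using scalar_op_D(2) [OF Z(1) f] scalar_op_D(2) [OF Z(2) f] by (simp_all add: Gam_def)
  have *: "klein a * (b * u * e_perp j) * e_perp a = - (b * (klein a * u * e_perp a) * e_perp j)"
    if b: "b = ep j \<or> b = em j" for b u
  proof (cases "a = j")
    case True
    have "klein j * b = - (b * klein j)" using b j by (auto simp: klein_ep klein_em ep_klein em_klein)
    then have "klein j * b * u * e_perp j * e_perp j = - (b * klein j) * u * e_perp j * e_perp j" by simp
    then show ?thesis using True by (simp add: mult.assoc)
  next
    case False
    have 1: "klein a * b = b * klein a" using b j False by (auto simp: klein_commute)
    have 2: "e_perp j * e_perp a = - (e_perp a * e_perp j)" using anti(5) [of j a] False j by auto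
    have "klein a * (b * u * e_perp j) * e_perp a = (klein a * b) * u * (e_perp j * e_perp a)"
      by (simp add: mult.assoc)
    then show ?thesis unfolding 1 2 by (simp add: mult.assoc)
  qed
  show "Gam a (witt_op Zp Zm j f) x = (- witt_op Zp Zm j (Gam a f)) x"
    unfolding witt_op_def 1 unfolding Gam_def lr_def
    by (simp add: right_diff_distrib left_diff_distrib *)
qed

lemma Gam_yF: "a \<in> {1..m} \<Longrightarrow> j \<in> {1..m} \<Longrightarrow> f \<in> F \<Longrightarrow> Gam a (yF j f) = - yF j (Gam a f)"
  and Gam_dF: "a \<in> {1..m} \<Longrightarrow> j \<in> {1..m} \<Longrightarrow> f \<in> F \<Longrightarrow> Gam a (dF j f) = - dF j (Gam a f)"
  unfolding yF_def dF_def by (rule Gam_witt_op; simp add: scalar_op_ops)+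

lemma Gam_sq: "a \<in> {1..m} \<Longrightarrow> Gam a (Gam a f) = - f"
proof
  fix x assume a: "a \<in> {1..m}"
  have "klein a * (klein a * f x * e_perp a) * e_perp a = (klein a * klein a) * f x * (e_perp a * e_perp a)"
    by (simp add: mult.assoc)
  then show "Gam a (Gam a f) x = (- f) x" by (simp add: Gam_def lr_def klein_sq [OF a] e_perp_sq [OF a])
qed

lemma Gam_anti:
  assumes "a \<in> {1..m}" "b \<in> {1..m}" "a \<noteq> b"
  shows "Gam a (Gam b f) = - Gam b (Gam a f)"
proof
  fix x
  have "klein a * (klein b * f x * e_perp b) * e_perp a = (klein a * klein b) * f x * (e_perp b * e_perp a)"
    by (simp add: mult.assoc)
  also have "\<dots> = - ((klein b * klein a) * f x * (e_perp a * e_perp b))"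
    unfolding klein_commute(3) [OF assms] anti(5) [OF assms] by simp
  finally show "Gam a (Gam b f) x = (- Gam b (Gam a f)) x" by (simp add: Gam_def lr_def mult.assoc)
qed

section \<open>The given operators in terms of commuting variables\<close>

lemma partial_eq: "partial j f = lr (ep j) 1 (var_diff 1 j f) + lr (em j) 1 (var_diff (- 1) j f)"
  by (simp add: partial_def forward_var_diff backward_var_diff lr_def fun_eq_iff)

lemma xi_eq: "xi j f = lr (ep j) 1 (X_var (- 1) j f) + lr (em j) 1 (X_var 1 j f)"
  by (simp add: xi_def lr_def fun_eq_iff)

lemma dF_partial: "j \<in> {1..m} \<Longrightarrow> dF j f = lr (klein j) (e_perp j) (partial j f)"
  by (rule ext) (simp add: dF_def witt_op_def partial_eq lr_def distrib_left distrib_right left_diff_distrib mult.assoc [symmetric] klein_ep klein_em)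

lemma yF_xi: "j \<in> {1..m} \<Longrightarrow> yF j f = lr (klein j) (e_perp j) (xi j f)"
  by (rule ext) (simp add: yF_def witt_op_def xi_eq lr_def distrib_left distrib_right left_diff_distrib mult.assoc [symmetric] klein_ep klein_em)

lemma linF_partial: "j \<in> {1..m} \<Longrightarrow> linF (partial j)"
  unfolding partial_eq by (intro linF_add linF_comp [OF linF_lr] linF_var_diff) auto

lemma dirac_eq: "dirac f = - (\<Sum>j = 1..m. Gam j (dF j f))"
  unfolding dirac_def sum_negf [symmetric]
proof (intro sum.cong refl ext)
  fix j x assume j: "j \<in> {1..m}"
  have "klein j * (klein j * u * e_perp j) * e_perp j = (klein j * klein j) * u * (e_perp j * e_perp j)" for u
    by (simp add: mult.assoc)
  then show "partial j f x = (- Gam j (dF j f)) x"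
    using j by (simp add: dF_partial Gam_def lr_def klein_sq e_perp_sq)
qed

lemma xi_lr:
  assumes "j \<in> {1..m}" "f \<in> F"
  shows "xi j (lr a b f) x = ep j * (a * X_var (- 1) j f x * b) + em j * (a * X_var 1 j f x * b)"
proof -
  have "X_var s j (lr a b f) = lr a b (X_var s j f)" if "s = 1 \<or> s = - 1" for s
    using scalar_op_D(2) [OF scalar_op_X [OF assms(1) that] assms(2)] .
  then show ?thesis by (simp add: xi_eq lr_def)
qed

text \<open>
  The Klein factors of the two indices combine to $V_{a,b}$ up to sign. Exchanging the indices changes the sign
  through $e_a^\perp e_b^\perp$ on the right, and the symmetric combination $L_{a,b}$ becomes the
  antisymmetric $y_a d_b - y_b d_a$ in \<open>dR_eq\<close>.
\<close>

lemma yF_dF_other: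
  assumes "a \<in> {1..m}" "b \<in> {1..m}" "a \<noteq> b" "f \<in> F"
  shows "yF a (dF b f) x = V_elt a b * xi a (partial b f) x * e_perp a * e_perp b"
proof -
  have pF: "partial b f \<in> F" using assms by (simp add: linFD linF_partial)
  define u v where "u = X_var (- 1) a (partial b f) x" and "v = X_var 1 a (partial b f) x"
  have 1: "ep a * (klein b * w * e_perp b) = klein b * (ep a * w) * e_perp b"
    "em a * (klein b * w * e_perp b) = klein b * (em a * w) * e_perp b" for w
    using klein_commute(1,2) [of b a] assms by (simp_all add: mult.assoc [symmetric])
  have "yF a (dF b f) x = klein a * (ep a * (klein b * u * e_perp b) + em a * (klein b * v * e_perp b)) * e_perp a"
    using assms xi_lr [OF assms(1) pF]
    by (simp add: yF_xi dF_partial u_def v_def lr_def [of "klein a"])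
  also have "\<dots> = klein a * klein b * (ep a * u + em a * v) * (e_perp b * e_perp a)"
    unfolding 1 by (simp add: distrib_left distrib_right mult.assoc)
  also have "ep a * u + em a * v = xi a (partial b f) x"
    by (simp add: xi_def u_def v_def)
  also have "e_perp b * e_perp a = - (e_perp a * e_perp b)" using anti(5) [of b a] assms by simp
  finally show ?thesis using assms by (simp add: V_elt_klein mult.assoc)
qed

lemma dR_eq:
  assumes "a \<in> {1..m}" "b \<in> {1..m}" "a \<noteq> b" "f \<in> F"
  shows "dR a b f = yF a (dF b f) - yF b (dF a f) - fscale (1 / 2) (Gam a (Gam b f))"
proof
  fix x
  have V: "V_elt b a = V_elt a b" using assms klein_commute(3) [of a b] by (simp add: V_elt_klein)
  have e: "e_perp b * e_perp a = - (e_perp a * e_perp b)" using anti(5) [of b a] assms by simp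
  have 1: "yF b (dF a f) x = - (V_elt a b * xi b (partial a f) x * e_perp a * e_perp b)"
    using yF_dF_other [of b a f x] assms by (simp add: V mult.assoc e)
  have 2: "Gam a (Gam b f) x = V_elt a b * f x * e_perp a * e_perp b"
    using assms by (simp add: Gam_def lr_def V_elt_klein mult.assoc e)
  show "dR a b f x = (yF a (dF b f) - yF b (dF a f) - fscale (1 / 2) (Gam a (Gam b f))) x"
    using assms(3) yF_dF_other [OF assms, of x]
    by (simp add: dR_def L_op_def 1 2 fscale_def algebra_simps scale_mult_left scale_mult_right)
qed

lemma euler_eq:
  assumes "f \<in> F"
  shows "euler f = (\<Sum>j = 1..m. yF j (dF j f))"
  unfolding euler_def
proof (intro sum.cong refl ext)
  fix j x assume j: "j \<in> {1..m}"
  have pF: "partial j f \<in> F" using assms j by (simp add: linFD linF_partial)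
  define u v where "u = X_var (- 1) j (partial j f) x" and "v = X_var 1 j (partial j f) x"
  have "klein j * (ep j * (klein j * u * e_perp j)) * e_perp j = ep j * u"
    "klein j * (em j * (klein j * v * e_perp j)) * e_perp j = em j * v"
    using j by (simp_all add: mult.assoc e_perp_sq)
      (simp_all add: mult.assoc [symmetric] klein_ep klein_em ep_klein em_klein)
  then have "yF j (dF j f) x = ep j * u + em j * v"
    using xi_lr [OF j pF, of "klein j" "e_perp j" x] j
    by (simp add: yF_xi dF_partial lr_def [of "klein j" _ "xi j _"] u_def v_def distrib_left distrib_right)
  then show "xi j (partial j f) x = yF j (dF j f) x" by (simp add: xi_def u_def v_def)
qed

section \<open>Constants and nilpotency of the derivatives\<close>

text \<open>
  Cancelling the invertible $e_j^\perp$, the hypothesis says $\mathbf{e}_j^- \Delta^- f = \mathbf{e}_j^+ \Delta^+ f$. Multiplying by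
  $\mathbf{e}_j^-$ and $\mathbf{e}_j^+$ shows that both sides vanish; as $\Delta^+ f$ is a translate of $\Delta^- f$, also
  $\mathbf{e}_j^- \Delta^+ f = 0$, and $\mathbf{e}_j^- \mathbf{e}_j^+ + \mathbf{e}_j^+ \mathbf{e}_j^- = 1$ gives $\Delta^+ f = 0$.
\<close>

lemma dF_0_shift:
  assumes "j \<in> {1..m}" "dF j f = 0"
  shows "f (x(j := x j + 1)) = f x"
proof -
  have *: "em j * var_diff (- 1) j f x = ep j * var_diff 1 j f x" for x
  proof -
    have "(em j * var_diff (- 1) j f x - ep j * var_diff 1 j f x) * e_perp j = 0"
      using fun_cong [OF assms(2), of x] by (simp add: dF_def witt_op_def lr_def left_diff_distrib)
    then have "(em j * var_diff (- 1) j f x - ep j * var_diff 1 j f x) * (e_perp j * e_perp j) = 0"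
      by (simp add: mult.assoc [symmetric])
    then show ?thesis using assms by (simp add: e_perp_sq)
  qed
  have m0: "em j * var_diff (- 1) j f x = 0" and p0: "ep j * var_diff 1 j f x = 0" for x
  proof -
    have "em j * (ep j * var_diff 1 j f x) = em j * (em j * var_diff (- 1) j f x)" using * [of x] by simp
    then have "em j * (ep j * var_diff 1 j f x) = 0" using assms by (simp add: mult.assoc [symmetric] em_sq)
    then have "ep j * (em j * (ep j * var_diff 1 j f x)) = 0" by simp
    then show "ep j * var_diff 1 j f x = 0" using assms by (simp add: mult.assoc [symmetric] ep_em_ep)
    with * [of x] show "em j * var_diff (- 1) j f x = 0" by simp
  qed
  have "var_diff 1 j f x = var_diff (- 1) j f (x(j := x j + 1))" by (simp add: var_diff_def)
  then have "em j * var_diff 1 j f x = 0" by (simp only: m0)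
  with p0 [of x] have "(em j * ep j + ep j * em j) * var_diff 1 j f x = 0"
    by (simp add: distrib_right mult.assoc)
  then have "var_diff 1 j f x = 0" using assms by (simp add: em_ep)
  then show ?thesis by (simp add: var_diff_def)
qed

lemma dF_0_indep:
  assumes "j \<in> {1..m}" "dF j f = 0"
  shows "f (x(j := t)) = f x"
proof -
  have "f (x(j := t)) = f (x(j := 0))" for t
  proof (induction t rule: int_induct [where k = 0])
    case (step1 i)
    then show ?case using dF_0_shift [OF assms, of "x(j := i)"] by (simp only: fun_upd_upd fun_upd_same)
  next
    case (step2 i)
    then show ?case using dF_0_shift [OF assms, of "x(j := i - 1)"]
      by (simp only: fun_upd_upd fun_upd_same diff_add_cancel)
  qed (rule refl)
  from this [of t] this [of "x j"] show ?thesis by simp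
qed

lemma F_restrict: "f \<in> F \<Longrightarrow> (\<And>l. l \<in> {1..m} \<Longrightarrow> x l = x' l) \<Longrightarrow> f x = f x'"
proof (induction rule: F_induct)
  case (gen p c)
  have "(\<Prod>l = 1..m. p l (x l)) = (\<Prod>l = 1..m. p l (x' l))" by (rule prod.cong) (auto simp: gen(2))
  then show ?case by (simp add: gen_def)
qed (auto simp: fscale_def)

lemma dF_0_const:
  assumes "f \<in> F" "\<And>j. j \<in> {1..m} \<Longrightarrow> dF j f = 0"
  shows "f = (\<lambda>_. f (\<lambda>_. 0))"
proof
  fix x
  have "f (\<lambda>l. if l \<in> A then 0 else x l) = f x" if "finite A" "A \<subseteq> {1..m}" for A
    using that
  proof (induction A rule: finite_induct)
    case (insert j A)
    have "(\<lambda>l. if l \<in> insert j A then 0 else x l) = (\<lambda>l. if l \<in> A then 0 else x l)(j := 0)"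
      by auto
    then show ?case using dF_0_indep [of j f] assms(2) [of j] insert by simp
  qed simp
  from this [of "{1..m}"] have "f x = f (\<lambda>l. if l \<in> {1..m} then 0 else x l)" by simp
  also have "\<dots> = f (\<lambda>_. 0)" by (rule F_restrict [OF assms(1)]) simp
  finally show "f x = f (\<lambda>_. 0)" .
qed

lemma const_F: "(\<lambda>_. c) \<in> F"
  using gen_F [of "\<lambda>_ _. 1" c] poly_funs_const by (simp add: gen_def)

lemma dF_const: "dF j (\<lambda>_. c) = 0"
  by (simp add: dF_def witt_op_def lr_def var_diff_def fun_eq_iff)

text \<open>
  Polynomials of ordinary total degree less than \<open>r\<close>, which the operators \<open>dF j\<close> lower.
\<close>

definition Fd :: "nat \<Rightarrow> ((nat \<Rightarrow> int) \<Rightarrow> 'c) set" where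
  "Fd r = fun_space.span {gen (\<lambda>l. poly (q l)) c | q c. (\<Sum>l = 1..m. degree (q l)) < r}"

lemma Fd_closed: "f \<in> Fd r \<Longrightarrow> g \<in> Fd r \<Longrightarrow> f + g \<in> Fd r"
  "f \<in> Fd r \<Longrightarrow> g \<in> Fd r \<Longrightarrow> f - g \<in> Fd r"
  "f \<in> Fd r \<Longrightarrow> fscale z f \<in> Fd r" "0 \<in> Fd r"
  unfolding Fd_def by (auto intro: fun_space.span_add fun_space.span_diff fun_space.span_scale fun_space.span_zero)

lemma Fd_gen: "(\<Sum>l = 1..m. degree (q l)) < r \<Longrightarrow> gen (\<lambda>l. poly (q l)) c \<in> Fd r"
  unfolding Fd_def by (rule fun_space.span_base) auto

lemma Fd_F: "Fd r \<subseteq> F"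
  unfolding Fd_def by (rule fun_space.span_minimal [OF _ F_subspace]) (auto intro!: gen_F simp: poly_funs_def)

lemma Fd_mono: "r \<le> r' \<Longrightarrow> Fd r \<subseteq> Fd r'"
  unfolding Fd_def by (rule fun_space.span_mono) (auto intro: order_less_le_trans)

lemma F_Fd: "f \<in> F \<Longrightarrow> \<exists>r. f \<in> Fd r"
proof (induction rule: F_induct)
  case (gen p c)
  then have "\<forall>l. \<exists>q. p l = poly q" unfolding poly_funs_def by blast
  then obtain q where "\<forall>l. p l = poly (q l)" by (rule choice [THEN exE])
  then have "p = (\<lambda>l. poly (q l))" by blast
  then have "gen p c \<in> Fd (Suc (\<Sum>l = 1..m. degree (q l)))" by (simp add: Fd_gen)
  then show ?case ..
next
  case (add f g)
  then obtain r r' where "f \<in> Fd r" "g \<in> Fd r'" by blast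
  then have "f \<in> Fd (max r r')" "g \<in> Fd (max r r')"
    using Fd_mono [of r "max r r'"] Fd_mono [of r' "max r r'"] by auto
  then show ?case using Fd_closed(1) by blast
next
  case zero
  show ?case using Fd_closed(4) by blast
qed (auto intro: Fd_closed)

lemma Fd_lift:
  assumes T: "linF T" and gen: "\<And>q c. (\<Sum>l = 1..m. degree (q l)) < r \<Longrightarrow> T (gen (\<lambda>l. poly (q l)) c) \<in> Fd r'"
    and f: "f \<in> Fd r"
  shows "T f \<in> Fd r'"
proof -
  have "f \<in> F \<and> T f \<in> Fd r'"
    using f unfolding Fd_def [of r]
  proof (rule fun_space.span_induct)
    show "fun_space.subspace {f. f \<in> F \<and> T f \<in> Fd r'}"
      unfolding fun_space.subspace_def using linFD(2,3) [OF T] linF_0 [OF T]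
      by (auto intro: Fd_closed F_add F_scale F_0)
    fix x assume "x \<in> {gen (\<lambda>l. poly (q l)) c | q c. (\<Sum>l = 1..m. degree (q l)) < r}"
    then show "x \<in> F \<and> T x \<in> Fd r'" using gen by (auto intro!: gen_F simp: poly_funs_def)
  qed
  then show ?thesis ..
qed

lemma Fd_var_diff:
  assumes j: "j \<in> {1..m}" and s: "s = 1 \<or> s = - 1" and f: "f \<in> Fd (Suc r)"
  shows "var_diff s j f \<in> Fd r"
proof (rule Fd_lift [OF linF_var_diff [OF j s] _ f])
  fix q :: "nat \<Rightarrow> int poly" and c assume d: "(\<Sum>l = 1..m. degree (q l)) < Suc r"
  obtain q' where q': "step_diff s (poly (q j)) = poly q'" "q' = 0 \<or> degree q' < degree (q j)"
    using step_diff_poly [OF s] by blast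
  have eq: "var_diff s j (gen (\<lambda>l. poly (q l)) c) = gen (\<lambda>l. poly ((q(j := q')) l)) c"
  proof -
    have "(\<lambda>l. poly (q l))(j := step_diff s (poly (q j))) = (\<lambda>l. poly ((q(j := q')) l))"
      unfolding q'(1) by auto
    then show ?thesis unfolding var_diff_gen [OF j] by simp
  qed
  show "var_diff s j (gen (\<lambda>l. poly (q l)) c) \<in> Fd r"
  proof (cases "q' = 0")
    case True
    have "gen (\<lambda>l. poly ((q(j := q')) l)) c = 0"
      unfolding True by (rule ext) (subst gen_split [OF j], simp)
    then show ?thesis unfolding eq by (simp add: Fd_closed)
  next
    case False
    have "(\<Sum>l = 1..m. degree ((q(j := q')) l)) = degree q' + (\<Sum>l\<in>{1..m} - {j}. degree (q l))"
      using j by (subst sum.remove [of _ j]) (auto intro!: sum.cong)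
    also have "\<dots> < degree (q j) + (\<Sum>l\<in>{1..m} - {j}. degree (q l))" using q'(2) False by simp
    also have "\<dots> = (\<Sum>l = 1..m. degree (q l))" using j by (subst sum.remove [of _ j]) auto
    finally show ?thesis unfolding eq using d by (intro Fd_gen) simp
  qed
qed

lemma Fd_lr: "f \<in> Fd r \<Longrightarrow> lr a b f \<in> Fd r"
  by (rule Fd_lift [OF linF_lr]) (auto simp: lr_gen Fd_gen)

lemma Fd_dF: "j \<in> {1..m} \<Longrightarrow> f \<in> Fd (Suc r) \<Longrightarrow> dF j f \<in> Fd r"
  unfolding dF_def witt_op_def by (intro Fd_closed Fd_lr Fd_var_diff) auto

lemma Fd_0: "f \<in> Fd 0 \<Longrightarrow> f = 0"
  by (simp add: Fd_def)

lemma linF_euler: "linF euler"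
proof -
  have "linF (\<lambda>f. \<Sum>j\<in>A. yF j (dF j f))" if "finite A" "A \<subseteq> {1..m}" for A
    using that
  proof (induction A rule: finite_induct)
    case empty
    show ?case using linF_scale [OF linF_id, of 0] by (simp only: fun_space.scale_zero_left sum.empty)
  next
    case (insert a A)
    have "linF (\<lambda>f. yF a (dF a f) + (\<Sum>j\<in>A. yF j (dF j f)))"
      using insert by (intro linF_add linF_comp [OF linF_yF linF_dF] insert.IH) auto
    then show ?case unfolding sum.insert [OF insert.hyps] .
  qed
  from this [of "{1..m}"] have *: "linF (\<lambda>f. \<Sum>j = 1..m. yF j (dF j f))" by simp
  show ?thesis
    unfolding linF_def
  proof (intro conjI ballI allI)
    show "euler f \<in> F" if "f \<in> F" for f
      using linFD(1) [OF * that] euler_eq [OF that] by simp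
    show "euler (f + g) = euler f + euler g" if "f \<in> F" "g \<in> F" for f g
      unfolding euler_eq [OF that(1)] euler_eq [OF that(2)] euler_eq [OF F_add [OF that]]
      by (rule linFD(2) [OF * that])
    show "euler (fscale z f) = fscale z (euler f)" if "f \<in> F" for z f
      unfolding euler_eq [OF that] euler_eq [OF F_scale [OF that]]
      by (rule linFD(3) [OF * that])
  qed
qed

lemma dF_euler:
  assumes "j \<in> {1..m}" "f \<in> F"
  shows "dF j (euler f) = euler (dF j f) + dF j f"
proof -
  have dFF: "dF i f \<in> F" if "i \<in> {1..m}" for i using that assms by (simp add: linFD linF_dF)
  have "dF j (euler f) = (\<Sum>i = 1..m. dF j (yF i (dF i f)))"
    unfolding euler_eq [OF assms(2)]
    by (rule linF_apply_sum [OF linF_dF [OF assms(1)]]) (simp add: linFD linF_yF dFF)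
  also have "\<dots> = (\<Sum>i = 1..m. yF i (dF i (dF j f)) + (if i = j then dF j f else 0))"
    by (rule sum.cong) (use assms in \<open>auto simp: dF_yF dFF dF_dF [of j]\<close>)
  also have "\<dots> = (\<Sum>i = 1..m. yF i (dF i (dF j f))) + dF j f"
    using assms(1) by (simp add: sum.distrib)
  finally show ?thesis using euler_eq [OF dFF [OF assms(1)]] by simp
qed

text \<open>
  Derivatives lower the Euler eigenvalue and are nilpotent, so by induction all derivatives of \<open>f\<close> vanish, and
  then \<open>euler f = 0\<close>. Consequently the derivatives of a polynomial that is homogeneous of degree 0 vanish, and it
  is constant.
\<close>

lemma negative_degree:
  "f \<in> Fd r \<Longrightarrow> euler f = fscale (- of_nat (Suc c)) f \<Longrightarrow> f = 0"
proof (induction r arbitrary: f c)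
  case 0
  from Fd_0 [OF this(1)] show ?case .
next
  case (Suc r)
  have fF: "f \<in> F" using Suc.prems(1) Fd_F by blast
  have "dF j f = 0" if j: "j \<in> {1..m}" for j
  proof (rule Suc.IH)
    show "dF j f \<in> Fd r" by (rule Fd_dF [OF j Suc.prems(1)])
    have "dF j (euler f) = fscale (- of_nat (Suc c)) (dF j f)"
      unfolding Suc.prems(2) using linFD(3) [OF linF_dF [OF j] fF] .
    then have "euler (dF j f) = fscale (- of_nat (Suc c)) (dF j f) - dF j f"
      using dF_euler [OF j fF] by (metis add_diff_cancel_right')
    moreover have "- of_nat (Suc (Suc c)) = - of_nat (Suc c) - (1 :: complex)" by simp
    ultimately show "euler (dF j f) = fscale (- of_nat (Suc (Suc c))) (dF j f)"
      by (simp only: fun_space.scale_left_diff_distrib fun_space.scale_one)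
  qed
  then have "euler f = (\<Sum>j = 1..m. 0)"
    unfolding euler_eq [OF fF] by (intro sum.cong refl) (simp add: linF_0 [OF linF_yF])
  then have "fscale (- of_nat (Suc c)) f = 0" using Suc.prems(2) by simp
  then show ?case unfolding fun_space.scale_eq_0_iff by (simp del: of_nat_Suc)
qed

end

section \<open>Modules over the canonical anticommutation relations\<close>

locale car = vector_space scale
  for scale :: "complex \<Rightarrow> 'v::ab_group_add \<Rightarrow> 'v" +
  fixes n :: nat and c cd :: "nat \<Rightarrow> 'v \<Rightarrow> 'v"
  assumes c_add: "c a (x + y) = c a x + c a y" and c_scale: "c a (scale z x) = scale z (c a x)"
    and cd_add: "cd a (x + y) = cd a x + cd a y" and cd_scale: "cd a (scale z x) = scale z (cd a x)"
    and c_c: "a \<in> {1..n} \<Longrightarrow> b \<in> {1..n} \<Longrightarrow> c a (c b x) = - c b (c a x)"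
    and cd_cd: "a \<in> {1..n} \<Longrightarrow> b \<in> {1..n} \<Longrightarrow> cd a (cd b x) = - cd b (cd a x)"
    and c_cd: "a \<in> {1..n} \<Longrightarrow> b \<in> {1..n} \<Longrightarrow> c a (cd b x) = scale (of_bool (a = b)) x - cd b (c a x)"
begin

lemma c_0 [simp]: "c a 0 = 0" and cd_0 [simp]: "cd a 0 = 0"
  using c_scale [of a 0 0] cd_scale [of a 0 0] by simp_all

lemma c_minus: "c a (- x) = - c a x" and cd_minus: "cd a (- x) = - cd a x"
  using c_scale [of a "- 1" x] cd_scale [of a "- 1" x] by simp_all

lemma self_neg: "x = - x \<Longrightarrow> x = (0 :: 'v)"
proof -
  assume "x = - x"
  then have "scale 1 x + scale 1 x = 0" by (simp add: eq_neg_iff_add_eq_0)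
  then have "scale (1 + 1) x = 0" by (simp only: scale_left_distrib)
  then show "x = 0" by simp
qed

lemma c_c_same: "a \<in> {1..n} \<Longrightarrow> c a (c a x) = 0" and cd_cd_same: "a \<in> {1..n} \<Longrightarrow> cd a (cd a x) = 0"
  by (rule self_neg, rule c_c cd_cd; assumption)+

text \<open>
  The product of the annihilators with index in \<open>B \<inter> {1..r}\<close>, the largest index outermost.
\<close>

fun ann_word :: "nat \<Rightarrow> nat set \<Rightarrow> 'v \<Rightarrow> 'v" where
  "ann_word 0 B x = x"
| "ann_word (Suc r) B x = (if Suc r \<in> B then c (Suc r) (ann_word r B x) else ann_word r B x)"

text \<open>
  The product of the commuting projections $c_a c_a^\dagger$ onto the kernels of $c_a$, along the images of
  $c_a^\dagger$.
\<close>

fun vac_proj :: "nat \<Rightarrow> 'v \<Rightarrow> 'v" where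
  "vac_proj 0 x = x"
| "vac_proj (Suc r) x = c (Suc r) (cd (Suc r) (vac_proj r x))"

lemma ann_word_add: "ann_word r B (x + y) = ann_word r B x + ann_word r B y" and ann_word_scale: "ann_word r B (scale z x) = scale z (ann_word r B x)"
  by (induction r) (simp_all add: c_add c_scale)

lemma vac_proj_add: "vac_proj r (x + y) = vac_proj r x + vac_proj r y" and vac_proj_scale: "vac_proj r (scale z x) = scale z (vac_proj r x)"
  by (induction r) (simp_all add: c_add c_scale cd_add cd_scale)

lemma ann_word_cong: "B \<inter> {1..r} = C \<inter> {1..r} \<Longrightarrow> ann_word r B = ann_word r C"
proof (induction r)
  case (Suc r)
  have "{1..Suc r} \<inter> {1..r} = {1..r}" by auto
  then have "B \<inter> {1..r} = C \<inter> {1..r}" using Suc.prems by (metis Int_assoc)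
  moreover have "Suc r \<in> B \<longleftrightarrow> Suc r \<in> C" using Suc.prems by (metis Int_iff atLeastAtMost_iff le_add1 order_refl plus_1_eq_Suc)
  ultimately show ?case using Suc.IH by (auto simp: fun_eq_iff)
qed (simp add: fun_eq_iff)

lemma ksign_Suc: "ksign (Suc a) B = (if a \<in> B then - ksign a B else ksign a B)"
proof -
  have "{b \<in> B. b < Suc a} = (if a \<in> B then insert a {b \<in> B. b < a} else {b \<in> B. b < a})"
    by (auto simp: less_Suc_eq)
  then show ?thesis by (simp add: ksign_def)
qed

lemma ksign_1: "0 \<notin> B \<Longrightarrow> ksign (Suc 0) B = 1"
proof -
  assume "0 \<notin> B"
  then have "{b \<in> B. b < Suc 0} = {}" by auto
  then show ?thesis unfolding ksign_def by (simp only: card.empty power_0)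
qed

lemma ann_word_pass:
  assumes "0 \<notin> B" "a \<in> {1..n}" "r \<le> n" "a \<notin> B \<inter> {1..r}"
  shows "ann_word r B (c a x) = scale (ksign (Suc r) B) (c a (ann_word r B x))"
    and "ann_word r B (cd a x) = scale (ksign (Suc r) B) (cd a (ann_word r B x))"
  using assms(3,4)
proof (induction r)
  case 0
  { case 1 show ?case using assms by (simp add: ksign_1) }
  { case 2 show ?case using assms by (simp add: ksign_1) }
next
  case (Suc r)
  { case 1
    then have IH: "ann_word r B (c a x) = scale (ksign (Suc r) B) (c a (ann_word r B x))"
      by (intro Suc.IH) auto
    show ?case
    proof (cases "Suc r \<in> B")
      case True
      then have "a \<noteq> Suc r" using 1 by auto
      then show ?thesis using True IH 1 assms c_c [of "Suc r" a "ann_word r B x"]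
        by (simp add: c_scale ksign_Suc [of "Suc r"] scale_minus_right)
    qed (simp add: IH ksign_Suc [of "Suc r"]) }
  { case 2
    then have IH: "ann_word r B (cd a x) = scale (ksign (Suc r) B) (cd a (ann_word r B x))"
      by (intro Suc.IH) auto
    show ?case
    proof (cases "Suc r \<in> B")
      case True
      then have "a \<noteq> Suc r" using 2 by auto
      then show ?thesis using True IH 2 assms c_cd [of "Suc r" a "ann_word r B x"]
        by (simp add: c_scale ksign_Suc [of "Suc r"] scale_minus_right)
    qed (simp add: IH ksign_Suc [of "Suc r"]) }
qed

lemma ann_word_c:
  assumes B: "0 \<notin> B" and "r \<le> n" "a \<in> {1..r}"
  shows "ann_word r B (c a x) = (if a \<in> B then 0 else scale (ksign a B) (ann_word r (insert a B) x))"
  using assms(2,3)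
proof (induction r)
  case (Suc r)
  show ?case
  proof (cases "a = Suc r")
    case True
    have "ann_word r B (c a x) = scale (ksign a B) (c a (ann_word r B x))"
      using ann_word_pass(1) [OF B, of a r x] Suc.prems True by auto
    moreover have "ann_word r (insert a B) = ann_word r B" using True by (intro ann_word_cong) auto
    ultimately show ?thesis using True Suc.prems by (simp add: c_scale c_c_same)
  next
    case False
    then have "ann_word r B (c a x) = (if a \<in> B then 0 else scale (ksign a B) (ann_word r (insert a B) x))"
      using Suc by auto
    with False show ?thesis by (auto simp: c_scale)
  qed
qed simp

text \<open>
  The remainder lies in the image of \<open>cd a\<close>, which \<open>vac_proj\<close> kills; so it does not show in \<open>vac_coord_cd\<close>.
\<close>

lemma ann_word_cd:
  assumes B: "0 \<notin> B" and "r \<le> n" "a \<in> {1..r}"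
  shows "\<exists>z. ann_word r B (cd a x) = (if a \<in> B then scale (ksign a B) (ann_word r (B - {a}) x) else 0) + cd a z"
  using assms(2,3)
proof (induction r)
  case (Suc r)
  show ?case
  proof (cases "a = Suc r")
    case True
    have *: "ann_word r B (cd a x) = cd a (scale (ksign a B) (ann_word r B x))"
      using ann_word_pass(2) [OF B, of a r x] Suc.prems True by (auto simp: cd_scale)
    show ?thesis
    proof (cases "a \<in> B")
      case aB: True
      have "ann_word r (B - {a}) = ann_word r B" using True by (intro ann_word_cong) auto
      then have "ann_word (Suc r) (B - {a}) = ann_word r B" using True by (simp add: fun_eq_iff)
      moreover have "ann_word (Suc r) B (cd a x) = scale (ksign a B) (ann_word r B x) - cd a (c a (scale (ksign a B) (ann_word r B x)))"
        using aB True * Suc.prems c_cd [of a a] by simp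
      ultimately show ?thesis using aB
        by (intro exI [of _ "- c a (scale (ksign a B) (ann_word r B x))"]) (simp add: cd_minus)
    next
      case False
      then show ?thesis using * True by auto
    qed
  next
    case False
    then obtain z where z: "ann_word r B (cd a x) = (if a \<in> B then scale (ksign a B) (ann_word r (B - {a}) x) else 0) + cd a z"
      using Suc by auto
    have "c (Suc r) (cd a z) = cd a (- c (Suc r) z)"
      using c_cd [of "Suc r" a z] Suc.prems False by (simp add: cd_minus)
    with z False show ?thesis
      by (cases "Suc r \<in> B") (auto simp: c_add c_scale)
  qed
qed simp

lemma vac_proj_pass:
  assumes "r < a" "a \<in> {1..n}"
  shows "vac_proj r (cd a x) = cd a (vac_proj r x)"
  using assms
proof (induction r)
  case (Suc r)
  then have r: "Suc r \<in> {1..n}" "Suc r \<noteq> a" by auto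
  then show ?case using Suc c_cd [of "Suc r" a] cd_cd [of "Suc r" a] by (simp add: c_minus)
qed simp

lemma vac_proj_cd: "a \<in> {1..r} \<Longrightarrow> r \<le> n \<Longrightarrow> vac_proj r (cd a x) = 0"
proof (induction r)
  case (Suc r)
  show ?case
  proof (cases "a = Suc r")
    case True
    then show ?thesis using Suc.prems vac_proj_pass [of r a x] cd_cd_same [of a] by simp
  qed (use Suc in auto)
qed simp

lemma c_vac_proj: "a \<in> {1..r} \<Longrightarrow> r \<le> n \<Longrightarrow> c a (vac_proj r x) = 0"
proof (induction r)
  case (Suc r)
  show ?case
  proof (cases "a = Suc r")
    case True
    then show ?thesis using Suc.prems c_c_same [of a] by simp
  next
    case False
    then show ?thesis using Suc c_c [of a "Suc r"] c_cd [of a "Suc r" "vac_proj r x"] by (simp add: c_minus)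
  qed
qed simp

definition vacua :: "'v set" where "vacua = {x. \<forall>a\<in>{1..n}. c a x = 0}"

lemma vac_proj_vacua: "vac_proj n x \<in> vacua"
  by (simp add: vacua_def c_vac_proj)

lemma vac_proj_id: "x \<in> vacua \<Longrightarrow> r \<le> n \<Longrightarrow> vac_proj r x = x"
  by (induction r) (simp_all add: vacua_def c_cd)

lemma vacua_subspace: "subspace vacua"
  by (auto simp: subspace_def vacua_def c_add c_scale)

definition vac_coord :: "'v \<Rightarrow> nat set \<Rightarrow> 'v" where "vac_coord x B = vac_proj n (ann_word n B x)"

lemma vac_coord_add: "vac_coord (x + y) B = vac_coord x B + vac_coord y B" and vac_coord_scale: "vac_coord (scale z x) B = scale z (vac_coord x B)"
  by (simp_all add: vac_coord_def ann_word_add vac_proj_add ann_word_scale vac_proj_scale)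

lemma vac_coord_0: "vac_coord 0 B = 0"
  using vac_coord_scale [of 0 0] by simp

lemma vac_coord_sum: "vac_coord (\<Sum>i\<in>I. f i) B = (\<Sum>i\<in>I. vac_coord (f i) B)"
  by (induction I rule: infinite_finite_induct) (simp_all add: vac_coord_0 vac_coord_add)

lemma vac_coord_c: "0 \<notin> B \<Longrightarrow> a \<in> {1..n} \<Longrightarrow> vac_coord (c a x) B = (if a \<in> B then 0 else scale (ksign a B) (vac_coord x (insert a B)))"
  using vac_proj_scale [of n 0 0] by (simp add: vac_coord_def ann_word_c vac_proj_scale)

lemma vac_coord_cd: "0 \<notin> B \<Longrightarrow> a \<in> {1..n} \<Longrightarrow> vac_coord (cd a x) B = (if a \<in> B then scale (ksign a B) (vac_coord x (B - {a})) else 0)"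
  using ann_word_cd [of B n a x] vac_proj_scale [of n 0 0] by (auto simp: vac_coord_def vac_proj_add vac_proj_cd vac_proj_scale)

lemma c_ann_word:
  assumes B: "B \<subseteq> {1..n}" and a: "a \<in> {1..n}"
  shows "c a (ann_word n B x) = (if a \<in> B then 0 else scale (ksign (Suc n) B * ksign a B) (ann_word n (insert a B) x))"
proof -
  have 0: "0 \<notin> B" using B by auto
  have *: "c a (ann_word n C x) = scale (ksign (Suc n) C * ksign a C) (ann_word n (insert a C) x)" if "a \<notin> C" "0 \<notin> C" for C
  proof -
    have "scale (ksign (Suc n) C) (c a (ann_word n C x)) = scale (ksign a C) (ann_word n (insert a C) x)"
      using ann_word_pass(1) [OF that(2) a order_refl, of x] ann_word_c [OF that(2) order_refl a, of x] that by simp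
    then have "scale (ksign (Suc n) C) (scale (ksign (Suc n) C) (c a (ann_word n C x)))
      = scale (ksign (Suc n) C) (scale (ksign a C) (ann_word n (insert a C) x))" by simp
    then show ?thesis by (simp only: scale_scale ksign_sq scale_one)
  qed
  show ?thesis
  proof (cases "a \<in> B")
    case True
    then have i: "insert a (B - {a}) = B" by auto
    have "c a (c a (ann_word n (B - {a}) x)) = 0" using a by (rule c_c_same)
    then show ?thesis using True *[of "B - {a}"] 0 i
      by (simp add: c_scale scale_eq_0_iff)
  qed (use * 0 in simp)
qed

text \<open>
  By induction from large sets \<open>B\<close> down to the empty one: if the words for all larger sets annihilate \<open>x\<close>, the word
  for \<open>B\<close> takes \<open>x\<close> to a vacuum, which the projection fixes.
\<close>

lemma vac_coord_inj:
  assumes 0: "\<And>B. B \<subseteq> {1..n} \<Longrightarrow> vac_coord x B = 0"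
  shows "x = 0"
proof -
  have "ann_word n B x = 0" if "B \<subseteq> {1..n}" for B
    using that
  proof (induction "n - card B" arbitrary: B rule: less_induct)
    case less
    have "c a (ann_word n B x) = 0" if a: "a \<in> {1..n}" for a
    proof (cases "a \<in> B")
      case False
      have fB: "finite B" using less.prems by (rule finite_subset) simp
      have ins: "insert a B \<subseteq> {1..n}" using a less.prems by auto
      then have "card (insert a B) \<le> n" using card_mono [OF _ ins] by simp
      then have "ann_word n (insert a B) x = 0" using False fB by (intro less.hyps ins) simp
      then show ?thesis using c_ann_word [OF less.prems a] by simp
    qed (use c_ann_word [OF less.prems a] in simp)
    then have "ann_word n B x \<in> vacua" by (simp add: vacua_def)
    then have "vac_proj n (ann_word n B x) = ann_word n B x" by (rule vac_proj_id) simp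
    then show ?case using 0 [OF less.prems] by (simp add: vac_coord_def)
  qed
  from this [of "{}"] have "ann_word n {} x = 0" by simp
  moreover have "ann_word r {} x = x" for r by (induction r) auto
  ultimately show ?thesis by simp
qed

lemma ann_word_vacua: "x \<in> vacua \<Longrightarrow> r \<le> n \<Longrightarrow> ann_word r C x = (if C \<inter> {1..r} = {} then x else 0)"
proof (induction r)
  case (Suc r)
  have "{1..Suc r} = insert (Suc r) {1..r}" by auto
  then show ?case using Suc by (auto simp: vacua_def)
qed simp

lemma vac_coord_surj1:
  assumes v: "v \<in> vacua" and B: "B \<subseteq> {1..n}"
  shows "\<exists>x. \<forall>C\<subseteq>{1..n}. vac_coord x C = (if C = B then v else 0)"
proof -
  have "finite B" using B by (rule finite_subset) simp
  then show ?thesis using B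
  proof (induction B rule: finite_induct)
    case empty
    have "vac_coord v C = (if C = {} then v else 0)" if "C \<subseteq> {1..n}" for C
    proof -
      have "C \<inter> {1..n} = C" using that by auto
      then show ?thesis using ann_word_vacua [OF v order_refl, of C] vac_proj_id [OF v order_refl] vac_proj_scale [of n 0 0]
        by (simp add: vac_coord_def)
    qed
    then show ?case by blast
  next
    case (insert b B)
    then obtain x where x: "\<And>C. C \<subseteq> {1..n} \<Longrightarrow> vac_coord x C = (if C = B then v else 0)" by auto
    have b: "b \<in> {1..n}" using insert by auto
    have "vac_coord (cd b (scale (ksign b (insert b B)) x)) C = (if C = insert b B then v else 0)"
      if C: "C \<subseteq> {1..n}" for C
    proof -
      have C0: "0 \<notin> C" using C by auto
      have "C - {b} = B \<longleftrightarrow> C = insert b B" if "b \<in> C" using that insert.hyps by auto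
      moreover have "C - {b} \<subseteq> {1..n}" using C by auto
      ultimately show ?thesis
        using vac_coord_cd [OF C0 b] x by (auto simp: vac_coord_scale)
    qed
    then show ?case by blast
  qed
qed

text \<open>
  A module over the canonical anticommutation relations is spinors tensor vacua. The coordinate \<open>\<kappa> i x B\<close> is the
  component of \<open>vac_coord x B\<close> along the \<open>i\<close>-th element of a basis of the space of vacua; in terms of it the
  operators act as \<open>ann\<close> and \<open>cre\<close>. Counting the \<open>2 ^ n * N\<close> coordinates gives the dimension.
\<close>

theorem coordinates:
  assumes fin: "dim (UNIV :: 'v set) > 0"
  shows "\<exists>N \<kappa>. 2 ^ n * N = dim (UNIV :: 'v set)
    \<and> (\<forall>i x y B. \<kappa> i (x + y) B = \<kappa> i x B + \<kappa> i y B)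
    \<and> (\<forall>i z x B. \<kappa> i (scale z x) B = z * \<kappa> i x B)
    \<and> (\<forall>i x B. \<kappa> i x B \<noteq> 0 \<longrightarrow> B \<subseteq> {1..n})
    \<and> (\<forall>i a x B. a \<in> {1..n} \<longrightarrow> \<kappa> i (c a x) B = (if a \<in> B then 0 else ksign a B * \<kappa> i x (insert a B)))
    \<and> (\<forall>i a x B. a \<in> {1..n} \<longrightarrow> \<kappa> i (cd a x) B = (if a \<in> B then ksign a B * \<kappa> i x (B - {a}) else 0))
    \<and> (\<forall>x. (\<forall>i<N. \<forall>B\<subseteq>{1..n}. \<kappa> i x B = 0) \<longrightarrow> x = 0)
    \<and> (\<forall>\<psi>. \<exists>x. \<forall>i<N. \<forall>B\<subseteq>{1..n}. \<kappa> i x B = (\<psi> i B :: complex))"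
proof -
  obtain S where S: "finite S" "span S = (UNIV :: 'v set)"
  proof -
    have "\<exists>b. independent b \<and> span b = span (UNIV :: 'v set)" using basis_exists span_subspace by (metis span_UNIV subspace_UNIV)
    then obtain b where b: "independent b" "span b = (UNIV :: 'v set)" by (auto simp: span_UNIV)
    then have "card b = dim (UNIV :: 'v set)" by (metis dim_eq_card span_UNIV)
    then have "finite b" using fin by (metis card.infinite less_numeral_extra(3))
    then show thesis using that b by blast
  qed
  obtain A where A: "A \<subseteq> vacua" "independent A" "vacua \<subseteq> span A"
    using maximal_independent_subset by blast
  have finA: "finite A" using independent_span_bound [OF S(1) A(2)] S(2) by auto
  have spanA: "span A = vacua" using A span_minimal [OF A(1) vacua_subspace] by auto
  define N where "N = card A"
  obtain e where e: "bij_betw e {..<N} A"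
    using ex_bij_betw_nat_finite [OF finA] by (auto simp: N_def atLeast0LessThan)
  define R where "R i v = representation A v (e i)" for i v
  define \<kappa> where "\<kappa> i x B = (if B \<subseteq> {1..n} then R i (vac_coord x B) else 0)" for i x B
  have kaA: "vac_coord x B \<in> span A" for x B by (simp add: spanA vac_coord_def vac_proj_vacua)
  have R_add: "R i (u + v) = R i u + R i v" if "u \<in> span A" "v \<in> span A" for i u v
    unfolding R_def using fun_cong [OF representation_add [OF A(2) that(2,1)], of "e i"] by (simp add: add.commute)
  have R_scale: "R i (scale z u) = z * R i u" if "u \<in> span A" for i z u
    unfolding R_def using fun_cong [OF representation_scale [OF A(2) that, of z], of "e i"] by simp
  have R_0: "R i 0 = 0" for i
    by (simp add: R_def representation_zero)
  have R_sum: "v = (\<Sum>i<N. scale (R i v) (e i))" if "v \<in> span A" for v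
  proof -
    have "(\<Sum>i<N. scale (R i v) (e i)) = (\<Sum>a\<in>A. scale (representation A v a) a)"
      unfolding R_def by (rule sum.reindex_bij_betw [OF e])
    also have "\<dots> = v" using that A(2) finA by (intro sum_representation_eq) auto
    finally show ?thesis by simp
  qed
  have eA: "e i \<in> A" if "i < N" for i using e that by (auto simp: bij_betw_def)
  have R_e: "R i (e j) = of_bool (i = j)" if "i < N" "j < N" for i j
    using representation_basis [OF A(2) eA [OF that(2)]] e that
    by (auto simp: R_def bij_betw_def inj_on_def)
  have surj: "\<exists>x. \<forall>i<N. \<forall>B\<subseteq>{1..n}. \<kappa> i x B = \<psi> i B" for \<psi>
  proof -
    have "\<exists>x. \<forall>C\<subseteq>{1..n}. vac_coord x C = (if C = B then (\<Sum>i<N. scale (\<psi> i B) (e i)) else 0)"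
      if "B \<subseteq> {1..n}" for B
      using that eA A(1) by (intro vac_coord_surj1 subspace_sum subspace_scale vacua_subspace) auto
    then obtain X where X: "\<And>B C. B \<subseteq> {1..n} \<Longrightarrow> C \<subseteq> {1..n} \<Longrightarrow>
        vac_coord (X B) C = (if C = B then (\<Sum>i<N. scale (\<psi> i B) (e i)) else 0)"
      by metis
    define x where "x = (\<Sum>B\<in>Pow {1..n}. X B)"
    have "vac_coord x C = (\<Sum>i<N. scale (\<psi> i C) (e i))" if "C \<subseteq> {1..n}" for C
    proof -
      have "vac_coord x C = (\<Sum>B\<in>Pow {1..n}. if C = B then (\<Sum>i<N. scale (\<psi> i B) (e i)) else 0)"
        unfolding x_def vac_coord_sum using that by (intro sum.cong) (auto simp: X)
      then show ?thesis using that by simp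
    qed
    moreover have "R i (\<Sum>j<N. scale (\<psi> j C) (e j)) = \<psi> i C" if "i < N" for i C
    proof -
      have "R i (\<Sum>j\<in>J. scale (\<psi> j C) (e j)) = (\<Sum>j\<in>J. \<psi> j C * R i (e j))" if "finite J" "J \<subseteq> {..<N}" for J
        using that
      proof (induction J rule: finite_induct)
        case (insert j J)
        then have "e j \<in> span A" "(\<Sum>j\<in>J. scale (\<psi> j C) (e j)) \<in> span A"
          using eA by (auto intro!: span_sum span_scale intro: span_base)
        then show ?case using insert by (simp add: R_add R_scale span_scale)
      qed (simp add: R_0)
      from this [of "{..<N}"] have "R i (\<Sum>j<N. scale (\<psi> j C) (e j)) = (\<Sum>j<N. \<psi> j C * R i (e j))" by simp
      also have "\<dots> = (\<Sum>j<N. if i = j then \<psi> j C else 0)"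
        using that by (intro sum.cong) (auto simp: R_e)
      finally show ?thesis using that by simp
    qed
    ultimately show ?thesis by (intro exI [of _ x]) (simp add: \<kappa>_def)
  qed
  have inj: "x = 0" if z: "\<And>i B. i < N \<Longrightarrow> B \<subseteq> {1..n} \<Longrightarrow> \<kappa> i x B = 0" for x
  proof (rule vac_coord_inj)
    fix B assume B: "B \<subseteq> {1..n}"
    have "vac_coord x B = (\<Sum>i<N. scale (R i (vac_coord x B)) (e i))" by (rule R_sum [OF kaA])
    also have "\<dots> = 0" using z [OF _ B] B by (intro sum.neutral) (auto simp: \<kappa>_def)
    finally show "vac_coord x B = 0" .
  qed
  have add: "\<kappa> i (x + y) B = \<kappa> i x B + \<kappa> i y B" for i x y B
    by (simp add: \<kappa>_def vac_coord_add R_add kaA)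
  have sca: "\<kappa> i (scale z x) B = z * \<kappa> i x B" for i z x B
    by (simp add: \<kappa>_def vac_coord_scale R_scale kaA)
  \<comment> \<open>The vectors X (B, i) with a single coordinate equal to 1 and the others 0 form a basis.\<close>
  have dimN: "2 ^ n * N = dim (UNIV :: 'v set)"
  proof -
    let ?I = "Pow {1..n} \<times> {..<N}"
    have "\<forall>p. \<exists>x. \<forall>i<N. \<forall>B\<subseteq>{1..n}. \<kappa> i x B = of_bool ((B, i) = p)"
      by (rule allI, rule surj)
    then obtain X where "\<forall>p. \<forall>i<N. \<forall>B\<subseteq>{1..n}. \<kappa> i (X p) B = of_bool ((B, i) = p)"
      by (rule choice [THEN exE])
    then have X: "\<And>p i B. i < N \<Longrightarrow> B \<subseteq> {1..n} \<Longrightarrow> \<kappa> i (X p) B = of_bool ((B, i) = p)"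
      by blast
    have k0: "\<kappa> i 0 B = 0" for i B using sca [of i 0 0 B] by simp
    have ksum: "\<kappa> i (\<Sum>p\<in>J. f p) B = (\<Sum>p\<in>J. \<kappa> i (f p) B)" for i B J and f :: "nat set \<times> nat \<Rightarrow> 'v"
      by (induction J rule: infinite_finite_induct) (simp_all add: k0 add)
    have kX: "\<kappa> i (\<Sum>p\<in>?I. scale (t p) (X p)) B = t (B, i)" if "i < N" "B \<subseteq> {1..n}" for i B t
    proof -
      have "\<kappa> i (\<Sum>p\<in>?I. scale (t p) (X p)) B = (\<Sum>p\<in>?I. if (B, i) = p then t p else 0)"
        unfolding ksum sca by (intro sum.cong refl) (use that in \<open>auto simp: X\<close>)
      then show ?thesis using that by simp
    qed
    have injX: "inj_on X ?I"
    proof (rule inj_onI)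
      fix p q assume pq: "p \<in> ?I" "q \<in> ?I" "X p = X q"
      obtain B i where p: "p = (B, i)" by (cases p)
      have "\<kappa> i (X p) B = 1" using X [of i B p] pq p by auto
      then have "\<kappa> i (X q) B = 1" using pq by simp
      then show "p = q" using X [of i B q] pq p by (auto split: if_splits simp: of_bool_def)
    qed
    have ind: "independent (X ` ?I)"
    proof (rule independent_if_scalars_zero)
      fix t x assume z: "(\<Sum>x\<in>X ` ?I. scale (t x) x) = 0" and x: "x \<in> X ` ?I"
      then obtain B i where Bi: "x = X (B, i)" "i < N" "B \<subseteq> {1..n}" by auto
      have "(\<Sum>p\<in>?I. scale (t (X p)) (X p)) = 0" using z unfolding sum.reindex [OF injX] by (simp only: o_def)
      then have "\<kappa> i (\<Sum>p\<in>?I. scale ((t \<circ> X) p) (X p)) B = 0" using k0 by simp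
      then show "t x = 0" unfolding kX [OF Bi(2,3)] by (simp add: Bi)
    qed simp
    have "x \<in> span (X ` ?I)" for x
    proof -
      have "x - (\<Sum>p\<in>?I. scale (\<kappa> (snd p) x (fst p)) (X p)) = 0"
      proof (rule inj)
        fix i B assume "i < N" "B \<subseteq> {1..n}"
        then have "\<kappa> i (\<Sum>p\<in>?I. scale (\<kappa> (snd p) x (fst p)) (X p)) B = \<kappa> i x B"
          by (subst kX) auto
        moreover have "\<kappa> i (x - y) B = \<kappa> i x B - \<kappa> i y B" for y
          using add [of i "x - y" y B] by simp
        ultimately show "\<kappa> i (x - (\<Sum>p\<in>?I. scale (\<kappa> (snd p) x (fst p)) (X p))) B = 0" by simp
      qed
      then have "x = (\<Sum>p\<in>?I. scale (\<kappa> (snd p) x (fst p)) (X p))" by simp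
      also have "\<dots> \<in> span (X ` ?I)" by (intro span_sum span_scale span_base imageI)
      finally show ?thesis .
    qed
    then have "dim (UNIV :: 'v set) = card (X ` ?I)"
      by (intro dim_unique [OF _ _ ind]) auto
    also have "\<dots> = 2 ^ n * N" unfolding card_image [OF injX] by (simp add: card_cartesian_product card_Pow)
    finally show ?thesis by simp
  qed
  have kc: "\<kappa> i (c a x) B = (if a \<in> B then 0 else ksign a B * \<kappa> i x (insert a B))" if "a \<in> {1..n}" for i a x B
  proof (cases "B \<subseteq> {1..n}")
    case True
    then have "0 \<notin> B" "insert a B \<subseteq> {1..n}" using that by auto
    then show ?thesis using True that by (auto simp: \<kappa>_def vac_coord_c R_scale kaA R_0)
  next
    case False
    then show ?thesis by (auto simp: \<kappa>_def)
  qed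
  have kcd: "\<kappa> i (cd a x) B = (if a \<in> B then ksign a B * \<kappa> i x (B - {a}) else 0)" if "a \<in> {1..n}" for i a x B
  proof (cases "B \<subseteq> {1..n}")
    case True
    then have "0 \<notin> B" "B - {a} \<subseteq> {1..n}" using that by auto
    then show ?thesis using True that by (auto simp: \<kappa>_def vac_coord_cd R_scale kaA R_0)
  next
    case False
    then have "\<not> B - {a} \<subseteq> {1..n}" using that by auto
    with False show ?thesis by (auto simp: \<kappa>_def)
  qed
  have ksupp: "B \<subseteq> {1..n}" if "\<kappa> i x B \<noteq> 0" for i x B using that by (auto simp: \<kappa>_def split: if_splits)
  have inj': "\<forall>x. (\<forall>i<N. \<forall>B\<subseteq>{1..n}. \<kappa> i x B = 0) \<longrightarrow> x = 0"
    by (intro allI impI inj) simp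
  show ?thesis
    by (rule exI [of _ N], rule exI [of _ \<kappa>], intro conjI inj' dimN; intro allI impI)
       (rule add sca kc kcd ksupp surj; assumption)+
qed

end

section \<open>Transporting a decomposition along coordinate maps\<close>

lemma so_rep_D:
  assumes "so_representation scale m \<rho> V"
  shows "module.subspace scale V"
    "a \<in> {1..m} \<Longrightarrow> b \<in> {1..m} \<Longrightarrow> x \<in> V \<Longrightarrow> \<rho> a b x \<in> V"
  using so_representation.subspace_V [OF assms] so_representation.maps_to [OF assms] by auto

text \<open>
  A representation \<open>M\<close> that is identified, by its coordinate maps \<open>\<Phi> i\<close>, with the product of irreducible
  representations \<open>H i\<close> on Fock space.
\<close>

locale coordinate_maps = vector_space scale
  for scale :: "complex \<Rightarrow> 'f::ab_group_add \<Rightarrow> 'f" +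
  fixes m :: nat and \<rho> :: "nat \<Rightarrow> nat \<Rightarrow> 'f \<Rightarrow> 'f" and M :: "'f set"
    and I :: "'i set" and H :: "'i \<Rightarrow> fock set" and \<Phi> :: "'i \<Rightarrow> 'f \<Rightarrow> fock"
    and wt :: "'i \<Rightarrow> nat \<Rightarrow> complex"
  assumes finI: "finite I" and subM: "subspace M"
    and \<Phi>_add: "i \<in> I \<Longrightarrow> x \<in> M \<Longrightarrow> y \<in> M \<Longrightarrow> \<Phi> i (x + y) = \<Phi> i x + \<Phi> i y"
    and \<Phi>_scale: "i \<in> I \<Longrightarrow> x \<in> M \<Longrightarrow> \<Phi> i (scale z x) = z \<odot> \<Phi> i x"
    and \<rho>_M: "a \<in> {1..m} \<Longrightarrow> b \<in> {1..m} \<Longrightarrow> x \<in> M \<Longrightarrow> \<rho> a b x \<in> M"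
    and \<Phi>_\<rho>: "i \<in> I \<Longrightarrow> a \<in> {1..m} \<Longrightarrow> b \<in> {1..m} \<Longrightarrow> x \<in> M \<Longrightarrow> \<Phi> i (\<rho> a b x) = rho_fock m a b (\<Phi> i x)"
    and \<Phi>_H: "i \<in> I \<Longrightarrow> x \<in> M \<Longrightarrow> \<Phi> i x \<in> H i"
    and inj: "x \<in> M \<Longrightarrow> (\<And>i. i \<in> I \<Longrightarrow> \<Phi> i x = 0) \<Longrightarrow> x = 0"
    and surj: "(\<And>i. i \<in> I \<Longrightarrow> \<psi> i \<in> H i) \<Longrightarrow> \<exists>x\<in>M. \<forall>i\<in>I. \<Phi> i x = \<psi> i"
    and irr: "i \<in> I \<Longrightarrow> so_irreducible_with_highest_weight smul m (rho_fock m) (wt i) (H i)"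
begin

lemma M_closed: "x \<in> M \<Longrightarrow> y \<in> M \<Longrightarrow> x + y \<in> M" "x \<in> M \<Longrightarrow> y \<in> M \<Longrightarrow> x - y \<in> M"
  "x \<in> M \<Longrightarrow> scale z x \<in> M" "0 \<in> M" "x \<in> M \<Longrightarrow> - x \<in> M"
  using subM by (auto intro: subspace_add subspace_diff subspace_scale subspace_0 subspace_neg)

lemma \<Phi>_neg: "i \<in> I \<Longrightarrow> x \<in> M \<Longrightarrow> \<Phi> i (- x) = - \<Phi> i x"
  using \<Phi>_scale [of i x "- 1"] by simp

lemma \<Phi>_diff: "i \<in> I \<Longrightarrow> x \<in> M \<Longrightarrow> y \<in> M \<Longrightarrow> \<Phi> i (x - y) = \<Phi> i x - \<Phi> i y"
  using \<Phi>_add [of i x "- y"] \<Phi>_neg [of i y] M_closed(5) by simp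

lemma \<Phi>_0: "i \<in> I \<Longrightarrow> \<Phi> i 0 = 0"
  using \<Phi>_scale [of i 0 0] M_closed(4) by simp

lemma eqI: "x \<in> M \<Longrightarrow> y \<in> M \<Longrightarrow> (\<And>i. i \<in> I \<Longrightarrow> \<Phi> i x = \<Phi> i y) \<Longrightarrow> x = y"
  using inj [of "x - y"] \<Phi>_diff M_closed(2) by simp

text \<open>
  The relations of the Lie algebra hold on \<open>M\<close> because they hold for all coordinates.
\<close>

lemma representation_sub:
  assumes "subspace U" "U \<subseteq> M" "\<And>a b x. a \<in> {1..m} \<Longrightarrow> b \<in> {1..m} \<Longrightarrow> x \<in> U \<Longrightarrow> \<rho> a b x \<in> U"
  shows "so_representation scale m \<rho> U"
proof unfold_locales
  show "subspace U" by fact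
  fix a b assume ab: "a \<in> {1..m}" "b \<in> {1..m}"
  { fix x assume "x \<in> U" with ab show "\<rho> a b x \<in> U" by (rule assms(3)) }
  { fix x y assume "x \<in> U" "y \<in> U"
    then have xy: "x \<in> M" "y \<in> M" using assms(2) by auto
    show "\<rho> a b (x + y) = \<rho> a b x + \<rho> a b y"
      by (rule eqI; (intro \<rho>_M M_closed ab xy)?; simp only: xy ab \<rho>_M M_closed \<Phi>_add \<Phi>_\<rho> rho_fock_rules) }
  { fix x z assume "x \<in> U"
    then have x: "x \<in> M" using assms(2) by auto
    show "\<rho> a b (scale z x) = scale z (\<rho> a b x)"
      by (rule eqI; (intro \<rho>_M M_closed ab x)?; simp only: x ab \<rho>_M M_closed \<Phi>_scale \<Phi>_\<rho> rho_fock_rules) }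
  { fix x assume "x \<in> U"
    then have x: "x \<in> M" using assms(2) by auto
    show "\<rho> b a x = - \<rho> a b x"
      by (rule eqI; (intro \<rho>_M M_closed ab x)?; simp only: x ab \<rho>_M M_closed \<Phi>_neg \<Phi>_\<rho> rho_fock_skew [OF ab]) }
  fix c d x assume cd: "c \<in> {1..m}" "d \<in> {1..m}" and "x \<in> U"
  then have x: "x \<in> M" using assms(2) by auto
  show "\<rho> a b (\<rho> c d x) - \<rho> c d (\<rho> a b x) =
        scale (of_bool (b = c)) (\<rho> a d x) - scale (of_bool (b = d)) (\<rho> a c x)
        - scale (of_bool (a = c)) (\<rho> b d x) + scale (of_bool (a = d)) (\<rho> b c x)" (is "?l = ?r")
  proof (rule eqI)
    note mem = ab cd x \<rho>_M M_closed
    show "?l \<in> M" "?r \<in> M" by (intro mem)+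
    fix i assume i: "i \<in> I"
    have l: "\<Phi> i ?l = rho_fock m a b (rho_fock m c d (\<Phi> i x)) - rho_fock m c d (rho_fock m a b (\<Phi> i x))"
      by (simp only: \<Phi>_diff \<Phi>_\<rho> i mem)
    have r: "\<Phi> i ?r = of_bool (b = c) \<odot> rho_fock m a d (\<Phi> i x) - of_bool (b = d) \<odot> rho_fock m a c (\<Phi> i x)
        - of_bool (a = c) \<odot> rho_fock m b d (\<Phi> i x) + of_bool (a = d) \<odot> rho_fock m b c (\<Phi> i x)"
      by (simp only: \<Phi>_diff \<Phi>_add \<Phi>_scale \<Phi>_\<rho> i mem)
    show "\<Phi> i ?l = \<Phi> i ?r" unfolding l r by (rule rho_fock_bracket [OF ab cd])
  qed
qed

lemma representation_M: "so_representation scale m \<rho> M"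
  by (rule representation_sub) (auto simp: subM intro: \<rho>_M)

definition W :: "'i \<Rightarrow> 'f set" where
  "W i = {x \<in> M. \<forall>j\<in>I - {i}. \<Phi> j x = 0}"

lemma W_M: "W i \<subseteq> M" by (auto simp: W_def)

lemma subW: "subspace (W i)"
  unfolding subspace_def W_def
  by (auto simp: M_closed \<Phi>_add \<Phi>_scale \<Phi>_0)

lemma \<rho>_W: "a \<in> {1..m} \<Longrightarrow> b \<in> {1..m} \<Longrightarrow> x \<in> W i \<Longrightarrow> \<rho> a b x \<in> W i"
  by (simp add: W_def \<rho>_M \<Phi>_\<rho> rho_fock_rules del: atLeastAtMost_iff)

lemma W_eqI: "i \<in> I \<Longrightarrow> x \<in> W i \<Longrightarrow> y \<in> W i \<Longrightarrow> \<Phi> i x = \<Phi> i y \<Longrightarrow> x = y"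
proof (rule eqI)
  fix j assume *: "i \<in> I" "x \<in> W i" "y \<in> W i" "\<Phi> i x = \<Phi> i y" "j \<in> I"
  show "\<Phi> j x = \<Phi> j y"
  proof (cases "j = i")
    case False
    with * have "\<Phi> j x = 0" "\<Phi> j y = 0" by (auto simp: W_def)
    then show ?thesis by (rule trans [OF _ sym])
  qed (use * in simp)
qed (auto simp: W_def)

lemma W_surj:
  assumes "i \<in> I" "v \<in> H i"
  shows "\<exists>x\<in>W i. \<Phi> i x = v"
proof -
  have "0 \<in> H j" if "j \<in> I" for j using \<Phi>_H [OF that M_closed(4)] \<Phi>_0 [OF that] by simp
  then have "\<exists>x\<in>M. \<forall>j\<in>I. \<Phi> j x = (if j = i then v else 0)"
    using assms by (intro surj) auto
  then obtain x where x: "x \<in> M" "\<forall>j\<in>I. \<Phi> j x = (if j = i then v else 0)" by blast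
  have "\<Phi> j x = 0" if "j \<in> I - {i}" for j using x(2) that by simp
  then have "x \<in> W i" using x(1) unfolding W_def by blast
  moreover have "\<Phi> i x = v" using x(2) assms(1) by simp
  ultimately show ?thesis by blast
qed

lemma bij_W: "i \<in> I \<Longrightarrow> bij_betw (\<Phi> i) (W i) (H i)"
  unfolding bij_betw_def inj_on_def using W_eqI W_surj \<Phi>_H W_M by (fastforce simp: image_iff)

lemma direct_sum: "internal_direct_sum M I W"
  unfolding internal_direct_sum_def
proof (intro conjI allI impI ballI)
  have sumM: "(\<Sum>j\<in>J. w j) \<in> M" if "\<forall>j\<in>J. w j \<in> M" for w :: "'i \<Rightarrow> 'f" and J
    using that subM by (intro subspace_sum) auto
  have \<Phi>_sum: "\<Phi> i (\<Sum>j\<in>J. w j) = (\<Sum>j\<in>J. \<Phi> i (w j))" if "i \<in> I" "finite J" "\<forall>j\<in>J. w j \<in> M" for i and w :: "'i \<Rightarrow> 'f" and J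
    using that(2,3)
  proof (induction J rule: finite_induct)
    case (insert j J)
    have "\<Phi> i (w j + sum w J) = \<Phi> i (w j) + \<Phi> i (sum w J)"
      by (rule \<Phi>_add [OF that(1)]) (use insert.prems sumM [of J w] in blast)+
    also have "\<Phi> i (sum w J) = (\<Sum>j\<in>J. \<Phi> i (w j))" using insert by (intro insert.IH) blast
    finally show ?case unfolding sum.insert [OF insert.hyps] .
  qed (simp add: \<Phi>_0 that(1))
  have \<Phi>_W: "\<Phi> i (\<Sum>j\<in>I. w j) = \<Phi> i (w i)" if "i \<in> I" "\<forall>j\<in>I. w j \<in> W j" for i w
  proof -
    have "\<Phi> i (\<Sum>j\<in>I. w j) = (\<Sum>j\<in>I. \<Phi> i (w j))"
      by (rule \<Phi>_sum [OF that(1) finI]) (use that(2) in \<open>auto simp: W_def\<close>)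
    also have "\<dots> = (\<Sum>j\<in>I. if j = i then \<Phi> i (w i) else 0)"
    proof (rule sum.cong [OF refl])
      fix j assume j: "j \<in> I"
      have "\<Phi> i (w j) = 0" if "j \<noteq> i"
        using \<open>\<forall>j\<in>I. w j \<in> W j\<close> j \<open>i \<in> I\<close> that unfolding W_def by blast
      then show "\<Phi> i (w j) = (if j = i then \<Phi> i (w i) else 0)" by (cases "j = i") simp_all
    qed
    finally show ?thesis unfolding sum.delta' [OF finI] sum.delta [OF finI] using that(1) by simp
  qed
  show "M = {\<Sum>i\<in>I. w i | w. \<forall>i\<in>I. w i \<in> W i}"
  proof (intro set_eqI iffI)
    fix x assume x: "x \<in> M"
    have "\<forall>i. \<exists>y. i \<in> I \<longrightarrow> y \<in> W i \<and> \<Phi> i y = \<Phi> i x" using W_surj \<Phi>_H [OF _ x] by blast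
    then obtain w where w: "\<And>i. i \<in> I \<Longrightarrow> w i \<in> W i \<and> \<Phi> i (w i) = \<Phi> i x" by metis
    have "x = (\<Sum>i\<in>I. w i)"
      using w W_M x by (intro eqI sumM) (auto simp: \<Phi>_W)
    then show "x \<in> {\<Sum>i\<in>I. w i | w. \<forall>i\<in>I. w i \<in> W i}" using w by blast
  next
    fix x assume "x \<in> {\<Sum>i\<in>I. w i | w. \<forall>i\<in>I. w i \<in> W i}"
    then show "x \<in> M" using W_M sumM by blast
  qed
  fix w i assume w: "\<forall>i\<in>I. w i \<in> W i" and 0: "(\<Sum>i\<in>I. w i) = 0" and i: "i \<in> I"
  have "\<Phi> i (w i) = 0" using \<Phi>_W [OF i w] 0 \<Phi>_0 [OF i] by simp
  moreover have "\<Phi> j (w i) = 0" if "j \<in> I" "j \<noteq> i" for j using w i that by (auto simp: W_def)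
  ultimately show "w i = 0" using w W_M i by (intro inj) blast+
qed

lemma image_representation:
  assumes i: "i \<in> I" and U: "so_representation scale m \<rho> U" "U \<subseteq> M"
  shows "so_representation smul m (rho_fock m) (\<Phi> i ` U)"
proof unfold_locales
  note sU = so_rep_D(1) [OF U(1)]
  show "fock.subspace (\<Phi> i ` U)"
    unfolding fock.subspace_def
  proof (intro conjI ballI allI)
    show "0 \<in> \<Phi> i ` U" using subspace_0 [OF sU] \<Phi>_0 [OF i] by force
    fix x assume "x \<in> \<Phi> i ` U"
    then obtain u where u: "u \<in> U" "x = \<Phi> i u" by auto
    { fix z
      have "z \<odot> x = \<Phi> i (scale z u)" using u i U(2) by (auto simp: \<Phi>_scale)
      then show "z \<odot> x \<in> \<Phi> i ` U" using subspace_scale [OF sU u(1)] by auto }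
    fix y assume "y \<in> \<Phi> i ` U"
    then obtain v where v: "v \<in> U" "y = \<Phi> i v" by auto
    have "u \<in> M" "v \<in> M" using u v U(2) by auto
    then have "x + y = \<Phi> i (u + v)" unfolding u(2) v(2) by (rule \<Phi>_add [OF i, symmetric])
    then show "x + y \<in> \<Phi> i ` U" using subspace_add [OF sU u(1) v(1)] by auto
  qed
  fix a b x assume ab: "a \<in> {1..m}" "b \<in> {1..m}" and "x \<in> \<Phi> i ` U"
  then obtain u where u: "u \<in> U" "x = \<Phi> i u" by auto
  then have "rho_fock m a b x = \<Phi> i (\<rho> a b u)" using \<Phi>_\<rho> [OF i ab] U(2) by auto
  then show "rho_fock m a b x \<in> \<Phi> i ` U" using so_rep_D(2) [OF U(1) ab u(1)] by auto
next
  fix a b x assume "a \<in> {1..m}" "b \<in> {1..m}"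
  then show "rho_fock m b a x = - rho_fock m a b x" by (rule rho_fock_skew)
qed (simp_all add: rho_fock_rules rho_fock_bracket)

lemma transport_hw:
  assumes i: "i \<in> I" and x: "x \<in> W i" and hw: "highest_weight_vector smul m (rho_fock m) w (\<Phi> i x)"
  shows "highest_weight_vector scale m \<rho> w x"
proof -
  define n where "n = m div 2"
  have ix: "2 * a - 1 \<in> {1..m}" "2 * a \<in> {1..m}" if "a \<in> {1..n}" for a
    using that by (auto simp: n_def)
  have xM: "x \<in> M" using x W_M by auto
  have W0: "0 \<in> W i" using subspace_0 [OF subW] .
  note clos = subspace_scale [OF subW] subspace_add [OF subW] subspace_diff [OF subW] \<rho>_W x
  note mem = M_closed \<rho>_M xM
  have z: "y = 0" if "y \<in> W i" "\<Phi> i y = 0" for y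
    using W_eqI [OF i that(1) W0] that \<Phi>_0 [OF i] by simp
  have H: "cartan_H scale \<rho> a x = scale (w a) x" if a: "a \<in> {1..n}" for a
  proof (rule W_eqI [OF i])
    show "cartan_H scale \<rho> a x \<in> W i" "scale (w a) x \<in> W i"
      unfolding cartan_H_def by (intro clos ix a)+
    show "\<Phi> i (cartan_H scale \<rho> a x) = \<Phi> i (scale (w a) x)"
      using hw a unfolding highest_weight_vector_def cartan_H_def n_def [symmetric]
      by (simp only: \<Phi>_scale \<Phi>_\<rho> i ix mem)
  qed
  have X: "root_X scale \<rho> a b x = 0" if ab: "a \<in> {1..n}" "b \<in> {1..n}" "a < b" for a b
  proof (rule z)
    show "root_X scale \<rho> a b x \<in> W i" unfolding root_X_def by (intro clos ix ab)
    have "\<Phi> i (root_X scale \<rho> a b x) = root_X smul (rho_fock m) a b (\<Phi> i x)"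
      unfolding root_X_def by (simp only: \<Phi>_scale \<Phi>_add \<Phi>_diff \<Phi>_\<rho> i ix mem ab)
    then show "\<Phi> i (root_X scale \<rho> a b x) = 0"
      using hw ab unfolding highest_weight_vector_def n_def [symmetric] by metis
  qed
  have Y: "root_Y scale \<rho> a b x = 0" if ab: "a \<in> {1..n}" "b \<in> {1..n}" "a \<noteq> b" for a b
  proof (rule z)
    show "root_Y scale \<rho> a b x \<in> W i" unfolding root_Y_def by (intro clos ix ab)
    have "\<Phi> i (root_Y scale \<rho> a b x) = root_Y smul (rho_fock m) a b (\<Phi> i x)"
      unfolding root_Y_def by (simp only: \<Phi>_scale \<Phi>_add \<Phi>_diff \<Phi>_\<rho> i ix mem ab)
    then show "\<Phi> i (root_Y scale \<rho> a b x) = 0"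
      using hw ab unfolding highest_weight_vector_def n_def [symmetric] by metis
  qed
  have U: "root_U scale m \<rho> a x = 0" if a: "a \<in> {1..n}" and o: "odd m" for a
  proof (rule z)
    have mm: "m \<in> {1..m}" using o by (cases m) auto
    show "root_U scale m \<rho> a x \<in> W i" unfolding root_U_def by (intro clos ix a mm)
    have "\<Phi> i (root_U scale m \<rho> a x) = root_U smul m (rho_fock m) a (\<Phi> i x)"
      unfolding root_U_def by (simp only: \<Phi>_scale \<Phi>_add \<Phi>_diff \<Phi>_\<rho> i ix mem a mm)
    then show "\<Phi> i (root_U scale m \<rho> a x) = 0"
      using hw a o unfolding highest_weight_vector_def n_def [symmetric] by metis
  qed
  have "x \<noteq> 0" using hw \<Phi>_0 [OF i] by (auto simp: highest_weight_vector_def)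
  then show ?thesis
    unfolding highest_weight_vector_def n_def [symmetric] using H X Y U by blast
qed

lemma irreducible_W:
  assumes i: "i \<in> I"
  shows "so_irreducible_with_highest_weight scale m \<rho> (wt i) (W i)"
proof -
  from irr [OF i] obtain v where v: "v \<in> H i" "highest_weight_vector smul m (rho_fock m) (wt i) v"
    and Hirr: "so_irreducible smul m (rho_fock m) (H i)"
    by (auto simp: so_irreducible_with_highest_weight_def)
  obtain x where x: "x \<in> W i" "\<Phi> i x = v" using W_surj [OF i v(1)] by blast
  have hw: "highest_weight_vector scale m \<rho> (wt i) x"
    by (rule transport_hw [OF i x(1)]) (simp add: x v)
  have "so_irreducible scale m \<rho> (W i)"
    unfolding so_irreducible_def
  proof (intro conjI allI impI)
    show "so_representation scale m \<rho> (W i)"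
      by (intro representation_sub subW W_M \<rho>_W)
    show "W i \<noteq> {0}" using x hw by (auto simp: highest_weight_vector_def)
    fix U assume U: "U \<subseteq> W i" "so_representation scale m \<rho> U"
    have UM: "U \<subseteq> M" using U(1) W_M by blast
    have "so_representation smul m (rho_fock m) (\<Phi> i ` U)"
      by (rule image_representation [OF i U(2) UM])
    moreover have "\<Phi> i ` U \<subseteq> H i" using UM \<Phi>_H [OF i] by auto
    ultimately have "\<Phi> i ` U = {0} \<or> \<Phi> i ` U = H i"
      using Hirr unfolding so_irreducible_def by blast
    then show "U = {0} \<or> U = W i"
    proof
      assume "\<Phi> i ` U = {0}"
      then have "\<Phi> i u = \<Phi> i 0" if "u \<in> U" for u using that \<Phi>_0 [OF i] by auto
      then have "u = 0" if "u \<in> U" for u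
        using W_eqI [OF i, of u 0] that U(1) subspace_0 [OF subW] by blast
      then show ?thesis using subspace_0 [OF so_rep_D(1) [OF U(2)]] by blast
    next
      assume *: "\<Phi> i ` U = H i"
      have "y \<in> U" if y: "y \<in> W i" for y
      proof -
        have "\<Phi> i y \<in> \<Phi> i ` U" unfolding * using \<Phi>_H [OF i] y W_M by auto
        then obtain u where "u \<in> U" "\<Phi> i y = \<Phi> i u" by auto
        then show ?thesis using W_eqI [OF i y, of u] U(1) by auto
      qed
      then show ?thesis using U(1) by auto
    qed
  qed
  with hw x(1) show ?thesis by (auto simp: so_irreducible_with_highest_weight_def)
qed

lemma isomorphic_W:
  assumes i: "i \<in> I" and j: "j \<in> I" and H: "H i = H j"
  shows "so_isomorphic scale m \<rho> (W i) (W j)"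
proof -
  define \<phi> where "\<phi> = inv_into (W j) (\<Phi> j) \<circ> \<Phi> i"
  have bij: "bij_betw \<phi> (W i) (W j)"
    unfolding \<phi>_def using bij_W [OF i] bij_betw_inv_into [OF bij_W [OF j]] H
    by (metis bij_betw_trans)
  have mem: "\<phi> x \<in> W j" and eq: "\<Phi> j (\<phi> x) = \<Phi> i x" if "x \<in> W i" for x
  proof -
    have "\<Phi> i x \<in> \<Phi> j ` W j" using bij_W [OF i] bij_W [OF j] H that by (auto simp: bij_betw_def)
    then show "\<phi> x \<in> W j" "\<Phi> j (\<phi> x) = \<Phi> i x"
      unfolding \<phi>_def by (simp_all add: inv_into_into f_inv_into_f)
  qed
  have WM: "x \<in> W l \<Longrightarrow> x \<in> M" for x l using W_M by auto
  note clos = subspace_add [OF subW] subspace_scale [OF subW] \<rho>_W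
  show ?thesis
    unfolding so_isomorphic_def
  proof (intro exI [of _ \<phi>] conjI ballI allI bij)
    fix x assume x: "x \<in> W i"
    { fix y assume y: "y \<in> W i"
      have xy: "x + y \<in> W i" by (intro clos x y)
      show "\<phi> (x + y) = \<phi> x + \<phi> y"
        by (rule W_eqI [OF j mem [OF xy]])
           (simp_all add: clos mem x y eq [OF xy] eq [OF x] eq [OF y] \<Phi>_add i j WM [OF x] WM [OF y] WM [OF mem [OF x]] WM [OF mem [OF y]]) }
    { fix z
      have zx: "scale z x \<in> W i" by (intro clos x)
      show "\<phi> (scale z x) = scale z (\<phi> x)"
        by (rule W_eqI [OF j mem [OF zx]])
           (simp_all add: clos mem x eq [OF zx] eq [OF x] \<Phi>_scale i j WM [OF x] WM [OF mem [OF x]]) }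
    fix a b assume ab: "a \<in> {1..m}" "b \<in> {1..m}"
    have rx: "\<rho> a b x \<in> W i" by (intro clos ab x)
    show "\<phi> (\<rho> a b x) = \<rho> a b (\<phi> x)"
    proof (rule W_eqI [OF j mem [OF rx]])
      show "\<rho> a b (\<phi> x) \<in> W j" by (intro clos ab mem x)
      show "\<Phi> j (\<phi> (\<rho> a b x)) = \<Phi> j (\<rho> a b (\<phi> x))"
        unfolding eq [OF rx] \<Phi>_\<rho> [OF i ab WM [OF x]] \<Phi>_\<rho> [OF j ab WM [OF mem [OF x]]] eq [OF x] ..
    qed
  qed
qed

text \<open>
  \<open>J\<close> selects the indices of one isomorphism type; for even \<open>m\<close> there are two.
\<close>

lemma isomorphic_irreducibles_W:
  assumes "J \<subseteq> I" "\<And>i j. i \<in> J \<Longrightarrow> j \<in> J \<Longrightarrow> H i = H j" "\<And>i. i \<in> J \<Longrightarrow> wt i = w"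
  shows "isomorphic_irreducibles scale m \<rho> w J W"
  unfolding isomorphic_irreducibles_def
proof (intro conjI ballI)
  fix i assume i: "i \<in> J"
  then have iI: "i \<in> I" using assms(1) by blast
  show "so_irreducible_with_highest_weight scale m \<rho> w (W i)"
    using irreducible_W [OF iI] assms(3) [OF i] by simp
  fix j assume j: "j \<in> J"
  then have jI: "j \<in> I" using assms(1) by blast
  show "so_isomorphic scale m \<rho> (W i) (W j)" by (rule isomorphic_W [OF iI jI assms(2) [OF i j]])
qed

end

section \<open>Splitting spinors by parity\<close>

definition par_proj :: "bool set \<Rightarrow> fock \<Rightarrow> fock" where
  "par_proj Q f = (\<lambda>\<alpha> B. if even (card B) \<in> Q then f \<alpha> B else 0)"

lemma par_proj_fock_par: "par_proj Q f \<in> fock_par Q"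
  by (auto simp: par_proj_def fock_par_def supported_def)

lemma par_proj_fock_deg: "f \<in> fock_deg m k \<Longrightarrow> par_proj Q f \<in> fock_deg m k"
  by (auto simp: par_proj_def fock_deg_def supported_def)

lemma par_proj_lin: "fock_linear (par_proj Q)"
  by (auto simp: fock_linear_def par_proj_def fun_eq_iff)

lemma par_proj_split: "f = par_proj Q f + par_proj (- Q) f"
  by (rule fock_eqI) (simp add: par_proj_def)

lemma par_proj_unique: "f \<in> fock_par Q \<Longrightarrow> g \<in> fock_par (- Q) \<Longrightarrow> par_proj Q (f + g) = f"
  by (rule fock_eqI) (auto simp: par_proj_def fock_par_def supported_def)

lemma fock_par_disjoint: "f \<in> fock_par Q \<Longrightarrow> g \<in> fock_par (- Q) \<Longrightarrow> f + g = 0 \<Longrightarrow> f = 0"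
  using par_proj_unique [of f Q g] lin_0 [OF par_proj_lin] by simp

lemma par_proj_rho_fock:
  assumes "valid_parity m Q" "valid_parity m (- Q)" "f \<in> fock_deg m k" "a \<in> {1..m}" "b \<in> {1..m}"
  shows "par_proj Q (rho_fock m a b f) = rho_fock m a b (par_proj Q f)"
proof -
  have "rho_fock m a b f = rho_fock m a b (par_proj Q f) + rho_fock m a b (par_proj (- Q) f)"
    using arg_cong [OF par_proj_split [of f Q], of "rho_fock m a b"] unfolding rho_fock_rules(1) .
  then show ?thesis
    using par_proj_unique [OF fock_par_rho_fock [OF assms(1) par_proj_fock_par par_proj_fock_deg [OF assms(3)] assms(4,5)]
        fock_par_rho_fock [OF assms(2) par_proj_fock_par par_proj_fock_deg [OF assms(3)] assms(4,5)]] by simp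
qed

lemma fock_par_dirac_fock:
  assumes "even m" "f \<in> fock_par Q" "f \<in> fock_deg m k"
  shows "dirac_fock m f \<in> fock_par (Not ` Q)"
proof -
  have "gam m a (dop a f) \<in> fock_par (Not ` Q)" if "a \<in> {1..m}" for a
  proof (cases k)
    case 0
    then show ?thesis using assms fock_deg_dop_0 [of f m a] by (simp add: gam_rules fock_par_closed)
  next
    case (Suc j)
    then have "dop a f \<in> fock_deg m j" using assms fock_deg_dop by simp
    with assms show ?thesis by (simp add: gam_def fock_par_theta fock_par_dop)
  qed
  then show ?thesis
    unfolding dirac_fock_def fock_par_def by (intro supported_closed) auto
qed

text \<open>
  The Dirac operator reverses the parity, so it vanishes on both parts of a monogenic polynomial separately.
\<close>

lemma par_proj_fock_monogenics:
  assumes "even m" "f \<in> fock_deg m k" "dirac_fock m f = 0"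
  shows "par_proj Q f \<in> fock_monogenics m k Q"
proof -
  have N: "Not ` (- Q) = - (Not ` Q)" by auto
  have "dirac_fock m (par_proj Q f) + dirac_fock m (par_proj (- Q) f) = 0"
    using arg_cong [OF par_proj_split [of f Q], of "dirac_fock m"] assms(3) unfolding dirac_fock_rules(1) by simp
  moreover have "dirac_fock m (par_proj Q f) \<in> fock_par (Not ` Q)"
    by (rule fock_par_dirac_fock [OF assms(1) par_proj_fock_par par_proj_fock_deg [OF assms(2)]])
  moreover have "dirac_fock m (par_proj (- Q) f) \<in> fock_par (- (Not ` Q))"
    using fock_par_dirac_fock [OF assms(1) par_proj_fock_par [of "- Q"] par_proj_fock_deg [OF assms(2)]] unfolding N .
  ultimately have "dirac_fock m (par_proj Q f) = 0" using fock_par_disjoint by blast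
  then show ?thesis using par_proj_fock_par par_proj_fock_deg [OF assms(2)] by (simp add: fock_monogenics_def)
qed

section \<open>The Euler operator and the commuting variables\<close>

context clifford_algebra
begin

lemma Gam_F: "f \<in> F \<Longrightarrow> Gam a f \<in> F"
  using linFD(1) [OF linF_Gam] .

lemma yF_F: "j \<in> {1..m} \<Longrightarrow> f \<in> F \<Longrightarrow> yF j f \<in> F" and dF_F: "j \<in> {1..m} \<Longrightarrow> f \<in> F \<Longrightarrow> dF j f \<in> F"
  using linFD(1) [OF linF_yF] linFD(1) [OF linF_dF] by blast+

lemma euler_yF:
  assumes "j \<in> {1..m}" "f \<in> F"
  shows "euler (yF j f) = yF j (euler f) + yF j f"
proof -
  have dFF: "dF i f \<in> F" if "i \<in> {1..m}" for i using that assms by (intro dF_F)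
  have "yF j (euler f) = (\<Sum>i = 1..m. yF j (yF i (dF i f)))"
    unfolding euler_eq [OF assms(2)]
    by (rule linF_apply_sum [OF linF_yF [OF assms(1)]]) (intro yF_F dFF)
  then have "yF j (euler f) + yF j f = (\<Sum>i = 1..m. yF j (yF i (dF i f)) + (if i = j then yF j f else 0))"
    using assms(1) by (simp add: sum.distrib)
  also have "\<dots> = (\<Sum>i = 1..m. yF i (dF i (yF j f)))"
  proof (rule sum.cong [OF refl])
    fix i assume i: "i \<in> {1..m}"
    have "yF i (dF i (yF j f)) = yF i (yF j (dF i f) + fscale (of_bool (i = j)) f)"
      by (simp only: dF_yF [OF i assms])
    also have "\<dots> = yF i (yF j (dF i f)) + fscale (of_bool (i = j)) (yF i f)"
      using i assms dFF [OF i]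
      by (simp only: linFD [OF linF_yF [OF i]] yF_F F_scale)
    finally show "yF j (yF i (dF i f)) + (if i = j then yF j f else 0) = yF i (dF i (yF j f))"
      by (simp add: yF_yF [OF assms(1) i dFF [OF i]])
  qed
  finally show ?thesis using euler_eq [OF yF_F [OF assms]] by simp
qed

lemma euler_Gam:
  assumes "a \<in> {1..m}" "f \<in> F"
  shows "euler (Gam a f) = Gam a (euler f)"
proof -
  have dFF: "dF i f \<in> F" if "i \<in> {1..m}" for i using that assms by (intro dF_F)
  have "Gam a (euler f) = (\<Sum>i = 1..m. Gam a (yF i (dF i f)))"
    unfolding euler_eq [OF assms(2)] by (rule linF_apply_sum [OF linF_Gam]) (intro yF_F dFF)
  also have "\<dots> = (\<Sum>i = 1..m. yF i (dF i (Gam a f)))"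
  proof (rule sum.cong [OF refl])
    fix i assume i: "i \<in> {1..m}"
    have "Gam a (yF i (dF i f)) = - yF i (Gam a (dF i f))" by (rule Gam_yF [OF assms(1) i dFF [OF i]])
    also have "\<dots> = yF i (- Gam a (dF i f))"
      by (rule linF_neg [OF linF_yF [OF i] Gam_F [OF dFF [OF i]], symmetric])
    also have "\<dots> = yF i (dF i (Gam a f))" by (simp only: Gam_dF [OF assms(1) i assms(2)] minus_minus)
    finally show "Gam a (yF i (dF i f)) = yF i (dF i (Gam a f))" .
  qed
  finally show ?thesis using euler_eq [OF Gam_F [OF assms(2)]] by simp
qed

section \<open>Null coordinates\<close>

text \<open>
  The counterparts of \<open>mulw\<close> and \<open>derw\<close> among the operators on discrete polynomials. The signs are such that
  \<open>null_d j\<close> is the derivative dual to \<open>null_y j\<close> (lemma \<open>null_d_null_y\<close>).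
\<close>

definition null_y :: "nat \<Rightarrow> ((nat \<Rightarrow> int) \<Rightarrow> 'c) \<Rightarrow> (nat \<Rightarrow> int) \<Rightarrow> 'c" where
  "null_y j f = (if j = 1 then fscale inv_sqrt2 (yF 1 f - fscale \<i> (yF 2 f))
     else if j = 2 then fscale inv_sqrt2 (yF 1 f + fscale \<i> (yF 2 f)) else yF j f)"

definition null_d :: "nat \<Rightarrow> ((nat \<Rightarrow> int) \<Rightarrow> 'c) \<Rightarrow> (nat \<Rightarrow> int) \<Rightarrow> 'c" where
  "null_d j f = (if j = 1 then fscale inv_sqrt2 (dF 1 f + fscale \<i> (dF 2 f))
     else if j = 2 then fscale inv_sqrt2 (dF 1 f - fscale \<i> (dF 2 f)) else dF j f)"

lemma null_y_12: "null_y 1 f = fscale inv_sqrt2 (yF 1 f - fscale \<i> (yF 2 f))" "null_y 2 f = fscale inv_sqrt2 (yF 1 f + fscale \<i> (yF 2 f))"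
  and null_d_12: "null_d 1 f = fscale inv_sqrt2 (dF 1 f + fscale \<i> (dF 2 f))" "null_d 2 f = fscale inv_sqrt2 (dF 1 f - fscale \<i> (dF 2 f))"
  by (simp_all add: null_y_def null_d_def)

context
  assumes m2: "m \<ge> 2"
begin

lemma mem12: "(1 :: nat) \<in> {1..m}" "(2 :: nat) \<in> {1..m}"
  using m2 by auto

lemma linF_null_y: "j \<in> {1..m} \<Longrightarrow> linF (null_y j)"
  unfolding null_y_def using mem12
  by (cases "j = 1"; cases "j = 2"; simp; intro linF_scale linF_diff linF_add linF_yF; simp)

lemma linF_null_d: "j \<in> {1..m} \<Longrightarrow> linF (null_d j)"
  unfolding null_d_def using mem12
  by (cases "j = 1"; cases "j = 2"; simp; intro linF_scale linF_diff linF_add linF_dF; simp)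

lemma null_y_F: "j \<in> {1..m} \<Longrightarrow> f \<in> F \<Longrightarrow> null_y j f \<in> F" and null_d_F: "j \<in> {1..m} \<Longrightarrow> f \<in> F \<Longrightarrow> null_d j f \<in> F"
  using linFD(1) [OF linF_null_y] linFD(1) [OF linF_null_d] by blast+

lemma scale_half: "fscale (1 / 2) f + fscale (1 / 2) f = f"
proof -
  have "(1 / 2 :: complex) + 1 / 2 = 1" by simp
  then show ?thesis by (metis fun_space.scale_left_distrib fun_space.scale_one)
qed

lemma fs_inv_sqrt2: "fscale inv_sqrt2 (fscale inv_sqrt2 f) = fscale (1 / 2) f"
  by (simp only: fun_space.scale_scale inv_sqrt2_sq)

lemma yF_null_y: "yF 1 f = fscale inv_sqrt2 (null_y 1 f + null_y 2 f)" "yF 2 f = fscale (\<i> * inv_sqrt2) (null_y 1 f - null_y 2 f)"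
proof -
  have 1: "null_y 1 f + null_y 2 f = fscale inv_sqrt2 (yF 1 f + yF 1 f)"
    by (simp add: null_y_def fun_space.scale_right_distrib fun_space.scale_right_diff_distrib)
  show "yF 1 f = fscale inv_sqrt2 (null_y 1 f + null_y 2 f)"
    unfolding 1 fs_inv_sqrt2 by (simp only: fun_space.scale_right_distrib scale_half)
  have 2: "null_y 1 f - null_y 2 f = fscale (- \<i>) (fscale inv_sqrt2 (yF 2 f + yF 2 f))"
    by (simp add: null_y_def fun_space.scale_right_distrib fun_space.scale_right_diff_distrib mult.commute)
  have "fscale (\<i> * inv_sqrt2) (null_y 1 f - null_y 2 f) = fscale (\<i> * - \<i>) (fscale inv_sqrt2 (fscale inv_sqrt2 (yF 2 f + yF 2 f)))"
    unfolding 2 fun_space.scale_scale by (simp add: mult_ac)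
  also have "\<dots> = yF 2 f" unfolding fs_inv_sqrt2 by (simp add: fun_space.scale_right_distrib scale_half)
  finally show "yF 2 f = fscale (\<i> * inv_sqrt2) (null_y 1 f - null_y 2 f)" by simp
qed

lemma dF_null_d: "dF 1 f = fscale inv_sqrt2 (null_d 1 f + null_d 2 f)" "dF 2 f = fscale (- \<i> * inv_sqrt2) (null_d 1 f - null_d 2 f)"
proof -
  have 1: "null_d 1 f + null_d 2 f = fscale inv_sqrt2 (dF 1 f + dF 1 f)"
    by (simp add: null_d_def fun_space.scale_right_distrib fun_space.scale_right_diff_distrib)
  show "dF 1 f = fscale inv_sqrt2 (null_d 1 f + null_d 2 f)"
    unfolding 1 fs_inv_sqrt2 by (simp only: fun_space.scale_right_distrib scale_half)
  have 2: "null_d 1 f - null_d 2 f = fscale \<i> (fscale inv_sqrt2 (dF 2 f + dF 2 f))"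
    by (simp add: null_d_def fun_space.scale_right_distrib fun_space.scale_right_diff_distrib mult.commute)
  have "fscale (- \<i> * inv_sqrt2) (null_d 1 f - null_d 2 f) = fscale (- \<i> * \<i>) (fscale inv_sqrt2 (fscale inv_sqrt2 (dF 2 f + dF 2 f)))"
    unfolding 2 fun_space.scale_scale by (simp add: mult_ac)
  also have "\<dots> = dF 2 f" unfolding fs_inv_sqrt2 by (simp add: fun_space.scale_right_distrib scale_half)
  finally show "dF 2 f = fscale (- \<i> * inv_sqrt2) (null_d 1 f - null_d 2 f)" by simp
qed

lemma null_d_commute_op:
  assumes T: "linF T" and c: "\<And>j. j \<in> {1..m} \<Longrightarrow> T (dF j f) = dF j g" and j: "j \<in> {1..m}" and f: "f \<in> F" 
  shows "T (null_d j f) = null_d j g"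
  using j unfolding null_d_def
  by (simp only: split: if_split) (intro conjI impI; simp only: linFD [OF T] linF_apply_diff [OF T] F_add F_diff F_scale dF_F mem12 f c)

lemma null_d_null_d:
  assumes i: "i \<in> {1..m}" and j: "j \<in> {1..m}" and f: "f \<in> F"
  shows "null_d i (null_d j f) = null_d j (null_d i f)"
proof (rule null_d_commute_op [OF linF_null_d [OF i] _ j f])
  fix l assume l: "l \<in> {1..m}"
  show "null_d i (dF l f) = dF l (null_d i f)"
    by (rule null_d_commute_op [OF linF_dF [OF l] _ i f, symmetric]) (rule dF_dF [OF l _ f])
qed

text \<open>
  Expanding in the Cartesian operators, the canonical commutation relations leave $\frac12 (1 + 1)$ for equal indices and
  $\frac12 (1 - 1)$ for the two different null directions.
\<close>

lemma null_d_null_y: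
  assumes i: "i \<in> {1..m}" and j: "j \<in> {1..m}" and f: "f \<in> F"
  shows "null_d i (null_y j f) = null_y j (null_d i f) + fscale (of_bool (i = j)) f"
proof -
  note lins = linFD [OF linF_yF] linF_apply_diff [OF linF_yF] linFD [OF linF_dF] linF_apply_diff [OF linF_dF]
  have mem: "1 \<in> {1..m}" "2 \<in> {1..m}" by (fact mem12)+
  note clos = F_add F_diff F_scale dF_F yF_F mem f i j
  have c: "dF a (yF b f) = yF b (dF a f) + fscale (of_bool (a = b)) f" if "a \<in> {1..m}" "b \<in> {1..m}" for a b
    by (rule dF_yF [OF that f])
  define h where "h = fscale (1 / 2) f"
  have f_h: "f = h + h" by (simp add: h_def scale_half)
  show ?thesis
  proof (rule ext)
    fix x
    have hx: "scale (1/2) (f x) + scale (1/2) (f x) = f x" for x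
      using fun_cong [OF scale_half [of f], of x] by (simp add: fscale_def)
    have hx2: "scale (1/2) (f x) + (scale (1/2) (f x) + z) = f x + z" for z x
      by (simp only: add.assoc [symmetric] hx)
    note arith = fscale_def scale_right_distrib scale_right_diff_distrib hx hx2
    consider "i = 1" "j = 1" | "i = 1" "j = 2" | "i = 2" "j = 1" | "i = 2" "j = 2"
      | "i \<notin> {1,2}" "j \<in> {1,2}" | "i \<in> {1,2}" "j \<notin> {1,2}" | "i \<notin> {1,2}" "j \<notin> {1,2}" by blast
    then show "null_d i (null_y j f) x = (null_y j (null_d i f) + fscale (of_bool (i = j)) f) x"
    proof cases
      case 1
      have "null_d 1 (null_y 1 f) = null_y 1 (null_d 1 f) + f"
        unfolding null_y_12 null_d_12
        by (simp only: lins clos c) (rule ext, simp add: arith algebra_simps)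
      with 1 show ?thesis by simp
    next
      case 2
      have "null_d 1 (null_y 2 f) = null_y 2 (null_d 1 f)"
        unfolding null_y_12 null_d_12
        by (simp only: lins clos c) (rule ext, simp add: arith algebra_simps)
      with 2 show ?thesis by simp
    next
      case 3
      have "null_d 2 (null_y 1 f) = null_y 1 (null_d 2 f)"
        unfolding null_y_12 null_d_12
        by (simp only: lins clos c) (rule ext, simp add: arith algebra_simps)
      with 3 show ?thesis by simp
    next
      case 4
      have "null_d 2 (null_y 2 f) = null_y 2 (null_d 2 f) + f"
        unfolding null_y_12 null_d_12
        by (simp only: lins clos c) (rule ext, simp add: arith algebra_simps)
      with 4 show ?thesis by simp
    next
      case 5
      then have "dF i (null_y j f) = null_y j (dF i f)"
        unfolding null_y_def
        by (auto simp: lins F_add F_diff F_scale dF_F yF_F f mem [simplified] i [simplified] c)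
      with 5 show ?thesis by (auto simp: null_d_def)
    next
      case 6
      then have "null_d i (yF j f) = yF j (null_d i f)"
        unfolding null_d_def
        by (auto simp: lins F_add F_diff F_scale dF_F yF_F f mem [simplified] j [simplified] c)
      with 6 show ?thesis by (auto simp: null_y_def)
    next
      case 7
      then show ?thesis using c [OF i j] by (simp add: null_d_def null_y_def)
    qed
  qed
qed

end

end

section \<open>Homogeneous discrete polynomials\<close>

context clifford_algebra
begin

definition homog_polys :: "nat \<Rightarrow> ((nat \<Rightarrow> int) \<Rightarrow> 'c) set" where
  "homog_polys k = {f \<in> F. euler f = fscale (of_nat k) f}"

lemma homog_polys_F: "f \<in> homog_polys k \<Longrightarrow> f \<in> F" and homog_polys_euler: "f \<in> homog_polys k \<Longrightarrow> euler f = fscale (of_nat k) f"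
  by (simp_all add: homog_polys_def)

lemma homog_polysI: "f \<in> F \<Longrightarrow> euler f = fscale (of_nat k) f \<Longrightarrow> f \<in> homog_polys k"
  by (simp add: homog_polys_def)

lemma homog_polys_subspace: "fun_space.subspace (homog_polys k)"
  unfolding fun_space.subspace_def
proof (intro conjI ballI allI)
  show "0 \<in> homog_polys k" using linF_0 [OF linF_euler] F_0 by (intro homog_polysI) simp_all
  fix f assume f: "f \<in> homog_polys k"
  { fix g assume g: "g \<in> homog_polys k"
    show "f + g \<in> homog_polys k"
      by (intro homog_polysI F_add homog_polys_F [OF f] homog_polys_F [OF g])
        (simp only: linFD(2) [OF linF_euler homog_polys_F [OF f] homog_polys_F [OF g]] homog_polys_euler [OF f] homog_polys_euler [OF g]
          fun_space.scale_right_distrib) }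
  fix z show "fscale z f \<in> homog_polys k"
    by (intro homog_polysI F_scale homog_polys_F [OF f])
      (simp add: linFD(3) [OF linF_euler homog_polys_F [OF f]] homog_polys_euler [OF f] mult.commute)
qed

lemma homog_polys_closed: "f \<in> homog_polys k \<Longrightarrow> g \<in> homog_polys k \<Longrightarrow> f + g \<in> homog_polys k" "f \<in> homog_polys k \<Longrightarrow> g \<in> homog_polys k \<Longrightarrow> f - g \<in> homog_polys k"
  "f \<in> homog_polys k \<Longrightarrow> fscale z f \<in> homog_polys k" "0 \<in> homog_polys k" "f \<in> homog_polys k \<Longrightarrow> - f \<in> homog_polys k"
  "(\<And>i. i \<in> I \<Longrightarrow> h i \<in> homog_polys k) \<Longrightarrow> (\<Sum>i\<in>I. h i) \<in> homog_polys k"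
  using homog_polys_subspace by (auto intro: fun_space.subspace_add fun_space.subspace_diff
    fun_space.subspace_neg fun_space.subspace_scale fun_space.subspace_0 fun_space.subspace_sum)

lemma homog_polys_dF:
  assumes "f \<in> homog_polys (Suc k)" "j \<in> {1..m}"
  shows "dF j f \<in> homog_polys k"
proof (rule homog_polysI)
  note f = homog_polys_F [OF assms(1)]
  show "dF j f \<in> F" using assms f by (intro dF_F)
  have "euler (dF j f) + dF j f = fscale (of_nat (Suc k)) (dF j f)"
    using dF_euler [OF assms(2) f] unfolding homog_polys_euler [OF assms(1)]
    by (simp only: linFD(3) [OF linF_dF [OF assms(2)] f])
  also have "\<dots> = fscale (of_nat k) (dF j f) + dF j f"
    by (simp only: of_nat_Suc fun_space.scale_left_distrib fun_space.scale_one add.commute)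
  finally show "euler (dF j f) = fscale (of_nat k) (dF j f)" by (rule add_right_imp_eq)
qed

lemma homog_polys_0_dF:
  assumes "f \<in> homog_polys 0" "j \<in> {1..m}"
  shows "dF j f = 0"
proof -
  note f = homog_polys_F [OF assms(1)]
  have "euler (dF j f) + dF j f = fscale (of_nat 0) (dF j f)"
    using dF_euler [OF assms(2) f] unfolding homog_polys_euler [OF assms(1)]
    by (simp only: linFD(3) [OF linF_dF [OF assms(2)] f])
  then have "euler (dF j f) + dF j f = 0" by simp
  then have "euler (dF j f) = fscale (- of_nat (Suc 0)) (dF j f)"
    by (simp add: add_eq_0_iff2)
  moreover obtain r where "dF j f \<in> Fd r" using F_Fd [OF dF_F [OF assms(2) f]] by blast
  ultimately show ?thesis by (intro negative_degree)
qed

lemma homog_polys_yF: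
  assumes "f \<in> homog_polys k" "j \<in> {1..m}"
  shows "yF j f \<in> homog_polys (Suc k)"
proof (rule homog_polysI)
  note f = homog_polys_F [OF assms(1)]
  show "yF j f \<in> F" using assms f by (intro yF_F)
  show "euler (yF j f) = fscale (of_nat (Suc k)) (yF j f)"
    unfolding euler_yF [OF assms(2) f] homog_polys_euler [OF assms(1)] linFD(3) [OF linF_yF [OF assms(2)] f]
    by (simp only: of_nat_Suc fun_space.scale_left_distrib fun_space.scale_one add.commute)
qed

lemma homog_polys_Gam:
  assumes "f \<in> homog_polys k" "a \<in> {1..m}"
  shows "Gam a f \<in> homog_polys k"
proof (rule homog_polysI)
  note f = homog_polys_F [OF assms(1)]
  show "Gam a f \<in> F" by (rule Gam_F [OF f])
  show "euler (Gam a f) = fscale (of_nat k) (Gam a f)"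
    unfolding euler_Gam [OF assms(2) f] homog_polys_euler [OF assms(1)] by (rule linFD(3) [OF linF_Gam f])
qed

lemma homog_polys_0_const: "f \<in> homog_polys 0 \<Longrightarrow> f = (\<lambda>_. f (\<lambda>_. 0))"
  by (rule dF_0_const [OF homog_polys_F homog_polys_0_dF])

lemma const_homog_polys: "(\<lambda>_. c) \<in> homog_polys 0"
proof (rule homog_polysI [OF const_F])
  have "euler (\<lambda>_. c) = (\<Sum>j = 1..m. 0)"
    unfolding euler_eq [OF const_F]
    by (intro sum.cong refl) (simp only: dF_const linF_0 [OF linF_yF])
  then show "euler (\<lambda>_. c) = fscale (of_nat 0) (\<lambda>_. c)" by simp
qed

lemma homog_polys_dR:
  assumes "f \<in> homog_polys k" "a \<in> {1..m}" "b \<in> {1..m}"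
  shows "dR a b f \<in> homog_polys k"
proof (cases "a = b")
  case True
  then show ?thesis by (simp add: dR_def homog_polys_closed)
next
  case False
  have y: "yF a (dF b f) \<in> homog_polys k" if "a \<in> {1..m}" "b \<in> {1..m}" for a b
  proof (cases k)
    case 0
    then have "yF a (dF b f) = 0"
      using homog_polys_0_dF [of f b] that assms(1) linF_0 [OF linF_yF [OF that(1)]] by simp
    then show ?thesis by (simp add: homog_polys_closed)
  next
    case (Suc j)
    then show ?thesis using assms(1) that by (auto intro!: homog_polys_yF homog_polys_dF)
  qed
  show ?thesis
    unfolding dR_eq [OF assms(2,3) False homog_polys_F [OF assms(1)]]
    by (intro homog_polys_closed y homog_polys_Gam assms)
qed

lemma monogenics_homog_polys: "monogenics k = {f \<in> homog_polys k. dirac f = 0}"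
  by (auto simp: monogenics_def homog_polys_def homogeneous_def monogenic_def)

text \<open>
  Extension of the derivatives by 0. The extended maps commute on all functions and for all indices, as
  \<open>fold_mset\<close> requires in order to define derivatives along a multiset.
\<close>

definition deriv_ext :: "nat \<Rightarrow> ((nat \<Rightarrow> int) \<Rightarrow> 'c) \<Rightarrow> (nat \<Rightarrow> int) \<Rightarrow> 'c" where
  "deriv_ext j f = (if f \<in> F \<and> j \<in> {1..m} then null_d j f else 0)"

definition iter_deriv :: "nat multiset \<Rightarrow> ((nat \<Rightarrow> int) \<Rightarrow> 'c) \<Rightarrow> (nat \<Rightarrow> int) \<Rightarrow> 'c" where
  "iter_deriv \<alpha> f = fold_mset deriv_ext f \<alpha>"

definition taylor_coeff :: "((nat \<Rightarrow> int) \<Rightarrow> 'c) \<Rightarrow> nat multiset \<Rightarrow> 'c" where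
  "taylor_coeff f \<alpha> = iter_deriv \<alpha> f (\<lambda>_. 0)"

definition gam_const :: "nat \<Rightarrow> 'c \<Rightarrow> 'c" where
  "gam_const a x = klein a * x * e_perp a"

context
  assumes m2: "m \<ge> 2"
begin

lemma Gam_null_d:
  assumes "a \<in> {1..m}" "j \<in> {1..m}" "f \<in> F"
  shows "Gam a (null_d j f) = - null_d j (Gam a f)"
proof -
  have "Gam a (null_d j f) = null_d j (- Gam a f)"
  proof (rule null_d_commute_op [OF m2 linF_Gam _ assms(2,3)])
    fix l assume l: "l \<in> {1..m}"
    show "Gam a (dF l f) = dF l (- Gam a f)"
      unfolding Gam_dF [OF assms(1) l assms(3)] linF_neg [OF linF_dF [OF l] Gam_F [OF assms(3)]] ..
  qed
  then show ?thesis unfolding linF_neg [OF linF_null_d [OF m2 assms(2)] Gam_F [OF assms(3)]] .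
qed

lemma euler_null_y:
  assumes f: "f \<in> F"
  shows "euler f = (\<Sum>j = 1..m. null_y j (null_d j f))"
proof -
  have m12: "{1..m} = insert 1 (insert 2 {3..m})" using m2 by auto
  have mem: "1 \<in> {1..m}" "2 \<in> {1..m}" using m2 by auto
  note lins = linFD [OF linF_yF] linF_apply_diff [OF linF_yF]
  have hx: "scale (1/2) z + scale (1/2) z = z" for z :: 'c
    using fun_cong [OF scale_half [OF m2, of "\<lambda>_. z"], of "\<lambda>_. 0"] by (simp add: fscale_def)
  have hx2: "scale (1/2) z + (scale (1/2) z + w) = z + w" for z w :: 'c
    by (simp only: add.assoc [symmetric] hx)
  have 12: "null_y 1 (null_d 1 f) + null_y 2 (null_d 2 f) = yF 1 (dF 1 f) + yF 2 (dF 2 f)"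
    unfolding null_y_12 null_d_12
    by (simp only: lins F_add F_diff F_scale dF_F mem f)
       (rule ext, simp add: fscale_def scale_right_distrib scale_right_diff_distrib algebra_simps hx hx2)
  have r: "(\<Sum>j = 3..m. null_y j (null_d j f)) = (\<Sum>j = 3..m. yF j (dF j f))"
    by (rule sum.cong) (auto simp: null_y_def null_d_def)
  have s: "(\<Sum>j\<in>{1..m}. h j) = h 1 + h 2 + (\<Sum>j = 3..m. h j)" for h :: "nat \<Rightarrow> (nat \<Rightarrow> int) \<Rightarrow> 'c"
    unfolding m12 by (simp add: add.assoc)
  show ?thesis unfolding euler_eq [OF f] s r 12 ..
qed

lemma homog_polys_null_d: "f \<in> homog_polys (Suc k) \<Longrightarrow> j \<in> {1..m} \<Longrightarrow> null_d j f \<in> homog_polys k"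
  unfolding null_d_def using m2 by (auto intro!: homog_polys_closed homog_polys_dF)

lemma homog_polys_0_null_d: "f \<in> homog_polys 0 \<Longrightarrow> j \<in> {1..m} \<Longrightarrow> null_d j f = 0"
  unfolding null_d_def using m2 homog_polys_0_dF [of f] by auto

lemma homog_polys_null_y: "f \<in> homog_polys k \<Longrightarrow> j \<in> {1..m} \<Longrightarrow> null_y j f \<in> homog_polys (Suc k)"
  unfolding null_y_def using m2 by (auto intro!: homog_polys_closed homog_polys_yF)

section \<open>Taylor coefficients\<close>

lemma deriv_ext_F: "deriv_ext j f \<in> F"
  by (simp add: deriv_ext_def F_0 null_d_F [OF m2])

lemma deriv_ext_deriv_ext: "deriv_ext j (deriv_ext i f) = deriv_ext i (deriv_ext j f)"
proof -
  have z: "deriv_ext i 0 = 0" for i by (simp add: deriv_ext_def linF_0 [OF linF_null_d [OF m2]])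
  show ?thesis
  proof (cases "f \<in> F \<and> i \<in> {1..m} \<and> j \<in> {1..m}")
    case True
    then show ?thesis using null_d_null_d [OF m2, of i j f] null_d_F [OF m2] by (simp add: deriv_ext_def)
  next
    case False
    then have "deriv_ext i f = 0 \<or> j \<notin> {1..m}" "deriv_ext j f = 0 \<or> i \<notin> {1..m}" by (auto simp: deriv_ext_def)
    then have "deriv_ext j (deriv_ext i f) = 0" "deriv_ext i (deriv_ext j f) = 0"
      using z by (metis deriv_ext_def)+
    then show ?thesis by (rule trans [OF _ sym])
  qed
qed

lemma deriv_ext_commute: "comp_fun_commute deriv_ext"
  by unfold_locales (simp add: fun_eq_iff deriv_ext_deriv_ext)

lemma iter_deriv_empty: "iter_deriv {#} f = f"
  by (simp add: iter_deriv_def)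

lemma iter_deriv_add: "iter_deriv (add_mset j \<alpha>) f = deriv_ext j (iter_deriv \<alpha> f)"
  unfolding iter_deriv_def by (rule comp_fun_commute.fold_mset_add_mset [OF deriv_ext_commute])

lemma iter_deriv_add': "iter_deriv (add_mset j \<alpha>) f = iter_deriv \<alpha> (deriv_ext j f)"
  unfolding iter_deriv_add unfolding iter_deriv_def by (rule comp_fun_commute.fold_mset_fun_left_comm [OF deriv_ext_commute])

lemma iter_deriv_F: "f \<in> F \<Longrightarrow> iter_deriv \<alpha> f \<in> F"
  by (cases \<alpha>) (simp_all add: iter_deriv_empty iter_deriv_add deriv_ext_F)

lemma linF_iter_deriv: "set_mset \<alpha> \<subseteq> {1..m} \<Longrightarrow> linF (iter_deriv \<alpha>)"
proof (induction \<alpha>)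
  case empty
  then show ?case using linF_id by (simp add: linF_def iter_deriv_empty)
next
  case (add j \<alpha>)
  then have j: "j \<in> {1..m}" and IH: "linF (iter_deriv \<alpha>)" by auto
  have "iter_deriv (add_mset j \<alpha>) f = null_d j (iter_deriv \<alpha> f)" if "f \<in> F" for f
    using that j by (simp add: iter_deriv_add deriv_ext_def iter_deriv_F)
  moreover have "linF (\<lambda>f. null_d j (iter_deriv \<alpha> f))" by (rule linF_comp [OF linF_null_d [OF m2 j] IH])
  ultimately show ?case by (auto simp: linF_def F_add F_scale)
qed

lemma iter_deriv_homog_polys:
  assumes "f \<in> homog_polys k" "set_mset \<alpha> \<subseteq> {1..m}"
  shows "size \<alpha> \<le> k \<Longrightarrow> iter_deriv \<alpha> f \<in> homog_polys (k - size \<alpha>)"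
  using assms(2)
proof (induction \<alpha>)
  case empty
  then show ?case using assms(1) by (simp add: iter_deriv_empty)
next
  case (add j \<alpha>)
  then have "iter_deriv \<alpha> f \<in> homog_polys (k - size \<alpha>)" by simp
  moreover have "k - size \<alpha> = Suc (k - size (add_mset j \<alpha>))" using add.prems by simp
  ultimately show ?case using add.prems by (simp add: iter_deriv_add deriv_ext_def homog_polys_F homog_polys_null_d)
qed

lemma iter_deriv_zero:
  assumes "f \<in> homog_polys k" "\<alpha> \<in> multi_index m (Suc k)"
  shows "iter_deriv \<alpha> f = 0"
proof -
  obtain j \<beta> where a: "\<alpha> = add_mset j \<beta>"
    using assms(2) by (metis (mono_tags, lifting) multi_index_def mem_Collect_eq size_eq_Suc_imp_eq_union)
  then have "iter_deriv \<beta> f \<in> homog_polys 0" "j \<in> {1..m}"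
    using iter_deriv_homog_polys [OF assms(1), of \<beta>] assms(2) by (auto simp: multi_index_def)
  then show ?thesis by (simp add: a iter_deriv_add deriv_ext_def homog_polys_F homog_polys_0_null_d)
qed

text \<open>
  The product rule for a derivative along \<open>\<alpha>\<close> of a product with a variable.
\<close>

lemma iter_deriv_null_y:
  assumes f: "f \<in> F" and j: "j \<in> {1..m}" and a: "set_mset \<alpha> \<subseteq> {1..m}"
  shows "iter_deriv \<alpha> (null_y j f) = null_y j (iter_deriv \<alpha> f) + fscale (of_nat (count \<alpha> j)) (iter_deriv (\<alpha> - {#j#}) f)"
  using a
proof (induction \<alpha>)
  case empty
  then show ?case by (simp add: iter_deriv_empty)
next
  case (add i \<alpha>)
  then have i: "i \<in> {1..m}" and IH: "iter_deriv \<alpha> (null_y j f) = null_y j (iter_deriv \<alpha> f) + fscale (of_nat (count \<alpha> j)) (iter_deriv (\<alpha> - {#j#}) f)"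
    by auto
  note P = linF_null_d [OF m2 i]
  have "iter_deriv (add_mset i \<alpha>) (null_y j f) = null_d i (iter_deriv \<alpha> (null_y j f))"
    using i f j by (simp add: iter_deriv_add deriv_ext_def iter_deriv_F null_y_F [OF m2])
  also have "\<dots> = null_d i (null_y j (iter_deriv \<alpha> f)) + fscale (of_nat (count \<alpha> j)) (null_d i (iter_deriv (\<alpha> - {#j#}) f))"
    unfolding IH by (simp only: linFD [OF P] null_y_F [OF m2 j] F_scale iter_deriv_F f)
  also have "null_d i (null_y j (iter_deriv \<alpha> f)) = null_y j (iter_deriv (add_mset i \<alpha>) f) + fscale (of_bool (i = j)) (iter_deriv \<alpha> f)"
    unfolding null_d_null_y [OF m2 i j iter_deriv_F [OF f]] using i f by (simp add: iter_deriv_add deriv_ext_def iter_deriv_F)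
  also have "null_d i (iter_deriv (\<alpha> - {#j#}) f) = iter_deriv (add_mset i (\<alpha> - {#j#})) f"
    using i f by (simp add: iter_deriv_add deriv_ext_def iter_deriv_F)
  also have "null_y j (iter_deriv (add_mset i \<alpha>) f) + fscale (of_bool (i = j)) (iter_deriv \<alpha> f)
      + fscale (of_nat (count \<alpha> j)) (iter_deriv (add_mset i (\<alpha> - {#j#})) f)
    = null_y j (iter_deriv (add_mset i \<alpha>) f) + fscale (of_nat (count (add_mset i \<alpha>) j)) (iter_deriv (add_mset i \<alpha> - {#j#}) f)"
  proof (cases "i = j")
    case True
    have "fscale (of_nat (count \<alpha> j)) (iter_deriv (add_mset i (\<alpha> - {#j#})) f) = fscale (of_nat (count \<alpha> j)) (iter_deriv \<alpha> f)"
    proof (cases "j \<in># \<alpha>")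
      case False
      then have "count \<alpha> j = 0" by (simp add: not_in_iff)
      then show ?thesis by simp
    qed (simp add: True)
    then show ?thesis using True by (simp add: fun_space.scale_left_distrib add.assoc)
  next
    case False
    show ?thesis
    proof (cases "j \<in># \<alpha>")
      case True
      then have "add_mset i (\<alpha> - {#j#}) = add_mset i \<alpha> - {#j#}" by simp
      then show ?thesis using False by simp
    next
      case n: False
      then have "count \<alpha> j = 0" by (simp add: not_in_iff)
      then show ?thesis using False by simp
    qed
  qed
  finally show ?case .
qed

lemma iter_deriv_Gam:
  assumes f: "f \<in> F" and j: "j \<in> {1..m}" and a: "set_mset \<alpha> \<subseteq> {1..m}"
  shows "iter_deriv \<alpha> (Gam j f) = fscale ((- 1) ^ size \<alpha>) (Gam j (iter_deriv \<alpha> f))"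
  using a
proof (induction \<alpha>)
  case empty
  then show ?case by (simp add: iter_deriv_empty)
next
  case (add i \<alpha>)
  then have i: "i \<in> {1..m}" and IH: "iter_deriv \<alpha> (Gam j f) = fscale ((- 1) ^ size \<alpha>) (Gam j (iter_deriv \<alpha> f))" by auto
  have "iter_deriv (add_mset i \<alpha>) (Gam j f) = null_d i (iter_deriv \<alpha> (Gam j f))"
    using i f by (simp add: iter_deriv_add deriv_ext_def iter_deriv_F Gam_F)
  also have "\<dots> = fscale ((- 1) ^ size \<alpha>) (null_d i (Gam j (iter_deriv \<alpha> f)))"
    unfolding IH by (rule linFD(3) [OF linF_null_d [OF m2 i] Gam_F [OF iter_deriv_F [OF f]]])
  also have "null_d i (Gam j (iter_deriv \<alpha> f)) = - Gam j (null_d i (iter_deriv \<alpha> f))"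
    using Gam_null_d [OF j i iter_deriv_F [OF f]] by simp
  also have "null_d i (iter_deriv \<alpha> f) = iter_deriv (add_mset i \<alpha>) f" using i f by (simp add: iter_deriv_add deriv_ext_def iter_deriv_F)
  also have "fscale ((- 1) ^ size \<alpha>) (- Gam j (iter_deriv (add_mset i \<alpha>) f))
      = fscale ((- 1) ^ size (add_mset i \<alpha>)) (Gam j (iter_deriv (add_mset i \<alpha>) f))"
    by (rule ext) (simp add: fscale_def)
  finally show ?case .
qed

lemma taylor_coeff_add: "f \<in> F \<Longrightarrow> g \<in> F \<Longrightarrow> \<alpha> \<in> multi_index m k \<Longrightarrow> taylor_coeff (f + g) \<alpha> = taylor_coeff f \<alpha> + taylor_coeff g \<alpha>"
  using linFD(2) [OF linF_iter_deriv, of \<alpha> f g] by (simp add: taylor_coeff_def multi_index_def)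

lemma taylor_coeff_scale: "f \<in> F \<Longrightarrow> \<alpha> \<in> multi_index m k \<Longrightarrow> taylor_coeff (fscale z f) \<alpha> = scale z (taylor_coeff f \<alpha>)"
  using linFD(3) [OF linF_iter_deriv, of \<alpha> f z] by (simp add: taylor_coeff_def multi_index_def fscale_def)

lemma taylor_coeff_null_d: "f \<in> F \<Longrightarrow> j \<in> {1..m} \<Longrightarrow> taylor_coeff (null_d j f) \<alpha> = taylor_coeff f (add_mset j \<alpha>)"
  by (simp add: taylor_coeff_def iter_deriv_add' deriv_ext_def)

lemma taylor_coeff_null_y:
  assumes "f \<in> homog_polys k" "j \<in> {1..m}" "\<alpha> \<in> multi_index m (Suc k)"
  shows "taylor_coeff (null_y j f) \<alpha> = scale (of_nat (count \<alpha> j)) (taylor_coeff f (\<alpha> - {#j#}))"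
proof -
  have "iter_deriv \<alpha> (null_y j f) = fscale (of_nat (count \<alpha> j)) (iter_deriv (\<alpha> - {#j#}) f)"
    using iter_deriv_null_y [OF homog_polys_F [OF assms(1)] assms(2), of \<alpha>] assms(3)
    unfolding iter_deriv_zero [OF assms(1,3)] linF_0 [OF linF_null_y [OF m2 assms(2)]] by (simp add: multi_index_def)
  then show ?thesis by (simp add: taylor_coeff_def fscale_def)
qed

lemma taylor_coeff_Gam: "f \<in> F \<Longrightarrow> j \<in> {1..m} \<Longrightarrow> \<alpha> \<in> multi_index m k \<Longrightarrow> taylor_coeff (Gam j f) \<alpha> = scale ((- 1) ^ k) (gam_const j (taylor_coeff f \<alpha>))"
  using iter_deriv_Gam [of f j \<alpha>] by (simp add: taylor_coeff_def multi_index_def fscale_def Gam_def lr_def gam_const_def)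

text \<open>
  By the Euler equation \<open>f\<close> is recovered from its derivatives, $k f = \sum y_j d_j f$, and these vanish by induction.
\<close>

lemma taylor_coeff_inj:
  assumes "f \<in> homog_polys k" "\<And>\<alpha>. \<alpha> \<in> multi_index m k \<Longrightarrow> taylor_coeff f \<alpha> = 0"
  shows "f = 0"
  using assms
proof (induction k arbitrary: f)
  case 0
  have "taylor_coeff f {#} = 0" using 0 by (simp add: multi_index_def)
  then have "f (\<lambda>_. 0) = 0" by (simp add: taylor_coeff_def iter_deriv_empty)
  then have "f x = 0" for x using fun_cong [OF homog_polys_0_const [OF 0(1)], of x] by simp
  then show ?case by (simp add: fun_eq_iff)
next
  case (Suc k)
  note f = homog_polys_F [OF Suc.prems(1)]
  have "null_d j f = 0" if j: "j \<in> {1..m}" for j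
  proof (rule Suc.IH [OF homog_polys_null_d [OF Suc.prems(1) j]])
    fix \<alpha> assume "\<alpha> \<in> multi_index m k"
    then have "add_mset j \<alpha> \<in> multi_index m (Suc k)" using j by (auto simp: multi_index_def)
    then show "taylor_coeff (null_d j f) \<alpha> = 0" using Suc.prems(2) taylor_coeff_null_d [OF f j] by simp
  qed
  then have "euler f = (\<Sum>j = 1..m. 0)"
    unfolding euler_null_y [OF f] by (intro sum.cong refl) (simp only: linF_0 [OF linF_null_y [OF m2]])
  then have "fscale (of_nat (Suc k)) f = 0" using homog_polys_euler [OF Suc.prems(1)] by simp
  then show ?case unfolding fun_space.scale_eq_0_iff by (simp del: of_nat_Suc)
qed

text \<open>
  Integration of prescribed derivatives: if \<open>g j\<close> has the Taylor coefficients that \<open>null_d j f\<close> should have, then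
  $f = \frac1{k+1} \sum_j y_j g_j$ by the Euler equation.
\<close>

lemma taylor_coeff_surj: "\<exists>f\<in>homog_polys k. \<forall>\<alpha>\<in>multi_index m k. taylor_coeff f \<alpha> = \<phi> \<alpha>"
proof (induction k arbitrary: \<phi>)
  case 0
  show ?case
    by (rule bexI [OF _ const_homog_polys [of "\<phi> {#}"]]) (simp add: multi_index_def taylor_coeff_def iter_deriv_empty)
next
  case (Suc k)
  have "\<forall>j. \<exists>g. g \<in> homog_polys k \<and> (\<forall>\<alpha>\<in>multi_index m k. taylor_coeff g \<alpha> = \<phi> (add_mset j \<alpha>))"
  proof
    fix j show "\<exists>g. g \<in> homog_polys k \<and> (\<forall>\<alpha>\<in>multi_index m k. taylor_coeff g \<alpha> = \<phi> (add_mset j \<alpha>))"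
      using Suc.IH [of "\<lambda>\<alpha>. \<phi> (add_mset j \<alpha>)"] by blast
  qed
  then obtain g where "\<forall>j. g j \<in> homog_polys k \<and> (\<forall>\<alpha>\<in>multi_index m k. taylor_coeff (g j) \<alpha> = \<phi> (add_mset j \<alpha>))"
    by (rule choice [THEN exE])
  then have g: "\<And>j. g j \<in> homog_polys k" "\<And>j \<alpha>. \<alpha> \<in> multi_index m k \<Longrightarrow> taylor_coeff (g j) \<alpha> = \<phi> (add_mset j \<alpha>)"
    by blast+
  define h where "h = (\<Sum>j = 1..m. null_y j (g j))"
  have null_y_homog: "null_y j (g j) \<in> homog_polys (Suc k)" if "j \<in> {1..m}" for j using homog_polys_null_y g that by blast
  have h_homog: "h \<in> homog_polys (Suc k)" unfolding h_def using null_y_homog by (rule homog_polys_closed(6))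
  have "taylor_coeff h \<alpha> = scale (of_nat (Suc k)) (\<phi> \<alpha>)" if a: "\<alpha> \<in> multi_index m (Suc k)" for \<alpha>
  proof -
    have "set_mset \<alpha> \<subseteq> {1..m}" using a by (simp add: multi_index_def)
    then have "iter_deriv \<alpha> h = (\<Sum>j = 1..m. iter_deriv \<alpha> (null_y j (g j)))"
      unfolding h_def by (intro linF_apply_sum linF_iter_deriv) (assumption, rule homog_polys_F [OF null_y_homog], assumption)
    then have "taylor_coeff h \<alpha> = (\<Sum>j = 1..m. taylor_coeff (null_y j (g j)) \<alpha>)" by (simp add: taylor_coeff_def)
    also have "\<dots> = (\<Sum>j = 1..m. scale (of_nat (count \<alpha> j)) (\<phi> \<alpha>))"
    proof (rule sum.cong [OF refl])
      fix j assume j: "j \<in> {1..m}"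
      have "taylor_coeff (null_y j (g j)) \<alpha> = scale (of_nat (count \<alpha> j)) (taylor_coeff (g j) (\<alpha> - {#j#}))"
        by (rule taylor_coeff_null_y [OF g(1) j a])
      also have "\<dots> = scale (of_nat (count \<alpha> j)) (\<phi> \<alpha>)"
      proof (cases "j \<in># \<alpha>")
        case True
        then obtain \<beta> where b: "\<alpha> = add_mset j \<beta>" by (rule mset_add)
        then have "\<beta> \<in> multi_index m k" using a by (auto simp: multi_index_def)
        then show ?thesis using g(2) [of \<beta> j] by (simp add: b)
      next
        case False
        then have "count \<alpha> j = 0" by (simp add: not_in_iff)
        then show ?thesis by simp
      qed
      finally show "taylor_coeff (null_y j (g j)) \<alpha> = scale (of_nat (count \<alpha> j)) (\<phi> \<alpha>)" .
    qed
    also have "\<dots> = scale (of_nat (\<Sum>j = 1..m. count \<alpha> j)) (\<phi> \<alpha>)"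
      by (simp add: scale_sum_left)
    also have "(\<Sum>j = 1..m. count \<alpha> j) = size \<alpha>"
      unfolding size_multiset_overloaded_eq
      by (rule sum.mono_neutral_right) (use a in \<open>auto simp: multi_index_def count_eq_zero_iff\<close>)
    finally show ?thesis using a by (simp add: multi_index_def)
  qed
  then have "\<forall>\<alpha>\<in>multi_index m (Suc k). taylor_coeff (fscale (1 / of_nat (Suc k)) h) \<alpha> = \<phi> \<alpha>"
    using taylor_coeff_scale [OF homog_polys_F [OF h_homog]] by (simp del: of_nat_Suc)
  then show ?case using homog_polys_closed(3) [OF h_homog] by blast
qed

end

end

section \<open>The Clifford constants as a Fock module\<close>

context clifford_algebra
begin

lemma gam_const_add: "gam_const a (x + y) = gam_const a x + gam_const a y" and gam_const_scale: "gam_const a (scale z x) = scale z (gam_const a x)"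
  and gam_const_minus: "gam_const a (- x) = - gam_const a x" and gam_const_0: "gam_const a 0 = 0" and gam_const_diff: "gam_const a (x - y) = gam_const a x - gam_const a y"
  by (simp_all add: gam_const_def algebra_simps scale_mult_left scale_mult_right)

lemma gam_const_sum: "gam_const a (\<Sum>i\<in>I. f i) = (\<Sum>i\<in>I. gam_const a (f i))"
  by (simp add: gam_const_def sum_distrib_left sum_distrib_right)

lemma Gam_const: "Gam a (\<lambda>_. x) = (\<lambda>_. gam_const a x)"
  by (simp add: Gam_def lr_def gam_const_def)

lemma gam_const_sq: "a \<in> {1..m} \<Longrightarrow> gam_const a (gam_const a x) = - x"
  using fun_cong [OF Gam_sq [of a "\<lambda>_. x"], of "\<lambda>_. 0"] by (simp add: Gam_const)

lemma gam_const_anti: "a \<in> {1..m} \<Longrightarrow> b \<in> {1..m} \<Longrightarrow> a \<noteq> b \<Longrightarrow> gam_const a (gam_const b x) = - gam_const b (gam_const a x)"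
  using fun_cong [OF Gam_anti [of a b "\<lambda>_. x"], of "\<lambda>_. 0"] by (simp add: Gam_const)

text \<open>
  For odd \<open>m\<close>, products with the last generator: these $m - 1$ elements of the even subalgebra are Clifford generators
  of square $-1$ again. As their number is even, all modules over them are multiples of one another, while the full
  set of generators has two inequivalent irreducible modules.
\<close>

definition theta_const :: "nat \<Rightarrow> 'c \<Rightarrow> 'c" where
  "theta_const a x = (if even m then gam_const a x else gam_const m (gam_const a x))"

lemma theta_const_lin: "theta_const a (x + y) = theta_const a x + theta_const a y" "theta_const a (scale z x) = scale z (theta_const a x)"
  "theta_const a (- x) = - theta_const a x" "theta_const a (x - y) = theta_const a x - theta_const a y"
  by (simp_all add: theta_const_def gam_const_add gam_const_scale gam_const_minus gam_const_diff)

lemma theta_const_theta_const: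
  assumes "a \<in> {1..2 * (m div 2)}" "b \<in> {1..2 * (m div 2)}"
  shows "theta_const a (theta_const b x) = gam_const a (gam_const b x)"
proof (cases "even m")
  case False
  then have "a \<in> {1..m}" "m \<in> {1..m}" "a \<noteq> m" using assms by (auto elim!: oddE)
  with False show ?thesis
    by (simp add: theta_const_def gam_const_anti [of a m] gam_const_minus gam_const_sq del: atLeastAtMost_iff)
qed (simp add: theta_const_def)

lemma theta_const_sq: "a \<in> {1..2 * (m div 2)} \<Longrightarrow> theta_const a (theta_const a x) = - x"
  by (simp only: theta_const_theta_const) (rule gam_const_sq, auto)

lemma theta_const_anti:
  assumes "a \<in> {1..2 * (m div 2)}" "b \<in> {1..2 * (m div 2)}" "a \<noteq> b"
  shows "theta_const a (theta_const b x) = - theta_const b (theta_const a x)"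
  unfolding theta_const_theta_const [OF assms(1,2)] theta_const_theta_const [OF assms(2,1)] using assms by (intro gam_const_anti) auto

definition ann_const :: "nat \<Rightarrow> 'c \<Rightarrow> 'c" where
  "ann_const a x = scale (1 / 2) (theta_const (2 * a - 1) x - scale \<i> (theta_const (2 * a) x))"

definition cre_const :: "nat \<Rightarrow> 'c \<Rightarrow> 'c" where
  "cre_const a x = scale (- 1 / 2) (theta_const (2 * a - 1) x + scale \<i> (theta_const (2 * a) x))"

lemma half_half: "scale (1 / 2) x + scale (1 / 2) x = x"
  by (simp flip: scale_left_distrib)

lemma theta_const_ann_const: "theta_const (2 * a - 1) x = ann_const a x - cre_const a x" "theta_const (2 * a) x = scale \<i> (ann_const a x + cre_const a x)"
proof -
  have "ann_const a x - cre_const a x = scale (1 / 2) (theta_const (2 * a - 1) x) + scale (1 / 2) (theta_const (2 * a - 1) x)"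
    by (simp add: ann_const_def cre_const_def scale_right_distrib scale_right_diff_distrib)
  then show "theta_const (2 * a - 1) x = ann_const a x - cre_const a x" by (simp only: half_half)
  have "scale \<i> (ann_const a x + cre_const a x) = scale (1 / 2) (theta_const (2 * a) x) + scale (1 / 2) (theta_const (2 * a) x)"
    by (simp add: ann_const_def cre_const_def scale_right_distrib scale_right_diff_distrib)
  then show "theta_const (2 * a) x = scale \<i> (ann_const a x + cre_const a x)" by (simp only: half_half)
qed

lemma car: "car scale (m div 2) ann_const cre_const"
proof unfold_locales
  fix a x y z
  show "ann_const a (x + y) = ann_const a x + ann_const a y" "ann_const a (scale z x) = scale z (ann_const a x)"
    "cre_const a (x + y) = cre_const a x + cre_const a y" "cre_const a (scale z x) = scale z (cre_const a x)"
    by (simp_all add: ann_const_def cre_const_def theta_const_lin scale_right_distrib scale_right_diff_distrib algebra_simps)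
next
  fix a b x assume ab: "a \<in> {1..m div 2}" "b \<in> {1..m div 2}"
  define p q r s where pq: "p = 2 * a - 1" "q = 2 * a" "r = 2 * b - 1" "s = 2 * b"
  have ran: "p \<in> {1..2 * (m div 2)}" "q \<in> {1..2 * (m div 2)}" "r \<in> {1..2 * (m div 2)}" "s \<in> {1..2 * (m div 2)}"
    using ab unfolding pq by auto
  have pq': "p \<noteq> q" using ab unfolding pq by auto
  define g where "g u v e x = theta_const u x + scale e (theta_const v x)" for u v e x
  have c: "ann_const a x = scale (1 / 2) (g p q (- \<i>) x)" "ann_const b x = scale (1 / 2) (g r s (- \<i>) x)"
    "cre_const a x = scale (- 1 / 2) (g p q \<i> x)" "cre_const b x = scale (- 1 / 2) (g r s \<i> x)" for x
    by (simp_all add: ann_const_def cre_const_def g_def pq)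
  have g_scale: "g u v e (scale z x) = scale z (g u v e x)" for u v e z x
    by (simp add: g_def theta_const_lin scale_right_distrib mult.commute)
  have gg: "g p q e (g r s e' x) + g r s e' (g p q e x)
    = (if a = b then - (x + x) - scale (e * e') (x + x) else 0)" for e e'
  proof (cases "a = b")
    case True
    then have rs: "r = p" "s = q" by (auto simp: pq)
    show ?thesis
      unfolding rs g_def using True theta_const_sq [OF ran(1)] theta_const_sq [OF ran(2)] theta_const_anti [OF ran(2,1)] pq'
      by (simp add: theta_const_lin scale_right_distrib algebra_simps)
  next
    case False
    then have "r \<noteq> p" "r \<noteq> q" "s \<noteq> p" "s \<noteq> q" using ab unfolding pq by auto
    then show ?thesis
      unfolding g_def using False theta_const_anti [OF ran(3,1)] theta_const_anti [OF ran(3,2)] theta_const_anti [OF ran(4,1)] theta_const_anti [OF ran(4,2)]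
      by (simp add: theta_const_lin scale_right_distrib algebra_simps)
  qed
  have gg0: "g p q e (g r s e x) = - g r s e (g p q e x)" if "e = \<i> \<or> e = - \<i>" for e
  proof -
    have "e * e = - 1" using that by auto
    then show ?thesis using gg [of e e] unfolding \<open>e * e = - 1\<close> by (auto simp: eq_neg_iff_add_eq_0)
  qed
  show "ann_const a (ann_const b x) = - ann_const b (ann_const a x)" "cre_const a (cre_const b x) = - cre_const b (cre_const a x)"
    unfolding c g_scale by (simp_all add: gg0)
  have "g p q (- \<i>) (g r s \<i> x) = (if a = b then - (x + x) - (x + x) else 0) - g r s \<i> (g p q (- \<i>) x)"
    using gg [of "- \<i>" \<i>] by (simp add: eq_diff_eq)
  then have "ann_const a (cre_const b x) = scale (- 1 / 4) (if a = b then - (x + x) - (x + x) else 0) - cre_const b (ann_const a x)"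
    unfolding c g_scale by (simp add: scale_right_diff_distrib)
  also have "scale (- 1 / 4) (if a = b then - (x + x) - (x + x) else 0) = scale (of_bool (a = b)) x"
  proof -
    have "- (x + x) - (x + x) = scale (- 4) x"
    proof -
      have "scale (- 4) x = scale (- 1 - 1 - 1 - 1) x" by simp
      also have "\<dots> = - x - x - x - x" by (simp only: scale_left_diff_distrib scale_minus_left scale_one)
      finally show ?thesis by simp
    qed
    then show ?thesis by simp
  qed
  finally show "ann_const a (cre_const b x) = scale (of_bool (a = b)) x - cre_const b (ann_const a x)" .
qed

end

section \<open>From discrete polynomials to Fock space\<close>

locale clifford_coordinates = clifford_algebra scale m ep em
  for scale :: "complex \<Rightarrow> 'c::ring_1 \<Rightarrow> 'c" and m ep em +
  fixes N :: nat and \<kappa> :: "nat \<Rightarrow> 'c \<Rightarrow> nat set \<Rightarrow> complex"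
  assumes m3: "m \<ge> 3"
    and \<kappa>_add: "\<kappa> i (x + y) B = \<kappa> i x B + \<kappa> i y B"
    and \<kappa>_scale: "\<kappa> i (scale z x) B = z * \<kappa> i x B"
    and \<kappa>_supported: "\<kappa> i x B \<noteq> 0 \<Longrightarrow> B \<subseteq> {1..m div 2}"
    and \<kappa>_ann_const: "a \<in> {1..m div 2} \<Longrightarrow> \<kappa> i (ann_const a x) B = (if a \<in> B then 0 else ksign a B * \<kappa> i x (insert a B))"
    and \<kappa>_cre_const: "a \<in> {1..m div 2} \<Longrightarrow> \<kappa> i (cre_const a x) B = (if a \<in> B then ksign a B * \<kappa> i x (B - {a}) else 0)"
    and \<kappa>_inj: "(\<And>i B. i < N \<Longrightarrow> B \<subseteq> {1..m div 2} \<Longrightarrow> \<kappa> i x B = 0) \<Longrightarrow> x = 0"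
    and \<kappa>_surj: "\<exists>x. \<forall>i<N. \<forall>B\<subseteq>{1..m div 2}. \<kappa> i x B = \<psi> i B"
begin

lemma m2: "m \<ge> 2" using m3 by simp

lemma \<kappa>_0: "\<kappa> i 0 B = 0" using \<kappa>_scale [of i 0 0 B] by simp

lemma \<kappa>_minus: "\<kappa> i (- x) B = - \<kappa> i x B" using \<kappa>_scale [of i "- 1" x B] by simp

lemma \<kappa>_diff: "\<kappa> i (x - y) B = \<kappa> i x B - \<kappa> i y B"
  using \<kappa>_add [of i x "- y" B] by (simp add: \<kappa>_minus)

lemma \<kappa>_sum: "\<kappa> i (\<Sum>j\<in>J. h j) B = (\<Sum>j\<in>J. \<kappa> i (h j) B)"
  by (induction J rule: infinite_finite_induct) (simp_all add: \<kappa>_0 \<kappa>_add)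

text \<open>
  Here and in \<open>gam_gam_at\<close> and \<open>gam_at\<close>, the hypothesis says that the slice of \<open>\<phi>\<close> at \<open>\<alpha>\<close> is the coordinate vector of
  the constant \<open>x\<close>; the operators on slices then correspond to those on constants.
\<close>

lemma theta_at:
  assumes "\<And>B. \<phi> \<alpha> B = \<kappa> i x B" "a \<in> {1..2 * (m div 2)}"
  shows "theta a \<phi> \<alpha> B = \<kappa> i (theta_const a x) B"
proof (cases "odd a")
  case True
  then obtain b where b: "a = 2 * b + 1" ..
  define b' where "b' = Suc b"
  have a: "a = 2 * b' - 1" "Suc a div 2 = b'" "b' \<in> {1..m div 2}" using b assms(2) by (auto simp: b'_def)
  have "theta a \<phi> \<alpha> B = ann b' \<phi> \<alpha> B - cre b' \<phi> \<alpha> B" using True a by (simp add: theta_def)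
  also have "\<dots> = \<kappa> i (theta_const a x) B"
    unfolding a(1) theta_const_ann_const \<kappa>_diff \<kappa>_ann_const [OF a(3)] \<kappa>_cre_const [OF a(3)] by (simp add: ann_def cre_def assms(1))
  finally show ?thesis .
next
  case False
  then obtain b where b: "a = 2 * b" by (auto elim: evenE)
  have b': "b \<in> {1..m div 2}" using b assms(2) by auto
  have "theta a \<phi> \<alpha> B = \<i> * (ann b \<phi> \<alpha> B + cre b \<phi> \<alpha> B)" using b by (simp add: theta_def)
  also have "\<dots> = \<kappa> i (theta_const a x) B"
    unfolding b theta_const_ann_const \<kappa>_scale \<kappa>_add \<kappa>_ann_const [OF b'] \<kappa>_cre_const [OF b'] by (simp add: ann_def cre_def assms(1))
  finally show ?thesis .
qed

lemma gam_gam_at: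
  assumes \<phi>: "\<And>B. \<phi> \<alpha> B = \<kappa> i x B" and ab: "a \<in> {1..m}" "b \<in> {1..m}" "a \<noteq> b"
  shows "gam m a (gam m b \<phi>) \<alpha> B = \<kappa> i (gam_const a (gam_const b x)) B"
proof -
  have last: "gam m a (gam m m \<phi>) \<alpha> B = \<kappa> i (gam_const a (gam_const m x)) B"
    if "odd m" "a \<in> {1..2 * (m div 2)}" for a
  proof -
    have a: "a \<in> {1..m}" "m \<in> {1..m}" "a \<noteq> m" using that by (auto elim!: oddE)
    have "gam m a (gam m m \<phi>) \<alpha> B = - theta a \<phi> \<alpha> B" using gam_gam_last [OF that, of \<phi>] by simp
    also have "\<dots> = - \<kappa> i (theta_const a x) B" using theta_at [of \<phi> \<alpha> i x a B] that \<phi> by simp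
    also have "\<dots> = \<kappa> i (gam_const a (gam_const m x)) B"
      unfolding gam_const_anti [OF a] using that by (simp add: theta_const_def \<kappa>_minus)
    finally show ?thesis .
  qed
  consider "a \<in> {1..2 * (m div 2)}" "b \<in> {1..2 * (m div 2)}" | "odd m" "a \<in> {1..2 * (m div 2)}" "b = m"
    | "odd m" "b \<in> {1..2 * (m div 2)}" "a = m"
  proof (cases "even m")
    case True
    then show ?thesis using that(1) ab by simp
  next
    case False
    then have "m = 2 * (m div 2) + 1" by simp
    then show ?thesis using that ab False by (metis atLeastAtMost_iff le_SucE Suc_eq_plus1)
  qed
  then show ?thesis
  proof cases
    case 1
    then show ?thesis
      unfolding gam_gam_theta [OF 1] theta_const_theta_const [OF 1, symmetric] by (intro theta_at \<phi>)
  next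
    case 2
    then show ?thesis using last by simp
  next
    case 3
    have "gam m a (gam m b \<phi>) \<alpha> B = - gam m b (gam m a \<phi>) \<alpha> B" using gam_anti [OF ab, of \<phi>] by simp
    also have "\<dots> = - \<kappa> i (gam_const b (gam_const a x)) B" using last [OF 3(1,2)] 3 by simp
    also have "\<dots> = \<kappa> i (gam_const a (gam_const b x)) B" unfolding gam_const_anti [OF ab] by (simp add: \<kappa>_minus)
    finally show ?thesis .
  qed
qed

definition fock_map :: "nat \<Rightarrow> nat \<Rightarrow> ((nat \<Rightarrow> int) \<Rightarrow> 'c) \<Rightarrow> fock" where
  "fock_map k i f = (\<lambda>\<alpha> B. if \<alpha> \<in> multi_index m k then \<kappa> i (taylor_coeff f \<alpha>) B else 0)"

lemma fock_map_fock_deg: "fock_map k i f \<in> fock_deg m k"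
  using \<kappa>_supported by (intro fock_degI) (auto simp: fock_map_def multi_index_def split: if_splits)

lemma fock_map_add: "f \<in> F \<Longrightarrow> g \<in> F \<Longrightarrow> fock_map k i (f + g) = fock_map k i f + fock_map k i g"
  by (rule fock_eqI) (simp add: fock_map_def taylor_coeff_add [OF m2] \<kappa>_add)

lemma fock_map_scale: "f \<in> F \<Longrightarrow> fock_map k i (fscale z f) = z \<odot> fock_map k i f"
  by (rule fock_eqI) (simp add: fock_map_def taylor_coeff_scale [OF m2] \<kappa>_scale)

lemma fock_map_0: "fock_map k i 0 = 0"
  using fock_map_scale [OF F_0, of k i 0] by simp

lemma fock_map_diff: "f \<in> F \<Longrightarrow> g \<in> F \<Longrightarrow> fock_map k i (f - g) = fock_map k i f - fock_map k i g"
  using fock_map_add [of "f - g" g k i] F_diff [of f g] by (simp add: eq_diff_eq)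

lemma fock_map_null_y:
  assumes "f \<in> homog_polys k" "j \<in> {1..m}"
  shows "fock_map (Suc k) i (null_y j f) = mulw j (fock_map k i f)"
proof (rule fock_eqI)
  fix \<alpha> B
  show "fock_map (Suc k) i (null_y j f) \<alpha> B = mulw j (fock_map k i f) \<alpha> B"
  proof (cases "j \<in># \<alpha>")
    case True
    then obtain \<beta> where b: "\<alpha> = add_mset j \<beta>" by (rule mset_add)
    then have "\<alpha> \<in> multi_index m (Suc k) \<longleftrightarrow> \<beta> \<in> multi_index m k" using assms by (auto simp: multi_index_def)
    then show ?thesis using taylor_coeff_null_y [OF m2 assms, of \<alpha>] b by (simp add: fock_map_def mulw_def \<kappa>_scale)
  next
    case False
    then have "count \<alpha> j = 0" by (simp add: not_in_iff)
    then show ?thesis using taylor_coeff_null_y [OF m2 assms, of \<alpha>] by (simp add: fock_map_def mulw_def \<kappa>_0)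
  qed
qed

lemma fock_map_null_d:
  assumes "f \<in> homog_polys (Suc k)" "j \<in> {1..m}"
  shows "fock_map k i (null_d j f) = derw j (fock_map (Suc k) i f)"
proof (rule fock_eqI)
  fix \<alpha> B
  have "add_mset j \<alpha> \<in> multi_index m (Suc k) \<longleftrightarrow> \<alpha> \<in> multi_index m k" using assms(2) by (auto simp: multi_index_def)
  then show "fock_map k i (null_d j f) \<alpha> B = derw j (fock_map (Suc k) i f) \<alpha> B"
    using taylor_coeff_null_d [OF m2 homog_polys_F [OF assms(1)] assms(2)] by (simp add: fock_map_def derw_def)
qed

lemma fock_map_yF:
  assumes "f \<in> homog_polys k" "j \<in> {1..m}"
  shows "fock_map (Suc k) i (yF j f) = yop j (fock_map k i f)"
proof -
  have mem: "1 \<in> {1..m}" "2 \<in> {1..m}" using m2 by auto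
  note W = null_y_F [OF m2 mem(1) homog_polys_F [OF assms(1)]] null_y_F [OF m2 mem(2) homog_polys_F [OF assms(1)]]
  note P = fock_map_null_y [OF assms(1) mem(1)] fock_map_null_y [OF assms(1) mem(2)]
  consider "j = 1" | "j = 2" | "j \<noteq> 1" "j \<noteq> 2" by blast
  then show ?thesis
  proof cases
    case 1
    show ?thesis unfolding 1 yF_null_y(1) [OF m2]
      by (simp only: fock_map_scale F_add W fock_map_add P yop_def simp_thms if_True)
  next
    case 2
    show ?thesis unfolding 2 yF_null_y(2) [OF m2]
      by (simp only: fock_map_scale F_diff W fock_map_diff P) (simp add: yop_def)
  next
    case 3
    then show ?thesis using fock_map_null_y [OF assms] by (simp add: null_y_def yop_def)
  qed
qed

lemma fock_map_dF:
  assumes "f \<in> homog_polys (Suc k)" "j \<in> {1..m}"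
  shows "fock_map k i (dF j f) = dop j (fock_map (Suc k) i f)"
proof -
  have mem: "1 \<in> {1..m}" "2 \<in> {1..m}" using m2 by auto
  note W = null_d_F [OF m2 mem(1) homog_polys_F [OF assms(1)]] null_d_F [OF m2 mem(2) homog_polys_F [OF assms(1)]]
  note P = fock_map_null_d [OF assms(1) mem(1)] fock_map_null_d [OF assms(1) mem(2)]
  consider "j = 1" | "j = 2" | "j \<noteq> 1" "j \<noteq> 2" by blast
  then show ?thesis
  proof cases
    case 1
    show ?thesis unfolding 1 dF_null_d(1) [OF m2]
      by (simp only: fock_map_scale F_add W fock_map_add P dop_def simp_thms if_True)
  next
    case 2
    show ?thesis unfolding 2 dF_null_d(2) [OF m2]
      by (simp only: fock_map_scale F_diff W fock_map_diff P) (simp add: dop_def)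
  next
    case 3
    then show ?thesis using fock_map_null_d [OF assms] by (simp add: null_d_def dop_def)
  qed
qed

lemma fock_map_yd:
  assumes "f \<in> homog_polys k" "a \<in> {1..m}" "b \<in> {1..m}"
  shows "fock_map k i (yF a (dF b f)) = yop a (dop b (fock_map k i f))"
proof (cases k)
  case 0
  then have "yF a (dF b f) = 0"
    using homog_polys_0_dF [of f b] assms linF_0 [OF linF_yF [OF assms(2)]] by simp
  then show ?thesis using fock_deg_dop_0 [of "fock_map 0 i f" m b] fock_map_fock_deg 0 by (simp add: fock_map_0 yop_rules)
next
  case (Suc j)
  then have f: "f \<in> homog_polys (Suc j)" using assms by simp
  show ?thesis unfolding Suc fock_map_yF [OF homog_polys_dF [OF f assms(3)] assms(2)] fock_map_dF [OF f assms(3)] ..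
qed

text \<open>
  Moving \<open>Gam\<close> past \<open>k\<close> derivatives costs $(-1)^k$; for a product of two the signs cancel.
\<close>

lemma fock_map_Gam_Gam:
  assumes "f \<in> homog_polys k" "a \<in> {1..m}" "b \<in> {1..m}" "a \<noteq> b"
  shows "fock_map k i (Gam a (Gam b f)) = gam m a (gam m b (fock_map k i f))"
proof (rule fock_eqI)
  fix \<alpha> B
  show "fock_map k i (Gam a (Gam b f)) \<alpha> B = gam m a (gam m b (fock_map k i f)) \<alpha> B"
  proof (cases "\<alpha> \<in> multi_index m k")
    case True
    note f = homog_polys_F [OF assms(1)]
    have "taylor_coeff (Gam a (Gam b f)) \<alpha> = scale ((- 1) ^ k * (- 1) ^ k) (gam_const a (gam_const b (taylor_coeff f \<alpha>)))"
      by (simp only: taylor_coeff_Gam [OF m2 Gam_F [OF f] assms(2) True] taylor_coeff_Gam [OF m2 f assms(3) True] gam_const_scale scale_scale)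
    then have "taylor_coeff (Gam a (Gam b f)) \<alpha> = gam_const a (gam_const b (taylor_coeff f \<alpha>))" by (simp flip: power_mult_distrib)
    moreover have "gam m a (gam m b (fock_map k i f)) \<alpha> B = \<kappa> i (gam_const a (gam_const b (taylor_coeff f \<alpha>))) B"
      by (rule gam_gam_at [OF _ assms(2-4)]) (simp add: fock_map_def True)
    ultimately show ?thesis by (simp add: fock_map_def True)
  next
    case False
    have "gam m a (gam m b (fock_map k i f)) \<in> fock_deg m k"
      using assms by (intro fock_deg_gam fock_map_fock_deg)
    then have "gam m a (gam m b (fock_map k i f)) \<alpha> B = 0"
      using False fock_degD [of "gam m a (gam m b (fock_map k i f))" m k \<alpha> B] by (auto simp: multi_index_def)
    then show ?thesis by (simp add: fock_map_def False)
  qed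
qed

lemma fock_map_dR:
  assumes "f \<in> homog_polys k" "a \<in> {1..m}" "b \<in> {1..m}"
  shows "fock_map k i (dR a b f) = rho_fock m a b (fock_map k i f)"
proof (cases "a = b")
  case True
  then show ?thesis by (simp add: dR_def rho_fock_def fock_map_0)
next
  case False
  note f = homog_polys_F [OF assms(1)]
  have mem: "yF a (dF b f) \<in> F" "yF b (dF a f) \<in> F" "Gam a (Gam b f) \<in> F"
    using assms f by (auto intro!: yF_F dF_F Gam_F)
  show ?thesis
    unfolding dR_eq [OF assms(2,3) False f]
    by (simp only: fock_map_diff fock_map_scale mem F_diff F_scale fock_map_yd [OF assms] fock_map_yd [OF assms(1,3,2)]
        fock_map_Gam_Gam [OF assms False] rho_fock_def False if_False)
qed

text \<open>
  The Dirac operator is odd in the Clifford generators, while for odd \<open>m\<close> coordinates of constants only respect even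
  products. Multiplying by one more generator makes it even and, being invertible, keeps its kernel.
\<close>

definition twist :: "fock \<Rightarrow> fock" where
  "twist f = (if even m then f else kappa (m div 2) f)"

definition twist_const :: "'c \<Rightarrow> 'c" where
  "twist_const x = (if even m then x else gam_const m x)"

lemma gam_at:
  assumes \<psi>: "\<And>B. \<psi> \<alpha> B = \<kappa> i u B" and j: "j \<in> {1..m}"
  shows "twist (gam m j \<psi>) \<alpha> B = \<kappa> i (twist_const (gam_const j u)) B"
proof (cases "even m")
  case True
  then show ?thesis using theta_at [of \<psi> \<alpha> i u j B] \<psi> j by (simp add: twist_def twist_const_def gam_def theta_const_def)
next
  case False
  then have m: "m = 2 * (m div 2) + 1" "m \<in> {1..m}" by (auto elim!: oddE)
  show ?thesis
  proof (cases "j = m")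
    case True
    with False show ?thesis using gam_const_sq [OF m(2)] by (simp add: twist_def twist_const_def gam_def \<kappa>_minus \<psi>)
  next
    case n: False
    have j': "j \<in> {1..2 * (m div 2)}" using j n m(1) by (metis atLeastAtMost_iff le_SucE Suc_eq_plus1)
    then have "twist (gam m j \<psi>) = theta j \<psi>"
      using False n kappa_theta [of j "m div 2" "kappa (m div 2) \<psi>"]
      by (simp add: twist_def gam_def theta_rules)
    moreover have "twist_const (gam_const j u) = theta_const j u" using False by (simp add: twist_const_def theta_const_def)
    ultimately show ?thesis using theta_at [of \<psi> \<alpha> i u j B] \<psi> j' by simp
  qed
qed

lemma twist_lin: "fock_linear twist"
  using kappa_lin by (auto simp: twist_def fock_linear_def)

lemma twist_0_iff: "twist f \<alpha> = (\<lambda>_. 0) \<longleftrightarrow> f \<alpha> = (\<lambda>_. 0)"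
  by (auto simp: twist_def kappa_def fun_eq_iff)

lemma twist_const_0_iff: "twist_const x = 0 \<longleftrightarrow> x = 0"
proof
  assume z: "twist_const x = 0"
  show "x = 0"
  proof (cases "even m")
    case False
    then have "m \<in> {1..m}" by (auto elim!: oddE)
    then have "gam_const m (gam_const m x) = - x" by (rule gam_const_sq)
    with z False show ?thesis by (simp add: twist_const_def gam_const_0)
  qed (use z in \<open>simp add: twist_const_def\<close>)
qed (simp add: twist_const_def gam_const_0)

lemma twist_const_sum: "twist_const (\<Sum>j\<in>J. h j) = (\<Sum>j\<in>J. twist_const (h j))"
  by (simp add: twist_const_def gam_const_sum)

lemma dirac_homog_polys:
  assumes "f \<in> homog_polys (Suc k)"
  shows "dirac f \<in> homog_polys k"
  unfolding dirac_eq using assms by (intro homog_polys_closed(5,6) homog_polys_Gam homog_polys_dF)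

text \<open>
  The Taylor coefficients of \<open>dirac f\<close> and those of \<open>dirac_fock m\<close> agree up to the sign $\pm (-1)^{k-1}$ from moving \<open>Gam\<close>
  past the derivatives and up to \<open>twist\<close>; neither affects whether they vanish.
\<close>

lemma dirac_0_iff:
  assumes f: "f \<in> homog_polys k"
  shows "dirac f = 0 \<longleftrightarrow> (\<forall>i<N. dirac_fock m (fock_map k i f) = 0)"
proof (cases k)
  case 0
  have "dirac f = 0"
    unfolding dirac_eq using homog_polys_0_dF [of f] f 0 by (simp add: linF_0 [OF linF_Gam])
  moreover have "dirac_fock m (fock_map k i f) = 0" for i
    unfolding dirac_fock_def using fock_deg_dop_0 [of "fock_map k i f" m] fock_map_fock_deg [of k i f] 0 by (simp add: gam_rules)
  ultimately show ?thesis by simp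
next
  case (Suc l)
  then have f': "f \<in> homog_polys (Suc l)" using f by simp
  have dF_homog: "dF j f \<in> homog_polys l" if "j \<in> {1..m}" for j using homog_polys_dF [OF f' that] .
  define S where "S \<beta> = (\<Sum>j = 1..m. gam_const j (taylor_coeff (dF j f) \<beta>))" for \<beta>
  have cfd: "taylor_coeff (dirac f) \<beta> = scale (- ((- 1) ^ l)) (S \<beta>)" if b: "\<beta> \<in> multi_index m l" for \<beta>
  proof -
    have bm: "set_mset \<beta> \<subseteq> {1..m}" using b by (simp add: multi_index_def)
    have sF: "(\<Sum>j = 1..m. Gam j (dF j f)) \<in> F"
      by (intro F_sum Gam_F homog_polys_F [OF dF_homog])
    have "iter_deriv \<beta> (dirac f) = - (\<Sum>j = 1..m. iter_deriv \<beta> (Gam j (dF j f)))"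
      unfolding dirac_eq linF_neg [OF linF_iter_deriv [OF m2 bm] sF]
      by (subst linF_apply_sum [OF linF_iter_deriv [OF m2 bm]]) (rule Gam_F [OF homog_polys_F [OF dF_homog]], assumption, rule refl)
    then have "taylor_coeff (dirac f) \<beta> = - (\<Sum>j = 1..m. taylor_coeff (Gam j (dF j f)) \<beta>)" by (simp add: taylor_coeff_def)
    also have "(\<Sum>j = 1..m. taylor_coeff (Gam j (dF j f)) \<beta>) = (\<Sum>j = 1..m. scale ((- 1) ^ l) (gam_const j (taylor_coeff (dF j f) \<beta>)))"
      by (intro sum.cong refl taylor_coeff_Gam [OF m2 homog_polys_F [OF dF_homog] _ b])
    finally show ?thesis by (simp add: S_def scale_sum_right sum_negf)
  qed
  have twS: "twist (dirac_fock m (fock_map k i f)) \<beta> B = \<kappa> i (twist_const (S \<beta>)) B" if b: "\<beta> \<in> multi_index m l" for \<beta> B i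
  proof -
    have "twist (dirac_fock m (fock_map k i f)) \<beta> B = (\<Sum>j = 1..m. twist (gam m j (dop j (fock_map k i f))) \<beta> B)"
      unfolding dirac_fock_def lin_sum [OF twist_lin] by simp
    also have "\<dots> = (\<Sum>j = 1..m. \<kappa> i (twist_const (gam_const j (taylor_coeff (dF j f) \<beta>))) B)"
    proof (intro sum.cong refl gam_at)
      fix j B assume j: "j \<in> {1..m}"
      show "dop j (fock_map k i f) \<beta> B = \<kappa> i (taylor_coeff (dF j f) \<beta>) B"
        using fun_cong [OF fun_cong [OF fock_map_dF [OF f' j, of i], of \<beta>], of B] b
        by (simp add: Suc fock_map_def [of l])
    qed
    finally show ?thesis by (simp add: S_def twist_const_sum \<kappa>_sum)
  qed
  have "dirac f = 0 \<longleftrightarrow> (\<forall>\<beta>\<in>multi_index m l. taylor_coeff (dirac f) \<beta> = 0)"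
  proof
    assume "dirac f = 0"
    then show "\<forall>\<beta>\<in>multi_index m l. taylor_coeff (dirac f) \<beta> = 0"
      using taylor_coeff_scale [OF m2 F_0, of _ l 0] by simp
  next
    assume "\<forall>\<beta>\<in>multi_index m l. taylor_coeff (dirac f) \<beta> = 0"
    then show "dirac f = 0" using taylor_coeff_inj [OF m2 dirac_homog_polys [OF f']] by blast
  qed
  also have "\<dots> \<longleftrightarrow> (\<forall>\<beta>\<in>multi_index m l. S \<beta> = 0)" using cfd by simp
  also have "\<dots> \<longleftrightarrow> (\<forall>\<beta>\<in>multi_index m l. \<forall>i<N. \<forall>B. \<kappa> i (twist_const (S \<beta>)) B = 0)"
  proof -
    have "S \<beta> = 0 \<longleftrightarrow> (\<forall>i<N. \<forall>B. \<kappa> i (twist_const (S \<beta>)) B = 0)" for \<beta>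
      using \<kappa>_inj [of "twist_const (S \<beta>)"] twist_const_0_iff [of "S \<beta>"] \<kappa>_0 by auto
    then show ?thesis by simp
  qed
  also have "\<dots> \<longleftrightarrow> (\<forall>i<N. dirac_fock m (fock_map k i f) = 0)"
  proof -
    have "(\<forall>\<beta>\<in>multi_index m l. \<forall>B. \<kappa> i (twist_const (S \<beta>)) B = 0) \<longleftrightarrow> dirac_fock m (fock_map k i f) = 0" for i
    proof
      assume z: "\<forall>\<beta>\<in>multi_index m l. \<forall>B. \<kappa> i (twist_const (S \<beta>)) B = 0"
      have h: "dirac_fock m (fock_map (Suc l) i f) \<in> fock_deg m l"
        unfolding dirac_fock_def
        by (rule fock.subspace_sum [OF supported_subspace, of _ _ "\<lambda>\<alpha> B. \<alpha> \<in> multi_index m l \<and> B \<subseteq> {1..m div 2}", folded fock_deg_def])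
           (intro fock_deg_gam fock_deg_dop fock_map_fock_deg)
      show "dirac_fock m (fock_map k i f) = 0"
      proof (rule fock_eqI)
        fix \<beta> B
        show "dirac_fock m (fock_map k i f) \<beta> B = 0 \<beta> B"
        proof (cases "\<beta> \<in> multi_index m l")
          case True
          then have "twist (dirac_fock m (fock_map k i f)) \<beta> = (\<lambda>_. 0)" using z twS by (simp add: fun_eq_iff)
          then show ?thesis unfolding twist_0_iff by simp
        next
          case False
          then show ?thesis using fock_degD [OF h [folded Suc], of \<beta> B] by (auto simp: multi_index_def)
        qed
      qed
    next
      assume "dirac_fock m (fock_map k i f) = 0"
      then have "twist (dirac_fock m (fock_map k i f)) = 0" using lin_0 [OF twist_lin] by simp
      then show "\<forall>\<beta>\<in>multi_index m l. \<forall>B. \<kappa> i (twist_const (S \<beta>)) B = 0" using twS [of _ i] by auto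
    qed
    then show ?thesis by blast
  qed
  finally show ?thesis .
qed

lemma fock_map_inj:
  assumes "f \<in> homog_polys k" "\<And>i. i < N \<Longrightarrow> fock_map k i f = 0"
  shows "f = 0"
proof (rule taylor_coeff_inj [OF m2 assms(1)])
  fix \<alpha> assume a: "\<alpha> \<in> multi_index m k"
  show "taylor_coeff f \<alpha> = 0"
  proof (rule \<kappa>_inj)
    fix i B assume "i < N"
    then have "fock_map k i f \<alpha> B = 0" using assms(2) by simp
    then show "\<kappa> i (taylor_coeff f \<alpha>) B = 0" using a by (simp add: fock_map_def)
  qed
qed

lemma fock_map_surj:
  assumes "\<And>i. i < N \<Longrightarrow> \<psi> i \<in> fock_deg m k"
  shows "\<exists>f\<in>homog_polys k. \<forall>i<N. fock_map k i f = \<psi> i"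
proof -
  have "\<forall>\<alpha>. \<exists>x. \<forall>i<N. \<forall>B\<subseteq>{1..m div 2}. \<kappa> i x B = \<psi> i \<alpha> B"
    by (rule allI, rule \<kappa>_surj)
  then obtain X where X: "\<forall>\<alpha>. \<forall>i<N. \<forall>B\<subseteq>{1..m div 2}. \<kappa> i (X \<alpha>) B = \<psi> i \<alpha> B"
    by (rule choice [THEN exE])
  obtain f where f: "f \<in> homog_polys k" "\<forall>\<alpha>\<in>multi_index m k. taylor_coeff f \<alpha> = X \<alpha>" using taylor_coeff_surj [OF m2] by blast
  have "fock_map k i f = \<psi> i" if i: "i < N" for i
  proof (rule fock_eqI)
    fix \<alpha> B
    note D = fock_degD [OF assms [OF i], of \<alpha> B]
    show "fock_map k i f \<alpha> B = \<psi> i \<alpha> B"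
    proof (cases "\<alpha> \<in> multi_index m k \<and> B \<subseteq> {1..m div 2}")
      case True
      then show ?thesis using X f(2) i by (simp add: fock_map_def)
    next
      case False
      then have "\<psi> i \<alpha> B = 0" using D by (auto simp: multi_index_def)
      moreover have "fock_map k i f \<alpha> B = 0" using False fock_degD [OF fock_map_fock_deg, of k i f \<alpha> B] by (auto simp: multi_index_def)
      ultimately show ?thesis by simp
    qed
  qed
  with f(1) show ?thesis by blast
qed

lemma monogenics_surj:
  assumes "\<And>i. i < N \<Longrightarrow> \<psi> i \<in> fock_deg m k \<and> dirac_fock m (\<psi> i) = 0"
  shows "\<exists>f\<in>monogenics k. \<forall>i<N. fock_map k i f = \<psi> i"
proof -
  obtain f where f: "f \<in> homog_polys k" "\<forall>i<N. fock_map k i f = \<psi> i" using fock_map_surj [of \<psi> k] assms by blast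
  then have "dirac f = 0" using dirac_0_iff [OF f(1)] assms by simp
  with f show ?thesis unfolding monogenics_homog_polys by blast
qed

lemma monogenics_dirac_fock: "f \<in> monogenics k \<Longrightarrow> i < N \<Longrightarrow> dirac_fock m (fock_map k i f) = 0"
  using dirac_0_iff [of f k] by (auto simp: monogenics_homog_polys)

lemma monogenics_subspace: "fun_space.subspace (monogenics k)"
proof -
  have "linF (\<lambda>f. \<Sum>j\<in>A. Gam j (dF j f))" if "finite A" "A \<subseteq> {1..m}" for A
    using that
  proof (induction A rule: finite_induct)
    case empty
    show ?case using linF_scale [OF linF_id, of 0] by (simp only: fun_space.scale_zero_left sum.empty)
  next
    case (insert a A)
    have "linF (\<lambda>f. Gam a (dF a f) + (\<Sum>j\<in>A. Gam j (dF j f)))"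
      using insert by (intro linF_add linF_comp [OF linF_Gam linF_dF] insert.IH) auto
    then show ?case unfolding sum.insert [OF insert.hyps] .
  qed
  from linF_minus [OF this [of "{1..m}"]] have *: "linF dirac"
    unfolding dirac_eq [abs_def] by simp
  note D = linFD(2,3) [OF *]
  show ?thesis
    unfolding fun_space.subspace_def monogenics_homog_polys
  proof (intro conjI ballI allI)
    show "0 \<in> {f \<in> homog_polys k. dirac f = 0}" using linF_0 [OF *] homog_polys_closed(4) by simp
    fix f assume f: "f \<in> {f \<in> homog_polys k. dirac f = 0}"
    { fix g assume g: "g \<in> {f \<in> homog_polys k. dirac f = 0}"
      have "dirac (f + g) = dirac f + dirac g" using D(1) homog_polys_F f g by blast
      then show "f + g \<in> {f \<in> homog_polys k. dirac f = 0}" using f g by (simp add: homog_polys_closed(1)) }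
    fix z
    have "dirac (fscale z f) = fscale z (dirac f)" using D(2) homog_polys_F f by blast
    then show "fscale z f \<in> {f \<in> homog_polys k. dirac f = 0}" using f by (simp add: homog_polys_closed(3))
  qed
qed

lemma monogenics_dR:
  assumes "f \<in> monogenics k" "a \<in> {1..m}" "b \<in> {1..m}"
  shows "dR a b f \<in> monogenics k"
proof -
  have f: "f \<in> homog_polys k" using assms by (simp add: monogenics_homog_polys)
  have "dirac_fock m (fock_map k i (dR a b f)) = 0" if "i < N" for i
    unfolding fock_map_dR [OF f assms(2,3)] dirac_fock_rho_fock [OF assms(2,3)] monogenics_dirac_fock [OF assms(1) that]
    by (simp add: rho_fock_rules)
  then show ?thesis
    using dirac_0_iff [OF homog_polys_dR [OF f assms(2,3)]] homog_polys_dR [OF f assms(2,3)] by (simp add: monogenics_homog_polys)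
qed

lemma fock_monogenics_highest_weight:
  assumes "valid_parity m Q"
  shows "so_irreducible_with_highest_weight smul m (rho_fock m) (hw_weight m k Q) (fock_monogenics m k Q)"
  unfolding so_irreducible_with_highest_weight_def
  using fock_monogenics_irreducible [OF assms] hw_vec_highest [OF assms] hw_vec_fock_monogenics [OF assms] by blast

lemma odd_case:
  assumes "odd m"
  shows "coordinate_maps fscale m dR (monogenics k) {..<N} (\<lambda>_. fock_monogenics m k UNIV) (fock_map k) (\<lambda>_. hw_weight m k UNIV)"
proof -
  have v: "valid_parity m UNIV" using assms m3 by (simp add: valid_parity_def)
  have pU: "f \<in> fock_par UNIV" for f by (simp add: fock_par_def supported_def)
  show ?thesis
  proof unfold_locales
    show "finite {..<N}" by simp
    show "fun_space.subspace (monogenics k)" by (rule monogenics_subspace)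
    fix i assume i: "i \<in> {..<N}"
    show "so_irreducible_with_highest_weight smul m (rho_fock m) (hw_weight m k UNIV) (fock_monogenics m k UNIV)" by (rule fock_monogenics_highest_weight [OF v])
    fix x assume x: "x \<in> monogenics k"
    then have xF: "x \<in> F" and xK: "x \<in> homog_polys k" by (auto simp: monogenics_homog_polys homog_polys_F)
    show "fock_map k i x \<in> fock_monogenics m k UNIV"
      using monogenics_dirac_fock [OF x, of i] i pU fock_map_fock_deg by (simp add: fock_monogenics_def)
    { fix y assume y: "y \<in> monogenics k"
      then show "fock_map k i (x + y) = fock_map k i x + fock_map k i y" using xF by (intro fock_map_add) (auto simp: monogenics_homog_polys homog_polys_F) }
    { fix z show "fock_map k i (fscale z x) = z \<odot> fock_map k i x" by (rule fock_map_scale [OF xF]) }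
    { fix a b assume "a \<in> {1..m}" "b \<in> {1..m}"
      then show "fock_map k i (dR a b x) = rho_fock m a b (fock_map k i x)" by (rule fock_map_dR [OF xK]) }
  next
    fix a b x assume "a \<in> {1..m}" "b \<in> {1..m}" "x \<in> monogenics k"
    then show "dR a b x \<in> monogenics k" by (intro monogenics_dR)
  next
    fix x assume "x \<in> monogenics k" "\<And>i. i \<in> {..<N} \<Longrightarrow> fock_map k i x = 0"
    then show "x = 0" by (intro fock_map_inj [of x k]) (auto simp: monogenics_homog_polys)
  next
    fix \<psi> assume "\<And>i. i \<in> {..<N} \<Longrightarrow> \<psi> i \<in> fock_monogenics m k UNIV"
    then show "\<exists>x\<in>monogenics k. \<forall>i\<in>{..<N}. fock_map k i x = \<psi> i"
      using monogenics_surj [of \<psi> k] by (force simp: fock_monogenics_def)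
  qed
qed

text \<open>
  The two halves of the \<open>i\<close>-th copy of the spinors: \<open>Inl i\<close> the even one, whose highest weight ends in $+\frac12$, and
  \<open>Inr i\<close> the odd one, whose highest weight ends in $-\frac12$.
\<close>

definition par_map :: "nat \<Rightarrow> nat + nat \<Rightarrow> ((nat \<Rightarrow> int) \<Rightarrow> 'c) \<Rightarrow> fock" where
  "par_map k s f = (case s of Inl i \<Rightarrow> par_proj {True} (fock_map k i f) | Inr i \<Rightarrow> par_proj {False} (fock_map k i f))"

definition par_of :: "nat + nat \<Rightarrow> bool set" where
  "par_of s = (case s of Inl _ \<Rightarrow> {True} | Inr _ \<Rightarrow> {False})"

lemma par_map_eq: "par_map k s f = par_proj (par_of s) (fock_map k (case s of Inl i \<Rightarrow> i | Inr i \<Rightarrow> i) f)"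
  by (cases s) (auto simp: par_map_def par_of_def)

lemma even_case:
  assumes "even m"
  shows "coordinate_maps fscale m dR (monogenics k) ({..<N} <+> {..<N}) (\<lambda>s. fock_monogenics m k (par_of s)) (par_map k)
    (\<lambda>s. hw_weight m k (par_of s))"
proof -
  have v: "valid_parity m (par_of s)" for s using assms m3 by (cases s) (auto simp: valid_parity_def par_of_def)
  have compl: "- {True} = {False}" "- {False} = {True}" by auto
  have vc: "valid_parity m (- par_of s)" for s using assms m3 by (cases s) (auto simp: valid_parity_def par_of_def compl)
  note par_proj_rules = lin_rules [OF par_proj_lin]
  show ?thesis
  proof unfold_locales
    show "finite ({..<N} <+> {..<N})" by simp
    show "fun_space.subspace (monogenics k)" by (rule monogenics_subspace)
    fix s assume s: "s \<in> {..<N} <+> {..<N}"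
    define i where "i = (case s of Inl i \<Rightarrow> i | Inr i \<Rightarrow> i)"
    have i: "i < N" using s by (auto simp: i_def)
    have P: "par_map k s f = par_proj (par_of s) (fock_map k i f)" for f by (simp add: par_map_eq i_def)
    show "so_irreducible_with_highest_weight smul m (rho_fock m) (hw_weight m k (par_of s)) (fock_monogenics m k (par_of s))" by (rule fock_monogenics_highest_weight [OF v])
    fix x assume x: "x \<in> monogenics k"
    then have xF: "x \<in> F" and xK: "x \<in> homog_polys k" by (auto simp: monogenics_homog_polys homog_polys_F)
    show "par_map k s x \<in> fock_monogenics m k (par_of s)"
      unfolding P by (rule par_proj_fock_monogenics [OF assms fock_map_fock_deg monogenics_dirac_fock [OF x i]])
    { fix y assume y: "y \<in> monogenics k"
      then have "y \<in> F" by (auto simp: monogenics_homog_polys homog_polys_F)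
      show "par_map k s (x + y) = par_map k s x + par_map k s y"
        unfolding P fock_map_add [OF xF \<open>y \<in> F\<close>] by (rule par_proj_rules(1)) }
    { fix z show "par_map k s (fscale z x) = z \<odot> par_map k s x" unfolding P fock_map_scale [OF xF] by (rule par_proj_rules(2)) }
    { fix a b assume ab: "a \<in> {1..m}" "b \<in> {1..m}"
      show "par_map k s (dR a b x) = rho_fock m a b (par_map k s x)"
        unfolding P fock_map_dR [OF xK ab] by (rule par_proj_rho_fock [OF v vc fock_map_fock_deg ab]) }
  next
    fix a b x assume "a \<in> {1..m}" "b \<in> {1..m}" "x \<in> monogenics k"
    then show "dR a b x \<in> monogenics k" by (intro monogenics_dR)
  next
    fix x assume x: "x \<in> monogenics k" and z: "\<And>s. s \<in> {..<N} <+> {..<N} \<Longrightarrow> par_map k s x = 0"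
    show "x = 0"
    proof (rule fock_map_inj [of x k])
      show "x \<in> homog_polys k" using x by (simp add: monogenics_homog_polys)
      fix i assume i: "i < N"
      have "par_proj {True} (fock_map k i x) = 0" "par_proj {False} (fock_map k i x) = 0"
        using z [of "Inl i"] z [of "Inr i"] i by (auto simp: par_map_def)
      then show "fock_map k i x = 0" using par_proj_split [of "fock_map k i x" "{True}"] unfolding compl by simp
    qed
  next
    fix \<psi> assume \<psi>: "\<And>s. s \<in> {..<N} <+> {..<N} \<Longrightarrow> \<psi> s \<in> fock_monogenics m k (par_of s)"
    have T: "\<psi> (Inl i) \<in> fock_monogenics m k {True}" and Fa: "\<psi> (Inr i) \<in> fock_monogenics m k {False}" if "i < N" for i
      using \<psi> [of "Inl i"] \<psi> [of "Inr i"] that by (auto simp: par_of_def)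
    \<comment> \<open>Combine the prescribed even and odd parts; the projections separate them again.\<close>
    define \<chi> where "\<chi> i = \<psi> (Inl i) + \<psi> (Inr i)" for i
    have "\<chi> i \<in> fock_deg m k \<and> dirac_fock m (\<chi> i) = 0" if "i < N" for i
      using T [OF that] Fa [OF that] by (simp add: \<chi>_def fock_monogenics_def fock_deg_closed dirac_fock_rules)
    then obtain f where f: "f \<in> monogenics k" "\<forall>i<N. fock_map k i f = \<chi> i" using monogenics_surj [of \<chi> k] by blast
    have "par_map k s f = \<psi> s" if s: "s \<in> {..<N} <+> {..<N}" for s
    proof (cases s)
      case (Inl i)
      then have "i < N" using s by auto
      then show ?thesis
        using f(2) par_proj_unique [of "\<psi> (Inl i)" "{True}" "\<psi> (Inr i)"] T Fa Inl
        unfolding compl by (simp add: par_map_def \<chi>_def fock_monogenics_def)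
    next
      case (Inr i)
      then have "i < N" using s by auto
      then show ?thesis
        using f(2) par_proj_unique [of "\<psi> (Inr i)" "{False}" "\<psi> (Inl i)"] T Fa Inr
        unfolding compl by (simp add: par_map_def \<chi>_def fock_monogenics_def add.commute)
    qed
    with f(1) show "\<exists>x\<in>monogenics k. \<forall>s\<in>{..<N} <+> {..<N}. par_map k s x = \<psi> s" by blast
  qed
qed

end

section \<open>The decomposition\<close>

text \<open>
  The number of copies of the spinor space in the Clifford algebra is $4^m / 2^n$.
\<close>

lemma coordinates_exist:
  assumes "clifford_algebra scale m ep em" "m \<ge> 3" "n = m div 2"
  shows "\<exists>\<kappa>. clifford_coordinates scale m ep em (2 ^ (2 * m - n)) \<kappa>"
proof -
  interpret clifford_algebra scale m ep em by (rule assms(1))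
  interpret car: car scale "m div 2" ann_const cre_const by (rule car)
  have "dim (UNIV :: 'a set) > 0" unfolding dim_algebra by simp
  from car.coordinates [OF this] obtain N \<kappa> where N: "2 ^ (m div 2) * N = dim (UNIV :: 'a set)"
    and \<kappa>: "\<forall>i x y B. \<kappa> i (x + y) B = \<kappa> i x B + \<kappa> i y B"
      "\<forall>i z x B. \<kappa> i (scale z x) B = z * \<kappa> i x B"
      "\<forall>i x B. \<kappa> i x B \<noteq> 0 \<longrightarrow> B \<subseteq> {1..m div 2}"
      "\<forall>i a x B. a \<in> {1..m div 2} \<longrightarrow> \<kappa> i (ann_const a x) B = (if a \<in> B then 0 else ksign a B * \<kappa> i x (insert a B))"
      "\<forall>i a x B. a \<in> {1..m div 2} \<longrightarrow> \<kappa> i (cre_const a x) B = (if a \<in> B then ksign a B * \<kappa> i x (B - {a}) else 0)"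
      "\<forall>x. (\<forall>i<N. \<forall>B\<subseteq>{1..m div 2}. \<kappa> i x B = 0) \<longrightarrow> x = 0"
      "\<forall>\<psi>. \<exists>x. \<forall>i<N. \<forall>B\<subseteq>{1..m div 2}. \<kappa> i x B = (\<psi> i B :: complex)"
    by (elim exE conjE) (rule that)
  have "2 ^ n * N = 2 ^ n * 2 ^ (2 * m - n)"
    using N unfolding dim_algebra assms(3) by (simp flip: power_add)
  then have NN: "N = 2 ^ (2 * m - n)" by simp
  have "clifford_coordinates scale m ep em N \<kappa>"
  proof (intro clifford_coordinates.intro clifford_coordinates_axioms.intro assms(1,2))
    show "x = 0" if "\<And>i B. i < N \<Longrightarrow> B \<subseteq> {1..m div 2} \<Longrightarrow> \<kappa> i x B = 0" for x
      using \<kappa>(6) that by simp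
  qed (rule \<kappa>(1-5,7) [rule_format]; assumption)+
  then show ?thesis unfolding NN by blast
qed

theorem mainTheorem1:
  fixes scale :: "complex \<Rightarrow> 'c::ring_1 \<Rightarrow> 'c"
    and ep em :: "nat \<Rightarrow> 'c"
    and m n k :: nat
  assumes "clifford_algebra scale m ep em"
  shows
    "let sc = clifford_algebra.fscale scale;
         \<rho> = clifford_algebra.dR scale ep em;
         M = clifford_algebra.monogenics scale m ep em k;
         I = {..<2 ^ (2 * m - n)} :: nat set
     in
      (n \<ge> 1 \<and> m = 2 * n + 1 \<longrightarrow>
        so_representation sc m \<rho> M \<and>
        (\<exists>W. internal_direct_sum M I W \<and>
          isomorphic_irreducibles sc m \<rho> (\<lambda>a. if a = 1 then of_nat k + 1 / 2 else 1 / 2) I W)) \<and>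
      (n \<ge> 2 \<and> m = 2 * n \<longrightarrow>
        so_representation sc m \<rho> M \<and>
        (\<exists>Wp Wm. internal_direct_sum M (I <+> I) (case_sum Wp Wm) \<and>
          isomorphic_irreducibles sc m \<rho>
            (\<lambda>a. if a = 1 then of_nat k + 1 / 2 else 1 / 2) I Wp \<and>
          isomorphic_irreducibles sc m \<rho>
            (\<lambda>a. if a = 1 then of_nat k + 1 / 2 else if a = n then - (1 / 2) else 1 / 2) I Wm))"
proof -
  interpret clifford_algebra scale m ep em by (rule assms)
  define N :: nat where "N = 2 ^ (2 * m - n)"
  have odd: "so_representation fscale m dR (monogenics k) \<and>
      (\<exists>W. internal_direct_sum (monogenics k) {..<N} W \<and>
        isomorphic_irreducibles fscale m dR (\<lambda>a. if a = 1 then of_nat k + 1 / 2 else 1 / 2) {..<N} W)"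
    if n: "n \<ge> 1" "m = 2 * n + 1"
  proof -
    have "\<exists>\<kappa>. clifford_coordinates scale m ep em N \<kappa>"
      unfolding N_def by (intro coordinates_exist [OF assms]) (use n in auto)
    then obtain \<kappa> where "clifford_coordinates scale m ep em N \<kappa>" by (rule exE)
    then interpret K: clifford_coordinates scale m ep em N \<kappa> .
    have o: "odd m" using n by simp
    interpret C: coordinate_maps fscale m dR "monogenics k" "{..<N}" "\<lambda>_. fock_monogenics m k UNIV" "K.fock_map k" "\<lambda>_. hw_weight m k UNIV"
      by (rule K.odd_case [OF o])
    have "hw_weight m k UNIV = (\<lambda>a. if a = 1 then of_nat k + 1 / 2 else 1 / 2)"
      by (simp add: hw_weight_def vacuum_def fun_eq_iff)
    then have "isomorphic_irreducibles fscale m dR (\<lambda>a. if a = 1 then of_nat k + 1 / 2 else 1 / 2) {..<N} C.W"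
      by (intro C.isomorphic_irreducibles_W) simp_all
    then show ?thesis
      by (intro conjI [OF C.representation_M] exI [of _ C.W] conjI C.direct_sum)
  qed
  have even: "so_representation fscale m dR (monogenics k) \<and>
      (\<exists>Wp Wm. internal_direct_sum (monogenics k) ({..<N} <+> {..<N}) (case_sum Wp Wm) \<and>
        isomorphic_irreducibles fscale m dR (\<lambda>a. if a = 1 then of_nat k + 1 / 2 else 1 / 2) {..<N} Wp \<and>
        isomorphic_irreducibles fscale m dR
          (\<lambda>a. if a = 1 then of_nat k + 1 / 2 else if a = n then - (1 / 2) else 1 / 2) {..<N} Wm)"
    if n: "n \<ge> 2" "m = 2 * n"
  proof -
    have "\<exists>\<kappa>. clifford_coordinates scale m ep em N \<kappa>"
      unfolding N_def by (intro coordinates_exist [OF assms]) (use n in auto)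
    then obtain \<kappa> where "clifford_coordinates scale m ep em N \<kappa>" by (rule exE)
    then interpret K: clifford_coordinates scale m ep em N \<kappa> .
    have e: "even m" using n by simp
    interpret C: coordinate_maps fscale m dR "monogenics k" "{..<N} <+> {..<N}"
      "\<lambda>s. fock_monogenics m k (K.par_of s)" "K.par_map k" "\<lambda>s. hw_weight m k (K.par_of s)"
      by (rule K.even_case [OF e])
    have sum: "case_sum (C.W \<circ> Inl) (C.W \<circ> Inr) = C.W"
      by (rule ext) (simp split: sum.split)
    have Q: "K.par_of (Inl i) = {True}" "K.par_of (Inr i) = {False}" for i
      by (simp_all add: K.par_of_def)
    have w: "hw_weight m k {True} = (\<lambda>a. if a = 1 then of_nat k + 1 / 2 else 1 / 2)"
      "hw_weight m k {False} = (\<lambda>a. if a = 1 then of_nat k + 1 / 2 else if a = n then - (1 / 2) else 1 / 2)"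
      using n by (simp_all add: hw_weight_def vacuum_def fun_eq_iff)
    have iso: "isomorphic_irreducibles fscale m dR w J (C.W \<circ> h)"
      if "isomorphic_irreducibles fscale m dR w (h ` J) C.W" for w J and h :: "nat \<Rightarrow> nat + nat"
      using that by (auto simp: isomorphic_irreducibles_def)
    have "isomorphic_irreducibles fscale m dR (hw_weight m k {True}) {..<N} (C.W \<circ> Inl)"
      by (intro iso C.isomorphic_irreducibles_W) (auto simp: Q)
    moreover have "isomorphic_irreducibles fscale m dR (hw_weight m k {False}) {..<N} (C.W \<circ> Inr)"
      by (intro iso C.isomorphic_irreducibles_W) (auto simp: Q)
    moreover have "internal_direct_sum (monogenics k) ({..<N} <+> {..<N}) (case_sum (C.W \<circ> Inl) (C.W \<circ> Inr))"
      unfolding sum by (rule C.direct_sum)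
    ultimately show ?thesis
      unfolding w
      by (intro conjI [OF C.representation_M] exI [of _ "C.W \<circ> Inl"] exI [of _ "C.W \<circ> Inr"] conjI)
  qed
  show ?thesis
    unfolding Let_def N_def [symmetric] by (rule conjI; rule impI; erule conjE; (erule (1) odd | erule (1) even))
qed

end
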